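(* The formulas $$\omega(k)=q^n\gamma\bar\gamma,\qquad \omega(e)=q^{-n+1}\hat Q,\qquad \omega(f)=-\Delta_q$$ determine a representation $\omega$ of $U_q(\mathrm{sl}_2)$ on $\mathcal A$ which commutes with the representation $L$ of $U_q(\mathrm{gl}_n)$ on $\mathcal A$. On each subspace $\mathbb C[Q]\otimes\mathcal H_{m,m'}\subset\mathcal A$ the irreducible representation $D_{m+m'+n}\times T_{m,m'}$ of $U_q(\mathrm{sl}_2)\times U_q(\mathrm{gl}_n)$ acts, and the representation $\omega\times L$ of $U_q(\mathrm{sl}_2)\times U_q(\mathrm{gl}_n)$ on $\mathcal A$ decomposes into irreducible components as $$\omega\times L=\bigoplus_{m,m'=0}^{\infty}D_{m+m'+n}\times T_{m,m'},$$ that is, each irreducible representation of $U_q(\mathrm{gl}_n)$ in this decomposition determines uniquely the corresponding irreducible representation of $U_q(\mathrm{sl}_2)$ and vice versa. This means that $U_q(\mathrm{sl}_2)$ and $U_q(\mathrm{gl}_n)$ constitute a dual pair under the action on $\mathcal A$.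
   Context: Let $n$ be a positive integer and $q$ a nonzero complex number that is not a root of unity (with a fixed square root $q^{1/2}$). Put $[a]=(q^a-q^{-a})/(q-q^{-1})$. $\mathcal A$ is the unital associative $\mathbb C$-algebra generated by $z_1,\dots,z_n,w_1,\dots,w_n$ with relations $z_iz_j=qz_jz_i$ and $w_iw_j=q^{-1}w_jw_i$ for $i<j$; $w_jz_i=qz_iw_j$ for $i\ne j$; $w_kz_k=z_kw_k+(1-q^2)\sum_{s<k}z_sw_s$. Both the monomials $z_1^{r_1}\cdots z_n^{r_n}w_1^{s_1}\cdots w_n^{s_n}$ and the monomials $w_1^{r_1}\cdots w_n^{r_n}z_1^{s_1}\cdots z_n^{s_n}$ form bases of $\mathcal A$. $\mathcal A_{m,m'}$ is the subspace of polynomials homogeneous of degree $m$ in the $z_i$ and of degree $m'$ in the $w_i$; $\gamma,\bar\gamma$ are the linear operators acting on $\mathcal A_{m,m'}$ as multiplication by $q^m$ and $q^{m'}$, respectively. Linear operators $\partial_i,\bar\partial_i$ on $\mathcal A$ are defined on these bases by $\partial_i(z_1^{r_1}\cdots z_n^{r_n}w_1^{s_1}\cdots w_n^{s_n})=q^{r_{i+1}+\cdots+r_n}[r_i]\,z_1^{r_1}\cdots z_i^{r_i-1}\cdots z_n^{r_n}w_1^{s_1}\cdots w_n^{s_n}$ and $\bar\partial_i(w_1^{r_1}\cdots w_n^{r_n}z_1^{s_1}\cdots z_n^{s_n})=q^{-(r_{i+1}+\cdots+r_n)}[r_i]\,w_1^{r_1}\cdots w_i^{r_i-1}\cdots w_n^{r_n}z_1^{s_1}\cdots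 z_n^{s_n}$ (both are $0$ if $r_i=0$). $\Delta_q=\sum_{i=1}^n\partial_i\bar\partial_i$ $(=\sum_{i=1}^n q^{2(i-1)}\bar\partial_i\partial_i)$, $\mathcal H_{m,m'}=\{p\in\mathcal A_{m,m'}:\Delta_qp=0\}$; $Q=\sum_{i=1}^n z_iw_i$ (central) and $\hat Q$ is multiplication by $Q$. $\mathbb C[Q]$ is the space of polynomials in $Q$, and $\mathbb C[Q]\otimes\mathcal H_{m,m'}$ is regarded as a subspace of $\mathcal A$, with $f\otimes h$ standing for the product $fh$. $U_q(\mathrm{sl}_2)$ is the algebra generated by $k,k^{-1},e,f$ with $kk^{-1}=k^{-1}k=1$, $ke=q^2ek$, $kf=q^{-2}fk$, $ef-fe=(k-k^{-1})/(q-q^{-1})$. For a positive integer $l$, $D_l$ is the irreducible (discrete series) representation of $U_q(\mathrm{sl}_2)$ with lowest weight $l$: it has a basis $|r\rangle$, $r=0,1,2,\dots$, with $k|r\rangle=q^{2r+l}|r\rangle$, $f|r\rangle=-[r]\,|r-1\rangle$, $e|r\rangle=[r+l]\,|r+1\rangle$. $U_q(\mathrm{gl}_n)$ is the algebra generated by pairwise commuting invertible $k_i^{\pm1/2}$ ($1\le i\le n$) and $e_j,f_j$ ($1\le j\le n-1$) with $k_i^{1/2}e_jk_i^{-1/2}=q^{a_{ij}/2}e_j$, $k_i^{1/2}f_jk_i^{-1/2}=q^{-a_{ij}/2}f_j$, where $a_{jj}=1$, $a_{j+1,j}=-1$, $a_{ij}=0$ otherwise; $[e_i,f_j]=\delta_{ij}(k_ik_{i+1}^{-1}-k_i^{-1}k_{i+1})/(q-q^{-1})$;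 $e_i^2e_{i\pm1}-(q+q^{-1})e_ie_{i\pm1}e_i+e_{i\pm1}e_i^2=0$ and the same for the $f$'s; $[e_i,e_j]=[f_i,f_j]=0$ for $|i-j|>1$. Its comultiplication is $k_i^{\pm 1/2}\mapsto k_i^{\pm 1/2}\otimes k_i^{\pm 1/2}$, $e_i\mapsto e_i\otimes k_i^{-1/2}k_{i+1}^{1/2}+k_i^{1/2}k_{i+1}^{-1/2}\otimes e_i$, $f_i\mapsto f_i\otimes k_i^{-1/2}k_{i+1}^{1/2}+k_i^{1/2}k_{i+1}^{-1/2}\otimes f_i$; the counit is $\varepsilon(k_i)=1$, $\varepsilon(e_i)=\varepsilon(f_i)=0$. The representation $L$ on $\mathcal A$, $L(X)p=X\triangleright p$, is given by $X\triangleright 1=\varepsilon(X)1$, $k_i^{1/2}\triangleright z_j=q^{\delta_{ij}/2}z_j$, $e_i\triangleright z_j=\delta_{j,i+1}z_{j-1}$, $f_i\triangleright z_j=\delta_{j,i}z_{j+1}$, $k_i^{1/2}\triangleright w_j=q^{-\delta_{ij}/2}w_j$, $e_i\triangleright w_j=-\delta_{j,i}q^{-1}w_{j+1}$, $f_i\triangleright w_j=-\delta_{j,i+1}q\,w_{j-1}$, and $X\triangleright(p_1p_2)=\sum(X_{(1)}\triangleright p_1)(X_{(2)}\triangleright p_2)$. $T_{m,m'}$ is the restriction of $L$ to the invariant subspace $\mathcal H_{m,m'}$. A representation of $U_q(\mathrm{sl}_2)\times U_q(\mathrm{gl}_n)$ means a representation of the tensor product algebra; $\omega\times L$ sends $X\otimes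 Y$ to $\omega(X)L(Y)$, and $D\times T$ denotes the outer tensor product.
   Formalization: "Vice versa" fails as stated: T_{1,0}, T_{0,1} are inequivalent but both go with D_{n+1}. Proved: D_l determines the sum over m+m'+n=l, and T once the scalar of k_1^{1/2}...k_n^{1/2} is fixed. Irreducibility is claimed for nonzero H_{m,m'} (zero iff n=1, m,m'>0). *)

theory Defs
  imports Complex_Main "HOL-Library.Poly_Mapping"
begin

section \<open>Complex vector spaces and algebras\<close>

class complex_vector = ab_group_add +
  fixes scaleC :: "complex \<Rightarrow> 'a \<Rightarrow> 'a"  (infixr \<open>*\<^sub>C\<close> 75)
  assumes scaleC_add_right: "c *\<^sub>C (x + y) = c *\<^sub>C x + c *\<^sub>C y"
    and scaleC_add_left: "(c + d) *\<^sub>C x = c *\<^sub>C x + d *\<^sub>C x"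
    and scaleC_scaleC: "c *\<^sub>C (d *\<^sub>C x) = (c * d) *\<^sub>C x"
    and scaleC_one: "1 *\<^sub>C x = x"

class complex_algebra_1 = complex_vector + ring_1 +
  assumes scaleC_mult_left: "(c *\<^sub>C x) * y = c *\<^sub>C (x * y)"
    and scaleC_mult_right: "x * (c *\<^sub>C y) = c *\<^sub>C (x * y)"

global_interpretation cvec: vector_space "scaleC :: complex \<Rightarrow> 'a \<Rightarrow> 'a::complex_vector"
  by unfold_locales (simp_all add: scaleC_add_right scaleC_add_left scaleC_scaleC scaleC_one)

abbreviation clinear :: "('a::complex_vector \<Rightarrow> 'b::complex_vector) \<Rightarrow> bool" where
  "clinear \<equiv> Vector_Spaces.linear scaleC scaleC"

instantiation complex :: complex_algebra_1
begin
definition "scaleC_complex (c::complex) (x::complex) = c * x"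
instance
  by standard (simp_all add: scaleC_complex_def algebra_simps)
end

instantiation poly_mapping :: (type, complex_vector) complex_vector
begin
definition "scaleC_poly_mapping (c::complex) (p :: 'a \<Rightarrow>\<^sub>0 'b) = Poly_Mapping.map (\<lambda>x. c *\<^sub>C x) p"
lemma lookup_scaleC:
  "Poly_Mapping.lookup (c *\<^sub>C p) i = c *\<^sub>C Poly_Mapping.lookup (p :: 'a \<Rightarrow>\<^sub>0 'b) i"
  by (simp add: scaleC_poly_mapping_def Poly_Mapping.map.rep_eq when_def)
instance
  by standard
    (rule poly_mapping_eqI,
     simp add: lookup_scaleC lookup_add scaleC_add_right scaleC_add_left scaleC_scaleC scaleC_one)+
end


section \<open>Algebras given by generators and relations\<close>

text \<open>The free unital algebra on generators of type \<open>'x\<close> is the monoid algebra of the free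
  monoid of words: finitely supported functions on words with the convolution product.\<close>

instantiation list :: (type) monoid_add
begin
definition "zero_list = ([] :: 'a list)"
definition "plus_list = (append :: 'a list \<Rightarrow> 'a list \<Rightarrow> 'a list)"
instance by standard (simp_all add: zero_list_def plus_list_def)
end

type_synonym 'x free_algebra = "'x list \<Rightarrow>\<^sub>0 complex"

definition gen :: "'x \<Rightarrow> 'x free_algebra" where
  "gen x = Poly_Mapping.single [x] 1"

definition free_on :: "'x set \<Rightarrow> 'x free_algebra set" where
  "free_on X = {p. \<forall>u\<in>Poly_Mapping.keys p. set u \<subseteq> X}"

definition free_eval :: "('x \<Rightarrow> 'a) \<Rightarrow> 'x free_algebra \<Rightarrow> 'a::complex_algebra_1" where
  "free_eval g p = (\<Sum>u\<in>Poly_Mapping.keys p. Poly_Mapping.lookup p u *\<^sub>C prod_list (map g u))"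

text \<open>The two-sided ideal of the free algebra on \<open>X\<close> generated by \<open>R\<close>.\<close>

inductive_set relation_ideal :: "'x set \<Rightarrow> 'x free_algebra set \<Rightarrow> 'x free_algebra set"
  for X R where
  zero: "0 \<in> relation_ideal X R"
| multiple: "r \<in> R \<Longrightarrow> a \<in> free_on X \<Longrightarrow> b \<in> free_on X \<Longrightarrow> a * r * b \<in> relation_ideal X R"
| add: "p \<in> relation_ideal X R \<Longrightarrow> p' \<in> relation_ideal X R \<Longrightarrow> p + p' \<in> relation_ideal X R"

text \<open>The whole type \<open>'a\<close>, with generators \<open>g x\<close> for \<open>x \<in> X\<close>, is (isomorphic to) the quotient
  of the free algebra on \<open>X\<close> by the ideal generated by \<open>R\<close>.\<close>

definition presented_algebra ::
    "'x set \<Rightarrow> 'x free_algebra set \<Rightarrow> ('x \<Rightarrow> 'a::complex_algebra_1) \<Rightarrow> bool" where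
  "presented_algebra X R g \<longleftrightarrow>
     free_eval g ` free_on X = UNIV \<and>
     (\<forall>p\<in>free_on X. free_eval g p = 0 \<longleftrightarrow> p \<in> relation_ideal X R)"


section \<open>Representations\<close>

definition representation ::
    "('u::complex_algebra_1 \<Rightarrow> 'v::complex_vector \<Rightarrow> 'v) \<Rightarrow> bool" where
  "representation \<rho> \<longleftrightarrow>
     (\<forall>X. clinear (\<rho> X)) \<and> \<rho> 1 = id \<and> (\<forall>X Y. \<rho> (X * Y) = \<rho> X \<circ> \<rho> Y) \<and>
     (\<forall>X Y v. \<rho> (X + Y) v = \<rho> X v + \<rho> Y v) \<and> (\<forall>c X v. \<rho> (c *\<^sub>C X) v = c *\<^sub>C \<rho> X v)"

text \<open>A restriction of a representation to a subspace \<open>V\<close> is written as the pair \<open>\<rho>\<close>, \<open>V\<close>.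
  In what follows the index type of \<open>\<rho>\<close> is an algebra, or a product type \<open>'u \<times> 'g\<close> whose element
  \<open>(X, Y)\<close> stands for the pure tensor of \<open>X\<close> and \<open>Y\<close>. As pure tensors span the tensor product
  algebra, invariance, irreducibility and equivalence can be tested on them.\<close>

definition subrep :: "('x \<Rightarrow> 'v::complex_vector \<Rightarrow> 'v) \<Rightarrow> 'v set \<Rightarrow> bool" where
  "subrep \<rho> V \<longleftrightarrow> cvec.subspace V \<and> (\<forall>X. \<forall>v\<in>V. \<rho> X v \<in> V)"

definition irreducible_rep :: "('x \<Rightarrow> 'v::complex_vector \<Rightarrow> 'v) \<Rightarrow> 'v set \<Rightarrow> bool" where
  "irreducible_rep \<rho> V \<longleftrightarrow>
     subrep \<rho> V \<and> V \<noteq> {0} \<and> (\<forall>W. subrep \<rho> W \<and> W \<subseteq> V \<longrightarrow> W = {0} \<or> W = V)"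

text \<open>The intertwiner may be taken linear on the whole ambient space, since a linear map defined
  on a subspace always extends.\<close>

definition rep_equiv ::
    "('x \<Rightarrow> 'v::complex_vector \<Rightarrow> 'v) \<Rightarrow> 'v set \<Rightarrow> ('x \<Rightarrow> 'w::complex_vector \<Rightarrow> 'w) \<Rightarrow> 'w set \<Rightarrow> bool"
where
  "rep_equiv \<rho> V \<sigma> W \<longleftrightarrow> subrep \<rho> V \<and> subrep \<sigma> W \<and>
     (\<exists>\<Phi>. clinear \<Phi> \<and> bij_betw \<Phi> V W \<and> (\<forall>X. \<forall>v\<in>V. \<Phi> (\<rho> X v) = \<sigma> X (\<Phi> v)))"

definition isotypic_component ::
    "('x \<Rightarrow> 'v::complex_vector \<Rightarrow> 'v) \<Rightarrow> ('x \<Rightarrow> 'w::complex_vector \<Rightarrow> 'w) \<Rightarrow> 'w set \<Rightarrow> 'v set" where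
  "isotypic_component \<rho> \<sigma> W = cvec.span (\<Union>{V. rep_equiv \<rho> V \<sigma> W})"

definition rep_prod ::
    "('u \<Rightarrow> 'v \<Rightarrow> 'v) \<Rightarrow> ('g \<Rightarrow> 'v \<Rightarrow> 'v) \<Rightarrow> 'u \<times> 'g \<Rightarrow> 'v \<Rightarrow> 'v" where
  "rep_prod \<omega> \<tau> = (\<lambda>(X, Y). \<omega> X \<circ> \<tau> Y)"

definition is_direct_sum :: "('i \<Rightarrow> 'v::complex_vector set) \<Rightarrow> bool" where
  "is_direct_sum V \<longleftrightarrow> (\<forall>i. cvec.subspace (V i)) \<and>
     (\<forall>v. \<exists>!g :: 'i \<Rightarrow>\<^sub>0 'v. (\<forall>i. Poly_Mapping.lookup g i \<in> V i) \<and>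
        v = (\<Sum>i\<in>Poly_Mapping.keys g. Poly_Mapping.lookup g i))"

text \<open>\<open>nat \<Rightarrow>\<^sub>0 complex\<close> is the space with basis \<open>ket 0, ket 1, \<dots>\<close>. Its tensor product with a
  subspace \<open>H\<close> of \<open>'a\<close> is the space of finitely supported sequences in \<open>H\<close>, where \<open>g\<close> stands
  for the sum over \<open>r\<close> of the pure tensors of \<open>ket r\<close> and \<open>g r\<close>.\<close>

definition ket :: "nat \<Rightarrow> (nat \<Rightarrow>\<^sub>0 complex)" where
  "ket r = Poly_Mapping.single r 1"

definition pure_tensor ::
    "(nat \<Rightarrow>\<^sub>0 complex) \<Rightarrow> 'a::complex_vector \<Rightarrow> (nat \<Rightarrow>\<^sub>0 'a)" where
  "pure_tensor d h = Poly_Mapping.map (\<lambda>c. c *\<^sub>C h) d"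

definition tensor_space :: "'a::complex_vector set \<Rightarrow> (nat \<Rightarrow>\<^sub>0 'a) set" where
  "tensor_space H = {g. \<forall>r. Poly_Mapping.lookup g r \<in> H}"

definition outer_tensor ::
    "('u \<Rightarrow> (nat \<Rightarrow>\<^sub>0 complex) \<Rightarrow> (nat \<Rightarrow>\<^sub>0 complex)) \<Rightarrow> ('g \<Rightarrow> 'a::complex_vector \<Rightarrow> 'a) \<Rightarrow>
     'u \<times> 'g \<Rightarrow> (nat \<Rightarrow>\<^sub>0 'a) \<Rightarrow> (nat \<Rightarrow>\<^sub>0 'a)" where
  "outer_tensor \<delta> \<tau> = (\<lambda>(X, Y) g.
     \<Sum>r\<in>Poly_Mapping.keys g. pure_tensor (\<delta> X (ket r)) (\<tau> Y (Poly_Mapping.lookup g r)))"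


section \<open>The algebra of \<open>z\<close> and \<open>w\<close>, its q-derivatives and harmonic polynomials\<close>

definition qnum :: "complex \<Rightarrow> nat \<Rightarrow> complex" where
  "qnum q a = (q ^ a - inverse q ^ a) / (q - inverse q)"

datatype zw_gen = Z nat | W nat

definition zw_gens :: "nat \<Rightarrow> zw_gen set" where
  "zw_gens n = Z ` {1..n} \<union> W ` {1..n}"

definition zw_relations :: "nat \<Rightarrow> complex \<Rightarrow> zw_gen free_algebra set" where
  "zw_relations n q =
     {gen (Z i) * gen (Z j) - q *\<^sub>C (gen (Z j) * gen (Z i)) |i j. 1 \<le> i \<and> i < j \<and> j \<le> n} \<union>
     {gen (W i) * gen (W j) - inverse q *\<^sub>C (gen (W j) * gen (W i)) |i j. 1 \<le> i \<and> i < j \<and> j \<le> n} \<union>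
     {gen (W j) * gen (Z i) - q *\<^sub>C (gen (Z i) * gen (W j)) |i j. i \<in> {1..n} \<and> j \<in> {1..n} \<and> i \<noteq> j} \<union>
     {gen (W k) * gen (Z k) - (gen (Z k) * gen (W k) +
        (1 - q^2) *\<^sub>C (\<Sum>s\<in>{1..<k}. gen (Z s) * gen (W s))) |k. k \<in> {1..n}}"

definition zw_algebra ::
    "nat \<Rightarrow> complex \<Rightarrow> (nat \<Rightarrow> 'a::complex_algebra_1) \<Rightarrow> (nat \<Rightarrow> 'a) \<Rightarrow> bool" where
  "zw_algebra n q z w \<longleftrightarrow> presented_algebra (zw_gens n) (zw_relations n q) (case_zw_gen z w)"

definition monomial :: "nat \<Rightarrow> (nat \<Rightarrow> 'a::monoid_mult) \<Rightarrow> (nat \<Rightarrow> nat) \<Rightarrow> 'a" where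
  "monomial n x r = prod_list (map (\<lambda>i. x i ^ r i) [1..<Suc n])"

definition homog ::
    "nat \<Rightarrow> (nat \<Rightarrow> 'a::complex_algebra_1) \<Rightarrow> (nat \<Rightarrow> 'a) \<Rightarrow> nat \<Rightarrow> nat \<Rightarrow> 'a set" where
  "homog n z w m m' = cvec.span {monomial n z r * monomial n w s |r s.
     (\<Sum>i=1..n. r i) = m \<and> (\<Sum>i=1..n. s i) = m'}"

text \<open>The factor \<open>qnum q 0 = 0\<close> makes the values below vanish if \<open>r i = 0\<close>, where
  \<open>r i - 1\<close> is truncated.\<close>

definition is_partial ::
    "nat \<Rightarrow> complex \<Rightarrow> (nat \<Rightarrow> 'a::complex_algebra_1) \<Rightarrow> (nat \<Rightarrow> 'a) \<Rightarrow> nat \<Rightarrow> ('a \<Rightarrow> 'a) \<Rightarrow> bool" where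
  "is_partial n q z w i d \<longleftrightarrow> clinear d \<and>
     (\<forall>r s. d (monomial n z r * monomial n w s) =
        (q ^ (\<Sum>j\<in>{i<..n}. r j) * qnum q (r i)) *\<^sub>C
          (monomial n z (r(i := r i - 1)) * monomial n w s))"

definition is_partial_bar ::
    "nat \<Rightarrow> complex \<Rightarrow> (nat \<Rightarrow> 'a::complex_algebra_1) \<Rightarrow> (nat \<Rightarrow> 'a) \<Rightarrow> nat \<Rightarrow> ('a \<Rightarrow> 'a) \<Rightarrow> bool" where
  "is_partial_bar n q z w i d \<longleftrightarrow> clinear d \<and>
     (\<forall>r s. d (monomial n w r * monomial n z s) =
        (inverse q ^ (\<Sum>j\<in>{i<..n}. r j) * qnum q (r i)) *\<^sub>C
          (monomial n w (r(i := r i - 1)) * monomial n z s))"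

definition q_laplace ::
    "nat \<Rightarrow> (nat \<Rightarrow> 'a \<Rightarrow> 'a::complex_algebra_1) \<Rightarrow> (nat \<Rightarrow> 'a \<Rightarrow> 'a) \<Rightarrow> 'a \<Rightarrow> 'a" where
  "q_laplace n d db p = (\<Sum>i=1..n. d i (db i p))"

definition harmonics ::
    "nat \<Rightarrow> (nat \<Rightarrow> 'a::complex_algebra_1) \<Rightarrow> (nat \<Rightarrow> 'a) \<Rightarrow> (nat \<Rightarrow> 'a \<Rightarrow> 'a) \<Rightarrow> (nat \<Rightarrow> 'a \<Rightarrow> 'a) \<Rightarrow>
     nat \<Rightarrow> nat \<Rightarrow> 'a set" where
  "harmonics n z w d db m m' = {p \<in> homog n z w m m'. q_laplace n d db p = 0}"

definition Q_elem :: "nat \<Rightarrow> (nat \<Rightarrow> 'a::complex_algebra_1) \<Rightarrow> (nat \<Rightarrow> 'a) \<Rightarrow> 'a" where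
  "Q_elem n z w = (\<Sum>i=1..n. z i * w i)"

text \<open>The elements of \<open>tensor_space H\<close> also represent those of the tensor product of the
  polynomials in \<open>Q\<close> with \<open>H\<close>: the sequence \<open>g\<close> stands for the sum of the tensors of \<open>Q ^ j\<close>
  and \<open>g j\<close>, and \<open>mult_Q\<close> is the multiplication map to the algebra.\<close>

definition mult_Q :: "'a::complex_algebra_1 \<Rightarrow> (nat \<Rightarrow>\<^sub>0 'a) \<Rightarrow> 'a" where
  "mult_Q Q g = (\<Sum>j\<in>Poly_Mapping.keys g. Q ^ j * Poly_Mapping.lookup g j)"

definition CQ_tensor :: "'a::complex_algebra_1 \<Rightarrow> 'a set \<Rightarrow> 'a set" where
  "CQ_tensor Q H = mult_Q Q ` tensor_space H"


section \<open>The quantized universal enveloping algebra of \<open>sl\<^sub>2\<close>\<close>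

datatype sl2_gen = SK | SKinv | SE | SF

definition sl2_relations :: "complex \<Rightarrow> sl2_gen free_algebra set" where
  "sl2_relations q =
     {gen SK * gen SKinv - 1, gen SKinv * gen SK - 1,
      gen SK * gen SE - q^2 *\<^sub>C (gen SE * gen SK),
      gen SK * gen SF - (inverse q)^2 *\<^sub>C (gen SF * gen SK),
      gen SE * gen SF - gen SF * gen SE - inverse (q - inverse q) *\<^sub>C (gen SK - gen SKinv)}"

definition Uq_sl2 :: "complex \<Rightarrow> 'u::complex_algebra_1 \<Rightarrow> 'u \<Rightarrow> 'u \<Rightarrow> 'u \<Rightarrow> bool" where
  "Uq_sl2 q k kinv e f \<longleftrightarrow>
     presented_algebra UNIV (sl2_relations q) (case_sl2_gen k kinv e f)"

definition discrete_series ::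
    "complex \<Rightarrow> 'u::complex_algebra_1 \<Rightarrow> 'u \<Rightarrow> 'u \<Rightarrow> nat \<Rightarrow>
     ('u \<Rightarrow> (nat \<Rightarrow>\<^sub>0 complex) \<Rightarrow> (nat \<Rightarrow>\<^sub>0 complex)) \<Rightarrow> bool" where
  "discrete_series q k e f l \<delta> \<longleftrightarrow> representation \<delta> \<and>
     (\<forall>r. \<delta> k (ket r) = q ^ (2 * r + l) *\<^sub>C ket r \<and>
          \<delta> f (ket r) = (- qnum q r) *\<^sub>C ket (r - 1) \<and>
          \<delta> e (ket r) = qnum q (r + l) *\<^sub>C ket (r + 1))"


section \<open>The quantized universal enveloping algebra of \<open>gl\<^sub>n\<close> and its action\<close>

text \<open>\<open>GK i\<close> and \<open>GKinv i\<close> stand for the square roots of \<open>k\<^sub>i\<close> and of its inverse.\<close>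

datatype gl_gen = GK nat | GKinv nat | GE nat | GF nat

definition gl_gens :: "nat \<Rightarrow> gl_gen set" where
  "gl_gens n = GK ` {1..n} \<union> GKinv ` {1..n} \<union> GE ` {1..<n} \<union> GF ` {1..<n}"

definition gl_weight :: "nat \<Rightarrow> nat \<Rightarrow> int" where
  "gl_weight i j = (if i = j then 1 else if i = j + 1 then -1 else 0)"

definition q_serre :: "complex \<Rightarrow> 'a::{ring_1, complex_vector} \<Rightarrow> 'a \<Rightarrow> 'a" where
  "q_serre q x y = x^2 * y - (q + inverse q) *\<^sub>C (x * y * x) + y * x^2"

text \<open>Here \<open>qh\<close> is the chosen square root of \<open>q\<close>.\<close>

definition gl_relations :: "nat \<Rightarrow> complex \<Rightarrow> complex \<Rightarrow> gl_gen free_algebra set" where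
  "gl_relations n q qh =
     {gen (GK i) * gen (GKinv i) - 1 |i. i \<in> {1..n}} \<union>
     {gen (GKinv i) * gen (GK i) - 1 |i. i \<in> {1..n}} \<union>
     {gen (GK i) * gen (GK j) - gen (GK j) * gen (GK i) |i j. i \<in> {1..n} \<and> j \<in> {1..n}} \<union>
     {gen (GK i) * gen (GE j) * gen (GKinv i) - (qh powi gl_weight i j) *\<^sub>C gen (GE j)
        |i j. i \<in> {1..n} \<and> j \<in> {1..<n}} \<union>
     {gen (GK i) * gen (GF j) * gen (GKinv i) - (qh powi (- gl_weight i j)) *\<^sub>C gen (GF j)
        |i j. i \<in> {1..n} \<and> j \<in> {1..<n}} \<union>
     {gen (GE i) * gen (GF j) - gen (GF j) * gen (GE i) -
        (if i = j then inverse (q - inverse q) *\<^sub>C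
           (gen (GK i)^2 * gen (GKinv (i + 1))^2 - gen (GKinv i)^2 * gen (GK (i + 1))^2) else 0)
        |i j. i \<in> {1..<n} \<and> j \<in> {1..<n}} \<union>
     {q_serre q (gen (G i)) (gen (G j)) |G i j.
        G \<in> {GE, GF} \<and> i \<in> {1..<n} \<and> j \<in> {1..<n} \<and> (i = j + 1 \<or> j = i + 1)} \<union>
     {gen (G i) * gen (G j) - gen (G j) * gen (G i) |G i j.
        G \<in> {GE, GF} \<and> i \<in> {1..<n} \<and> j \<in> {1..<n} \<and> (i > j + 1 \<or> j > i + 1)}"

definition Uq_gl ::
    "nat \<Rightarrow> complex \<Rightarrow> complex \<Rightarrow> (gl_gen \<Rightarrow> 'g::complex_algebra_1) \<Rightarrow> bool" where
  "Uq_gl n q qh x \<longleftrightarrow> presented_algebra (gl_gens n) (gl_relations n q qh) x"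

text \<open>Comultiplication and counit on generators, a list of pairs standing for the sum of the
  corresponding pure tensors. Both are algebra homomorphisms.\<close>

fun gl_comult :: "(gl_gen \<Rightarrow> 'g::complex_algebra_1) \<Rightarrow> gl_gen \<Rightarrow> ('g \<times> 'g) list" where
  "gl_comult x (GK i) = [(x (GK i), x (GK i))]"
| "gl_comult x (GKinv i) = [(x (GKinv i), x (GKinv i))]"
| "gl_comult x (GE i) = [(x (GE i), x (GKinv i) * x (GK (i + 1))),
                         (x (GK i) * x (GKinv (i + 1)), x (GE i))]"
| "gl_comult x (GF i) = [(x (GF i), x (GKinv i) * x (GK (i + 1))),
                         (x (GK i) * x (GKinv (i + 1)), x (GF i))]"

fun gl_counit :: "gl_gen \<Rightarrow> complex" where
  "gl_counit (GK i) = 1"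
| "gl_counit (GKinv i) = 1"
| "gl_counit (GE i) = 0"
| "gl_counit (GF i) = 0"

text \<open>Since comultiplication and counit are homomorphisms, the rules for the action on \<open>1\<close> and on
  products need to be imposed for the generators only.\<close>

definition gl_action ::
    "nat \<Rightarrow> complex \<Rightarrow> complex \<Rightarrow> (nat \<Rightarrow> 'a::complex_algebra_1) \<Rightarrow> (nat \<Rightarrow> 'a) \<Rightarrow>
     (gl_gen \<Rightarrow> 'g::complex_algebra_1) \<Rightarrow> ('g \<Rightarrow> 'a \<Rightarrow> 'a) \<Rightarrow> bool" where
  "gl_action n q qh z w x L \<longleftrightarrow> representation L \<and>
     (\<forall>G\<in>gl_gens n. L (x G) 1 = gl_counit G *\<^sub>C 1 \<and>
        (\<forall>p p'. L (x G) (p * p') = (\<Sum>(X, Y)\<leftarrow>gl_comult x G. L X p * L Y p'))) \<and>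
     (\<forall>i\<in>{1..n}. \<forall>j\<in>{1..n}.
        L (x (GK i)) (z j) = (if i = j then qh else 1) *\<^sub>C z j \<and>
        L (x (GK i)) (w j) = (if i = j then inverse qh else 1) *\<^sub>C w j) \<and>
     (\<forall>i\<in>{1..<n}. \<forall>j\<in>{1..n}.
        L (x (GE i)) (z j) = (if j = i + 1 then z (j - 1) else 0) \<and>
        L (x (GF i)) (z j) = (if j = i then z (j + 1) else 0) \<and>
        L (x (GE i)) (w j) = (if j = i then (- inverse q) *\<^sub>C w (j + 1) else 0) \<and>
        L (x (GF i)) (w j) = (if j = i + 1 then (- q) *\<^sub>C w (j - 1) else 0))"


section \<open>The action of \<open>U\<^sub>q(sl\<^sub>2)\<close> on the algebra of \<open>z\<close> and \<open>w\<close>\<close>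

definition sl2_action ::
    "nat \<Rightarrow> complex \<Rightarrow> (nat \<Rightarrow> 'a::complex_algebra_1) \<Rightarrow> (nat \<Rightarrow> 'a) \<Rightarrow>
     (nat \<Rightarrow> 'a \<Rightarrow> 'a) \<Rightarrow> (nat \<Rightarrow> 'a \<Rightarrow> 'a) \<Rightarrow> ('a \<Rightarrow> 'a) \<Rightarrow> ('a \<Rightarrow> 'a) \<Rightarrow>
     'u::complex_algebra_1 \<Rightarrow> 'u \<Rightarrow> 'u \<Rightarrow> ('u \<Rightarrow> 'a \<Rightarrow> 'a) \<Rightarrow> bool" where
  "sl2_action n q z w d db \<gamma> \<gamma>b k e f \<omega> \<longleftrightarrow> representation \<omega> \<and>
     (\<forall>p. \<omega> k p = q ^ n *\<^sub>C \<gamma> (\<gamma>b p)) \<and>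
     (\<forall>p. \<omega> e p = (q powi (1 - int n)) *\<^sub>C (Q_elem n z w * p)) \<and>
     (\<forall>p. \<omega> f p = - q_laplace n d db p)"

end

theory Submission
  imports Defs
begin

text \<open>On the monomials \<open>w\<^sup>s z\<^sup>r\<close> both the operator \<open>\<Delta>\<^sub>q\<close> and multiplication by \<open>Q\<close> are explicit, which gives
  \<open>\<Delta>\<^sub>q Q - Q \<Delta>\<^sub>q = q\<^sup>n\<^sup>-\<^sup>1[n + m + m']\<close> in degree \<open>(m, m')\<close>: this is the \<open>sl\<^sub>2\<close> relation, and
  since \<open>q\<close> is not a root of unity the elements \<open>Q\<^sup>j h\<close> with harmonic \<open>h\<close> form a direct sum decomposition
  of the algebra. A symmetric nondegenerate form in which the monomials are orthogonal makes \<open>e\<^sub>i\<close>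
  and \<open>f\<^sub>i\<close> adjoint to each other and \<open>\<Delta>\<^sub>q\<close> adjoint, up to scalars, to multiplication by \<open>Q\<close>; as
  \<open>Q\<close> is invariant, \<open>\<Delta>\<^sub>q\<close> commutes with the action of \<open>gl\<^sub>n\<close>. Every nonzero submodule contains a
  highest weight vector, and in the harmonic elements of degree \<open>(m, m')\<close> this is unique up to scalars, namely
  \<open>w\<^sub>n\<^sup>m\<^sup>' z\<^sub>1\<^sup>m\<close>; together with the form this gives irreducibility. The isotypic components are read off
  from highest weight vectors for \<open>gl\<^sub>n\<close> and lowest weight vectors for \<open>sl\<^sub>2\<close>.\<close>

text \<open>The obstacle is that the derivatives live on different families of monomials:
  \<open>d i\<close> is given with the \<open>z\<close> in front, \<open>db i\<close> with the
  \<open>w\<close> in front, and \<open>Lap\<close> mixes them. It becomes explicit only through a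
  rule for moving \<open>d i\<close> past \<open>w j\<close>; for \<open>Q\<close>, centrality does
  the corresponding job. Linear independence of the monomials is extracted from the operators
  themselves: the presentation provides an augmentation, and composing it with the
  \<open>d i\<close> and \<open>db i\<close> yields, after rescaling, all coordinate functionals.
  The summands \<open>Q ^ j * h\<close> are told apart by three operators, the two degree operators
  and \<open>Q * Lap\<close>, whose eigenvalues differ because no positive power of \<open>q\<close>
  is 1. Adjointness of \<open>e_i\<close> and \<open>f_i\<close> fixes the ratios of the norms of
  monomials within one bidegree; that the same norms relate \<open>Lap\<close> and \<open>Q\<close>
  is then a computation. The form is complex bilinear, so a submodule could meet its orthogonal
  complement; the argument instead places the highest weight vector, of nonzero norm, in
  both.\<close>

interpretation cpair: vector_space_pair "scaleC :: complex \<Rightarrow> 'a \<Rightarrow> 'a::complex_vector"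
    "scaleC :: complex \<Rightarrow> 'b \<Rightarrow> 'b::complex_vector"
  by unfold_locales

lemma clinear_iff:
  "clinear f \<longleftrightarrow> (\<forall>x y. f (x + y) = f x + f y) \<and> (\<forall>c x. f (c *\<^sub>C x) = c *\<^sub>C f x)"
  by (simp add: Vector_Spaces.linear_iff cvec.vector_space_axioms)

lemma clinearI:
  "(\<And>x y. f (x + y) = f x + f y) \<Longrightarrow> (\<And>c x. f (c *\<^sub>C x) = c *\<^sub>C f x) \<Longrightarrow> clinear f"
  by (simp add: clinear_iff)

lemmas clinear_simps = cpair.linear_add cpair.linear_scale cpair.linear_0 cpair.linear_neg cpair.linear_diff cpair.linear_sum

lemma clinear_compose: "clinear f \<Longrightarrow> clinear g \<Longrightarrow> clinear (\<lambda>x. f (g x))"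
  by (simp add: clinear_iff)

lemma clinear_mult_left: "clinear (\<lambda>x::'a::complex_algebra_1. a * x)"
  by (simp add: clinear_iff distrib_left scaleC_mult_right)

lemma subspace_vimage: "clinear f \<Longrightarrow> cvec.subspace S \<Longrightarrow> cvec.subspace {x. f x \<in> S}"
  using cpair.linear_subspace_vimage by (simp add: vimage_def)

lemma clinear_span_into:
  assumes "clinear f" "\<And>b. b \<in> B \<Longrightarrow> f b \<in> S" "cvec.subspace S" "x \<in> cvec.span B"
  shows "f x \<in> S"
  using cvec.span_minimal[of B "{x. f x \<in> S}"] subspace_vimage[OF assms(1,3)] assms(2,4) by blast

section \<open>Free algebras and presentations\<close>

lemma poly_mapping_sum_single:
  fixes p :: "'k \<Rightarrow>\<^sub>0 'b::comm_monoid_add"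
  shows "p = (\<Sum>u\<in>Poly_Mapping.keys p. Poly_Mapping.single u (Poly_Mapping.lookup p u))"
  by (rule poly_mapping_eqI)
    (auto simp: lookup_sum lookup_single when_def in_keys_iff if_distrib sum.delta' cong: if_cong)

lemma poly_mapping_single_induct:
  fixes p :: "'k \<Rightarrow>\<^sub>0 'b::comm_monoid_add"
  assumes "P 0" "\<And>u c. u \<in> Poly_Mapping.keys p \<Longrightarrow> P (Poly_Mapping.single u c)"
    "\<And>a b. P a \<Longrightarrow> P b \<Longrightarrow> P (a + b)"
  shows "P p"
proof -
  have "P (\<Sum>u\<in>A. Poly_Mapping.single u (Poly_Mapping.lookup p u))" if "A \<subseteq> Poly_Mapping.keys p" for A
    using finite_subset[OF that finite_keys] that
    by (induction A rule: finite_induct) (use assms in auto)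
  then show ?thesis by (metis order_refl poly_mapping_sum_single)
qed

lemma scaleC_single: "c *\<^sub>C Poly_Mapping.single u x = Poly_Mapping.single u (c *\<^sub>C x)"
  by (rule poly_mapping_eqI) (simp add: lookup_scaleC lookup_single when_def)

lemma sum_keys_extend:
  assumes "finite S" "Poly_Mapping.keys p \<subseteq> S" "\<And>u. f u 0 = 0"
  shows "(\<Sum>u\<in>Poly_Mapping.keys p. f u (Poly_Mapping.lookup p u)) = (\<Sum>u\<in>S. f u (Poly_Mapping.lookup p u))"
  by (rule sum.mono_neutral_left) (use assms in \<open>auto simp: in_keys_iff\<close>)

lemma sum_keys_add:
  assumes "\<And>u. f u 0 = 0" "\<And>u a b. f u (a + b) = f u a + f u b"
  shows "(\<Sum>u\<in>Poly_Mapping.keys (p + p'). f u (Poly_Mapping.lookup (p + p') u)) =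
    (\<Sum>u\<in>Poly_Mapping.keys p. f u (Poly_Mapping.lookup p u)) +
    (\<Sum>u\<in>Poly_Mapping.keys p'. f u (Poly_Mapping.lookup p' u))"
  by (rule setsum_keys_plus_distrib) (use assms in auto)

lemma sum_keys_scale:
  assumes "\<And>u. f u 0 = 0" "\<And>u a. f u (c *\<^sub>C a) = c *\<^sub>C f u a"
  shows "(\<Sum>u\<in>Poly_Mapping.keys (c *\<^sub>C p). f u (Poly_Mapping.lookup (c *\<^sub>C p) u)) =
    c *\<^sub>C (\<Sum>u\<in>Poly_Mapping.keys p. f u (Poly_Mapping.lookup p u))"
proof -
  have "Poly_Mapping.keys (c *\<^sub>C p) \<subseteq> Poly_Mapping.keys p"
    by (auto simp: in_keys_iff lookup_scaleC)
  from sum_keys_extend[OF finite_keys this, of f] show ?thesis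
    by (simp add: assms lookup_scaleC cvec.scale_sum_right)
qed

lemma clinear_sum_keys:
  assumes "\<And>u. clinear (f u)"
  shows "clinear (\<lambda>p. \<Sum>u\<in>Poly_Mapping.keys p. f u (Poly_Mapping.lookup p u))"
  by (rule clinearI; (rule sum_keys_add | rule sum_keys_scale)) (simp_all add: assms clinear_simps)

lemma clinear_scale_left: "clinear (\<lambda>c. c *\<^sub>C x)"
  by (simp add: clinear_iff scaleC_add_left scaleC_complex_def scaleC_scaleC)

lemma free_eval_linear: "clinear (free_eval g)"
  unfolding free_eval_def by (rule clinear_sum_keys[OF clinear_scale_left])

lemma free_eval_single: "free_eval g (Poly_Mapping.single u c) = c *\<^sub>C prod_list (map g u)"
  by (simp add: free_eval_def)

lemma free_eval_one [simp]: "free_eval g 1 = 1"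
  unfolding single_one[symmetric] free_eval_single by (simp add: zero_list_def scaleC_one)

lemma free_eval_gen [simp]: "free_eval g (gen x) = g x"
  by (simp add: gen_def free_eval_single scaleC_one)

lemma free_eval_mult [simp]: "free_eval g (a * b) = free_eval g a * free_eval g b"
proof (rule poly_mapping_single_induct[of "\<lambda>a. free_eval g (a * b) = free_eval g a * free_eval g b"])
  fix u c
  show "free_eval g (Poly_Mapping.single u c * b) = free_eval g (Poly_Mapping.single u c) * free_eval g b"
  proof (rule poly_mapping_single_induct[of "\<lambda>b. free_eval g (Poly_Mapping.single u c * b) =
      free_eval g (Poly_Mapping.single u c) * free_eval g b"])
    fix v d
    show "free_eval g (Poly_Mapping.single u c * Poly_Mapping.single v d) =
      free_eval g (Poly_Mapping.single u c) * free_eval g (Poly_Mapping.single v d)"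
      by (simp add: mult_single free_eval_single plus_list_def scaleC_mult_left scaleC_mult_right
          scaleC_scaleC mult.commute)
  qed (simp_all add: clinear_simps[OF free_eval_linear] distrib_left)
qed (simp_all add: clinear_simps[OF free_eval_linear] distrib_right)

lemmas free_eval_simps [simp] = clinear_simps[OF free_eval_linear]

lemma subspace_free_on: "cvec.subspace (free_on X)"
  unfolding cvec.subspace_def free_on_def
proof (safe, goal_cases)
  case (2 x y u i)
  then show ?case using Poly_Mapping.keys_add[of x y] by blast
next
  case (3 c x u i)
  then have "u \<in> Poly_Mapping.keys x" by (auto simp: in_keys_iff lookup_scaleC)
  with 3 show ?case by blast
qed simp

lemma free_on_gen: "x \<in> X \<Longrightarrow> gen x \<in> free_on X"
  by (simp add: free_on_def gen_def)

lemma free_on_one: "1 \<in> free_on X"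
  by (simp add: free_on_def zero_list_def)

lemma free_on_mult: "a \<in> free_on X \<Longrightarrow> b \<in> free_on X \<Longrightarrow> a * b \<in> free_on X"
  using keys_mult[of a b] unfolding free_on_def by (fastforce simp: plus_list_def)

lemma free_on_power: "a \<in> free_on X \<Longrightarrow> a ^ i \<in> free_on X"
  by (induction i) (simp_all add: free_on_mult free_on_one)

lemmas free_on_intros = free_on_gen free_on_one free_on_mult free_on_power
  cvec.subspace_add[OF subspace_free_on] cvec.subspace_diff[OF subspace_free_on]
  cvec.subspace_scale[OF subspace_free_on] cvec.subspace_sum[OF subspace_free_on]
  cvec.subspace_0[OF subspace_free_on]

lemma presented_relation:
  assumes "presented_algebra X R g" "r \<in> R" "r \<in> free_on X"
  shows "free_eval g r = 0"
proof -
  have "1 * r * 1 \<in> relation_ideal X R"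
    by (rule relation_ideal.multiple) (use assms in \<open>auto intro: free_on_intros\<close>)
  with assms show ?thesis unfolding presented_algebra_def by simp
qed

lemma presented_surj:
  assumes "presented_algebra X R g"
  obtains p where "p \<in> free_on X" "free_eval g p = Y"
  using assms unfolding presented_algebra_def by (metis UNIV_I imageE)

text \<open>Words span the algebra and arise by left multiplication with one generator at a time;
  \<open>P 0\<close> comes from scaling \<open>P 1\<close> by zero.\<close>

lemma presented_induct:
  assumes "presented_algebra X R g"
    and "P 1" "\<And>x Y. x \<in> X \<Longrightarrow> P Y \<Longrightarrow> P (g x * Y)"
    and "\<And>a b. P a \<Longrightarrow> P b \<Longrightarrow> P (a + b)" "\<And>c a. P a \<Longrightarrow> P (c *\<^sub>C a)"
  shows "P Y"
proof -
  obtain p where p: "p \<in> free_on X" "free_eval g p = Y" by (rule presented_surj[OF assms(1)])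
  have words: "P (prod_list (map g u))" if "set u \<subseteq> X" for u
    using that by (induction u) (use assms(2,3) in auto)
  have P0: "P 0" using assms(5)[OF assms(2), of 0] by simp
  have "P (free_eval g p)"
  proof (rule poly_mapping_single_induct[of "\<lambda>p. P (free_eval g p)" p])
    fix u c assume "u \<in> Poly_Mapping.keys p"
    then have "set u \<subseteq> X" using p(1) by (auto simp: free_on_def)
    then show "P (free_eval g (Poly_Mapping.single u c))"
      by (simp add: free_eval_single words assms(5))
  qed (simp_all add: P0 assms(4))
  with p(2) show ?thesis by simp
qed

text \<open>The universal property. The lift evaluates a chosen preimage with \<open>g'\<close>; two
  preimages of one element differ by a member of the relation ideal, which \<open>g'\<close>
  annihilates, so the lift inherits all rules from \<open>free_eval\<close>.\<close>

lemma presented_lift: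
  fixes g :: "'x \<Rightarrow> 'a::complex_algebra_1" and g' :: "'x \<Rightarrow> 'b::complex_algebra_1"
  assumes pres: "presented_algebra X R g" and rel: "\<And>r. r \<in> R \<Longrightarrow> free_eval g' r = 0"
  obtains \<phi> :: "'a \<Rightarrow> 'b" where "clinear \<phi>" "\<phi> 1 = 1" "\<And>a b. \<phi> (a * b) = \<phi> a * \<phi> b"
    "\<And>x. x \<in> X \<Longrightarrow> \<phi> (g x) = g' x"
proof -
  define \<phi> where "\<phi> Y = free_eval g' (SOME p. p \<in> free_on X \<and> free_eval g p = Y)" for Y
  have ideal: "free_eval g' p = 0" if "p \<in> relation_ideal X R" for p
    using that by induction (simp_all add: rel)
  have \<phi>: "\<phi> (free_eval g p) = free_eval g' p" if "p \<in> free_on X" for p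
  proof -
    let ?p = "SOME p'. p' \<in> free_on X \<and> free_eval g p' = free_eval g p"
    have "?p \<in> free_on X \<and> free_eval g ?p = free_eval g p"
      by (rule someI[of _ p]) (use that in simp)
    then have "free_eval g (?p - p) = 0" "?p - p \<in> free_on X"
      using that by (auto intro: free_on_intros)
    with pres have "?p - p \<in> relation_ideal X R" unfolding presented_algebra_def by blast
    from ideal[OF this] show ?thesis by (simp add: \<phi>_def)
  qed
  note surj = presented_surj[OF pres]
  show ?thesis
  proof (rule that)
    show "clinear \<phi>"
    proof (rule clinearI)
      fix x y
      obtain p where p: "p \<in> free_on X" "free_eval g p = x" by (rule surj)
      obtain p' where p': "p' \<in> free_on X" "free_eval g p' = y" by (rule surj)
      show "\<phi> (x + y) = \<phi> x + \<phi> y" using \<phi>[of "p + p'"] \<phi>[of p] \<phi>[of p'] p p'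
        by (simp add: free_on_intros)
    next
      fix c x
      obtain p where p: "p \<in> free_on X" "free_eval g p = x" by (rule surj)
      show "\<phi> (c *\<^sub>C x) = c *\<^sub>C \<phi> x" using \<phi>[of "c *\<^sub>C p"] \<phi>[of p] p by (simp add: free_on_intros)
    qed
    show "\<phi> 1 = 1" using \<phi>[of 1] by (simp add: free_on_one)
    show "\<phi> (x * y) = \<phi> x * \<phi> y" for x y
    proof -
      obtain p where p: "p \<in> free_on X" "free_eval g p = x" by (rule surj)
      obtain p' where p': "p' \<in> free_on X" "free_eval g p' = y" by (rule surj)
      show ?thesis using \<phi>[of "p * p'"] \<phi>[of p] \<phi>[of p'] p p' by (simp add: free_on_intros)
    qed
    show "\<phi> (g x) = g' x" if "x \<in> X" for x using \<phi>[of "gen x"] that by (simp add: free_on_gen)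
  qed
qed

section \<open>Linear endomorphisms\<close>

text \<open>Universal properties of presented algebras are available only for maps to a type, so the
  operators on \<open>'a\<close> have to be made into one.\<close>

typedef (overloaded) 'a cendo = "{f :: 'a::complex_algebra_1 \<Rightarrow> 'a. clinear f}"
  morphisms app_cendo Cendo
  using cvec.linear_ident by blast

setup_lifting type_definition_cendo

lemma clinear_app_cendo: "clinear (app_cendo f)"
  using app_cendo[of f] by simp

instantiation cendo :: (complex_algebra_1) complex_algebra_1
begin
lift_definition zero_cendo :: "'a cendo" is "\<lambda>x. 0" by (rule cpair.linear_zero)
lift_definition one_cendo :: "'a cendo" is "\<lambda>x. x" by (rule cvec.linear_ident)
lift_definition plus_cendo :: "'a cendo \<Rightarrow> 'a cendo \<Rightarrow> 'a cendo" is "\<lambda>f g x. f x + g x"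
  by (rule cpair.linear_compose_add)
lift_definition minus_cendo :: "'a cendo \<Rightarrow> 'a cendo \<Rightarrow> 'a cendo" is "\<lambda>f g x. f x - g x"
  by (rule cpair.linear_compose_sub)
lift_definition uminus_cendo :: "'a cendo \<Rightarrow> 'a cendo" is "\<lambda>f x. - f x"
  by (rule cpair.linear_compose_neg)
lift_definition times_cendo :: "'a cendo \<Rightarrow> 'a cendo \<Rightarrow> 'a cendo" is "\<lambda>f g x. f (g x)"
  by (rule clinear_compose)
lift_definition scaleC_cendo :: "complex \<Rightarrow> 'a cendo \<Rightarrow> 'a cendo" is "\<lambda>c f x. c *\<^sub>C f x"
  by (rule cpair.linear_compose_scale_right)
instance
proof
  show "(0::'a cendo) \<noteq> 1" by transfer (metis zero_neq_one)
qed (transfer; auto simp: clinear_simps scaleC_add_right scaleC_add_left scaleC_scaleC scaleC_one fun_eq_iff)+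
end

section \<open>Exponents and q-numbers\<close>

text \<open>\<open>lo r k\<close> and \<open>hi n r k\<close> count the factors of a monomial to the
  left and to the right of the block of index \<open>k\<close>. They become exponents of the
  commutation constant when a factor \<open>x k\<close> is moved into that block from the left or
  from the right.\<close>

definition lo :: "(nat \<Rightarrow> nat) \<Rightarrow> nat \<Rightarrow> nat" where "lo r k = (\<Sum>i\<in>{1..<k}. r i)"
definition hi :: "nat \<Rightarrow> (nat \<Rightarrow> nat) \<Rightarrow> nat \<Rightarrow> nat" where "hi n r k = (\<Sum>i\<in>{k<..n}. r i)"
definition tot :: "nat \<Rightarrow> (nat \<Rightarrow> nat) \<Rightarrow> nat" where "tot n r = (\<Sum>i=1..n. r i)"
definition inc :: "nat \<Rightarrow> (nat \<Rightarrow> nat) \<Rightarrow> nat \<Rightarrow> nat" where "inc i r = r(i := Suc (r i))"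
text \<open>The truncation at \<open>r i = 0\<close> is harmless in the formulas for the
  derivatives, where \<open>dec i\<close> comes with the factor \<open>qnum q (r i)\<close>, which
  vanishes there.\<close>

definition dec :: "nat \<Rightarrow> (nat \<Rightarrow> nat) \<Rightarrow> nat \<Rightarrow> nat" where "dec i r = r(i := r i - 1)"
text \<open>\<open>monomial n x\<close> reads exponents on \<open>{1..n}\<close> only; fixing the
  other values lets distinct members of \<open>exps n\<close> label distinct monomials.\<close>

definition exps :: "nat \<Rightarrow> (nat \<Rightarrow> nat) set" where "exps n = {r. \<forall>i. i \<notin> {1..n} \<longrightarrow> r i = 0}"

lemma inc_apply [simp]: "inc i r i = Suc (r i)" "j \<noteq> i \<Longrightarrow> inc i r j = r j"
  and dec_apply [simp]: "dec i r i = r i - 1" "j \<noteq> i \<Longrightarrow> dec i r j = r j"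
  by (simp_all add: inc_def dec_def)

lemma dec_inc [simp]: "dec i (inc i r) = r"
  and inc_dec: "r i > 0 \<Longrightarrow> inc i (dec i r) = r"
  and inc_commute: "inc i (inc j r) = inc j (inc i r)"
  and dec_inc_commute: "i \<noteq> j \<Longrightarrow> dec i (inc j r) = inc j (dec i r)"
  by (auto simp: inc_def dec_def)

lemma sum_inc: "finite A \<Longrightarrow> (\<Sum>j\<in>A. inc i r j) = (\<Sum>j\<in>A. r j) + (if i \<in> A then 1 else 0)"
  by (induction A rule: finite_induct) (auto simp: inc_def)

lemma lo_inc: "lo (inc i r) k = lo r k + (if 1 \<le> i \<and> i < k then 1 else 0)"
  and hi_inc: "hi n (inc i r) k = hi n r k + (if k < i \<and> i \<le> n then 1 else 0)"
  and tot_inc: "tot n (inc i r) = tot n r + (if 1 \<le> i \<and> i \<le> n then 1 else 0)"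
  unfolding lo_def hi_def tot_def by (simp_all add: sum_inc)

lemma lo_Suc: "1 \<le> k \<Longrightarrow> lo r (Suc k) = lo r k + r k"
  and lo_one [simp]: "lo r (Suc 0) = 0"
  by (simp_all add: lo_def)

lemma tot_split: "k \<in> {1..n} \<Longrightarrow> tot n r = lo r k + r k + hi n r k"
proof -
  assume "k \<in> {1..n}"
  then have "{1..n} = insert k {1..<k} \<union> {k<..n}" by auto
  moreover have "{1..<k} \<inter> {k<..n} = {}" by auto
  ultimately show ?thesis unfolding tot_def lo_def hi_def
    by (simp add: sum.union_disjoint)
qed

lemma tot_eq_lo: "tot n r = lo r (Suc n)"
  by (simp add: tot_def lo_def atLeastLessThanSuc_atLeastAtMost)

lemma exps_zero: "(\<lambda>_. 0) \<in> exps n"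
  and exps_inc: "r \<in> exps n \<Longrightarrow> i \<in> {1..n} \<Longrightarrow> inc i r \<in> exps n"
  and exps_dec: "r \<in> exps n \<Longrightarrow> dec i r \<in> exps n"
  by (auto simp: exps_def inc_def dec_def)

lemma tot_zero: "tot n (\<lambda>_. 0) = 0"
  by (simp add: tot_def)

lemma tot_eq_0_iff: "r \<in> exps n \<Longrightarrow> tot n r = 0 \<longleftrightarrow> r = (\<lambda>_. 0)"
  by (auto simp: exps_def tot_def fun_eq_iff)

lemma tot_pos_ex: "tot n r > 0 \<Longrightarrow> \<exists>j\<in>{1..n}. r j > 0"
  unfolding tot_def by (metis (no_types, lifting) not_gr_zero sum.neutral)

lemma finite_exps: "finite {r \<in> exps n. tot n r = m}"
proof -
  have "{r \<in> exps n. tot n r = m} \<subseteq> {r. \<forall>i. (i \<in> {1..n} \<longrightarrow> r i \<in> {0..m}) \<and> (i \<notin> {1..n} \<longrightarrow> r i = 0)}"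
  proof safe
    fix r i assume "r \<in> exps n" "i \<in> {1..n}"
    then show "r i \<in> {0..tot n r}" using member_le_sum[of i "{1..n}" r] by (auto simp: tot_def)
  qed (auto simp: exps_def)
  then show ?thesis by (rule finite_subset) (rule finite_set_of_finite_funs; simp)
qed

text \<open>The last unit is added at an index below which nothing stands, so the new factor appears
  at the far left of the monomial without any power of \<open>q\<close>; see
  \<open>left_mult_min\<close>.\<close>

lemma exps_induct_min [consumes 1, case_names zero inc]:
  assumes "r \<in> exps n" "P (\<lambda>_. 0)"
    "\<And>j r. r \<in> exps n \<Longrightarrow> j \<in> {1..n} \<Longrightarrow> (\<And>i. i < j \<Longrightarrow> r i = 0) \<Longrightarrow> P r \<Longrightarrow> P (inc j r)"
  shows "P r"
  using assms(1)
proof (induction "tot n r" arbitrary: r)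
  case 0
  then show ?case using tot_eq_0_iff[of r n] assms(2) by simp
next
  case (Suc m)
  then have "\<exists>j. r j > 0" using tot_pos_ex[of n r] by auto
  define j where "j = (LEAST j. r j > 0)"
  have j: "r j > 0" unfolding j_def using \<open>\<exists>j. r j > 0\<close> by (rule LeastI_ex)
  have min: "r i = 0" if "i < j" for i using not_less_Least[of i "\<lambda>j. r j > 0"] that by (auto simp: j_def)
  have jn: "j \<in> {1..n}" using j Suc.prems unfolding exps_def by force
  have r: "r = inc j (dec j r)" using j by (simp add: inc_dec)
  have "tot n (inc j (dec j r)) = Suc m" using Suc.hyps(2) r by simp
  then have "m = tot n (dec j r)" using jn by (simp add: tot_inc)
  then have "P (dec j r)" using Suc by (simp add: exps_dec)
  then show ?case using assms(3)[of "dec j r" j] r jn min Suc.prems by (simp add: exps_dec)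
qed

text \<open>Here \<open>j\<close> is at least every index already present, the situation in which
  \<open>d j\<close> passes a monomial in the \<open>w\<close> with a mere scalar; see
  \<open>d_w_monomial\<close>.\<close>

lemma exps_induct_max [consumes 1, case_names zero inc]:
  assumes "r \<in> exps n" "P (\<lambda>_. 0)"
    "\<And>j r. r \<in> exps n \<Longrightarrow> j \<in> {1..n} \<Longrightarrow> (\<And>i. j < i \<Longrightarrow> r i = 0) \<Longrightarrow> P r \<Longrightarrow> P (inc j r)"
  shows "P r"
  using assms(1)
proof (induction "tot n r" arbitrary: r)
  case 0
  then show ?case using tot_eq_0_iff[of r n] assms(2) by simp
next
  case (Suc m)
  then have ex: "\<exists>j. r j > 0" using tot_pos_ex[of n r] by auto
  have bnd: "i \<le> n" if "r i > 0" for i using that Suc.prems unfolding exps_def by force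
  define j where "j = (GREATEST j. r j > 0)"
  have j: "r j > 0" unfolding j_def using ex GreatestI_ex_nat[of "\<lambda>j. r j > 0" n] bnd by blast
  have max: "r i = 0" if "j < i" for i
    using Greatest_le_nat[of "\<lambda>j. r j > 0" i n] bnd that unfolding j_def by (metis not_gr_zero not_le)
  have jn: "j \<in> {1..n}" using j Suc.prems unfolding exps_def by force
  have r: "r = inc j (dec j r)" using j by (simp add: inc_dec)
  have "tot n (inc j (dec j r)) = Suc m" using Suc.hyps(2) r by simp
  then have "m = tot n (dec j r)" using jn by (simp add: tot_inc)
  then have "P (dec j r)" using Suc by (simp add: exps_dec)
  then show ?case using assms(3)[of "dec j r" j] r jn max Suc.prems by (simp add: exps_dec)
qed

section \<open>q-numbers and their identities\<close>

lemma qnum_0 [simp]: "qnum q 0 = 0"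
  by (simp add: qnum_def)

text \<open>The symmetry through which general statements for a constant \<open>c\<close> apply to
  the \<open>z\<close>, whose commutation constant is \<open>inverse q\<close>.\<close>

lemma qnum_inverse: "qnum (inverse q) a = qnum q a"
proof -
  have "inverse q ^ a - q ^ a = - (q ^ a - inverse q ^ a)" "inverse q - q = - (q - inverse q)" by simp_all
  then show ?thesis unfolding qnum_def inverse_inverse_eq by (metis minus_divide_divide)
qed

locale generic_q =
  fixes q :: complex
  assumes q0: "q \<noteq> 0" and nonroot: "\<And>j. j > 0 \<Longrightarrow> q ^ j \<noteq> 1"
begin

lemma qq [simp]: "q * inverse q = 1" "inverse q * q = 1" "q * (inverse q * x) = x" "inverse q * (q * x) = x"
  using q0 by (simp_all add: mult.assoc[symmetric])

lemma lam0: "q - inverse q \<noteq> 0"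
proof
  assume "q - inverse q = 0"
  then have "q * q = 1" by (metis eq_iff_diff_eq_0 qq(1))
  with nonroot[of 2] show False by (simp add: power2_eq_square)
qed

lemma pow_inverse_pow [simp]: "q ^ a * inverse q ^ a = 1" "inverse q ^ a * q ^ a = 1"
  using q0 by (simp_all add: power_mult_distrib[symmetric])

lemma qnum_lam: "(q - inverse q) * qnum q a = q ^ a - inverse q ^ a"
  using lam0 by (simp add: qnum_def)

lemma qnum_eqI:
  assumes "(q - inverse q) * x = (q - inverse q) * y"
  shows "x = y"
  using assms lam0 by simp

lemma qnum_1 [simp]: "qnum q (Suc 0) = 1"
  using lam0 by (simp add: qnum_def)

lemma qnum_Suc: "qnum q (Suc a) = q * qnum q a + inverse q ^ a"
  by (rule qnum_eqI) (simp add: distrib_left mult.left_commute[of _ q] qnum_lam, simp add: algebra_simps)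

lemma qnum_Suc': "qnum q (Suc a) = inverse q * qnum q a + q ^ a"
  by (rule qnum_eqI)
    (simp add: distrib_left mult.left_commute[of _ "inverse q"] qnum_lam, simp add: algebra_simps)

lemma pow_inj: "q ^ a = q ^ b \<Longrightarrow> a = b"
proof (induction a b rule: linorder_wlog)
  case (le a b)
  then have "q ^ a * q ^ (b - a) = q ^ a * 1" by (metis le_add_diff_inverse mult.right_neutral power_add)
  then have "q ^ (b - a) = 1" using q0 by simp
  then show ?case using nonroot[of "b - a"] le by force
qed auto

lemma qnum_nonzero: "a > 0 \<Longrightarrow> qnum q a \<noteq> 0"
proof
  assume a: "a > 0" "qnum q a = 0"
  then have "q ^ a = inverse q ^ a" using qnum_lam[of a] by simp
  then have "q ^ (a + a) = 1" unfolding power_add by (metis pow_inverse_pow(1))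
  with nonroot[of "a + a"] a show False by simp
qed

lemma qnum_eq_0_iff: "qnum q a = 0 \<longleftrightarrow> a = 0"
  using qnum_nonzero by fastforce

text \<open>This separates the eigenvalues of \<open>Q * Lap\<close> on \<open>Q ^ j * h\<close> for
  different \<open>j\<close> in the same bidegree: their difference factors into two q-numbers of
  positive arguments, up to a power of \<open>q\<close>.\<close>

lemma qnum_exchange: "qnum q (a + t) * qnum q (a + u) - qnum q a * qnum q (a + t + u) = qnum q t * qnum q u"
proof -
  have "q ^ a * inverse q ^ a = 1" "q ^ t * inverse q ^ t = 1" "q ^ u * inverse q ^ u = 1" by simp_all
  \<comment> \<open>Powers and their inverses are abstracted to variables with product 1, which
    turns the identity of q-numbers into a polynomial one.\<close>
  moreover have ring: "(A * T - A' * T') * (A * U - A' * U') - (A - A') * (A * T * U - A' * T' * U') = (T - T') * (U - U')"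
    if "A * A' = 1" "T * T' = 1" "U * U' = 1" for A A' T T' U U' :: complex
    using that by algebra
  ultimately have "((q - inverse q) * qnum q (a + t)) * ((q - inverse q) * qnum q (a + u))
      - ((q - inverse q) * qnum q a) * ((q - inverse q) * qnum q (a + t + u))
      = ((q - inverse q) * qnum q t) * ((q - inverse q) * qnum q u)"
    unfolding qnum_lam power_add by (intro ring)
  then have "((q - inverse q) * (q - inverse q)) * (qnum q (a + t) * qnum q (a + u) - qnum q a * qnum q (a + t + u))
      = ((q - inverse q) * (q - inverse q)) * (qnum q t * qnum q u)"
    by (simp add: algebra_simps)
  then show ?thesis using lam0 by simp
qed

text \<open>The source of the commutator of \<open>Lap\<close> with \<open>Q\<close> in one index,
  and of the recursion for the coefficients in \<open>Lap_Q_pow\<close>.\<close>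

lemma qnum_diag: "qnum q (Suc a) * qnum q (Suc b) - qnum q a * qnum q b = qnum q (Suc (a + b))"
proof (rule qnum_eqI, rule qnum_eqI)
  have ring: "(Q * A - Q' * A') * (Q * B - Q' * B') - (A - A') * (B - B') = (Q - Q') * (Q * (A * B) - Q' * (A' * B'))"
    if "A * A' = 1" "B * B' = 1" "Q * Q' = 1" for A A' B B' Q Q' :: complex
    using that by algebra
  have "(q - inverse q) * ((q - inverse q) * (qnum q (Suc a) * qnum q (Suc b) - qnum q a * qnum q b)) =
    ((q - inverse q) * qnum q (Suc a)) * ((q - inverse q) * qnum q (Suc b))
      - ((q - inverse q) * qnum q a) * ((q - inverse q) * qnum q b)"
    by (simp add: algebra_simps)
  also have "\<dots> = (q - inverse q) * ((q - inverse q) * qnum q (Suc (a + b)))"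
    unfolding qnum_lam power_Suc power_add by (intro ring) simp_all
  finally show "(q - inverse q) * ((q - inverse q) * (qnum q (Suc a) * qnum q (Suc b) - qnum q a * qnum q b)) =
    (q - inverse q) * ((q - inverse q) * qnum q (Suc (a + b)))" .
qed

text \<open>Multiplied by \<open>q - inverse q\<close>, the summand is the difference of
  \<open>inverse q ^ tot n r * q ^ (2 * lo r s)\<close> at \<open>Suc s\<close> and
  \<open>s\<close>, because \<open>tot n r\<close> splits as
  \<open>lo r s + r s + hi n r s\<close>.\<close>

lemma qnum_telescope_lo:
  "(q - inverse q) * (\<Sum>s\<in>{1..<k}. inverse q ^ hi n r s * q ^ lo r s * qnum q (r s)) =
    inverse q ^ tot n r * (q ^ (2 * lo r k) - 1)" if "1 \<le> k" "k \<le> Suc n"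
  using that
proof (induction k rule: nat_induct_at_least)
  case (Suc k)
  then have split: "tot n r = lo r k + r k + hi n r k" by (intro tot_split) auto
  have "(q - inverse q) * (\<Sum>s\<in>{1..<Suc k}. inverse q ^ hi n r s * q ^ lo r s * qnum q (r s)) =
    inverse q ^ tot n r * (q ^ (2 * lo r k) - 1) + inverse q ^ hi n r k * q ^ lo r k * ((q - inverse q) * qnum q (r k))"
    using Suc by (simp add: algebra_simps)
  also have "\<dots> = inverse q ^ tot n r * (q ^ (2 * lo r (Suc k)) - 1)"
  proof -
    have "L' * R' * H' * (L * L - 1) + H' * L * (R - R') = L' * R' * H' * (L * R * (L * R) - 1)"
      if "L * L' = 1" "R * R' = 1" for L L' R R' H' :: complex
      using that by algebra
    then show ?thesis unfolding qnum_lam split lo_Suc[OF Suc.hyps] mult_2 power_add by simp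
  qed
  finally show ?case .
qed simp

text \<open>A q-analogue of the exponents adding up to \<open>tot n r\<close>. The summand is again
  a difference, this time with \<open>inverse q ^ (2 * lo r s)\<close>.\<close>

lemma qnum_telescope:
  "(\<Sum>s\<in>{1..n}. q ^ hi n r s * inverse q ^ lo r s * qnum q (r s)) = qnum q (tot n r)"
proof -
  have *: "(q - inverse q) * (\<Sum>s\<in>{1..<k}. q ^ hi n r s * inverse q ^ lo r s * qnum q (r s)) =
    q ^ tot n r * (1 - inverse q ^ (2 * lo r k))" if "1 \<le> k" "k \<le> Suc n" for k
    using that
  proof (induction k rule: nat_induct_at_least)
    case (Suc k)
    then have split: "tot n r = lo r k + r k + hi n r k" by (intro tot_split) auto
    have "(q - inverse q) * (\<Sum>s\<in>{1..<Suc k}. q ^ hi n r s * inverse q ^ lo r s * qnum q (r s)) =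
      q ^ tot n r * (1 - inverse q ^ (2 * lo r k)) + q ^ hi n r k * inverse q ^ lo r k * ((q - inverse q) * qnum q (r k))"
      using Suc by (simp add: algebra_simps)
    also have "\<dots> = q ^ tot n r * (1 - inverse q ^ (2 * lo r (Suc k)))"
    proof -
      have "L * R * H * (1 - L' * L') + H * L' * (R - R') = L * R * H * (1 - L' * R' * (L' * R'))"
        if "L * L' = 1" "R * R' = 1" for L L' R R' H :: complex
        using that by algebra
      then show ?thesis unfolding qnum_lam split lo_Suc[OF Suc.hyps] mult_2 power_add by simp
    qed
    finally show ?case .
  qed simp
  have "q ^ tot n r * (1 - inverse q ^ (2 * tot n r)) = q ^ tot n r - q ^ tot n r * inverse q ^ tot n r * inverse q ^ tot n r"
    by (simp add: right_diff_distrib mult_2 power_add)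
  then have closed: "q ^ tot n r * (1 - inverse q ^ (2 * tot n r)) = (q - inverse q) * qnum q (tot n r)"
    by (simp add: qnum_lam)
  have eq: "(q - inverse q) * (\<Sum>s\<in>{1..<Suc n}. q ^ hi n r s * inverse q ^ lo r s * qnum q (r s)) =
      q ^ tot n r * (1 - inverse q ^ (2 * tot n r))"
    by (rule *[of "Suc n", unfolded tot_eq_lo[symmetric]]) simp_all
  show ?thesis
    by (rule qnum_eqI) (rule trans[OF eq closed, unfolded atLeastLessThanSuc_atLeastAtMost])
qed

end

section \<open>Monomials in q-commuting variables\<close>

lemma monomial_0: "monomial n x (\<lambda>_. 0) = 1"
  by (induction n) (simp_all add: monomial_def)

lemma monomial_Suc: "monomial (Suc n) x r = monomial n x r * x (Suc n) ^ r (Suc n)"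
  by (simp add: monomial_def)

lemma monomial_cong: "(\<And>i. i \<in> {1..n} \<Longrightarrow> r i = s i) \<Longrightarrow> monomial n x r = monomial n x s"
  unfolding monomial_def by (intro arg_cong[of _ _ prod_list] map_cong) auto

lemma monomial_exps:
  obtains r' where "r' \<in> exps n" "monomial n x r = monomial n x r'" "tot n r' = tot n r"
proof (rule that)
  let ?r = "\<lambda>i. if i \<in> {1..n} then r i else 0"
  show "?r \<in> exps n" by (simp add: exps_def)
  show "monomial n x r = monomial n x ?r" by (rule monomial_cong) simp
  show "tot n ?r = tot n r" by (simp add: tot_def)
qed

lemma commute_power:
  fixes a b :: "'a::complex_algebra_1"
  assumes "a * b = c *\<^sub>C (b * a)"
  shows "a * b ^ m = c ^ m *\<^sub>C (b ^ m * a)" and "a ^ m * b = c ^ m *\<^sub>C (b * a ^ m)"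
proof -
  show "a * b ^ m = c ^ m *\<^sub>C (b ^ m * a)"
  proof (induction m)
    case (Suc m)
    have "a * b ^ Suc m = (a * b) * b ^ m" by (simp add: mult.assoc)
    also have "\<dots> = c *\<^sub>C (b * (a * b ^ m))" by (simp add: assms scaleC_mult_left mult.assoc)
    finally show ?case by (simp add: Suc scaleC_mult_right scaleC_scaleC mult.assoc)
  qed (simp add: scaleC_one)
  show "a ^ m * b = c ^ m *\<^sub>C (b * a ^ m)"
  proof (induction m)
    case (Suc m)
    have "a ^ Suc m * b = a * (a ^ m * b)" by (simp add: mult.assoc)
    also have "\<dots> = c ^ m *\<^sub>C ((a * b) * a ^ m)" by (simp add: Suc scaleC_mult_right mult.assoc)
    finally show ?case by (simp add: assms scaleC_mult_left scaleC_scaleC mult.assoc mult.commute)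
  qed (simp add: scaleC_one)
qed

text \<open>The \<open>w\<close> form an instance with \<open>c = q\<close>, the \<open>z\<close>
  one with \<open>c = inverse q\<close>, so the reordering of monomials is computed once for
  both.\<close>

locale q_commuting =
  fixes n :: nat and c :: complex and x :: "nat \<Rightarrow> 'a::complex_algebra_1"
  assumes comm: "\<And>i j. 1 \<le> i \<Longrightarrow> i < j \<Longrightarrow> j \<le> n \<Longrightarrow> x j * x i = c *\<^sub>C (x i * x j)"
begin

lemma pass_block: "k < j \<Longrightarrow> j \<le> n \<Longrightarrow> x j * monomial k x r = c ^ lo r (Suc k) *\<^sub>C (monomial k x r * x j)"
proof (induction k)
  case 0
  then show ?case by (simp add: monomial_def scaleC_one)
next
  case (Suc k)
  have "x j * monomial (Suc k) x r = (x j * monomial k x r) * x (Suc k) ^ r (Suc k)"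
    by (simp add: monomial_Suc mult.assoc)
  also have "\<dots> = c ^ lo r (Suc k) *\<^sub>C (monomial k x r * (x j * x (Suc k) ^ r (Suc k)))"
    using Suc by (simp add: scaleC_mult_left mult.assoc)
  also have "x j * x (Suc k) ^ r (Suc k) = c ^ r (Suc k) *\<^sub>C (x (Suc k) ^ r (Suc k) * x j)"
    by (rule commute_power, rule comm) (use Suc in auto)
  finally show ?case
    by (simp add: monomial_Suc scaleC_mult_right scaleC_scaleC mult.assoc lo_Suc power_add)
qed

lemma left_mult_block: "1 \<le> j \<Longrightarrow> j \<le> k \<Longrightarrow> k \<le> n \<Longrightarrow>
  x j * monomial k x r = c ^ lo r j *\<^sub>C monomial k x (inc j r)"
proof (induction k)
  case (Suc k)
  show ?case
  proof (cases "j = Suc k")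
    case True
    have "monomial k x (inc j r) = monomial k x r" by (rule monomial_cong) (use True in auto)
    then show ?thesis using pass_block[of k j r] True Suc.prems
      by (simp add: monomial_Suc mult.assoc[symmetric] scaleC_mult_left)
  next
    case False
    with Suc show ?thesis by (simp add: monomial_Suc mult.assoc[symmetric] scaleC_mult_left)
  qed
qed simp

lemma left_mult: "j \<in> {1..n} \<Longrightarrow> x j * monomial n x r = c ^ lo r j *\<^sub>C monomial n x (inc j r)"
  by (rule left_mult_block) auto

lemma left_mult_min: "j \<in> {1..n} \<Longrightarrow> (\<And>i. i < j \<Longrightarrow> r i = 0) \<Longrightarrow> monomial n x (inc j r) = x j * monomial n x r"
  using left_mult[of j r] by (simp add: lo_def scaleC_one)

lemma right_mult_block: "1 \<le> j \<Longrightarrow> j \<le> k \<Longrightarrow> k \<le> n \<Longrightarrow>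
  monomial k x r * x j = c ^ hi k r j *\<^sub>C monomial k x (inc j r)"
proof (induction k)
  case (Suc k)
  show ?case
  proof (cases "j = Suc k")
    case True
    have "monomial k x (inc j r) = monomial k x r" by (rule monomial_cong) (use True in auto)
    then show ?thesis using True
      by (simp add: monomial_Suc hi_def scaleC_one mult.assoc power_commutes)
  next
    case False
    with Suc.prems have "x (Suc k) ^ r (Suc k) * x j = c ^ r (Suc k) *\<^sub>C (x j * x (Suc k) ^ r (Suc k))"
      by (intro commute_power comm) auto
    moreover have "hi (Suc k) r j = hi k r j + r (Suc k)"
    proof -
      have "{j<..Suc k} = insert (Suc k) {j<..k}" using False Suc.prems by auto
      then show ?thesis by (simp add: hi_def)
    qed
    moreover have "monomial k x r * (x j * y) = c ^ hi k r j *\<^sub>C (monomial k x (inc j r) * y)" for y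
      using Suc.IH False Suc.prems by (simp add: mult.assoc[symmetric] scaleC_mult_left)
    ultimately show ?thesis using False
      by (simp add: monomial_Suc mult.assoc scaleC_mult_right scaleC_scaleC power_add mult.commute)
  qed
qed simp

lemma right_mult: "j \<in> {1..n} \<Longrightarrow> monomial n x r * x j = c ^ hi n r j *\<^sub>C monomial n x (inc j r)"
  by (rule right_mult_block) auto

end

text \<open>Covers \<open>d\<close> on monomials in \<open>z\<close> and \<open>db\<close> on monomials in \<open>w\<close>; \<open>Y\<close> consists of the monomials
  in the other variables, on which \<open>\<delta>\<close> does not act.\<close>

locale q_derivative = q_commuting n c x + generic_q c
  for n c and x :: "nat \<Rightarrow> 'a::complex_algebra_1" +
  fixes \<delta> :: "nat \<Rightarrow> 'a \<Rightarrow> 'a" and Y :: "'a set"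
  assumes lin: "\<And>i. i \<in> {1..n} \<Longrightarrow> clinear (\<delta> i)"
    and der: "\<And>i r y. i \<in> {1..n} \<Longrightarrow> y \<in> Y \<Longrightarrow>
      \<delta> i (monomial n x r * y) = (inverse c ^ hi n r i * qnum c (r i)) *\<^sub>C (monomial n x (dec i r) * y)"
begin

lemma mono_mult_left: "j \<in> {1..n} \<Longrightarrow> x j * (monomial n x r * y) = c ^ lo r j *\<^sub>C (monomial n x (inc j r) * y)"
  by (simp add: mult.assoc[symmetric] left_mult scaleC_mult_left)

text \<open>For \<open>i < k\<close> the new \<open>x k\<close> enlarges \<open>hi n r i\<close>
  while the removed \<open>x i\<close> diminishes \<open>lo r k\<close>, and the two powers of
  \<open>c\<close> cancel; for \<open>i > k\<close> neither count changes.\<close>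

lemma der_other:
  assumes "i \<in> {1..n}" "k \<in> {1..n}" "i \<noteq> k" "y \<in> Y"
  shows "\<delta> i (x k * (monomial n x r * y)) = x k * \<delta> i (monomial n x r * y)"
proof (cases "r i = 0")
  case True
  then show ?thesis using assms by (simp add: mono_mult_left cpair.linear_scale[OF lin] der)
next
  case False
  define r' where "r' = dec i r"
  have r: "r = inc i r'" using False by (simp add: r'_def inc_dec)
  show ?thesis using assms unfolding r
    by (simp add: mono_mult_left cpair.linear_scale[OF lin] der dec_inc_commute scaleC_mult_right scaleC_scaleC
        lo_inc hi_inc inc_commute[of k i])
qed

text \<open>Every term is a multiple of the monomial itself, since each
  \<open>x s * \<delta> s\<close> is diagonal. \<open>qnum_telescope_lo\<close> sums the eigenvalues
  for \<open>s < k\<close>, and the recursion \<open>qnum_Suc\<close> accounts for the rest.\<close>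

lemma der_same:
  assumes "k \<in> {1..n}" "y \<in> Y"
  shows "\<delta> k (x k * (monomial n x r * y)) = c *\<^sub>C (x k * \<delta> k (monomial n x r * y)) +
    inverse c ^ tot n r *\<^sub>C (monomial n x r * y) +
    (c - inverse c) *\<^sub>C (\<Sum>s\<in>{1..<k}. x s * \<delta> s (monomial n x r * y))"
proof -
  let ?M = "monomial n x r * y"
  have xs: "x s * \<delta> s ?M = (inverse c ^ hi n r s * c ^ lo r s * qnum c (r s)) *\<^sub>C ?M" if "s \<in> {1..n}" for s
  proof (cases "r s = 0")
    case True
    then show ?thesis using that assms by (simp add: der)
  next
    case False
    then have "inc s (dec s r) = r" "lo (dec s r) s = lo r s"
      by (auto simp: inc_dec lo_def intro!: sum.cong)
    then show ?thesis using that assms by (simp add: der mono_mult_left scaleC_mult_right scaleC_scaleC mult_ac)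
  qed
  have "(\<Sum>s\<in>{1..<k}. x s * \<delta> s ?M) = (\<Sum>s\<in>{1..<k}. inverse c ^ hi n r s * c ^ lo r s * qnum c (r s)) *\<^sub>C ?M"
    using assms xs by (simp add: cvec.scale_sum_left)
  then have sum: "(c - inverse c) *\<^sub>C (\<Sum>s\<in>{1..<k}. x s * \<delta> s ?M) = (inverse c ^ tot n r * (c ^ (2 * lo r k) - 1)) *\<^sub>C ?M"
    using qnum_telescope_lo[of k n r] assms by (simp only: scaleC_scaleC) auto
  have "\<delta> k (x k * ?M) = (c ^ lo r k * (inverse c ^ hi n r k * qnum c (Suc (r k)))) *\<^sub>C ?M"
    using assms by (simp add: mono_mult_left cpair.linear_scale[OF lin] der scaleC_scaleC hi_inc)
  also have "c ^ lo r k * (inverse c ^ hi n r k * qnum c (Suc (r k))) =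
     c * (inverse c ^ hi n r k * c ^ lo r k * qnum c (r k)) + inverse c ^ tot n r
      + inverse c ^ tot n r * (c ^ (2 * lo r k) - 1)"
  proof -
    have "L * (H' * (c * N + R')) = c * (H' * L * N) + L' * R' * H' + L' * R' * H' * (L * L - 1)"
      if "L * L' = 1" for L L' R' H' N :: complex
      using that by algebra
    then show ?thesis unfolding qnum_Suc tot_split[OF assms(1)] mult_2 power_add by simp
  qed
  finally show ?thesis unfolding sum xs[OF assms(1)] by (simp only: scaleC_add_left scaleC_scaleC)
qed

end

lemmas vec_simps = scaleC_add_right scaleC_add_left scaleC_scaleC scaleC_one
  cvec.scale_right_diff_distrib cvec.scale_left_diff_distrib scaleC_mult_right scaleC_mult_left

lemma sum_split_at:
  "1 \<le> j \<Longrightarrow> j < k \<Longrightarrow>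
    (\<Sum>s\<in>{1..<k}. f s) = (\<Sum>s\<in>{1..<j}. f s) + f j + (\<Sum>s\<in>{j<..<k::nat}. f s :: 'a::comm_monoid_add)"
proof -
  assume "1 \<le> j" "j < k"
  then have eq: "{1..<k} = {1..<j} \<union> ({j} \<union> {j<..<k})" by auto
  have "sum f ({1..<j} \<union> ({j} \<union> {j<..<k})) = sum f {1..<j} + sum f ({j} \<union> {j<..<k})"
    by (rule sum.union_disjoint) auto
  then show ?thesis unfolding eq by (simp add: add.assoc)
qed

section \<open>The algebra of \<open>z\<close> and \<open>w\<close>\<close>

locale zw = generic_q q for q :: complex +
  fixes n :: nat and z w :: "nat \<Rightarrow> 'a::complex_algebra_1"
  assumes npos: "n \<ge> 1" and zw: "zw_algebra n q z w"
begin

lemmas zw_presented = zw[unfolded zw_algebra_def]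

lemma zw_rel:
  assumes "r \<in> zw_relations n q" "r \<in> free_on (zw_gens n)"
  shows "free_eval (case_zw_gen z w) r = 0"
  using presented_relation[OF zw_presented assms] .

lemma gens: "i \<in> {1..n} \<Longrightarrow> Z i \<in> zw_gens n" "i \<in> {1..n} \<Longrightarrow> W i \<in> zw_gens n"
  by (auto simp: zw_gens_def)

lemma zz: "1 \<le> i \<Longrightarrow> i < j \<Longrightarrow> j \<le> n \<Longrightarrow> z j * z i = inverse q *\<^sub>C (z i * z j)"
proof -
  assume a: "1 \<le> i" "i < j" "j \<le> n"
  have "gen (Z i) * gen (Z j) - q *\<^sub>C (gen (Z j) * gen (Z i)) \<in> zw_relations n q"
    unfolding zw_relations_def using a by blast
  from zw_rel[OF this] a show ?thesis by (simp add: free_on_intros gens vec_simps)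
qed

lemma ww: "1 \<le> i \<Longrightarrow> i < j \<Longrightarrow> j \<le> n \<Longrightarrow> w j * w i = q *\<^sub>C (w i * w j)"
proof -
  assume a: "1 \<le> i" "i < j" "j \<le> n"
  have "gen (W i) * gen (W j) - inverse q *\<^sub>C (gen (W j) * gen (W i)) \<in> zw_relations n q"
    unfolding zw_relations_def using a by blast
  from zw_rel[OF this] a show ?thesis by (simp add: free_on_intros gens vec_simps)
qed

lemma wz: "i \<in> {1..n} \<Longrightarrow> j \<in> {1..n} \<Longrightarrow> i \<noteq> j \<Longrightarrow> w j * z i = q *\<^sub>C (z i * w j)"
proof -
  assume a: "i \<in> {1..n}" "j \<in> {1..n}" "i \<noteq> j"
  have "gen (W j) * gen (Z i) - q *\<^sub>C (gen (Z i) * gen (W j)) \<in> zw_relations n q"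
    unfolding zw_relations_def using a by blast
  from zw_rel[OF this] a show ?thesis by (simp add: free_on_intros gens)
qed

lemma wzk: "k \<in> {1..n} \<Longrightarrow> w k * z k = z k * w k + (1 - q^2) *\<^sub>C (\<Sum>s\<in>{1..<k}. z s * w s)"
proof -
  assume a: "k \<in> {1..n}"
  have "gen (W k) * gen (Z k) - (gen (Z k) * gen (W k) +
        (1 - q^2) *\<^sub>C (\<Sum>s\<in>{1..<k}. gen (Z s) * gen (W s))) \<in> zw_relations n q"
    unfolding zw_relations_def using a by blast
  moreover have "gen (W k) * gen (Z k) - (gen (Z k) * gen (W k) +
        (1 - q^2) *\<^sub>C (\<Sum>s\<in>{1..<k}. gen (Z s) * gen (W s))) \<in> free_on (zw_gens n)"
    by (intro free_on_intros gens) (use a in auto)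
  ultimately show ?thesis using zw_rel by fastforce
qed

text \<open>An initial segment of \<open>Q\<close> applied to \<open>X\<close>. It stays folded so
  that the correction terms of \<open>w k * z k\<close> can be compared and cancelled as single
  terms.\<close>

definition ZW :: "nat \<Rightarrow> 'a \<Rightarrow> 'a" where "ZW k X = (\<Sum>s\<in>{1..<k}. z s * (w s * X))"

lemma wzk_mult: "k \<in> {1..n} \<Longrightarrow> w k * (z k * X) = z k * (w k * X) + (1 - q^2) *\<^sub>C ZW k X"
  by (simp add: mult.assoc[symmetric] wzk distrib_right scaleC_mult_left ZW_def sum_distrib_right)

lemma wz_mult: "i \<in> {1..n} \<Longrightarrow> j \<in> {1..n} \<Longrightarrow> i \<noteq> j \<Longrightarrow> w j * (z i * X) = q *\<^sub>C (z i * (w j * X))"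
  by (simp add: mult.assoc[symmetric] wz scaleC_mult_left)

lemma zw_mult: "i \<in> {1..n} \<Longrightarrow> j \<in> {1..n} \<Longrightarrow> i \<noteq> j \<Longrightarrow> z i * (w j * X) = inverse q *\<^sub>C (w j * (z i * X))"
  by (simp add: wz_mult vec_simps)

sublocale zq: q_commuting n "inverse q" z
  by unfold_locales (rule zz)

sublocale wq: q_commuting n q w
  by unfold_locales (rule ww)

lemma zw_algebra_induct:
  assumes "P 1" "\<And>i Y. i \<in> {1..n} \<Longrightarrow> P Y \<Longrightarrow> P (z i * Y)" "\<And>i Y. i \<in> {1..n} \<Longrightarrow> P Y \<Longrightarrow> P (w i * Y)"
    and "\<And>a b. P a \<Longrightarrow> P b \<Longrightarrow> P (a + b)" "\<And>c a. P a \<Longrightarrow> P (c *\<^sub>C a)"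
  shows "P Y"
proof (rule presented_induct[OF zw_presented, of P])
  fix x Y assume "x \<in> zw_gens n" "P Y"
  then show "P (case_zw_gen z w x * Y)" by (auto simp: zw_gens_def assms(2,3))
qed (use assms in auto)

subsection \<open>Homogeneous components\<close>

abbreviation A :: "nat \<Rightarrow> nat \<Rightarrow> 'a set" where "A \<equiv> homog n z w"

text \<open>The monomials with the \<open>w\<close> in front, on which \<open>db i\<close>,
  \<open>Q\<close> and finally \<open>Lap\<close> act explicitly. \<open>A_eq_B\<close> identifies
  their spans with the components defined by the other order.\<close>

definition M :: "(nat \<Rightarrow> nat) \<Rightarrow> (nat \<Rightarrow> nat) \<Rightarrow> 'a" where "M s r = monomial n w s * monomial n z r"

definition B :: "nat \<Rightarrow> nat \<Rightarrow> 'a set" where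
  "B m m' = cvec.span {M s r |s r. s \<in> exps n \<and> r \<in> exps n \<and> tot n r = m \<and> tot n s = m'}"

lemma subspace_A [simp]: "cvec.subspace (A m m')"
  by (simp add: homog_def cvec.subspace_span)

lemma A_I: "tot n r = m \<Longrightarrow> tot n s = m' \<Longrightarrow> monomial n z r * monomial n w s \<in> A m m'"
  unfolding homog_def tot_def by (rule cvec.span_base) blast

lemma A_def': "A m m' = cvec.span {monomial n z r * monomial n w s |s r.
    s \<in> exps n \<and> r \<in> exps n \<and> tot n r = m \<and> tot n s = m'}" (is "_ = cvec.span ?S")
proof -
  have "{monomial n z r * monomial n w s |r s. (\<Sum>i=1..n. r i) = m \<and> (\<Sum>i=1..n. s i) = m'} = ?S"
  proof (intro set_eqI iffI; clarsimp)
    fix r s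
    obtain r' where "r' \<in> exps n" "monomial n z r = monomial n z r'" "tot n r' = tot n r" by (rule monomial_exps)
    moreover obtain s' where "s' \<in> exps n" "monomial n w s = monomial n w s'" "tot n s' = tot n s" by (rule monomial_exps)
    ultimately show "\<exists>s' r'. monomial n z r * monomial n w s = monomial n z r' * monomial n w s' \<and>
      s' \<in> exps n \<and> r' \<in> exps n \<and> tot n r' = sum r {Suc 0..n} \<and> tot n s' = sum s {Suc 0..n}"
      unfolding tot_def by (metis One_nat_def)
  next
    fix s r assume "s \<in> exps n" "r \<in> exps n"
    show "\<exists>r' s'. monomial n z r * monomial n w s = monomial n z r' * monomial n w s' \<and>
       sum r' {Suc 0..n} = tot n r \<and> sum s' {Suc 0..n} = tot n s"
      by (intro exI[of _ r] exI[of _ s]) (simp add: tot_def)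
  qed
  then show ?thesis by (simp add: homog_def)
qed

lemma z_A: "p \<in> A m m' \<Longrightarrow> j \<in> {1..n} \<Longrightarrow> z j * p \<in> A (Suc m) m'"
  unfolding A_def'[of m m']
proof (erule clinear_span_into[OF clinear_mult_left, rotated 2])
  assume j: "j \<in> {1..n}"
  fix b assume "b \<in> {monomial n z r * monomial n w s |s r. s \<in> exps n \<and> r \<in> exps n \<and> tot n r = m \<and> tot n s = m'}"
  then obtain s r where b: "b = monomial n z r * monomial n w s" "tot n r = m" "tot n s = m'" by auto
  have "z j * b = inverse q ^ lo r j *\<^sub>C (monomial n z (inc j r) * monomial n w s)"
    unfolding b mult.assoc[symmetric] using j by (simp add: zq.left_mult scaleC_mult_left)
  then show "z j * b \<in> A (Suc m) m'" using b j
    by (auto intro!: cvec.subspace_scale[OF subspace_A] A_I simp: tot_inc)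
qed simp

text \<open>\<open>w j\<close> is pushed to the right past one leading \<open>z i\<close> at a time.
  The corrections have the form \<open>z s * (w s * X)\<close>, so they have the same bidegree and
  fall under the induction hypothesis.\<close>

lemma w_A: "p \<in> A m m' \<Longrightarrow> j \<in> {1..n} \<Longrightarrow> w j * p \<in> A m (Suc m')"
proof -
  have main: "w j * (monomial n z r * monomial n w s) \<in> A (tot n r) (Suc (tot n s))"
    if "r \<in> exps n" "j \<in> {1..n}" for r s j
    using that
  proof (induction arbitrary: j rule: exps_induct_min)
    case zero
    then have "w j * monomial n w s = q ^ lo s j *\<^sub>C monomial n w (inc j s)" by (simp add: wq.left_mult)
    moreover have "monomial n z (\<lambda>_. 0) * monomial n w (inc j s) \<in> A (tot n (\<lambda>_. 0)) (Suc (tot n s))"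
      by (rule A_I) (use zero in \<open>simp_all add: tot_inc\<close>)
    ultimately show ?case using zero by (simp add: monomial_0 cvec.subspace_scale)
  next
    case (inc i r)
    let ?X = "monomial n z r * monomial n w s"
    have zi: "monomial n z (inc i r) * monomial n w s = z i * ?X"
      using inc by (simp add: zq.left_mult_min mult.assoc)
    have t: "tot n (inc i r) = Suc (tot n r)" using inc by (simp add: tot_inc)
    have *: "z a * (w b * ?X) \<in> A (Suc (tot n r)) (Suc (tot n s))" if "a \<in> {1..n}" "b \<in> {1..n}" for a b
      using inc that by (intro z_A) auto
    show ?case
    proof (cases "i = j")
      case True
      then show ?thesis unfolding zi t using inc *
        by (auto simp: wzk_mult ZW_def intro!: cvec.subspace_add cvec.subspace_scale cvec.subspace_sum)
    next
      case False
      then show ?thesis unfolding zi t using inc *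
        by (auto simp: wz_mult intro!: cvec.subspace_scale)
    qed
  qed
  assume "p \<in> A m m'" and j: "j \<in> {1..n}"
  then show ?thesis unfolding A_def'[of m m']
    by (elim clinear_span_into[OF clinear_mult_left, rotated 2]) (auto intro: main)
qed

lemma M_A: "s \<in> exps n \<Longrightarrow> M s r \<in> A (tot n r) (tot n s)"
proof (induction rule: exps_induct_min)
  case zero
  have "monomial n z r * monomial n w (\<lambda>_. 0) \<in> A (tot n r) (tot n (\<lambda>_. 0))" by (rule A_I) simp_all
  then show ?case by (simp add: M_def monomial_0)
next
  case (inc j s)
  then have "w j * M s r \<in> A (tot n r) (Suc (tot n s))" by (intro w_A)
  with inc show ?case by (simp add: M_def wq.left_mult_min mult.assoc tot_inc)
qed

lemma subspace_B [simp]: "cvec.subspace (B m m')"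
  by (simp add: B_def cvec.subspace_span)

lemma M_B: "s \<in> exps n \<Longrightarrow> r \<in> exps n \<Longrightarrow> tot n r = m \<Longrightarrow> tot n s = m' \<Longrightarrow> M s r \<in> B m m'"
  unfolding B_def by (rule cvec.span_base) blast

lemma w_M: "j \<in> {1..n} \<Longrightarrow> w j * M s r = q ^ lo s j *\<^sub>C M (inc j s) r"
  by (simp add: M_def mult.assoc[symmetric] wq.left_mult scaleC_mult_left)

lemma w_B: "p \<in> B m m' \<Longrightarrow> j \<in> {1..n} \<Longrightarrow> w j * p \<in> B m (Suc m')"
  unfolding B_def[of m m']
  by (elim clinear_span_into[OF clinear_mult_left, rotated 2])
    (auto simp: w_M tot_inc exps_inc intro!: cvec.subspace_scale M_B)

lemma z_B: "p \<in> B m m' \<Longrightarrow> j \<in> {1..n} \<Longrightarrow> z j * p \<in> B (Suc m) m'"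
proof -
  have main: "z j * M s r \<in> B (Suc (tot n r)) (tot n s)"
    if "s \<in> exps n" "r \<in> exps n" "j \<in> {1..n}" for r s j
    using that
  proof (induction arbitrary: j rule: exps_induct_min)
    case zero
    then have "z j * monomial n z r = inverse q ^ lo r j *\<^sub>C monomial n z (inc j r)" by (simp add: zq.left_mult)
    moreover have "M (\<lambda>_. 0) (inc j r) \<in> B (Suc (tot n r)) (tot n (\<lambda>_. 0))"
      by (rule M_B) (use zero in \<open>simp_all add: tot_inc exps_zero exps_inc\<close>)
    ultimately show ?case using zero by (simp add: M_def monomial_0 cvec.subspace_scale)
  next
    case (inc i s)
    have wi: "M (inc i s) r = w i * M s r"
      using inc by (simp add: M_def wq.left_mult_min mult.assoc)
    have t: "tot n (inc i s) = Suc (tot n s)" using inc by (simp add: tot_inc)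
    have *: "w b * (z a * M s r) \<in> B (Suc (tot n r)) (Suc (tot n s))" if "a \<in> {1..n}" "b \<in> {1..n}" for a b
      using inc that by (intro w_B) auto
    \<comment> \<open>Solved for \<open>z a * w a\<close>, the relation has corrections with indices
      below \<open>a\<close> only, whence the inner induction on \<open>a\<close>.\<close>
    have diag: "z a * (w a * M s r) \<in> B (Suc (tot n r)) (Suc (tot n s))" if "a \<in> {1..n}" for a
      using that
    proof (induction a rule: less_induct)
      case (less a)
      have eq: "z a * (w a * M s r) = w a * (z a * M s r) - (1 - q^2) *\<^sub>C ZW a (M s r)"
        using less by (simp add: wzk_mult)
      show ?case unfolding eq ZW_def
        by (intro cvec.subspace_diff cvec.subspace_scale cvec.subspace_sum) (use less * in auto)
    qed
    show ?case
    proof (cases "i = j")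
      case True
      then show ?thesis unfolding wi t using inc diag by auto
    next
      case False
      then show ?thesis unfolding wi t using inc *
        by (auto simp: zw_mult intro!: cvec.subspace_scale)
    qed
  qed
  assume "p \<in> B m m'" and j: "j \<in> {1..n}"
  then show ?thesis unfolding B_def[of m m']
    by (elim clinear_span_into[OF clinear_mult_left, rotated 2]) (auto intro: main)
qed

lemma A_eq_B: "A m m' = B m m'"
proof (rule antisym)
  have "monomial n z r * monomial n w s \<in> B (tot n r) (tot n s)" if "r \<in> exps n" "s \<in> exps n" for r s
    using that
  proof (induction rule: exps_induct_min)
    case zero
    have "M s (\<lambda>_. 0) \<in> B (tot n (\<lambda>_. 0)) (tot n s)" by (rule M_B) (use zero in \<open>simp_all add: exps_zero\<close>)
    then show ?case by (simp add: M_def monomial_0)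
  next
    case (inc j r)
    then have "z j * (monomial n z r * monomial n w s) \<in> B (Suc (tot n r)) (tot n s)" by (intro z_B) auto
    with inc show ?case by (simp add: zq.left_mult_min mult.assoc tot_inc)
  qed
  then show "A m m' \<subseteq> B m m'" unfolding A_def' by (intro cvec.span_minimal) auto
  show "B m m' \<subseteq> A m m'" unfolding B_def by (intro cvec.span_minimal) (auto intro: M_A)
qed

lemma A_induct [consumes 1, case_names zero add scale mono]:
  assumes "p \<in> A m m'" "P 0" "\<And>a b. P a \<Longrightarrow> P b \<Longrightarrow> P (a + b)" "\<And>c a. P a \<Longrightarrow> P (c *\<^sub>C a)"
    "\<And>s r. s \<in> exps n \<Longrightarrow> r \<in> exps n \<Longrightarrow> tot n r = m \<Longrightarrow> tot n s = m' \<Longrightarrow> P (M s r)"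
  shows "P p"
  using assms(1) unfolding A_eq_B B_def
  by (induction rule: cvec.span_induct_alt) (use assms(2-5) in auto)

lemma A_induct' [consumes 1, case_names zero add scale mono]:
  assumes "p \<in> A m m'" "P 0" "\<And>a b. P a \<Longrightarrow> P b \<Longrightarrow> P (a + b)" "\<And>c a. P a \<Longrightarrow> P (c *\<^sub>C a)"
    "\<And>s r. s \<in> exps n \<Longrightarrow> r \<in> exps n \<Longrightarrow> tot n r = m \<Longrightarrow> tot n s = m' \<Longrightarrow> P (monomial n z r * monomial n w s)"
  shows "P p"
  using assms(1) unfolding A_def'
  by (induction rule: cvec.span_induct_alt) (use assms(2-5) in auto)

lemma all_homog_induct:
  assumes "\<And>a b. P a \<Longrightarrow> P b \<Longrightarrow> P (a + b)" "\<And>m m' p. p \<in> A m m' \<Longrightarrow> P p"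
  shows "P p"
proof -
  have base: "x \<in> cvec.span (\<Union>m m'. A m m')" if "x \<in> A m m'" for x m m'
    using that by (intro cvec.span_base) blast
  have "p \<in> cvec.span (\<Union>m m'. A m m')" for p
  proof (induction p rule: zw_algebra_induct)
    case 1
    have "monomial n z (\<lambda>_. 0) * monomial n w (\<lambda>_. 0) \<in> A 0 0" by (rule A_I) (simp_all add: tot_zero)
    then show ?case by (auto simp: monomial_0 intro: cvec.span_base)
  next
    case (2 i Y)
    show ?case by (rule clinear_span_into[OF clinear_mult_left _ _ 2(2)]) (use base[OF z_A[OF _ 2(1)]] in auto)
  next
    case (3 i Y)
    show ?case by (rule clinear_span_into[OF clinear_mult_left _ _ 3(2)]) (use base[OF w_A[OF _ 3(1)]] in auto)
  qed (simp_all add: cvec.span_add cvec.span_scale)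
  then show ?thesis
  proof (induction p rule: cvec.span_induct_alt)
    case base
    show ?case by (rule assms(2)[of _ 0 0]) (simp add: cvec.subspace_0)
  next
    case (step c x y)
    then obtain m m' where "x \<in> A m m'" by blast
    then have "P (c *\<^sub>C x)" by (intro assms(2) cvec.subspace_scale) simp_all
    with step show ?case by (intro assms(1))
  qed
qed

lemma clinear_eqI:
  assumes "clinear f" "clinear g" "\<And>s r. s \<in> exps n \<Longrightarrow> r \<in> exps n \<Longrightarrow> f (M s r) = g (M s r)"
  shows "f p = g p"
proof (induction p rule: all_homog_induct)
  case (2 m m' p)
  then show ?case by (induction rule: A_induct) (simp_all add: assms clinear_simps)
qed (simp add: assms clinear_simps)

lemma clinear_eqI':
  assumes "clinear f" "clinear g"
    "\<And>s r. s \<in> exps n \<Longrightarrow> r \<in> exps n \<Longrightarrow> f (monomial n z r * monomial n w s) = g (monomial n z r * monomial n w s)"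
  shows "f p = g p"
proof (induction p rule: all_homog_induct)
  case (2 m m' p)
  then show ?case by (induction rule: A_induct') (simp_all add: assms clinear_simps)
qed (simp add: assms clinear_simps)

subsection \<open>The element \<open>Q\<close>\<close>

abbreviation Q :: 'a where "Q \<equiv> Q_elem n z w"

text \<open>Let \<open>Q_k\<close> be the sum of the first \<open>k\<close> products
  \<open>z i * w i\<close>. The relation for \<open>w (Suc k) * z (Suc k)\<close> says that
  \<open>Q_(k+1)\<close> is this product plus \<open>q^2\<close> times \<open>Q_k\<close>; iteration
  produces the powers of \<open>q^2\<close>.\<close>

lemma Q_wz: "Q = (\<Sum>i=1..n. (q ^ (2 * (n - i))) *\<^sub>C (w i * z i))"
proof -
  have "(\<Sum>i=1..k. z i * w i) = (\<Sum>i=1..k. (q ^ (2 * (k - i))) *\<^sub>C (w i * z i))" if "k \<le> n" for k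
    using that
  proof (induction k)
    case (Suc k)
    have "(\<Sum>i=1..k. (q ^ (2 * (Suc k - i))) *\<^sub>C (w i * z i)) = q^2 *\<^sub>C (\<Sum>i=1..k. (q ^ (2 * (k - i))) *\<^sub>C (w i * z i))"
      unfolding cvec.scale_sum_right
    proof (rule sum.cong)
      fix i assume "i \<in> {1..k}"
      then have "2 * (Suc k - i) = 2 + 2 * (k - i)" by auto
      then show "q ^ (2 * (Suc k - i)) *\<^sub>C (w i * z i) = q\<^sup>2 *\<^sub>C q ^ (2 * (k - i)) *\<^sub>C (w i * z i)"
        by (simp only: power_add scaleC_scaleC)
    qed simp
    then show ?case using Suc
      by (simp add: wzk atLeastLessThanSuc_atLeastAtMost vec_simps)
  qed simp
  from this[of n] show ?thesis by (simp add: Q_elem_def)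
qed

text \<open>When \<open>z j\<close> or \<open>w j\<close> is moved through \<open>Q\<close>, the
  summands with \<open>i < j\<close> gain a factor \<open>q^2\<close> and those with
  \<open>i > j\<close> none; the correction from \<open>i = j\<close> is \<open>1 - q^2\<close>
  times the initial segment and restores the balance.\<close>

lemma Q_central: "Q * p = p * Q"
proof (induction p rule: zw_algebra_induct)
  case 1
  show ?case by simp
next
  case (2 j Y)
  have "Q * z j = (\<Sum>i=1..n. z i * w i * z j)" by (simp add: Q_elem_def sum_distrib_right)
  also have "\<dots> = (\<Sum>i\<in>{1..<Suc n}. z j * (z i * w i) +
     (if i < j then (q^2 - 1) *\<^sub>C (z j * (z i * w i)) else if i = j then (1 - q^2) *\<^sub>C (z j * (\<Sum>s\<in>{1..<j}. z s * w s)) else 0))"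
    unfolding atLeastLessThanSuc_atLeastAtMost
  proof (rule sum.cong)
    fix i assume i: "i \<in> {1..n}"
    consider "i < j" | "i = j" | "j < i" by linarith
    then show "z i * w i * z j = z j * (z i * w i) +
     (if i < j then (q^2 - 1) *\<^sub>C (z j * (z i * w i)) else if i = j then (1 - q^2) *\<^sub>C (z j * (\<Sum>s\<in>{1..<j}. z s * w s)) else 0)"
    proof cases
      case 1
      then have "z i * w i * z j = q *\<^sub>C (z i * z j * w i)" using i 2 by (simp add: mult.assoc wz scaleC_mult_right)
      also have "z i * z j = q *\<^sub>C (z j * z i)" using zz[of i j] i 2 1 by (simp add: vec_simps)
      finally show ?thesis using 1 by (simp add: vec_simps mult.assoc power2_eq_square)
    next
      case 2
      then show ?thesis using i by (simp add: mult.assoc wzk vec_simps distrib_left right_diff_distrib)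
    next
      case 3
      then have "z i * w i * z j = q *\<^sub>C (z i * z j * w i)" using i 2 by (simp add: mult.assoc wz scaleC_mult_right)
      also have "z i * z j = inverse q *\<^sub>C (z j * z i)" using zz[of j i] i 2 3 by simp
      finally show ?thesis using 3 by (simp add: vec_simps mult.assoc)
    qed
  qed simp
  also have "\<dots> = z j * Q"
  proof -
    have "(\<Sum>i\<in>{1..<Suc n}. (if i < j then (q^2 - 1) *\<^sub>C (z j * (z i * w i)) else if i = j then (1 - q^2) *\<^sub>C (z j * (\<Sum>s\<in>{1..<j}. z s * w s)) else 0)) = 0"
      using 2(1) by (subst sum_split_at[of j]) (auto simp: cvec.scale_sum_right sum_distrib_left vec_simps sum_subtractf)
    then show ?thesis unfolding sum.distrib Q_elem_def by (simp add: sum_distrib_left atLeastLessThanSuc_atLeastAtMost)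
  qed
  finally show ?case using 2(2) by (metis mult.assoc)
next
  case (3 j Y)
  have "w j * Q = (\<Sum>i=1..n. w j * (z i * w i))" by (simp add: Q_elem_def sum_distrib_left)
  also have "\<dots> = (\<Sum>i\<in>{1..<Suc n}. z i * w i * w j +
     (if i < j then (q^2 - 1) *\<^sub>C (z i * w i * w j) else if i = j then (1 - q^2) *\<^sub>C ((\<Sum>s\<in>{1..<j}. z s * w s) * w j) else 0))"
    unfolding atLeastLessThanSuc_atLeastAtMost
  proof (rule sum.cong)
    fix i assume i: "i \<in> {1..n}"
    consider "i < j" | "i = j" | "j < i" by linarith
    then show "w j * (z i * w i) = z i * w i * w j +
     (if i < j then (q^2 - 1) *\<^sub>C (z i * w i * w j) else if i = j then (1 - q^2) *\<^sub>C ((\<Sum>s\<in>{1..<j}. z s * w s) * w j) else 0)"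
    proof cases
      case 1
      then have "w j * (z i * w i) = q *\<^sub>C (z i * (w j * w i))" using i 3 by (simp add: wz_mult)
      also have "w j * w i = q *\<^sub>C (w i * w j)" using ww[of i j] i 3 1 by simp
      finally show ?thesis using 1 by (simp add: vec_simps mult.assoc power2_eq_square)
    next
      case 2
      then show ?thesis using i by (simp add: mult.assoc[symmetric] wzk vec_simps distrib_right left_diff_distrib)
    next
      case eq: 3
      then have "w j * (z i * w i) = q *\<^sub>C (z i * (w j * w i))" using i 3 by (simp add: wz_mult)
      also have "w j * w i = inverse q *\<^sub>C (w i * w j)" using ww[of j i] i 3 eq by (simp add: vec_simps)
      finally show ?thesis using eq by (simp add: vec_simps mult.assoc)
    qed
  qed simp
  also have "\<dots> = Q * w j"
  proof -
    have "(\<Sum>i\<in>{1..<Suc n}. (if i < j then (q^2 - 1) *\<^sub>C (z i * w i * w j) else if i = j then (1 - q^2) *\<^sub>C ((\<Sum>s\<in>{1..<j}. z s * w s) * w j) else 0)) = 0"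
      using 3(1) by (subst sum_split_at[of j]) (auto simp: cvec.scale_sum_right sum_distrib_right vec_simps sum_subtractf)
    then show ?thesis unfolding sum.distrib Q_elem_def by (simp add: sum_distrib_right atLeastLessThanSuc_atLeastAtMost)
  qed
  finally show ?case using 3(2) by (metis mult.assoc)
qed (simp_all add: distrib_left distrib_right scaleC_mult_left scaleC_mult_right)

lemma Q_A: "p \<in> A m m' \<Longrightarrow> Q * p \<in> A (Suc m) (Suc m')"
  unfolding Q_elem_def sum_distrib_right mult.assoc
  by (intro cvec.subspace_sum z_A w_A) auto

text \<open>Being central, \<open>Q\<close> may be inserted between the block of \<open>w\<close>
  and the block of \<open>z\<close>. In the form \<open>Q_wz\<close> each summand then extends the
  first block from the right and the second from the left.\<close>

lemma Q_M: "Q * M s r = (\<Sum>i=1..n. (q ^ (2 * (n - i)) * q ^ hi n s i * inverse q ^ lo r i) *\<^sub>C M (inc i s) (inc i r))"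
proof -
  have "Q * M s r = monomial n w s * Q * monomial n z r"
    unfolding M_def by (metis Q_central mult.assoc)
  also have "\<dots> = (\<Sum>i=1..n. (q ^ (2 * (n - i))) *\<^sub>C ((monomial n w s * w i) * (z i * monomial n z r)))"
    by (simp add: Q_wz sum_distrib_left sum_distrib_right vec_simps mult.assoc)
  also have "\<dots> = (\<Sum>i=1..n. (q ^ (2 * (n - i)) * q ^ hi n s i * inverse q ^ lo r i) *\<^sub>C M (inc i s) (inc i r))"
    by (rule sum.cong) (simp_all add: wq.right_mult zq.left_mult vec_simps M_def mult_ac)
  finally show ?thesis .
qed

end

section \<open>The q-derivatives and the q-Laplace operator\<close>

locale zw_diff = zw q n z w for q n and z w :: "nat \<Rightarrow> 'a::complex_algebra_1" +
  fixes d db :: "nat \<Rightarrow> 'a \<Rightarrow> 'a"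
  assumes d: "\<And>i. i \<in> {1..n} \<Longrightarrow> is_partial n q z w i (d i)"
    and db: "\<And>i. i \<in> {1..n} \<Longrightarrow> is_partial_bar n q z w i (db i)"
begin

lemma clinear_d: "i \<in> {1..n} \<Longrightarrow> clinear (d i)"
  and clinear_db: "i \<in> {1..n} \<Longrightarrow> clinear (db i)"
  using d db by (simp_all add: is_partial_def is_partial_bar_def)

lemma d_mono: "i \<in> {1..n} \<Longrightarrow> d i (monomial n z r * monomial n w s) =
    (q ^ hi n r i * qnum q (r i)) *\<^sub>C (monomial n z (dec i r) * monomial n w s)"
  using d by (simp add: is_partial_def hi_def dec_def)

lemma db_M: "i \<in> {1..n} \<Longrightarrow> db i (M s r) = (inverse q ^ hi n s i * qnum q (s i)) *\<^sub>C M (dec i s) r"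
  using db by (simp add: is_partial_bar_def hi_def dec_def M_def)

lemma generic_inverse: "generic_q (inverse q)"
  by unfold_locales (use q0 nonroot in \<open>auto simp: power_inverse\<close>)

interpretation zd: q_derivative n "inverse q" z d "range (monomial n w)"
  by (intro q_derivative.intro q_derivative_axioms.intro generic_inverse zq.q_commuting_axioms clinear_d)
    (auto simp: d_mono qnum_inverse)

interpretation wd: q_derivative n q w db "range (monomial n z)"
  by (intro q_derivative.intro q_derivative_axioms.intro generic_q_axioms wq.q_commuting_axioms clinear_db)
    (auto simp: db_M M_def[symmetric])

lemma d_z_other: "i \<in> {1..n} \<Longrightarrow> k \<in> {1..n} \<Longrightarrow> i \<noteq> k \<Longrightarrow> d i (z k * p) = z k * d i p"
  by (rule clinear_eqI'[where f = "\<lambda>p. d i (z k * p)"])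
    (auto intro!: clinear_compose[OF clinear_d] clinear_compose[OF clinear_mult_left] clinear_mult_left
      clinear_d zd.der_other)

lemma db_w_other: "i \<in> {1..n} \<Longrightarrow> k \<in> {1..n} \<Longrightarrow> i \<noteq> k \<Longrightarrow> db i (w k * p) = w k * db i p"
  by (rule clinear_eqI[where f = "\<lambda>p. db i (w k * p)"])
    (auto simp: M_def intro!: clinear_compose[OF clinear_db] clinear_compose[OF clinear_mult_left] clinear_mult_left
      clinear_db wd.der_other)

text \<open>The rule for monomials extended by linearity; its middle coefficient depends on the
  degree in the \<open>z\<close>, which is why \<open>p\<close> is taken in one component.\<close>

lemma d_z_same:
  assumes "p \<in> A m m'" "k \<in> {1..n}"
  shows "d k (z k * p) = inverse q *\<^sub>C (z k * d k p) + q ^ m *\<^sub>C p +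
    (inverse q - q) *\<^sub>C (\<Sum>s\<in>{1..<k}. z s * d s p)"
  using assms(1)
proof (induction rule: A_induct')
  case zero
  then show ?case using assms by (simp add: clinear_simps[OF clinear_d])
next
  case (add a b)
  have "(\<Sum>s\<in>{1..<k}. z s * d s (a + b)) = (\<Sum>s\<in>{1..<k}. z s * d s a) + (\<Sum>s\<in>{1..<k}. z s * d s b)"
    unfolding sum.distrib[symmetric] using assms(2)
    by (intro sum.cong) (auto simp: clinear_simps[OF clinear_d] distrib_left)
  with add show ?case using assms(2)
    by (simp add: clinear_simps[OF clinear_d] distrib_left scaleC_add_right)
next
  case (scale c a)
  have "(\<Sum>s\<in>{1..<k}. z s * d s (c *\<^sub>C a)) = c *\<^sub>C (\<Sum>s\<in>{1..<k}. z s * d s a)"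
    unfolding cvec.scale_sum_right using assms(2)
    by (intro sum.cong) (auto simp: clinear_simps[OF clinear_d] scaleC_mult_right)
  with scale show ?case using assms(2)
    by (simp add: clinear_simps[OF clinear_d] scaleC_mult_right scaleC_add_right scaleC_scaleC mult_ac)
next
  case (mono s r)
  then show ?case using zd.der_same[OF assms(2), of "monomial n w s" r] by simp
qed

lemma db_w_same:
  assumes "p \<in> A m m'" "k \<in> {1..n}"
  shows "db k (w k * p) = q *\<^sub>C (w k * db k p) + inverse q ^ m' *\<^sub>C p +
    (q - inverse q) *\<^sub>C (\<Sum>s\<in>{1..<k}. w s * db s p)"
  using assms(1)
proof (induction rule: A_induct)
  case zero
  then show ?case using assms by (simp add: clinear_simps[OF clinear_db])
next
  case (add a b)
  have "(\<Sum>s\<in>{1..<k}. w s * db s (a + b)) = (\<Sum>s\<in>{1..<k}. w s * db s a) + (\<Sum>s\<in>{1..<k}. w s * db s b)"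
    unfolding sum.distrib[symmetric] using assms(2)
    by (intro sum.cong) (auto simp: clinear_simps[OF clinear_db] distrib_left)
  with add show ?case using assms(2)
    by (simp add: clinear_simps[OF clinear_db] distrib_left scaleC_add_right)
next
  case (scale c a)
  have "(\<Sum>s\<in>{1..<k}. w s * db s (c *\<^sub>C a)) = c *\<^sub>C (\<Sum>s\<in>{1..<k}. w s * db s a)"
    unfolding cvec.scale_sum_right using assms(2)
    by (intro sum.cong) (auto simp: clinear_simps[OF clinear_db] scaleC_mult_right)
  with scale show ?case using assms(2)
    by (simp add: clinear_simps[OF clinear_db] scaleC_mult_right scaleC_add_right scaleC_scaleC mult_ac)
next
  case (mono s r)
  then show ?case using wd.der_same[OF assms(2), of "monomial n z r" s] by (simp add: M_def)
qed

lemma d_A: "p \<in> A (Suc m) m' \<Longrightarrow> i \<in> {1..n} \<Longrightarrow> d i p \<in> A m m'"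
proof (induction rule: A_induct')
  case (mono s r)
  show ?case
  proof (cases "r i = 0")
    case False
    then have "tot n r = Suc (tot n (dec i r))" using tot_inc[of n i "dec i r"] mono by (simp add: inc_dec)
    with mono show ?thesis by (auto simp: d_mono intro!: cvec.subspace_scale A_I)
  qed (use mono in \<open>simp add: d_mono cvec.subspace_0\<close>)
qed (auto simp: clinear_simps[OF clinear_d] cvec.subspace_0 cvec.subspace_add cvec.subspace_scale)

lemma d_A0: "p \<in> A 0 m' \<Longrightarrow> i \<in> {1..n} \<Longrightarrow> d i p = 0"
proof (induction rule: A_induct')
  case (mono s r)
  then show ?case by (simp add: d_mono tot_eq_0_iff)
qed (auto simp: clinear_simps[OF clinear_d])

lemma db_A: "p \<in> A m (Suc m') \<Longrightarrow> i \<in> {1..n} \<Longrightarrow> db i p \<in> A m m'"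
proof (induction rule: A_induct)
  case (mono s r)
  show ?case
  proof (cases "s i = 0")
    case False
    then have "tot n s = Suc (tot n (dec i s))" using tot_inc[of n i "dec i s"] mono by (simp add: inc_dec)
    with mono show ?thesis unfolding A_eq_B by (auto simp: db_M intro!: cvec.subspace_scale M_B exps_dec)
  qed (use mono in \<open>simp add: db_M cvec.subspace_0\<close>)
qed (auto simp: clinear_simps[OF clinear_db] cvec.subspace_0 cvec.subspace_add cvec.subspace_scale)

lemma db_A0: "p \<in> A m 0 \<Longrightarrow> i \<in> {1..n} \<Longrightarrow> db i p = 0"
proof (induction rule: A_induct)
  case (mono s r)
  then show ?case by (simp add: db_M tot_eq_0_iff)
qed (auto simp: clinear_simps[OF clinear_db])

subsection \<open>Moving \<open>d i\<close> past \<open>w j\<close>\<close>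

text \<open>All pairs \<open>i\<close>, \<open>j\<close> are treated at once because the step from
  \<open>p\<close> to \<open>z k * p\<close> uses the rule for other pairs. The induction runs over
  monomials with the \<open>z\<close> in front, where \<open>d i\<close> is known.\<close>

definition d_w_rule :: "'a \<Rightarrow> bool" where
  "d_w_rule p \<longleftrightarrow> (\<forall>i\<in>{1..n}. \<forall>j\<in>{1..n}. d i (w j * p) =
    (if i = j then w j * d i p else if j < i then q *\<^sub>C (w j * d i p)
     else q *\<^sub>C (w j * d i p) + (1 - q^2) *\<^sub>C (w i * d j p)))"

text \<open>As \<open>j\<close> and \<open>k\<close> differ, \<open>w j\<close> passes
  \<open>z k\<close> with a factor \<open>q\<close>. The work lies in \<open>i = k\<close>, where
  the sum in \<open>d_z_same\<close> has to be moved past \<open>w j\<close>.\<close>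

lemma d_w_rule_step_other:
  assumes p: "p \<in> A m m'" and IH: "d_w_rule p" and k: "k \<in> {1..n}" and i: "i \<in> {1..n}" and j: "j \<in> {1..n}" and jk: "j \<noteq> k"
  shows "d i (w j * (z k * p)) = (if i = j then w j * d i (z k * p) else if j < i then q *\<^sub>C (w j * d i (z k * p))
     else q *\<^sub>C (w j * d i (z k * p)) + (1 - q^2) *\<^sub>C (w i * d j (z k * p)))"
proof -
  have eq: "d a (w a * p) = w a * d a p" if "a \<in> {1..n}" for a using IH that by (simp add: d_w_rule_def)
  have gt: "d a (w b * p) = q *\<^sub>C (w b * d a p)" if "a \<in> {1..n}" "b \<in> {1..n}" "b < a" for a b
    using IH that by (simp add: d_w_rule_def)
  have lt: "d a (w b * p) = q *\<^sub>C (w b * d a p) + (1 - q^2) *\<^sub>C (w a * d b p)"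
    if "a \<in> {1..n}" "b \<in> {1..n}" "a < b" for a b
    using IH that by (simp add: d_w_rule_def)
  have push: "d i (w j * (z k * p)) = q *\<^sub>C d i (z k * (w j * p))"
    using k j jk i by (simp add: wz_mult cpair.linear_scale[OF clinear_d])
  show ?thesis
  proof (cases "i = k")
    case False
    have zw': "z k * (w a * X) = inverse q *\<^sub>C (w a * (z k * X))" if "a \<in> {1..n}" "a \<noteq> k" for a X
      using that k by (simp add: zw_mult)
    show ?thesis unfolding push d_z_other[OF i k False]
      using False i j k jk
      by (auto simp: eq gt lt d_z_other zw' vec_simps distrib_left right_diff_distrib left_diff_distrib)
  next
    case True
    define S where "S = (\<Sum>s\<in>{1..<k}. z s * d s p)"
    have wA: "w j * p \<in> A m (Suc m')" using w_A[OF p j] .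
    have lhs: "d i (w j * (z k * p)) = q *\<^sub>C (inverse q *\<^sub>C (z k * d k (w j * p)) + q ^ m *\<^sub>C (w j * p) +
        (inverse q - q) *\<^sub>C (\<Sum>s\<in>{1..<k}. z s * d s (w j * p)))"
      unfolding push[unfolded True] True d_z_same[OF wA k] ..
    have rhs: "d k (z k * p) = inverse q *\<^sub>C (z k * d k p) + q ^ m *\<^sub>C p + (inverse q - q) *\<^sub>C S"
      unfolding S_def by (rule d_z_same[OF p k])
    show ?thesis
    proof (cases "j < k")
      case jlt: True
      \<comment> \<open>The corrections collected from \<open>s < j\<close> by the rule for
        \<open>p\<close> cancel the one that arises when \<open>z j\<close> passes
        \<open>w j\<close>.\<close>
      have "(\<Sum>s\<in>{1..<k}. z s * d s (w j * p)) = w j * S"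
      proof -
        let ?X = "d j p"
        have s1: "(\<Sum>s\<in>{1..<j}. z s * d s (w j * p)) = w j * (\<Sum>s\<in>{1..<j}. z s * d s p) + (1 - q^2) *\<^sub>C ZW j ?X"
          unfolding ZW_def sum_distrib_left cvec.scale_sum_right sum.distrib[symmetric]
          by (rule sum.cong) (use j jlt k in \<open>auto simp: lt wz_mult vec_simps distrib_left right_diff_distrib left_diff_distrib\<close>)
        have s2: "z j * d j (w j * p) = w j * (z j * ?X) - (1 - q^2) *\<^sub>C ZW j ?X"
          using j by (simp add: eq wzk_mult)
        have s3: "(\<Sum>s\<in>{j<..<k}. z s * d s (w j * p)) = w j * (\<Sum>s\<in>{j<..<k}. z s * d s p)"
          unfolding sum_distrib_left
          by (rule sum.cong) (use j jlt k in \<open>auto simp: gt wz_mult vec_simps\<close>)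
        show ?thesis unfolding S_def
          using sum_split_at[of j k "\<lambda>s. z s * d s (w j * p)"] sum_split_at[of j k "\<lambda>s. z s * d s p"] j jlt s1 s2 s3
          by (simp add: distrib_left)
      qed
      then show ?thesis unfolding lhs using jlt True k j jk
        by (simp add: rhs gt vec_simps distrib_left right_diff_distrib left_diff_distrib wz_mult)
    next
      case False
      then have kj: "k < j" using jk by simp
      \<comment> \<open>Now a correction survives. It matches the one produced on the right-hand
        side, where \<open>w k\<close> stands before \<open>d j (z k * p)\<close>.\<close>
      have "(\<Sum>s\<in>{1..<k}. z s * d s (w j * p)) = w j * S + (1 - q^2) *\<^sub>C ZW k (d j p)"
        unfolding ZW_def S_def sum_distrib_left cvec.scale_sum_right sum.distrib[symmetric]
        by (rule sum.cong) (use j kj k in \<open>auto simp: lt wz_mult vec_simps distrib_left right_diff_distrib left_diff_distrib\<close>)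
      then show ?thesis unfolding lhs using kj True k j jk
        by (simp add: rhs lt vec_simps distrib_left right_diff_distrib left_diff_distrib wz_mult wzk_mult d_z_other power2_eq_square)
    qed
  qed
qed

text \<open>\<open>w k * z k\<close> is expanded by its relation, so \<open>d i\<close> meets all
  \<open>z s * w s\<close> with \<open>s < k\<close>. The delicate case is \<open>i < k\<close>, in
  which the summand \<open>s = i\<close> contributes a further sum through
  \<open>d_z_same\<close>.\<close>

lemma d_w_rule_step_same:
  assumes p: "p \<in> A m m'" and IH: "d_w_rule p" and k: "k \<in> {1..n}" and i: "i \<in> {1..n}"
  shows "d i (w k * (z k * p)) = (if i = k then w k * d i (z k * p) else if k < i then q *\<^sub>C (w k * d i (z k * p))
     else q *\<^sub>C (w k * d i (z k * p)) + (1 - q^2) *\<^sub>C (w i * d k (z k * p)))"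
proof -
  have eq: "d a (w a * p) = w a * d a p" if "a \<in> {1..n}" for a using IH that by (simp add: d_w_rule_def)
  have gt: "d a (w b * p) = q *\<^sub>C (w b * d a p)" if "a \<in> {1..n}" "b \<in> {1..n}" "b < a" for a b
    using IH that by (simp add: d_w_rule_def)
  have lt: "d a (w b * p) = q *\<^sub>C (w b * d a p) + (1 - q^2) *\<^sub>C (w a * d b p)"
    if "a \<in> {1..n}" "b \<in> {1..n}" "a < b" for a b
    using IH that by (simp add: d_w_rule_def)
  have push: "d i (w k * (z k * p)) = d i (z k * (w k * p)) + (1 - q^2) *\<^sub>C (\<Sum>s\<in>{1..<k}. d i (z s * (w s * p)))"
    unfolding wzk_mult[OF k] ZW_def using i by (simp add: clinear_simps[OF clinear_d])
  have wA: "w j * p \<in> A m (Suc m')" if "j \<in> {1..n}" for j using w_A[OF p that] .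
  define S where "S = (\<Sum>s\<in>{1..<k}. z s * d s p)"
  have dkz: "d k (z k * p) = inverse q *\<^sub>C (z k * d k p) + q ^ m *\<^sub>C p + (inverse q - q) *\<^sub>C S"
    unfolding S_def by (rule d_z_same[OF p k])
  consider "k < i" | "i = k" | "i < k" by linarith
  then show ?thesis
  proof cases
    case 1
    have "(\<Sum>s\<in>{1..<k}. d i (z s * (w s * p))) = q *\<^sub>C ZW k (d i p)"
      unfolding ZW_def cvec.scale_sum_right
      by (rule sum.cong) (use 1 i k in \<open>auto simp: d_z_other gt vec_simps\<close>)
    then show ?thesis unfolding push using 1 i k
      by (simp add: d_z_other gt vec_simps wzk_mult distrib_left right_diff_distrib left_diff_distrib)
  next
    case 2
    have s1: "(\<Sum>s\<in>{1..<k}. d i (z s * (w s * p))) = q *\<^sub>C ZW k (d k p)"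
      unfolding ZW_def cvec.scale_sum_right
      by (rule sum.cong) (use 2 i k in \<open>auto simp: d_z_other gt vec_simps\<close>)
    have s2: "(\<Sum>s\<in>{1..<k}. z s * d s (w k * p)) = w k * S + (1 - q^2) *\<^sub>C ZW k (d k p)"
      unfolding ZW_def S_def sum_distrib_left cvec.scale_sum_right sum.distrib[symmetric]
      by (rule sum.cong) (use k in \<open>auto simp: lt wz_mult vec_simps distrib_left right_diff_distrib left_diff_distrib\<close>)
    show ?thesis unfolding push s1 unfolding 2 d_z_same[OF wA[OF k] k] s2 using k
      by (simp add: dkz eq vec_simps wzk_mult distrib_left right_diff_distrib left_diff_distrib power2_eq_square algebra_simps)
  next
    case 3
    let ?X = "d i p"
    define a3 where "a3 = (\<Sum>s\<in>{i<..<k}. z s * (w s * ?X))"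
    define b1 where "b1 = (\<Sum>s\<in>{1..<i}. z s * (w i * d s p))"
    define b3 where "b3 = (\<Sum>s\<in>{i<..<k}. z s * (w i * d s p))"
    have t1: "(\<Sum>s\<in>{1..<i}. d i (z s * (w s * p))) = q *\<^sub>C ZW i ?X"
      unfolding ZW_def cvec.scale_sum_right
      by (rule sum.cong) (use 3 i k in \<open>auto simp: d_z_other gt vec_simps\<close>)
    have t3: "(\<Sum>s\<in>{i<..<k}. d i (z s * (w s * p))) = q *\<^sub>C a3 + (1 - q^2) *\<^sub>C b3"
      unfolding a3_def b3_def cvec.scale_sum_right sum.distrib[symmetric]
      by (rule sum.cong) (use 3 i k in \<open>auto simp: d_z_other lt vec_simps distrib_left right_diff_distrib left_diff_distrib\<close>)
    have t2s: "(\<Sum>s\<in>{1..<i}. z s * d s (w i * p)) = q *\<^sub>C b1 + (1 - q^2) *\<^sub>C ZW i ?X"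
      unfolding ZW_def b1_def cvec.scale_sum_right sum.distrib[symmetric]
      by (rule sum.cong) (use 3 i k in \<open>auto simp: lt vec_simps distrib_left right_diff_distrib left_diff_distrib\<close>)
    have t2: "d i (z i * (w i * p)) = inverse q *\<^sub>C (z i * (w i * ?X)) + q ^ m *\<^sub>C (w i * p)
        + (inverse q - q) *\<^sub>C (q *\<^sub>C b1 + (1 - q^2) *\<^sub>C ZW i ?X)"
      unfolding d_z_same[OF wA[OF i] i] t2s using i by (simp add: eq)
    have lsum: "(\<Sum>s\<in>{1..<k}. d i (z s * (w s * p))) = q *\<^sub>C ZW i ?X + (inverse q *\<^sub>C (z i * (w i * ?X)) + q ^ m *\<^sub>C (w i * p)
        + (inverse q - q) *\<^sub>C (q *\<^sub>C b1 + (1 - q^2) *\<^sub>C ZW i ?X)) + (q *\<^sub>C a3 + (1 - q^2) *\<^sub>C b3)"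
      using sum_split_at[of i k "\<lambda>s. d i (z s * (w s * p))"] 3 i t1 t2 t3 by simp
    have zwk: "ZW k ?X = ZW i ?X + z i * (w i * ?X) + a3"
      unfolding ZW_def a3_def using sum_split_at[of i k "\<lambda>s. z s * (w s * ?X)"] 3 i by simp
    have wS: "w i * S = q *\<^sub>C b1 + (z i * (w i * ?X) + (1 - q^2) *\<^sub>C ZW i ?X) + q *\<^sub>C b3"
    proof -
      have "(\<Sum>s\<in>{1..<i}. w i * (z s * d s p)) = q *\<^sub>C b1"
        unfolding b1_def cvec.scale_sum_right by (rule sum.cong) (use 3 i k in \<open>auto simp: wz_mult\<close>)
      moreover have "(\<Sum>s\<in>{i<..<k}. w i * (z s * d s p)) = q *\<^sub>C b3"
        unfolding b3_def cvec.scale_sum_right by (rule sum.cong) (use 3 i k in \<open>auto simp: wz_mult\<close>)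
      ultimately show ?thesis unfolding S_def sum_distrib_left
        using sum_split_at[of i k "\<lambda>s. w i * (z s * d s p)"] 3 i by (simp add: wzk_mult)
    qed
    have w1: "w i * d k (z k * p) = z k * (w i * d k p) + q ^ m *\<^sub>C (w i * p) + (inverse q - q) *\<^sub>C (w i * S)"
      unfolding dkz using 3 i k by (simp add: distrib_left vec_simps wz_mult right_diff_distrib left_diff_distrib)
    have w2: "w k * d i (z k * p) = z k * (w k * ?X) + (1 - q^2) *\<^sub>C ZW k ?X"
      using 3 i k by (simp add: d_z_other wzk_mult)
    have l1: "d i (z k * (w k * p)) = q *\<^sub>C (z k * (w k * ?X)) + (1 - q^2) *\<^sub>C (z k * (w i * d k p))"
      using 3 i k by (simp add: d_z_other lt distrib_left vec_simps right_diff_distrib left_diff_distrib)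
    \<comment> \<open>Both sides are combinations of the same eight terms. With variables in their
      place, only the coefficients in \<open>q\<close> have to be compared.\<close>
    have fin: "q *\<^sub>C e1 + (1 - q^2) *\<^sub>C e2 + (1 - q^2) *\<^sub>C
        (q *\<^sub>C y1 + (inverse q *\<^sub>C y2 + q ^ m *\<^sub>C y4 + (inverse q - q) *\<^sub>C (q *\<^sub>C y5 + (1 - q^2) *\<^sub>C y1)) + (q *\<^sub>C y3 + (1 - q^2) *\<^sub>C y6))
      = q *\<^sub>C (e1 + (1 - q^2) *\<^sub>C (y1 + y2 + y3)) + (1 - q^2) *\<^sub>C (e2 + q ^ m *\<^sub>C y4 + (inverse q - q) *\<^sub>C
        (q *\<^sub>C y5 + (y2 + (1 - q^2) *\<^sub>C y1) + q *\<^sub>C y6))" for e1 e2 y1 y2 y3 y4 y5 y6 :: 'a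
      by (simp add: vec_simps algebra_simps power2_eq_square)
    show ?thesis unfolding push lsum l1 w1 w2 wS zwk using 3 fin by simp
  qed
qed

lemma d_w_rule_all: "d_w_rule p"
proof (induction p rule: all_homog_induct)
  case (1 a b)
  then show ?case unfolding d_w_rule_def
    by (auto simp: distrib_left clinear_simps[OF clinear_d] vec_simps)
next
  case (2 m m' p)
  then show ?case
  proof (induction rule: A_induct')
    case zero
    show ?case by (auto simp: d_w_rule_def clinear_simps[OF clinear_d])
  next
    case (add a b)
    then show ?case unfolding d_w_rule_def
      by (auto simp: distrib_left clinear_simps[OF clinear_d] vec_simps)
  next
    case (scale c a)
    then show ?case unfolding d_w_rule_def
      by (auto simp: scaleC_mult_right clinear_simps[OF clinear_d] scaleC_add_right scaleC_scaleC mult.commute)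
  next
    case (mono s r)
    from mono(2) show ?case
    proof (induction rule: exps_induct_min)
      case zero
      have A0: "monomial n z (\<lambda>_. 0) * monomial n w s \<in> A 0 (tot n s)" by (rule A_I) (simp_all add: tot_zero)
      have "d i (monomial n z (\<lambda>_. 0) * monomial n w s) = 0"
        "d i (w j * (monomial n z (\<lambda>_. 0) * monomial n w s)) = 0" if "i \<in> {1..n}" "j \<in> {1..n}" for i j
        using d_A0[OF A0 that(1)] d_A0[OF w_A[OF A0 that(2)] that(1)] by simp_all
      then show ?case unfolding d_w_rule_def by (simp del: atLeastAtMost_iff)
    next
      case (inc k r)
      let ?p = "monomial n z r * monomial n w s"
      have "monomial n z (inc k r) * monomial n w s = z k * ?p"
        using inc by (simp add: zq.left_mult_min mult.assoc)
      moreover have p: "?p \<in> A (tot n r) (tot n s)" by (rule A_I) simp_all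
      ultimately show ?case
        using d_w_rule_step_same[OF p inc(4,2)] d_w_rule_step_other[OF p inc(4,2)]
        unfolding d_w_rule_def by metis
    qed
  qed
qed

lemma d_w_same: "i \<in> {1..n} \<Longrightarrow> d i (w i * p) = w i * d i p"
  and d_w_above: "i \<in> {1..n} \<Longrightarrow> j \<in> {1..n} \<Longrightarrow> j < i \<Longrightarrow> d i (w j * p) = q *\<^sub>C (w j * d i p)"
  and d_w_below: "i \<in> {1..n} \<Longrightarrow> j \<in> {1..n} \<Longrightarrow> i < j \<Longrightarrow>
    d i (w j * p) = q *\<^sub>C (w j * d i p) + (1 - q^2) *\<^sub>C (w i * d j p)"
  using d_w_rule_all[of p] by (simp_all add: d_w_rule_def)

text \<open>All factors have index at most \<open>j\<close>, so the two-term case of the rule never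
  occurs, and each \<open>w k\<close> with \<open>k < j\<close> contributes one factor
  \<open>q\<close>.\<close>

lemma d_w_monomial:
  assumes "s \<in> exps n" "j \<in> {1..n}" "\<And>i. j < i \<Longrightarrow> s i = 0"
  shows "d j (monomial n w s * p) = q ^ lo s j *\<^sub>C (monomial n w s * d j p)"
  using assms
proof (induction rule: exps_induct_min)
  case zero
  show ?case by (simp add: monomial_0 lo_def scaleC_one)
next
  case (inc k s)
  have "k \<le> j" using inc(6)[of k] by (metis inc_apply(1) nat.distinct(1) not_le)
  have "s i = 0" if "j < i" for i using inc(6)[OF that] \<open>k \<le> j\<close> that by (simp add: inc_def)
  then have IH: "d j (monomial n w s * p) = q ^ lo s j *\<^sub>C (monomial n w s * d j p)" using inc by simp
  have eq: "monomial n w (inc k s) * X = w k * (monomial n w s * X)" for X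
    using inc by (simp add: wq.left_mult_min mult.assoc)
  show ?case
  proof (cases "k = j")
    case True
    then show ?thesis unfolding eq using inc IH by (simp add: d_w_same lo_inc scaleC_mult_right)
  next
    case False
    then show ?thesis unfolding eq using inc IH \<open>k \<le> j\<close>
      by (simp add: d_w_above lo_inc scaleC_mult_right scaleC_scaleC mult.commute)
  qed
qed

section \<open>The q-Laplace operator\<close>

definition Lap :: "'a \<Rightarrow> 'a" where "Lap = q_laplace n d db"

lemma Lap_def': "Lap p = (\<Sum>i=1..n. d i (db i p))"
  by (simp add: Lap_def q_laplace_def)

lemma clinear_Lap: "clinear Lap"
  unfolding Lap_def' by (intro cpair.linear_compose_sum ballI clinear_compose[OF clinear_d clinear_db]) auto

text \<open>The sum over \<open>s < j\<close> in \<open>db_w_same\<close> cancels the second terms of \<open>d_w_below\<close>.\<close>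

lemma Lap_w:
  assumes "p \<in> A m m'" "j \<in> {1..n}"
  shows "Lap (w j * p) = q *\<^sub>C (w j * Lap p) + inverse q ^ m' *\<^sub>C d j p"
proof -
  let ?S = "\<Sum>s\<in>{1..<j}. w s * d j (db s p)"
  have "Lap (w j * p) = (\<Sum>i\<in>{1..<Suc n}. d i (db i (w j * p)))"
    by (simp add: Lap_def' atLeastLessThanSuc_atLeastAtMost)
  also have "\<dots> = (\<Sum>i\<in>{1..<j}. d i (db i (w j * p))) + d j (db j (w j * p)) + (\<Sum>i\<in>{j<..<Suc n}. d i (db i (w j * p)))"
    by (rule sum_split_at) (use assms in auto)
  also have "(\<Sum>i\<in>{1..<j}. d i (db i (w j * p))) = q *\<^sub>C (w j * (\<Sum>i\<in>{1..<j}. d i (db i p))) + (1 - q^2) *\<^sub>C ?S"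
    unfolding sum_distrib_left cvec.scale_sum_right sum.distrib[symmetric]
    by (rule sum.cong) (use assms in \<open>auto simp: db_w_other d_w_below\<close>)
  also have "(\<Sum>i\<in>{j<..<Suc n}. d i (db i (w j * p))) = q *\<^sub>C (w j * (\<Sum>i\<in>{j<..<Suc n}. d i (db i p)))"
    unfolding sum_distrib_left cvec.scale_sum_right
    by (rule sum.cong) (use assms in \<open>auto simp: db_w_other d_w_above\<close>)
  also have "d j (db j (w j * p)) = q *\<^sub>C (w j * d j (db j p)) + inverse q ^ m' *\<^sub>C d j p + (q - inverse q) *\<^sub>C (q *\<^sub>C ?S)"
  proof -
    have "d j (\<Sum>s\<in>{1..<j}. w s * db s p) = q *\<^sub>C ?S"
      unfolding cpair.linear_sum[OF clinear_d[OF assms(2)]] cvec.scale_sum_right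
      by (rule sum.cong) (use assms in \<open>auto simp: d_w_above\<close>)
    then show ?thesis unfolding db_w_same[OF assms] using assms(2)
      by (simp add: cpair.linear_add[OF clinear_d] cpair.linear_scale[OF clinear_d] d_w_same)
  qed
  also have "(q *\<^sub>C (w j * (\<Sum>i\<in>{1..<j}. d i (db i p))) + (1 - q^2) *\<^sub>C ?S) +
      (q *\<^sub>C (w j * d j (db j p)) + inverse q ^ m' *\<^sub>C d j p + (q - inverse q) *\<^sub>C (q *\<^sub>C ?S)) +
      q *\<^sub>C (w j * (\<Sum>i\<in>{j<..<Suc n}. d i (db i p))) =
    q *\<^sub>C (w j * ((\<Sum>i\<in>{1..<j}. d i (db i p)) + d j (db j p) + (\<Sum>i\<in>{j<..<Suc n}. d i (db i p)))) + inverse q ^ m' *\<^sub>C d j p"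
    by (simp add: vec_simps distrib_left left_diff_distrib power2_eq_square)
  also have "(\<Sum>i\<in>{1..<j}. d i (db i p)) + d j (db j p) + (\<Sum>i\<in>{j<..<Suc n}. d i (db i p)) = (\<Sum>i\<in>{1..<Suc n}. d i (db i p))"
    by (rule sum_split_at[symmetric]) (use assms in auto)
  also have "\<dots> = Lap p" by (simp add: Lap_def' atLeastLessThanSuc_atLeastAtMost)
  finally show ?thesis .
qed

text \<open>\<open>d k\<close> is not given on monomials of this order, so the formula is built up
  along the \<open>w\<close> part. Since the new index \<open>j\<close> is the greatest,
  \<open>Lap_w\<close> leaves a single term with \<open>d j\<close>, which
  \<open>d_w_monomial\<close> evaluates; it supplies the missing part of the summand
  \<open>k = j\<close>.\<close>

lemma Lap_M:
  assumes "s \<in> exps n" "r \<in> exps n"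
  shows "Lap (M s r) = (\<Sum>k=1..n. (q ^ hi n r k * inverse q ^ lo s k * qnum q (s k) * qnum q (r k)) *\<^sub>C M (dec k s) (dec k r))"
  using assms(1)
proof (induction rule: exps_induct_max)
  case zero
  then show ?case by (simp add: Lap_def' db_M cpair.linear_0[OF clinear_d])
next
  case (inc j s)
  define f where "f s k = (q ^ hi n r k * inverse q ^ lo s k * qnum q (s k) * qnum q (r k)) *\<^sub>C M (dec k s) (dec k r)" for s k
  have lo_s: "lo s j + s j = tot n s"
    using tot_split[OF inc(2), of s] inc(3) by (simp add: hi_def)
  have wM: "w j * M s r = q ^ lo s j *\<^sub>C M (inc j s) r" by (rule w_M[OF inc(2)])
  have "d j (M s r) = (q ^ lo s j * q ^ hi n r j * qnum q (r j)) *\<^sub>C M s (dec j r)"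
  proof -
    have "d j (monomial n z r) = (q ^ hi n r j * qnum q (r j)) *\<^sub>C monomial n z (dec j r)"
      using d_mono[OF inc(2), of r "\<lambda>_. 0"] by (simp add: monomial_0)
    then show ?thesis using d_w_monomial[OF inc(1,2,3), of "monomial n z r"]
      by (simp add: M_def vec_simps mult.assoc)
  qed
  then have "q ^ lo s j *\<^sub>C Lap (M (inc j s) r) = q *\<^sub>C (w j * Lap (M s r)) +
      (inverse q ^ tot n s * (q ^ lo s j * q ^ hi n r j * qnum q (r j))) *\<^sub>C M s (dec j r)"
    using Lap_w[OF M_A[OF inc(1)] inc(2), of r] unfolding wM cpair.linear_scale[OF clinear_Lap] by (simp add: scaleC_scaleC)
  also have "q *\<^sub>C (w j * Lap (M s r)) = (\<Sum>k=1..n. q *\<^sub>C (w j * f s k))"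
    unfolding inc.IH f_def[symmetric] by (simp add: sum_distrib_left cvec.scale_sum_right)
  also have "\<dots> = (\<Sum>k=1..n. q ^ lo s j *\<^sub>C (if k = j then (q * q ^ hi n r j * inverse q ^ lo s j * qnum q (s j) * qnum q (r j)) *\<^sub>C M s (dec j r)
      else f (inc j s) k))"
  proof (rule sum.cong)
    fix k assume k: "k \<in> {1..n}"
    show "q *\<^sub>C (w j * f s k) = q ^ lo s j *\<^sub>C (if k = j then (q * q ^ hi n r j * inverse q ^ lo s j * qnum q (s j) * qnum q (r j)) *\<^sub>C M s (dec j r)
      else f (inc j s) k)"
    proof (cases "s k = 0")
      case True
      then show ?thesis by (cases "k = j") (simp_all add: f_def)
    next
      case False
      then have kj: "k \<le> j" using inc(3)[of k] by (meson not_le)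
      define s' where "s' = dec k s"
      have s: "s = inc k s'" using False by (simp add: s'_def inc_dec)
      show ?thesis
      proof (cases "k = j")
        case True
        show ?thesis unfolding s True f_def using inc(2)
          by (simp add: vec_simps w_M lo_inc mult_ac)
      next
        case False
        then have "k < j" using kj by simp
        then show ?thesis unfolding s f_def using inc(2) k False
          by (simp add: vec_simps w_M lo_inc dec_inc_commute inc_commute[of j k] mult_ac)
      qed
    qed
  qed simp
  also have "\<dots> + (inverse q ^ tot n s * (q ^ lo s j * q ^ hi n r j * qnum q (r j))) *\<^sub>C M s (dec j r)
      = q ^ lo s j *\<^sub>C (\<Sum>k=1..n. f (inc j s) k)"
  proof -
    \<comment> \<open>The two contributions to \<open>k = j\<close> combine by
      \<open>qnum_Suc\<close>; the exponent of \<open>inverse q\<close> fits because no factor of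
      index above \<open>j\<close> is present in \<open>s\<close>.\<close>
    have c: "q * q ^ hi n r j * inverse q ^ lo s j * qnum q (s j) * qnum q (r j) + inverse q ^ tot n s * q ^ hi n r j * qnum q (r j)
        = q ^ hi n r j * inverse q ^ lo s j * qnum q (Suc (s j)) * qnum q (r j)"
      unfolding lo_s[symmetric] power_add qnum_Suc by (simp add: algebra_simps)
    have E: "(inverse q ^ tot n s * (q ^ lo s j * q ^ hi n r j * qnum q (r j))) *\<^sub>C M s (dec j r) =
      q ^ lo s j *\<^sub>C (\<Sum>k=1..n. if k = j then (inverse q ^ tot n s * q ^ hi n r j * qnum q (r j)) *\<^sub>C M s (dec j r) else 0)"
      using inc(2) by (simp add: scaleC_scaleC mult_ac)
    show ?thesis
      unfolding cvec.scale_sum_right[symmetric] E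
      unfolding cvec.scale_right_distrib[symmetric] sum.distrib[symmetric]
      by (intro arg_cong[of _ _ "(*\<^sub>C) (q ^ lo s j)"] sum.cong)
        (auto simp: scaleC_add_left[symmetric] c f_def lo_inc)
  qed
  finally have "q ^ lo s j *\<^sub>C Lap (M (inc j s) r) = q ^ lo s j *\<^sub>C (\<Sum>k=1..n. f (inc j s) k)" .
  then show ?case unfolding f_def using q0 by simp
qed

lemma Lap_A: "p \<in> A (Suc m) (Suc m') \<Longrightarrow> Lap p \<in> A m m'"
  unfolding Lap_def' by (intro cvec.subspace_sum d_A db_A) auto

lemma Lap_A0: "p \<in> A m m' \<Longrightarrow> m = 0 \<or> m' = 0 \<Longrightarrow> Lap p = 0"
proof (cases m')
  case 0
  moreover assume "p \<in> A m m'"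
  ultimately show ?thesis by (auto simp: Lap_def' db_A0 cpair.linear_0[OF clinear_d] intro!: sum.neutral)
next
  case (Suc m'')
  moreover assume "p \<in> A m m'" "m = 0 \<or> m' = 0"
  ultimately have "d i (db i p) = 0" if "i \<in> {1..n}" for i
    using that d_A0[OF db_A[of p 0 m''], of i i] by simp
  then show ?thesis by (simp add: Lap_def')
qed

text \<open>On a monomial both products are double sums over the index \<open>i\<close> raised by
  \<open>Q\<close> and the index \<open>k\<close> lowered by \<open>Lap\<close>. For
  \<open>i \<noteq> k\<close> the order does not matter; only the diagonal contributes, by
  \<open>qnum_diag\<close>, and \<open>qnum_telescope\<close> adds it up.\<close>

lemma Lap_Q:
  assumes "p \<in> A m m'"
  shows "Lap (Q * p) = Q * Lap p + (q ^ (n - 1) * qnum q (n + m + m')) *\<^sub>C p"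
  using assms
proof (induction rule: A_induct)
  case zero
  show ?case by (simp add: clinear_simps[OF clinear_Lap])
next
  case (add a b)
  then show ?case by (simp add: distrib_left clinear_simps[OF clinear_Lap] vec_simps algebra_simps)
next
  case (scale c a)
  then show ?case by (simp add: clinear_simps[OF clinear_Lap] vec_simps mult_ac)
next
  case (mono s r)
  let ?a = "\<lambda>s r i. q ^ (2 * (n - i)) * q ^ hi n s i * inverse q ^ lo r i"
  let ?b = "\<lambda>s r k. q ^ hi n r k * inverse q ^ lo s k * qnum q (s k) * qnum q (r k)"
  define F where "F i k = (?a s r i * ?b (inc i s) (inc i r) k) *\<^sub>C M (dec k (inc i s)) (dec k (inc i r))" for i k
  define G where "G i k = (?b s r k * ?a (dec k s) (dec k r) i) *\<^sub>C M (inc i (dec k s)) (inc i (dec k r))" for i k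
  have L: "Lap (Q * M s r) = (\<Sum>i=1..n. \<Sum>k=1..n. F i k)"
  proof -
    have "Lap (Q * M s r) = (\<Sum>i=1..n. ?a s r i *\<^sub>C Lap (M (inc i s) (inc i r)))"
      unfolding Q_M by (simp add: clinear_simps[OF clinear_Lap])
    also have "\<dots> = (\<Sum>i=1..n. \<Sum>k=1..n. F i k)"
      by (rule sum.cong) (use mono in \<open>simp_all add: Lap_M exps_inc cvec.scale_sum_right scaleC_scaleC F_def\<close>)
    finally show ?thesis .
  qed
  have "Q * Lap (M s r) = (\<Sum>k=1..n. \<Sum>i=1..n. G i k)"
    using mono by (simp add: Lap_M sum_distrib_left scaleC_mult_right Q_M cvec.scale_sum_right scaleC_scaleC G_def)
  also have "\<dots> = (\<Sum>i=1..n. \<Sum>k=1..n. G i k)" by (rule sum.swap)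
  finally have R: "Q * Lap (M s r) = (\<Sum>i=1..n. \<Sum>k=1..n. G i k)" .
  have off: "F i k = G i k" if ik: "i \<noteq> k" "i \<in> {1..n}" "k \<in> {1..n}" for i k
  proof (cases "s k = 0 \<or> r k = 0")
    case True
    then show ?thesis using ik by (auto simp: F_def G_def)
  next
    case False
    define s' where "s' = dec k s"
    define r' where "r' = dec k r"
    have sr: "s = inc k s'" "r = inc k r'" using False by (simp_all add: s'_def r'_def inc_dec)
    show ?thesis using ik unfolding F_def G_def sr
      by (cases "i < k") (simp_all add: lo_inc hi_inc dec_inc_commute inc_commute[of i k] mult_ac)
  qed
  \<comment> \<open>With the extra 1 per index, \<open>tot n u\<close> is \<open>n + m + m'\<close>,
    and the diagonal differences become the summands of \<open>qnum_telescope\<close> for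
    \<open>u\<close>, up to the common factor \<open>q ^ (n - 1)\<close>.\<close>
  define u where "u i = s i + r i + 1" for i
  have diag: "F i i - G i i = (q ^ (n - 1) * (q ^ hi n u i * inverse q ^ lo u i * qnum q (u i))) *\<^sub>C M s r"
    if i: "i \<in> {1..n}" for i
  proof -
    have G: "G i i = (?a s r i * (q ^ hi n r i * inverse q ^ lo s i * (qnum q (s i) * qnum q (r i)))) *\<^sub>C M s r"
    proof (cases "s i = 0 \<or> r i = 0")
      case True
      then show ?thesis by (auto simp: G_def)
    next
      case False
      define s' where "s' = dec i s"
      define r' where "r' = dec i r"
      have sr: "s = inc i s'" "r = inc i r'" using False by (simp_all add: s'_def r'_def inc_dec)
      show ?thesis unfolding G_def sr by (simp add: lo_inc hi_inc mult_ac)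
    qed
    have F: "F i i = (?a s r i * (q ^ hi n r i * inverse q ^ lo s i * (qnum q (Suc (s i)) * qnum q (Suc (r i))))) *\<^sub>C M s r"
      unfolding F_def by (simp add: lo_inc hi_inc mult_ac)
    have lo_u: "lo u i = lo s i + lo r i + (i - 1)" and hi_u: "hi n u i = hi n s i + hi n r i + (n - i)"
      unfolding lo_def hi_def u_def by (simp_all add: sum.distrib sum_Suc)
    have "F i i - G i i = (?a s r i * (q ^ hi n r i * inverse q ^ lo s i *
        (qnum q (Suc (s i)) * qnum q (Suc (r i)) - qnum q (s i) * qnum q (r i)))) *\<^sub>C M s r"
      unfolding F G by (simp add: vec_simps right_diff_distrib)
    also have "qnum q (Suc (s i)) * qnum q (Suc (r i)) - qnum q (s i) * qnum q (r i) = qnum q (u i)"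
      by (simp add: qnum_diag u_def)
    also have "?a s r i * (q ^ hi n r i * inverse q ^ lo s i * qnum q (u i)) =
       q ^ (n - 1) * (q ^ hi n u i * inverse q ^ lo u i * qnum q (u i))"
    proof -
      have "n - 1 = (n - i) + (i - 1)" using i by auto
      then show ?thesis unfolding lo_u hi_u power_add mult_2 by (simp add: power_add mult_ac)
    qed
    finally show ?thesis .
  qed
  have "Lap (Q * M s r) - Q * Lap (M s r) = (\<Sum>i=1..n. \<Sum>k=1..n. F i k - G i k)"
    unfolding L R by (simp add: sum_subtractf)
  also have "\<dots> = (\<Sum>i=1..n. F i i - G i i)"
  proof (rule sum.cong)
    fix i assume i: "i \<in> {1..n}"
    have "(\<Sum>k=1..n. F i k - G i k) = (\<Sum>k=1..n. if k = i then F i i - G i i else 0)"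
      by (rule sum.cong) (use off i in auto)
    then show "(\<Sum>k=1..n. F i k - G i k) = F i i - G i i" using i by simp
  qed simp
  also have "\<dots> = (q ^ (n - 1) * (\<Sum>i=1..n. q ^ hi n u i * inverse q ^ lo u i * qnum q (u i))) *\<^sub>C M s r"
    by (simp add: diag cvec.scale_sum_left[symmetric] sum_distrib_left)
  also have "(\<Sum>i=1..n. q ^ hi n u i * inverse q ^ lo u i * qnum q (u i)) = qnum q (n + m + m')"
  proof -
    have "tot n u = n + m + m'" using mono by (simp add: tot_def u_def sum.distrib sum_Suc)
    then show ?thesis using qnum_telescope[where n = n and r = u] by simp
  qed
  finally show ?case by (simp add: algebra_simps)
qed

end

lemma clinear_complex_iff: "clinear (f :: 'a::complex_vector \<Rightarrow> complex) \<longleftrightarrow>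
    (\<forall>x y. f (x + y) = f x + f y) \<and> (\<forall>c x. f (c *\<^sub>C x) = c * f x)"
  by (simp add: clinear_iff scaleC_complex_def)

context zw_diff
begin

subsection \<open>Coordinates\<close>

text \<open>The augmentation, which sends all generators to zero; it exists because no relation has
  a constant term. All other coordinate functionals are obtained from it by means of
  derivatives.\<close>

lemma character_ex: "\<exists>\<epsilon> :: 'a \<Rightarrow> complex. clinear \<epsilon> \<and> (\<forall>s\<in>exps n. \<forall>r\<in>exps n.
    \<epsilon> (M s r) = (if s = (\<lambda>_. 0) \<and> r = (\<lambda>_. 0) then 1 else 0))"
proof -
  have rel: "free_eval (\<lambda>_. 0 :: complex) r = 0" if "r \<in> zw_relations n q" for r
    using that unfolding zw_relations_def by (auto simp: sum_distrib_left)
  obtain \<epsilon> :: "'a \<Rightarrow> complex" where \<epsilon>: "clinear \<epsilon>" "\<epsilon> 1 = 1" "\<And>a b. \<epsilon> (a * b) = \<epsilon> a * \<epsilon> b"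
    "\<And>x. x \<in> zw_gens n \<Longrightarrow> \<epsilon> (case_zw_gen z w x) = 0"
    using presented_lift[OF zw_presented rel] by metis
  have gen0: "\<epsilon> (z i) = 0" "\<epsilon> (w i) = 0" if "i \<in> {1..n}" for i
    using \<epsilon>(4)[OF gens(1)[OF that]] \<epsilon>(4)[OF gens(2)[OF that]] by simp_all
  have m: "\<epsilon> (monomial n w s) = (if s = (\<lambda>_. 0) then 1 else 0)" if "s \<in> exps n" for s
    using that
  proof (induction rule: exps_induct_min)
    case (inc j s)
    have "inc j s \<noteq> (\<lambda>_. 0)" by (auto simp: fun_eq_iff inc_def)
    with inc show ?case by (simp add: wq.left_mult_min \<epsilon>(3) gen0)
  qed (simp add: monomial_0 \<epsilon>)
  have m': "\<epsilon> (monomial n z s) = (if s = (\<lambda>_. 0) then 1 else 0)" if "s \<in> exps n" for s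
    using that
  proof (induction rule: exps_induct_min)
    case (inc j s)
    have "inc j s \<noteq> (\<lambda>_. 0)" by (auto simp: fun_eq_iff inc_def)
    with inc show ?case by (simp add: zq.left_mult_min \<epsilon>(3) gen0)
  qed (simp add: monomial_0 \<epsilon>)
  show ?thesis by (intro exI[of _ \<epsilon>]) (auto simp: M_def \<epsilon> m m')
qed

text \<open>Apply \<open>d j\<close>, then the functional for \<open>r0\<close>, and divide by the
  scalar \<open>k\<close> that \<open>d j\<close> produces. For
  \<open>s \<noteq> (\<lambda>_. 0)\<close> no formula for \<open>d j (M s r)\<close> is at hand,
  but \<open>d j\<close> keeps the degree in the \<open>w\<close>, and the previous functional
  vanishes where that degree is positive.\<close>

lemma coordinate_ex0:
  assumes "r0 \<in> exps n"
  shows "\<exists>c :: 'a \<Rightarrow> complex. clinear c \<and> (\<forall>s\<in>exps n. \<forall>r\<in>exps n.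
    c (M s r) = (if s = (\<lambda>_. 0) \<and> r = r0 then 1 else 0))"
  using assms
proof (induction rule: exps_induct_min)
  case zero
  show ?case by (rule character_ex)
next
  case (inc j r0)
  from inc(4) obtain c' :: "'a \<Rightarrow> complex" where "clinear c' \<and> (\<forall>s\<in>exps n. \<forall>r\<in>exps n.
    c' (M s r) = (if s = (\<lambda>_. 0) \<and> r = r0 then 1 else 0))" ..
  then have c': "clinear c'" "\<And>s r. s \<in> exps n \<Longrightarrow> r \<in> exps n \<Longrightarrow>
    c' (M s r) = (if s = (\<lambda>_. 0) \<and> r = r0 then 1 else 0)" by auto
  have vanish: "c' p = 0" if "p \<in> A m m'" "m' > 0" for p m m'
    using that by (induction rule: A_induct) (auto simp: clinear_simps[OF c'(1)] c'(2) tot_zero scaleC_complex_def)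
  define k where "k = q ^ hi n r0 j * qnum q (Suc (r0 j))"
  have k: "k \<noteq> 0" using q0 by (simp add: k_def qnum_nonzero)
  define c where "c p = inverse k *\<^sub>C c' (d j p)" for p
  have "clinear c" unfolding c_def by (intro cpair.linear_compose_scale_right clinear_compose[OF c'(1)] clinear_d inc)
  moreover have "c (M s r) = (if s = (\<lambda>_. 0) \<and> r = inc j r0 then 1 else 0)" if sr: "s \<in> exps n" "r \<in> exps n" for s r
  proof (cases "s = (\<lambda>_. 0)")
    case True
    have eq: "d j (M s r) = (q ^ hi n r j * qnum q (r j)) *\<^sub>C M s (dec j r)"
      using d_mono[OF inc(2), of r "\<lambda>_. 0"] by (simp add: M_def monomial_0 True)
    show ?thesis
    proof (cases "r j = 0")
      case True
      then have "r \<noteq> inc j r0" by auto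
      with True show ?thesis by (simp add: c_def eq cpair.linear_0[OF c'(1)])
    next
      case False
      then have r: "inc j (dec j r) = r" by (simp add: inc_dec)
      show ?thesis
      proof (cases "r = inc j r0")
        case True
        have "dec j r = r0" "q ^ hi n r j * qnum q (r j) = k" using True by (simp_all add: k_def hi_inc)
        then have "c (M s r) = inverse k *\<^sub>C c' (k *\<^sub>C M s r0)" by (simp only: c_def eq)
        also have "\<dots> = c' (M s r0)" using k by (simp add: clinear_simps[OF c'(1)] scaleC_complex_def)
        finally show ?thesis using True \<open>s = _\<close> c'(2)[OF sr(1) inc(1)] by simp
      next
        case False
        then have "dec j r \<noteq> r0" using r by auto
        then show ?thesis using False sr
          by (simp add: c_def eq clinear_simps[OF c'(1)] c'(2) scaleC_complex_def exps_dec)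
      qed
    qed
  next
    case False
    then have pos: "tot n s > 0" using tot_eq_0_iff[OF sr(1)] by simp
    have "c' (d j (M s r)) = 0"
    proof (cases "tot n r")
      case 0
      then show ?thesis using d_A0[of "M s r" "tot n s" j] M_A[OF sr(1), of r] inc(2) by (simp add: cpair.linear_0[OF c'(1)])
    next
      case (Suc m)
      then show ?thesis using vanish[OF d_A[of "M s r" m "tot n s" j] pos] M_A[OF sr(1), of r] inc(2) by simp
    qed
    then show ?thesis using False by (simp add: c_def scaleC_complex_def)
  qed
  ultimately show ?case by blast
qed

text \<open>\<open>db j\<close> raises the \<open>w\<close> exponent of the functional in the same
  way and acts on \<open>M s r\<close> explicitly.\<close>

lemma coordinate_ex:
  assumes "s0 \<in> exps n" "r0 \<in> exps n"
  shows "\<exists>c :: 'a \<Rightarrow> complex. clinear c \<and> (\<forall>s\<in>exps n. \<forall>r\<in>exps n.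
    c (M s r) = (if s = s0 \<and> r = r0 then 1 else 0))"
  using assms(1)
proof (induction rule: exps_induct_min)
  case zero
  show ?case by (rule coordinate_ex0[OF assms(2)])
next
  case (inc j s0)
  from inc(4) obtain c' :: "'a \<Rightarrow> complex" where "clinear c' \<and> (\<forall>s\<in>exps n. \<forall>r\<in>exps n.
    c' (M s r) = (if s = s0 \<and> r = r0 then 1 else 0))" ..
  then have c': "clinear c'" "\<And>s r. s \<in> exps n \<Longrightarrow> r \<in> exps n \<Longrightarrow>
    c' (M s r) = (if s = s0 \<and> r = r0 then 1 else 0)" by auto
  define k where "k = inverse q ^ hi n s0 j * qnum q (Suc (s0 j))"
  have k: "k \<noteq> 0" using q0 by (simp add: k_def qnum_nonzero)
  define c where "c p = inverse k *\<^sub>C c' (db j p)" for p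
  have "clinear c" unfolding c_def by (intro cpair.linear_compose_scale_right clinear_compose[OF c'(1)] clinear_db inc)
  moreover have "c (M s r) = (if s = inc j s0 \<and> r = r0 then 1 else 0)" if sr: "s \<in> exps n" "r \<in> exps n" for s r
  proof (cases "s j = 0")
    case True
    then have "s \<noteq> inc j s0" by auto
    with True show ?thesis using inc by (simp add: c_def db_M cpair.linear_0[OF c'(1)] scaleC_complex_def)
  next
    case False
    then have s: "inc j (dec j s) = s" by (simp add: inc_dec)
    show ?thesis
    proof (cases "s = inc j s0")
      case True
      have "dec j s = s0" "inverse q ^ hi n s j * qnum q (s j) = k" using True by (simp_all add: k_def hi_inc)
      then have "c (M s r) = inverse k *\<^sub>C c' (k *\<^sub>C M s0 r)" using inc(2) by (simp only: c_def db_M)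
      also have "\<dots> = c' (M s0 r)" using k by (simp add: clinear_simps[OF c'(1)] scaleC_complex_def)
      finally show ?thesis using True c'(2)[OF inc(1) sr(2)] by simp
    next
      case False
      then have "dec j s \<noteq> s0" using s by auto
      then show ?thesis using False sr inc(2)
        by (simp add: c_def db_M clinear_simps[OF c'(1)] c'(2) scaleC_complex_def exps_dec)
    qed
  qed
  ultimately show ?case by blast
qed

definition cf :: "(nat \<Rightarrow> nat) \<Rightarrow> (nat \<Rightarrow> nat) \<Rightarrow> 'a \<Rightarrow> complex" where
  "cf s0 r0 = (SOME c. clinear c \<and> (\<forall>s\<in>exps n. \<forall>r\<in>exps n. c (M s r) = (if s = s0 \<and> r = r0 then 1 else 0)))"

lemma clinear_cf: "s0 \<in> exps n \<Longrightarrow> r0 \<in> exps n \<Longrightarrow> clinear (cf s0 r0)"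
  and cf_M: "s0 \<in> exps n \<Longrightarrow> r0 \<in> exps n \<Longrightarrow> s \<in> exps n \<Longrightarrow> r \<in> exps n \<Longrightarrow>
    cf s0 r0 (M s r) = (if s = s0 \<and> r = r0 then 1 else 0)"
  unfolding cf_def using someI_ex[OF coordinate_ex, of s0 r0] by auto

lemmas cf_simps = clinear_simps[OF clinear_cf]

definition Ix :: "nat \<Rightarrow> nat \<Rightarrow> ((nat \<Rightarrow> nat) \<times> (nat \<Rightarrow> nat)) set" where
  "Ix m m' = {s \<in> exps n. tot n s = m'} \<times> {r \<in> exps n. tot n r = m}"

lemma finite_Ix [simp]: "finite (Ix m m')"
  by (simp add: Ix_def finite_exps)

lemma expand:
  assumes "p \<in> A m m'"
  shows "p = (\<Sum>(s, r)\<in>Ix m m'. cf s r p *\<^sub>C M s r)"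
  using assms
proof (induction rule: A_induct)
  case zero
  show ?case by (rule sym, rule sum.neutral) (auto simp: Ix_def cf_simps)
next
  case (add a b)
  have "(\<Sum>(s, r)\<in>Ix m m'. cf s r (a + b) *\<^sub>C M s r) =
      (\<Sum>(s, r)\<in>Ix m m'. cf s r a *\<^sub>C M s r) + (\<Sum>(s, r)\<in>Ix m m'. cf s r b *\<^sub>C M s r)"
    unfolding sum.distrib[symmetric] by (rule sum.cong) (auto simp: Ix_def cf_simps scaleC_add_left)
  with add show ?case by simp
next
  case (scale c a)
  have "(\<Sum>(s, r)\<in>Ix m m'. cf s r (c *\<^sub>C a) *\<^sub>C M s r) = c *\<^sub>C (\<Sum>(s, r)\<in>Ix m m'. cf s r a *\<^sub>C M s r)"
    unfolding cvec.scale_sum_right by (rule sum.cong) (auto simp: Ix_def cf_simps scaleC_complex_def scaleC_scaleC)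
  with scale show ?case by simp
next
  case (mono s r)
  have "(\<Sum>(s', r')\<in>Ix m m'. cf s' r' (M s r) *\<^sub>C M s' r') = (\<Sum>x\<in>Ix m m'. if x = (s, r) then M s r else 0)"
  proof (rule sum.cong)
    fix x assume "x \<in> Ix m m'"
    then have "cf (fst x) (snd x) (M s r) = (if x = (s, r) then 1 else 0)"
      using mono by (cases x) (simp add: Ix_def cf_M eq_commute)
    then show "(case x of (s', r') \<Rightarrow> cf s' r' (M s r) *\<^sub>C M s' r') = (if x = (s, r) then M s r else 0)"
      by (cases x) (simp add: scaleC_one)
  qed simp
  then show ?case using mono by (simp add: Ix_def finite_exps)
qed

lemma coords_zero:
  assumes "\<And>s r. s \<in> exps n \<Longrightarrow> r \<in> exps n \<Longrightarrow> cf s r p = 0"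
  shows "p = 0"
proof -
  \<comment> \<open>Demanding the expansion for every finite index set above \<open>F\<close> makes
    the property survive addition: two sets can be united.\<close>
  define good where "good F p \<longleftrightarrow> finite F \<and> F \<subseteq> exps n \<times> exps n \<and>
    (\<forall>G. finite G \<and> F \<subseteq> G \<and> G \<subseteq> exps n \<times> exps n \<longrightarrow> p = (\<Sum>(s, r)\<in>G. cf s r p *\<^sub>C M s r))" for F p
  have "\<exists>F. good F p" for p
  proof (induction p rule: all_homog_induct)
    case (1 a b)
    then obtain F F' where F: "good F a" "good F' b" by blast
    have "a + b = (\<Sum>(s, r)\<in>G. cf s r (a + b) *\<^sub>C M s r)"
      if G: "finite G" "F \<union> F' \<subseteq> G" "G \<subseteq> exps n \<times> exps n" for G
    proof -
      have "(\<Sum>(s, r)\<in>G. cf s r (a + b) *\<^sub>C M s r) = (\<Sum>(s, r)\<in>G. cf s r a *\<^sub>C M s r) + (\<Sum>(s, r)\<in>G. cf s r b *\<^sub>C M s r)"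
        unfolding sum.distrib[symmetric] by (rule sum.cong) (use G in \<open>auto simp: cf_simps scaleC_add_left\<close>)
      also have "(\<Sum>(s, r)\<in>G. cf s r a *\<^sub>C M s r) = a" using F(1) G by (simp add: good_def)
      also have "(\<Sum>(s, r)\<in>G. cf s r b *\<^sub>C M s r) = b" using F(2) G by (simp add: good_def)
      finally show ?thesis by simp
    qed
    then have "good (F \<union> F') (a + b)" using F by (simp add: good_def)
    then show ?case by blast
  next
    case (2 m m' p)
    have off: "cf s r p = 0" if "s \<in> exps n" "r \<in> exps n" "(s, r) \<notin> Ix m m'" for s r
      using 2
    proof (induction rule: A_induct)
      case (mono s' r')
      then have "\<not> (s' = s \<and> r' = r)" using that by (auto simp: Ix_def)
      with mono that show ?case by (simp add: cf_M)
    qed (simp_all add: cf_simps that scaleC_complex_def)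
    have "p = (\<Sum>(s, r)\<in>G. cf s r p *\<^sub>C M s r)"
      if G: "finite G" "Ix m m' \<subseteq> G" "G \<subseteq> exps n \<times> exps n" for G
    proof -
      have "(\<Sum>(s, r)\<in>Ix m m'. cf s r p *\<^sub>C M s r) = (\<Sum>(s, r)\<in>G. cf s r p *\<^sub>C M s r)"
        by (rule sum.mono_neutral_left) (use G off in auto)
      with expand[OF 2] show ?thesis by simp
    qed
    then have "good (Ix m m') p" unfolding good_def by (auto simp: Ix_def finite_exps)
    then show ?case by blast
  qed
  then obtain F where F: "good F p" by blast
  then have eq: "p = (\<Sum>(s, r)\<in>F. cf s r p *\<^sub>C M s r)" by (simp only: good_def) fast
  have FE: "F \<subseteq> exps n \<times> exps n" using F unfolding good_def by blast
  have "(\<Sum>(s, r)\<in>F. cf s r p *\<^sub>C M s r) = 0"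
  proof (rule sum.neutral, rule ballI)
    fix x assume "x \<in> F"
    then have "fst x \<in> exps n" "snd x \<in> exps n" using FE by auto
    then show "(case x of (s, r) \<Rightarrow> cf s r p *\<^sub>C M s r) = 0" by (simp add: case_prod_beta assms)
  qed
  from trans[OF eq this] show ?thesis .
qed

subsection \<open>A bilinear form\<close>

text \<open>The norms \<open>N s r\<close> of the monomials are chosen such that, up to scalars, \<open>Lap\<close> is adjoint to
  multiplication by \<open>Q\<close> and the action of \<open>GE i\<close> is adjoint to that of \<open>GF i\<close>.\<close>

definition Nw :: "nat \<Rightarrow> nat \<Rightarrow> complex" where
  "Nw i a = (\<Prod>t<a. qnum q (Suc t) * q ^ t * q ^ (2 * i))"
definition Nz :: "nat \<Rightarrow> complex" where
  "Nz a = (\<Prod>t<a. qnum q (Suc t) * inverse q ^ t)"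
definition N :: "(nat \<Rightarrow> nat) \<Rightarrow> (nat \<Rightarrow> nat) \<Rightarrow> complex" where
  "N s r = (\<Prod>i=1..n. Nw i (s i)) * (\<Prod>i=1..n. Nz (r i))"

lemma N_nonzero: "N s r \<noteq> 0"
  using q0 by (auto simp: N_def Nw_def Nz_def qnum_nonzero)

lemma prod_inc:
  assumes "j \<in> {1..n}" "\<And>a. f j (Suc a) = f j a * g a"
  shows "(\<Prod>i=1..n. f i (inc j s i)) = (\<Prod>i=1..n. f i (s i)) * (g (s j) :: complex)"
proof -
  have "(\<Prod>i=1..n. f i (inc j s i)) = f j (inc j s j) * (\<Prod>i\<in>{1..n} - {j}. f i (inc j s i))"
    by (rule prod.remove) (use assms in auto)
  also have "(\<Prod>i\<in>{1..n} - {j}. f i (inc j s i)) = (\<Prod>i\<in>{1..n} - {j}. f i (s i))"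
    by (rule prod.cong) auto
  also have "f j (inc j s j) * (\<Prod>i\<in>{1..n} - {j}. f i (s i)) = (f j (s j) * (\<Prod>i\<in>{1..n} - {j}. f i (s i))) * g (s j)"
    by (simp add: assms(2) mult_ac)
  also have "f j (s j) * (\<Prod>i\<in>{1..n} - {j}. f i (s i)) = (\<Prod>i=1..n. f i (s i))"
    by (rule prod.remove[symmetric]) (use assms in auto)
  finally show ?thesis .
qed

lemma N_inc_w: "j \<in> {1..n} \<Longrightarrow> N (inc j s) r = N s r * (qnum q (Suc (s j)) * q ^ s j * q ^ (2 * j))"
  unfolding N_def by (subst prod_inc[where f = Nw and g = "\<lambda>a. qnum q (Suc a) * q ^ a * q ^ (2 * j)"])
    (auto simp: Nw_def mult_ac)

lemma N_inc_z: "j \<in> {1..n} \<Longrightarrow> N s (inc j r) = N s r * (qnum q (Suc (r j)) * inverse q ^ r j)"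
  unfolding N_def by (subst prod_inc[where f = "\<lambda>_. Nz" and g = "\<lambda>a. qnum q (Suc a) * inverse q ^ a"])
    (auto simp: Nz_def mult_ac)

text \<open>One form for each bidegree, which keeps the index set finite.\<close>

definition Bf :: "nat \<Rightarrow> nat \<Rightarrow> 'a \<Rightarrow> 'a \<Rightarrow> complex" where
  "Bf m m' p p' = (\<Sum>(s, r)\<in>Ix m m'. N s r * cf s r p * cf s r p')"

lemma clinear_Bf_right: "clinear (Bf m m' p)"
  unfolding clinear_complex_iff
proof (intro conjI allI)
  fix x y c
  show "Bf m m' p (x + y) = Bf m m' p x + Bf m m' p y"
    unfolding Bf_def sum.distrib[symmetric] by (rule sum.cong) (auto simp: Ix_def cf_simps distrib_left)
  show "Bf m m' p (c *\<^sub>C x) = c * Bf m m' p x"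
    unfolding Bf_def sum_distrib_left by (rule sum.cong) (auto simp: Ix_def cf_simps scaleC_complex_def)
qed

lemma Bf_sym: "Bf m m' p p' = Bf m m' p' p"
  by (simp add: Bf_def mult_ac)

lemma clinear_Bf_left: "clinear (\<lambda>p. Bf m m' p p')"
proof -
  have "(\<lambda>p. Bf m m' p p') = Bf m m' p'" by (rule ext) (rule Bf_sym)
  then show ?thesis using clinear_Bf_right[of m m' p'] by simp
qed

lemma Bf_M: "s \<in> exps n \<Longrightarrow> r \<in> exps n \<Longrightarrow> tot n r = m \<Longrightarrow> tot n s = m' \<Longrightarrow>
  Bf m m' (M s r) p = N s r * cf s r p"
proof -
  assume a: "s \<in> exps n" "r \<in> exps n" "tot n r = m" "tot n s = m'"
  have "Bf m m' (M s r) p = (\<Sum>x\<in>Ix m m'. if x = (s, r) then N s r * cf s r p else 0)"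
    unfolding Bf_def
  proof (rule sum.cong)
    fix x assume "x \<in> Ix m m'"
    then have "cf (fst x) (snd x) (M s r) = (if x = (s, r) then 1 else 0)"
      using a by (cases x) (simp add: Ix_def cf_M eq_commute)
    then show "(case x of (s', r') \<Rightarrow> N s' r' * cf s' r' (M s r) * cf s' r' p) = (if x = (s, r) then N s r * cf s r p else 0)"
      by (cases x) simp
  qed simp
  with a show ?thesis by (simp add: Ix_def finite_exps)
qed

lemma Bf_MM: "s \<in> exps n \<Longrightarrow> r \<in> exps n \<Longrightarrow> tot n r = m \<Longrightarrow> tot n s = m' \<Longrightarrow> s' \<in> exps n \<Longrightarrow> r' \<in> exps n \<Longrightarrow>
  Bf m m' (M s r) (M s' r') = (if s = s' \<and> r = r' then N s r else 0)"
  by (auto simp: Bf_M cf_M)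

lemma Bf_nondegenerate:
  assumes "p \<in> A m m'" "\<And>s r. s \<in> exps n \<Longrightarrow> r \<in> exps n \<Longrightarrow> tot n r = m \<Longrightarrow> tot n s = m' \<Longrightarrow> Bf m m' (M s r) p = 0"
  shows "p = 0"
  by (subst expand[OF assms(1)], rule sum.neutral)
    (use assms(2) N_nonzero in \<open>auto simp: Ix_def Bf_M\<close>)

lemma bilinear_eqI:
  assumes lin: "\<And>y. clinear (\<lambda>x. f x y)" "\<And>x. clinear (f x)" "\<And>y. clinear (\<lambda>x. g x y)" "\<And>x. clinear (g x)"
    and mono: "\<And>s r s' r'. s \<in> exps n \<Longrightarrow> r \<in> exps n \<Longrightarrow> tot n r = m \<Longrightarrow> tot n s = m' \<Longrightarrow>
      s' \<in> exps n \<Longrightarrow> r' \<in> exps n \<Longrightarrow> tot n r' = k \<Longrightarrow> tot n s' = k' \<Longrightarrow> f (M s r) (M s' r') = (g (M s r) (M s' r') :: complex)"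
    and p: "p \<in> A m m'" and p': "p' \<in> A k k'"
  shows "f p p' = g p p'"
  using p
proof (induction rule: A_induct)
  case (mono s r)
  show ?case using p'
    by (induction rule: A_induct) (use mono assms(5) in \<open>auto simp: clinear_simps[OF lin(2)] clinear_simps[OF lin(4)]\<close>)
qed (auto simp: clinear_simps[OF lin(1)] clinear_simps[OF lin(3)])

text \<open>The index raised by \<open>Q\<close> on one side is the index lowered by
  \<open>Lap\<close> on the other. Coefficients and norms together leave the power
  \<open>2 * n + m' - m\<close> of \<open>q\<close>, in which the index \<open>i\<close> has
  cancelled: \<open>2 * (n - i)\<close> meets the factor \<open>q ^ (2 * i)\<close> of
  \<open>Nw\<close>.\<close>

lemma Bf_Q:
  assumes "p \<in> A m m'" "p' \<in> A (Suc m) (Suc m')"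
  shows "Bf (Suc m) (Suc m') (Q * p) p' = q ^ (2 * n + m') * inverse q ^ m * Bf m m' p (Lap p')"
proof (rule bilinear_eqI[where f = "\<lambda>p p'. Bf (Suc m) (Suc m') (Q * p) p'"
      and g = "\<lambda>p p'. q ^ (2 * n + m') * inverse q ^ m * Bf m m' p (Lap p')", OF _ _ _ _ _ assms])
  show "clinear (\<lambda>x. Bf (Suc m) (Suc m') (Q * x) y)" for y
    by (rule clinear_compose[OF clinear_Bf_left clinear_mult_left])
  show "clinear (Bf (Suc m) (Suc m') (Q * x))" for x by (rule clinear_Bf_right)
  show "clinear (\<lambda>x. q ^ (2 * n + m') * inverse q ^ m * Bf m m' x (Lap y))" for y
    using cpair.linear_compose_scale_right[OF clinear_Bf_left, of "q ^ (2 * n + m') * inverse q ^ m" m m' "Lap y"] by (simp add: scaleC_complex_def)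
  show "clinear (\<lambda>y. q ^ (2 * n + m') * inverse q ^ m * Bf m m' x (Lap y))" for x
    using cpair.linear_compose_scale_right[OF clinear_compose[OF clinear_Bf_right clinear_Lap], of "q ^ (2 * n + m') * inverse q ^ m" m m' x]
    by (simp add: scaleC_complex_def)
next
  fix \<sigma> \<rho> s r
  assume \<sigma>\<rho>: "\<sigma> \<in> exps n" "\<rho> \<in> exps n" "tot n \<rho> = m" "tot n \<sigma> = m'"
    and sr: "s \<in> exps n" "r \<in> exps n" "tot n r = Suc m" "tot n s = Suc m'"
  let ?a = "\<lambda>i. q ^ (2 * (n - i)) * q ^ hi n \<sigma> i * inverse q ^ lo \<rho> i"
  let ?b = "\<lambda>k. q ^ hi n r k * inverse q ^ lo s k * qnum q (s k) * qnum q (r k)"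
  have "Bf (Suc m) (Suc m') (Q * M \<sigma> \<rho>) (M s r) = (\<Sum>i=1..n. ?a i * Bf (Suc m) (Suc m') (M (inc i \<sigma>) (inc i \<rho>)) (M s r))"
    unfolding Q_M cpair.linear_sum[OF clinear_Bf_left] cpair.linear_scale[OF clinear_Bf_left] by (simp add: scaleC_complex_def)
  also have "\<dots> = (\<Sum>i=1..n. q ^ (2 * n + m') * inverse q ^ m * (?b i * Bf m m' (M \<sigma> \<rho>) (M (dec i s) (dec i r))))"
  proof (rule sum.cong)
    fix i assume i: "i \<in> {1..n}"
    show "?a i * Bf (Suc m) (Suc m') (M (inc i \<sigma>) (inc i \<rho>)) (M s r) =
      q ^ (2 * n + m') * inverse q ^ m * (?b i * Bf m m' (M \<sigma> \<rho>) (M (dec i s) (dec i r)))"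
    proof (cases "s = inc i \<sigma> \<and> r = inc i \<rho>")
      case True
      have "2 * n + m' = 2 * (n - i) + 2 * i + (lo \<sigma> i + \<sigma> i + hi n \<sigma> i)" "m = lo \<rho> i + \<rho> i + hi n \<rho> i"
        using i tot_split[OF i, of \<sigma>] tot_split[OF i, of \<rho>] \<sigma>\<rho> by auto
      then have e: "q ^ (2 * n + m') = q ^ (2 * (n - i)) * q ^ (2 * i) * (q ^ lo \<sigma> i * q ^ \<sigma> i * q ^ hi n \<sigma> i)"
        "inverse q ^ m = inverse q ^ lo \<rho> i * inverse q ^ \<rho> i * inverse q ^ hi n \<rho> i"
        by (simp_all only: power_add)
      have ring: "a1 * h1 * l2 * (K * (n1 * x1 * a2) * (n2 * y2)) = a1 * a2 * (l1 * x1 * h1) * (l2 * y2 * h2') * ((h2 * l1' * n1 * n2) * K)"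
        if "l1 * l1' = 1" "h2 * h2' = 1" for a1 a2 h1 h2 h2' l1 l1' l2 x1 y2 n1 n2 K :: complex
        using that by algebra
      have "Bf (Suc m) (Suc m') (M (inc i \<sigma>) (inc i \<rho>)) (M s r) = N (inc i \<sigma>) (inc i \<rho>)"
        using True \<sigma>\<rho> sr i by (subst Bf_MM) (auto simp: exps_inc tot_inc)
      also have "\<dots> = N \<sigma> \<rho> * (qnum q (Suc (\<sigma> i)) * q ^ \<sigma> i * q ^ (2 * i)) * (qnum q (Suc (\<rho> i)) * inverse q ^ \<rho> i)"
        using i by (simp only: N_inc_w N_inc_z)
      finally have B1: "Bf (Suc m) (Suc m') (M (inc i \<sigma>) (inc i \<rho>)) (M s r) = N \<sigma> \<rho> *
        (qnum q (Suc (\<sigma> i)) * q ^ \<sigma> i * q ^ (2 * i)) * (qnum q (Suc (\<rho> i)) * inverse q ^ \<rho> i)" .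
      have B2: "Bf m m' (M \<sigma> \<rho>) (M (dec i s) (dec i r)) = N \<sigma> \<rho>"
        using True \<sigma>\<rho> by (subst Bf_MM) auto
      have b: "?b i = q ^ hi n \<rho> i * inverse q ^ lo \<sigma> i * qnum q (Suc (\<sigma> i)) * qnum q (Suc (\<rho> i))"
        using True by (simp add: lo_inc hi_inc)
      show ?thesis unfolding B1 B2 b e by (intro ring) simp_all
    next
      case False
      \<comment> \<open>If index \<open>i\<close> is absent from \<open>s\<close> or
        \<open>r\<close>, truncation in \<open>dec\<close> could produce a spurious match with
        \<open>\<sigma>\<close> and \<open>\<rho>\<close>, but then the coefficient is zero.\<close>
      have "?b i = 0 \<or> \<not> (\<sigma> = dec i s \<and> \<rho> = dec i r)"
      proof (cases "s i = 0 \<or> r i = 0")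
        case True
        then have "?b i = 0" by auto
        then show ?thesis ..
      next
        case nonzero: False
        then have "inc i (dec i s) = s" "inc i (dec i r) = r" by (simp_all add: inc_dec)
        with False show ?thesis by metis
      qed
      moreover have "Bf (Suc m) (Suc m') (M (inc i \<sigma>) (inc i \<rho>)) (M s r) = 0"
        using False \<sigma>\<rho> sr i by (subst Bf_MM) (auto simp: exps_inc tot_inc)
      ultimately show ?thesis using \<sigma>\<rho> sr by (auto simp: Bf_MM exps_dec)
    qed
  qed simp
  also have "\<dots> = q ^ (2 * n + m') * inverse q ^ m * Bf m m' (M \<sigma> \<rho>) (Lap (M s r))"
    using sr by (simp add: Lap_M clinear_simps[OF clinear_Bf_right] scaleC_complex_def sum_distrib_left)
  finally show "Bf (Suc m) (Suc m') (Q * M \<sigma> \<rho>) (M s r) = q ^ (2 * n + m') * inverse q ^ m * Bf m m' (M \<sigma> \<rho>) (Lap (M s r))" .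
qed

subsection \<open>Powers of \<open>Q\<close> times harmonic elements\<close>

abbreviation H :: "nat \<Rightarrow> nat \<Rightarrow> 'a set" where "H \<equiv> harmonics n z w d db"

lemma H_iff: "p \<in> H m m' \<longleftrightarrow> p \<in> A m m' \<and> Lap p = 0"
  by (simp add: harmonics_def Lap_def)

lemma subspace_H [simp]: "cvec.subspace (H m m')"
  using cvec.subspace_inter[OF subspace_A cpair.linear_subspace_kernel[OF clinear_Lap]] by (simp add: harmonics_def Lap_def Int_def)

lemma Q_pow_A: "p \<in> A m m' \<Longrightarrow> Q ^ j * p \<in> A (m + j) (m' + j)"
proof (induction j)
  case (Suc j)
  then show ?case using Q_A[of "Q ^ j * p" "m + j" "m' + j"] by (simp add: mult.assoc)
qed simp

text \<open>With \<open>l = m + m' + n\<close>, each further factor \<open>Q\<close> adds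
  \<open>qnum q (l + 2 * j + 2)\<close> to \<open>qnum q (j + 1) * qnum q (l + j)\<close>, and
  \<open>qnum_diag\<close> identifies the sum as the next product. The coefficients are nonzero, as
  \<open>l > 0\<close>.\<close>

lemma Lap_Q_pow:
  assumes "h \<in> H m m'"
  shows "Lap (Q ^ Suc j * h) = (q ^ (n - 1) * qnum q (Suc j) * qnum q (m + m' + n + j)) *\<^sub>C (Q ^ j * h)"
proof (induction j)
  case 0
  show ?case using assms Lap_Q[of h m m'] by (simp add: H_iff ac_simps)
next
  case (Suc j)
  have A: "Q ^ Suc j * h \<in> A (m + Suc j) (m' + Suc j)" using assms by (intro Q_pow_A) (simp add: H_iff)
  have "Lap (Q ^ Suc (Suc j) * h) = Q * Lap (Q ^ Suc j * h) +
     (q ^ (n - 1) * qnum q (n + (m + Suc j) + (m' + Suc j))) *\<^sub>C (Q ^ Suc j * h)"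
    using Lap_Q[OF A] by (simp only: power_Suc mult.assoc)
  also have "Q * Lap (Q ^ Suc j * h) = (q ^ (n - 1) * qnum q (Suc j) * qnum q (m + m' + n + j)) *\<^sub>C (Q ^ Suc j * h)"
    unfolding Suc by (simp add: scaleC_mult_right mult.assoc)
  also have "qnum q (n + (m + Suc j) + (m' + Suc j)) = qnum q (Suc (Suc j + (m + m' + n + j)))"
    by (rule arg_cong[of _ _ "qnum q"]) simp
  also have "\<dots> = qnum q (Suc (Suc j)) * qnum q (m + m' + n + Suc j) - qnum q (Suc j) * qnum q (m + m' + n + j)"
    using qnum_diag[of "Suc j" "m + m' + n + j"] by simp
  finally show ?case by (simp only: scaleC_add_left[symmetric]) (simp add: algebra_simps)
qed

text \<open>\<open>Lap\<close> undoes one factor \<open>Q\<close> at a time, up to nonzero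
  scalars.\<close>

lemma Q_pow_zero:
  assumes "h \<in> H m m'" "Q ^ j * h = 0"
  shows "h = 0"
  using assms(2)
proof (induction j)
  case (Suc j)
  have "Lap (Q ^ Suc j * h) = 0" using Suc.prems by (simp add: cpair.linear_0[OF clinear_Lap])
  then have "Q ^ j * h = 0" unfolding Lap_Q_pow[OF assms(1)] using q0 npos by (simp add: qnum_eq_0_iff)
  then show ?case by (rule Suc.IH)
qed simp

definition QH :: "nat \<Rightarrow> nat \<Rightarrow> 'a set" where
  "QH m m' = {Q ^ j * h |j h a b. h \<in> H a b \<and> a + j = m \<and> b + j = m'}"

lemma QH_I: "h \<in> H a b \<Longrightarrow> a + j = m \<Longrightarrow> b + j = m' \<Longrightarrow> Q ^ j * h \<in> QH m m'"
  unfolding QH_def by blast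

text \<open>By induction \<open>Lap p\<close> is a combination of elements \<open>Q ^ j * h\<close>.
  Suitable multiples of \<open>Q ^ Suc j * h\<close> have the same image under \<open>Lap\<close>,
  and subtracting them from \<open>p\<close> leaves a harmonic element. If \<open>m\<close> or
  \<open>m'\<close> is zero, everything is harmonic.\<close>

lemma harmonic_decomposition: "p \<in> A m m' \<Longrightarrow> p \<in> cvec.span (QH m m')"
proof (induction m arbitrary: m' p)
  case 0
  then have "Q ^ 0 * p \<in> QH 0 m'" by (intro QH_I[of _ 0 m']) (auto simp: H_iff Lap_A0)
  then show ?case by (simp add: cvec.span_base)
next
  case (Suc m)
  show ?case
  proof (cases m')
    case 0
    then have "Q ^ 0 * p \<in> QH (Suc m) m'" using Suc.prems
      by (intro QH_I[of _ "Suc m" m']) (auto simp: H_iff Lap_A0)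
    then show ?thesis by (simp add: cvec.span_base)
  next
    case (Suc m'')
    have "Lap p \<in> cvec.span (QH m m'')" using Suc.IH[OF Lap_A] Suc.prems Suc by blast
    then have "\<exists>p'\<in>cvec.span (QH (Suc m) m') \<inter> A (Suc m) m'. Lap p' = Lap p"
    proof (induction rule: cvec.span_induct_alt)
      case base
      show ?case by (intro bexI[of _ 0]) (simp_all add: cpair.linear_0[OF clinear_Lap] cvec.span_zero cvec.subspace_0)
    next
      case (step c x y)
      then obtain j h a b where x: "x = Q ^ j * h" "h \<in> H a b" "a + j = m" "b + j = m''" unfolding QH_def by blast
      from step obtain p' where p': "p' \<in> cvec.span (QH (Suc m) m') \<inter> A (Suc m) m'" "Lap p' = y" by blast
      define k where "k = q ^ (n - 1) * qnum q (Suc j) * qnum q (a + b + n + j)"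
      have k: "k \<noteq> 0" unfolding k_def using q0 npos by (simp add: qnum_eq_0_iff)
      let ?x = "Q ^ Suc j * h"
      have "?x \<in> QH (Suc m) m'" using x Suc by (intro QH_I[of _ a b]) auto
      moreover have "?x \<in> A (Suc m) m'" using Q_pow_A[of h a b "Suc j"] x Suc by (simp add: H_iff)
      ultimately have "(c / k) *\<^sub>C ?x + p' \<in> cvec.span (QH (Suc m) m')" "(c / k) *\<^sub>C ?x + p' \<in> A (Suc m) m'"
        using p' by (blast intro: cvec.span_add cvec.span_scale cvec.span_base)
          (use p' \<open>?x \<in> A (Suc m) m'\<close> in \<open>simp add: cvec.subspace_add cvec.subspace_scale\<close>)
      moreover have "Lap ((c / k) *\<^sub>C ?x + p') = c *\<^sub>C x + y"
        using k p' x(1) unfolding cpair.linear_add[OF clinear_Lap] cpair.linear_scale[OF clinear_Lap] Lap_Q_pow[OF x(2)] k_def[symmetric]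
        by (simp add: scaleC_scaleC)
      ultimately show ?case by blast
    qed
    then obtain p' where p': "p' \<in> cvec.span (QH (Suc m) m')" "p' \<in> A (Suc m) m'" "Lap p' = Lap p" by blast
    have "p - p' \<in> H (Suc m) m'"
      using p' Suc.prems by (simp add: H_iff cpair.linear_diff[OF clinear_Lap] cvec.subspace_diff)
    then have "Q ^ 0 * (p - p') \<in> QH (Suc m) m'" by (intro QH_I[of _ "Suc m" m']) auto
    then have "p - p' \<in> cvec.span (QH (Suc m) m')" by (simp add: cvec.span_base)
    from cvec.span_add[OF this p'(1)] show ?thesis by simp
  qed
qed

end

text \<open>If \<open>T\<close> separates \<open>i\<close> from \<open>j\<close>, applying
  \<open>op T - ev T j\<close> to the relation removes the summand \<open>j\<close> and multiplies
  the summand \<open>i\<close> by a nonzero scalar. The vectors may be zero, which is why the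
  conclusion is that each of them is.\<close>

lemma joint_eigenvectors_independent:
  fixes v :: "'i \<Rightarrow> 'v::complex_vector" and op :: "'t \<Rightarrow> 'v \<Rightarrow> 'v"
  assumes "finite F" "\<And>T. T \<in> \<T> \<Longrightarrow> clinear (op T)"
    and "\<And>i T. i \<in> F \<Longrightarrow> T \<in> \<T> \<Longrightarrow> op T (v i) = ev T i *\<^sub>C v i"
    and "\<And>i j. i \<in> F \<Longrightarrow> j \<in> F \<Longrightarrow> i \<noteq> j \<Longrightarrow> \<exists>T\<in>\<T>. ev T i \<noteq> ev T j"
    and "(\<Sum>i\<in>F. v i) = 0" "i \<in> F"
  shows "v i = 0"
  using assms(1,3-)
proof (induction "card F" arbitrary: F v i rule: less_induct)
  case less
  show ?case
  proof (cases "F = {i}")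
    case True
    with less show ?thesis by simp
  next
    case False
    then obtain j where j: "j \<in> F" "j \<noteq> i" using less.prems by blast
    obtain T where T: "T \<in> \<T>" "ev T i \<noteq> ev T j" using less.prems(3)[of i j] less.prems(5) j by blast
    define u where "u a = (ev T a - ev T j) *\<^sub>C v a" for a
    have "op T (\<Sum>a\<in>F. v a) = (\<Sum>a\<in>F. ev T a *\<^sub>C v a)"
      unfolding cpair.linear_sum[OF assms(2)[OF T(1)]] by (rule sum.cong) (use less.prems T in auto)
    then have "(\<Sum>a\<in>F. u a) = 0"
      using less.prems(4) cpair.linear_0[OF assms(2)[OF T(1)]]
      by (simp add: u_def cvec.scale_left_diff_distrib sum_subtractf cvec.scale_sum_right[symmetric])
    moreover have "u j = 0" by (simp add: u_def)
    ultimately have "(\<Sum>a\<in>F - {j}. u a) = 0" using less.prems(1) j by (simp add: sum_diff1)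
    have eig: "op S (u a) = ev S a *\<^sub>C u a" if "a \<in> F - {j}" "S \<in> \<T>" for a S
      using that less.prems(2)[of a S] by (simp add: u_def cpair.linear_scale[OF assms(2)] scaleC_scaleC mult.commute)
    have "u i = 0"
    proof (rule less.hyps[of "F - {j}" u i])
      show "card (F - {j}) < card F" using less.prems(1) j(1) by (rule card_Diff1_less)
      show "\<exists>S\<in>\<T>. ev S a \<noteq> ev S b" if "a \<in> F - {j}" "b \<in> F - {j}" "a \<noteq> b" for a b
        using less.prems(3)[of a b] that by simp
    qed (use less.prems j eig \<open>(\<Sum>a\<in>F - {j}. u a) = 0\<close> in auto)
    then show ?thesis using T by (simp add: u_def)
  qed
qed

section \<open>Representations\<close>

lemma representationD:
  assumes "representation \<rho>"
  shows "clinear (\<rho> X)" "\<rho> 1 v = v" "\<rho> (X * Y) v = \<rho> X (\<rho> Y v)" "\<rho> (X + Y) v = \<rho> X v + \<rho> Y v"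
    "\<rho> (c *\<^sub>C X) v = c *\<^sub>C \<rho> X v"
  using assms unfolding representation_def by (auto simp: fun_eq_iff)

lemma intertwiner_on_generators:
  assumes "presented_algebra G R g" "representation \<rho>" "representation \<sigma>" "clinear T"
    and "\<And>x v. x \<in> G \<Longrightarrow> T (\<rho> (g x) v) = \<sigma> (g x) (T v)"
  shows "T (\<rho> X v) = \<sigma> X (T v)"
proof (induction X arbitrary: v rule: presented_induct[OF assms(1)])
  case (2 x Y)
  then show ?case using assms(5) by (simp add: representationD(3)[OF assms(2)] representationD(3)[OF assms(3)])
qed (simp_all add: representationD[OF assms(2)] representationD[OF assms(3)] clinear_simps[OF assms(4)])

lemma invariant_on_generators:
  assumes "presented_algebra G R g" "representation \<rho>" "cvec.subspace V"
    and "\<And>x v. x \<in> G \<Longrightarrow> v \<in> V \<Longrightarrow> \<rho> (g x) v \<in> V"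
  shows "subrep \<rho> V"
proof -
  have "\<rho> X v \<in> V" if "v \<in> V" for X v
    using that
  proof (induction X arbitrary: v rule: presented_induct[OF assms(1)])
    case (2 x Y)
    then show ?case using assms(4) by (simp add: representationD(3)[OF assms(2)])
  qed (simp_all add: representationD[OF assms(2)] cvec.subspace_add[OF assms(3)] cvec.subspace_scale[OF assms(3)])
  with assms(3) show ?thesis by (simp add: subrep_def)
qed

lemma rep_equiv_sym:
  assumes "rep_equiv \<rho> V \<sigma> V'"
  shows "rep_equiv \<sigma> V' \<rho> V"
proof -
  from assms obtain \<Phi> where sub: "subrep \<rho> V" "subrep \<sigma> V'"
    and \<Phi>: "clinear \<Phi>" "bij_betw \<Phi> V V'" "\<And>X v. v \<in> V \<Longrightarrow> \<Phi> (\<rho> X v) = \<sigma> X (\<Phi> v)"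
    unfolding rep_equiv_def by blast
  have "inj_on \<Phi> V" "\<Phi> ` V = V'" using \<Phi>(2) by (auto simp: bij_betw_def)
  \<comment> \<open>An inverse on \<open>V'\<close> alone would not do: \<open>rep_equiv\<close>
    asks for an intertwiner that is linear on the whole space.\<close>
  then obtain \<Psi> where \<Psi>: "clinear \<Psi>" "\<forall>v\<in>V. \<Psi> (\<Phi> v) = v"
    using cpair.linear_exists_left_inverse_on[OF \<Phi>(1), of V] sub(1) by (auto simp: subrep_def)
  have "bij_betw \<Psi> V' V"
    unfolding bij_betw_def using \<Psi>(2) \<open>\<Phi> ` V = V'\<close> by (force simp: inj_on_def image_iff)
  moreover have "\<Psi> (\<sigma> X v) = \<rho> X (\<Psi> v)" if "v \<in> V'" for X v
  proof -
    have "v \<in> \<Phi> ` V" using \<open>\<Phi> ` V = V'\<close> that by simp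
    then obtain u where u: "u \<in> V" "v = \<Phi> u" by blast
    moreover have "\<rho> X u \<in> V" using sub(1) u by (simp add: subrep_def)
    ultimately show ?thesis using \<Psi>(2) \<Phi>(3)[of u X] by metis
  qed
  ultimately show ?thesis unfolding rep_equiv_def using sub \<Psi>(1) by blast
qed

lemma rep_equiv_refl: "subrep \<rho> V \<Longrightarrow> rep_equiv \<rho> V \<rho> V"
  unfolding rep_equiv_def by (auto intro!: exI[of _ "\<lambda>x. x"] cvec.linear_ident simp: bij_betw_def)

lemma subrep_span_Union:
  assumes "\<And>V. V \<in> \<V> \<Longrightarrow> subrep \<rho> V" "\<And>X. clinear (\<rho> X)"
  shows "subrep \<rho> (cvec.span (\<Union>\<V>))"
  unfolding subrep_def
proof (intro conjI allI ballI cvec.subspace_span)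
  fix X v assume "v \<in> cvec.span (\<Union>\<V>)"
  then show "\<rho> X v \<in> cvec.span (\<Union>\<V>)"
    by (rule clinear_span_into[OF assms(2), rotated 2])
      (use assms(1) in \<open>auto simp: subrep_def intro!: cvec.span_base\<close>)
qed

lemma is_direct_sumI:
  fixes V :: "'i \<Rightarrow> 'v::complex_vector set"
  assumes sub: "\<And>i. cvec.subspace (V i)" and span: "\<And>v. v \<in> cvec.span (\<Union>i. V i)"
    and ind: "\<And>F g. finite F \<Longrightarrow> (\<And>i. i \<in> F \<Longrightarrow> g i \<in> V i) \<Longrightarrow> (\<Sum>i\<in>F. g i) = 0 \<Longrightarrow> \<forall>i\<in>F. g i = 0"
  shows "is_direct_sum V"
  unfolding is_direct_sum_def
proof (intro conjI allI)
  fix v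
  let ?S = "\<lambda>g :: 'i \<Rightarrow>\<^sub>0 'v. \<Sum>i\<in>Poly_Mapping.keys g. Poly_Mapping.lookup g i"
  have ex: "\<exists>g. (\<forall>i. Poly_Mapping.lookup g i \<in> V i) \<and> v = ?S g"
    using span[of v]
  proof (induction rule: cvec.span_induct_alt)
    case base
    show ?case by (intro exI[of _ 0]) (simp add: cvec.subspace_0[OF sub])
  next
    case (step c x y)
    then obtain i g where i: "x \<in> V i" and g: "\<forall>i. Poly_Mapping.lookup g i \<in> V i" "y = ?S g" by blast
    let ?g = "Poly_Mapping.single i (c *\<^sub>C x) + g"
    have "?S ?g = ?S (Poly_Mapping.single i (c *\<^sub>C x)) + ?S g"
      by (rule sum_keys_add[where f = "\<lambda>_ a. a"]) simp_all
    moreover have "Poly_Mapping.lookup ?g a \<in> V a" for a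
      using i g by (auto simp: lookup_add lookup_single when_def sub cvec.subspace_add cvec.subspace_scale)
    ultimately show ?case using g(2) by (intro exI[of _ ?g]) auto
  qed
  show "\<exists>!g. (\<forall>i. Poly_Mapping.lookup g i \<in> V i) \<and> v = ?S g"
  proof (rule ex_ex1I[OF ex])
    fix g g'
    assume a: "(\<forall>i. Poly_Mapping.lookup g i \<in> V i) \<and> v = ?S g" "(\<forall>i. Poly_Mapping.lookup g' i \<in> V i) \<and> v = ?S g'"
    let ?F = "Poly_Mapping.keys g \<union> Poly_Mapping.keys g'"
    have "?S g = (\<Sum>i\<in>?F. Poly_Mapping.lookup g i)" "?S g' = (\<Sum>i\<in>?F. Poly_Mapping.lookup g' i)"
      by (rule sum_keys_extend[where f = "\<lambda>_ a. a"]; simp)+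
    with a have "(\<Sum>i\<in>?F. Poly_Mapping.lookup g i - Poly_Mapping.lookup g' i) = 0"
      by (simp add: sum_subtractf)
    then have "\<forall>i\<in>?F. Poly_Mapping.lookup g i - Poly_Mapping.lookup g' i = 0"
      using a by (intro ind) (auto simp: cvec.subspace_diff[OF sub])
    then show "g = g'" by (intro poly_mapping_eqI) (metis UnI1 UnI2 eq_iff_diff_eq_0 in_keys_iff)
  qed
qed (rule sub)

lemma clinear_ket_eqI:
  assumes "clinear f" "clinear g" "\<And>r. f (ket r) = g (ket r)"
  shows "f p = g p"
proof (induction rule: poly_mapping_single_induct)
  case (2 u c)
  have "Poly_Mapping.single u c = c *\<^sub>C ket u" by (simp add: ket_def scaleC_single scaleC_complex_def)
  then show ?case by (simp add: assms clinear_simps)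
qed (simp_all add: assms clinear_simps)

lemma subspace_tensor_space: "cvec.subspace V \<Longrightarrow> cvec.subspace (tensor_space V)"
  by (auto simp: tensor_space_def cvec.subspace_def lookup_add lookup_scaleC)

lemma lookup_pure_tensor: "Poly_Mapping.lookup (pure_tensor d h) r = Poly_Mapping.lookup d r *\<^sub>C h"
  by (simp add: pure_tensor_def Poly_Mapping.map.rep_eq when_def)

section \<open>The action of \<open>U\<^sub>q(sl\<^sub>2)\<close>\<close>

locale zw_deg = zw_diff q n z w d db for q n and z w :: "nat \<Rightarrow> 'a::complex_algebra_1" and d db +
  fixes \<gamma> \<gamma>b :: "'a \<Rightarrow> 'a"
  assumes clinear_g: "clinear \<gamma>" and g: "\<And>m m' p. p \<in> A m m' \<Longrightarrow> \<gamma> p = q ^ m *\<^sub>C p"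
    and clinear_gb: "clinear \<gamma>b" and gb: "\<And>m m' p. p \<in> A m m' \<Longrightarrow> \<gamma>b p = q ^ m' *\<^sub>C p"
begin

lemma QLap_eigen:
  assumes "h \<in> H m m'"
  shows "Q * Lap (Q ^ j * h) = (q ^ (n - 1) * (qnum q j * qnum q (m + m' + n + j - 1))) *\<^sub>C (Q ^ j * h)"
proof (cases j)
  case 0
  then show ?thesis using assms by (simp add: H_iff)
next
  case (Suc i)
  then show ?thesis using Lap_Q_pow[OF assms, of i] by (simp add: scaleC_mult_right mult.assoc)
qed

text \<open>The \<open>Q ^ j * h\<close> are joint eigenvectors of \<open>\<gamma>\<close>,
  \<open>\<gamma>b\<close> and \<open>Q * Lap\<close>, coded as 0, 1 and 2. The first two determine
  \<open>a + j\<close> and \<open>b + j\<close>; given these, the third determines \<open>j\<close>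
  by \<open>qnum_exchange\<close>.\<close>

lemma Q_pow_H_independent:
  fixes h :: "'i \<Rightarrow> 'a" and j a b :: "'i \<Rightarrow> nat"
  assumes "finite F" "inj_on (\<lambda>i. (j i, a i, b i)) F" "\<And>i. i \<in> F \<Longrightarrow> h i \<in> H (a i) (b i)"
    and "(\<Sum>i\<in>F. Q ^ j i * h i) = 0" "i \<in> F"
  shows "h i = 0"
proof -
  let ?T3 = "\<lambda>p. Q * Lap p"
  let ?e3 = "\<lambda>i. q ^ (n - 1) * (qnum q (j i) * qnum q (a i + b i + n + j i - 1))"
  define ev where "ev T i = (if T = 0 then q ^ (a i + j i) else if T = 1 then q ^ (b i + j i) else ?e3 i)" for T :: nat and i
  define op where "op T = (if T = 0 then \<gamma> else if T = 1 then \<gamma>b else ?T3)" for T :: nat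
  have hA: "Q ^ j i * h i \<in> A (a i + j i) (b i + j i)" if "i \<in> F" for i
    using assms(3)[OF that] by (intro Q_pow_A) (simp add: H_iff)
  have sep3: "?e3 i \<noteq> ?e3 i'"
    if "a i + j i = a i' + j i'" "b i + j i = b i' + j i'" "j i < j i'" for i i'
  proof
    assume "?e3 i = ?e3 i'"
    then have e: "qnum q (j i) * qnum q (a i + b i + n + j i - 1) = qnum q (j i') * qnum q (a i' + b i' + n + j i' - 1)"
      using q0 by simp
    define t where "t = j i' - j i"
    define u where "u = a i' + b i' + n - 1 + t"
    have "j i' = j i + t" "a i' + b i' + n + j i' - 1 = j i + u" "a i + b i + n + j i - 1 = j i + t + u"
      using that npos by (simp_all add: t_def u_def)
    with e have "qnum q t * qnum q u = 0" using qnum_exchange[of "j i" t u] by simp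
    then show False using that by (auto simp: qnum_eq_0_iff t_def u_def)
  qed
  have sep: "\<exists>T\<in>{0,1,2::nat}. ev T i \<noteq> ev T i'" if ii': "i \<in> F" "i' \<in> F" "i \<noteq> i'" for i i'
  proof (rule ccontr)
    assume "\<not> ?thesis"
    then have e: "ev 0 i = ev 0 i'" "ev 1 i = ev 1 i'" "ev 2 i = ev 2 i'" by auto
    then have ab: "a i + j i = a i' + j i'" "b i + j i = b i' + j i'" using pow_inj by (auto simp: ev_def)
    have "?e3 i = ?e3 i'" using e(3) by (simp add: ev_def)
    then have "j i = j i'" using sep3[of i i'] sep3[of i' i] ab by (metis linorder_neqE_nat)
    then have "(j i, a i, b i) = (j i', a i', b i')" using ab by simp
    then show False using assms(2) ii' unfolding inj_on_def by blast
  qed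
  have opev: "op T (Q ^ j i * h i) = ev T i *\<^sub>C (Q ^ j i * h i)" if "i \<in> F" for i T
    using g[OF hA[OF that]] gb[OF hA[OF that]] QLap_eigen[OF assms(3)[OF that], of "j i"]
    by (simp add: op_def ev_def)
  have lin: "clinear (op T)" for T
    by (simp add: op_def clinear_g clinear_gb clinear_compose[OF clinear_mult_left clinear_Lap])
  have "Q ^ j i * h i = 0"
  proof (rule joint_eigenvectors_independent[where \<T> = "{0,1,2::nat}" and F = F and ev = ev and v = "\<lambda>i. Q ^ j i * h i" and op = op])
  qed (use assms sep opev lin in auto)
  then show ?thesis using Q_pow_zero[OF assms(3)[OF assms(5)]] by blast
qed

text \<open>Multiplication into the algebra with weights on the powers of \<open>Q\<close>. Weights
  1 give \<open>mult_Q\<close>; the weights \<open>coef l\<close> will turn it into an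
  intertwiner.\<close>

definition Psi :: "(nat \<Rightarrow> complex) \<Rightarrow> (nat \<Rightarrow>\<^sub>0 'a) \<Rightarrow> 'a" where
  "Psi c g = (\<Sum>r\<in>Poly_Mapping.keys g. c r *\<^sub>C (Q ^ r * Poly_Mapping.lookup g r))"

lemma clinear_Psi: "clinear (Psi c)"
  unfolding Psi_def by (rule clinear_sum_keys[where f = "\<lambda>r x. c r *\<^sub>C (Q ^ r * x)"])
    (intro cpair.linear_compose_scale_right clinear_mult_left)

lemma mult_Q_Psi: "mult_Q Q = Psi (\<lambda>_. 1)"
  by (simp add: fun_eq_iff mult_Q_def Psi_def scaleC_one)

lemma Psi_single: "Psi c (Poly_Mapping.single r h) = c r *\<^sub>C (Q ^ r * h)"
  by (simp add: Psi_def)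

lemma Psi_inj:
  assumes "\<And>r. c r \<noteq> 0"
  shows "inj_on (Psi c) (tensor_space (H m m'))"
proof (rule inj_onI)
  fix g1 g2 assume g12: "g1 \<in> tensor_space (H m m')" "g2 \<in> tensor_space (H m m')" "Psi c g1 = Psi c g2"
  define g where "g = g1 - g2"
  have gH: "Poly_Mapping.lookup g r \<in> H m m'" for r
    using g12 by (simp add: g_def tensor_space_def lookup_minus cvec.subspace_diff)
  have "(\<Sum>r\<in>Poly_Mapping.keys g. Q ^ r * (c r *\<^sub>C Poly_Mapping.lookup g r)) = 0"
    using g12 cpair.linear_diff[OF clinear_Psi, of c g1 g2] by (simp add: g_def[symmetric] Psi_def scaleC_mult_right)
  then have "c r *\<^sub>C Poly_Mapping.lookup g r = 0" if "r \<in> Poly_Mapping.keys g" for r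
    using Q_pow_H_independent[where F = "Poly_Mapping.keys g" and j = "\<lambda>r. r" and a = "\<lambda>_. m" and b = "\<lambda>_. m'"
        and h = "\<lambda>r. c r *\<^sub>C Poly_Mapping.lookup g r" and i = r] that gH
    by (simp add: inj_on_def cvec.subspace_scale)
  then have "Poly_Mapping.lookup g r = 0" for r using assms by (cases "r \<in> Poly_Mapping.keys g") (auto simp: in_keys_iff)
  then have "g = 0" by (intro poly_mapping_eqI) simp
  then show "g1 = g2" by (simp add: g_def)
qed

text \<open>Nonzero weights only rescale the slots, so all \<open>Psi c\<close> have the same image,
  and \<open>CQ_tensor\<close> may be described with the weights adapted to the discrete
  series.\<close>

lemma Psi_image:
  assumes "cvec.subspace V" "\<And>r. c r \<noteq> 0"
  shows "Psi c ` tensor_space V = cvec.span {Q ^ r * h |r h. h \<in> V}"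
proof (rule antisym)
  show "Psi c ` tensor_space V \<subseteq> cvec.span {Q ^ r * h |r h. h \<in> V}"
  proof safe
    fix g assume "g \<in> tensor_space V"
    then show "Psi c g \<in> cvec.span {Q ^ r * h |r h. h \<in> V}"
      unfolding Psi_def tensor_space_def by (intro cvec.span_sum cvec.span_scale cvec.span_base) auto
  qed
  have "cvec.subspace (Psi c ` tensor_space V)"
    by (rule cpair.linear_subspace_image[OF clinear_Psi subspace_tensor_space[OF assms(1)]])
  moreover have "Q ^ r * h \<in> Psi c ` tensor_space V" if "h \<in> V" for r h
  proof (rule image_eqI)
    show "Q ^ r * h = Psi c (Poly_Mapping.single r (inverse (c r) *\<^sub>C h))"
      using assms(2) by (simp add: Psi_single scaleC_mult_right scaleC_scaleC scaleC_one)
    show "Poly_Mapping.single r (inverse (c r) *\<^sub>C h) \<in> tensor_space V"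
      using that assms(1) by (simp add: tensor_space_def lookup_single when_def cvec.subspace_scale cvec.subspace_0)
  qed
  ultimately show "cvec.span {Q ^ r * h |r h. h \<in> V} \<subseteq> Psi c ` tensor_space V"
    by (intro cvec.span_minimal) auto
qed

abbreviation CQ :: "nat \<Rightarrow> nat \<Rightarrow> 'a set" where "CQ m m' \<equiv> CQ_tensor Q (H m m')"

lemma CQ_span: "CQ m m' = cvec.span {Q ^ r * h |r h. h \<in> H m m'}"
  unfolding CQ_tensor_def mult_Q_Psi by (rule Psi_image) simp_all

lemma CQ_I: "h \<in> H m m' \<Longrightarrow> Q ^ r * h \<in> CQ m m'"
  unfolding CQ_span by (rule cvec.span_base) blast

lemma subspace_CQ [simp]: "cvec.subspace (CQ m m')"
  by (simp add: CQ_span cvec.subspace_span)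

lemma span_CQ: "v \<in> cvec.span (\<Union>i. case i of (m, m') \<Rightarrow> CQ m m')"
proof (induction v rule: all_homog_induct)
  case (2 m m' p)
  have "QH m m' \<subseteq> (\<Union>i. case i of (m, m') \<Rightarrow> CQ m m')"
    unfolding QH_def using CQ_I by fastforce
  with harmonic_decomposition[OF 2] show ?case using cvec.span_mono by blast
qed (rule cvec.span_add)

text \<open>Expanding every \<open>v i\<close> in powers of \<open>Q\<close> gives one sum over
  pairs of a component and a power; these have pairwise distinct labels, as
  \<open>Q_pow_H_independent\<close> requires.\<close>

lemma CQ_independent:
  assumes "finite F" "\<And>i. i \<in> F \<Longrightarrow> v i \<in> CQ (fst i) (snd i)" "(\<Sum>i\<in>F. v i) = 0" "i \<in> F"
  shows "v i = 0"
proof -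
  have "\<exists>G. G \<in> tensor_space (H (fst i) (snd i)) \<and> v i = mult_Q Q G" if "i \<in> F" for i
    using assms(2)[OF that] unfolding CQ_tensor_def by blast
  then obtain G where G: "\<And>i. i \<in> F \<Longrightarrow> G i \<in> tensor_space (H (fst i) (snd i))" "\<And>i. i \<in> F \<Longrightarrow> v i = mult_Q Q (G i)"
    by metis
  let ?S = "SIGMA i:F. Poly_Mapping.keys (G i)"
  have "(\<Sum>x\<in>?S. Q ^ snd x * Poly_Mapping.lookup (G (fst x)) (snd x)) = (\<Sum>i\<in>F. v i)"
    using assms(1) G(2) sum.Sigma[of F "\<lambda>i. Poly_Mapping.keys (G i)" "\<lambda>i r. Q ^ r * Poly_Mapping.lookup (G i) r"]
    by (simp add: mult_Q_def case_prod_beta)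
  then have "Poly_Mapping.lookup (G (fst x)) (snd x) = 0" if "x \<in> ?S" for x
    using Q_pow_H_independent[where F = ?S and j = snd and a = "fst \<circ> fst" and b = "snd \<circ> fst"
        and h = "\<lambda>x. Poly_Mapping.lookup (G (fst x)) (snd x)" and i = x] assms(1,3) that G(1)
    by (auto simp: inj_on_def tensor_space_def)
  then have "Poly_Mapping.keys (G i) = {}" using assms(4) by (fastforce simp: in_keys_iff)
  then show ?thesis using G(2)[OF assms(4)] by (simp add: mult_Q_def)
qed

lemma CQ_direct_sum: "is_direct_sum (\<lambda>(m, m'). CQ m m')"
proof (rule is_direct_sumI)
  show "cvec.subspace (case i of (m, m') \<Rightarrow> CQ m m')" for i by (cases i) simp
  show "v \<in> cvec.span (\<Union>i. case i of (m, m') \<Rightarrow> CQ m m')" for v by (rule span_CQ)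
  show "\<forall>i\<in>F. v i = 0" if "finite F" "\<And>i. i \<in> F \<Longrightarrow> v i \<in> (case i of (m, m') \<Rightarrow> CQ m m')" "(\<Sum>i\<in>F. v i) = 0"
    for F and v :: "nat \<times> nat \<Rightarrow> 'a"
    using CQ_independent[of F v] that by (auto simp: case_prod_beta)
qed

section \<open>The relations of U_q(sl_2) as operator identities\<close>

definition Kop :: "'a \<Rightarrow> 'a" where "Kop p = q ^ n *\<^sub>C \<gamma> (\<gamma>b p)"

lemma clinear_Kop: "clinear Kop"
  unfolding Kop_def by (intro cpair.linear_compose_scale_right clinear_compose[OF clinear_g clinear_gb])

lemma Kop_A: "p \<in> A m m' \<Longrightarrow> Kop p = q ^ (n + m + m') *\<^sub>C p"
  by (simp add: Kop_def gb g cpair.linear_scale[OF clinear_g] scaleC_scaleC power_add mult_ac)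

text \<open>The inverse will represent \<open>kinv\<close>. Injectivity is read off from the
  coordinates, each of which is multiplied by a nonzero scalar; surjectivity from the homogeneous
  components.\<close>

lemma Kop_inverse:
  obtains Ki where "clinear Ki" "\<And>p. Ki (Kop p) = p" "\<And>p. Kop (Ki p) = p"
proof -
  have "Kop p = 0 \<Longrightarrow> p = 0" for p
  proof (rule coords_zero)
    fix s r assume sr: "s \<in> exps n" "r \<in> exps n" and 0: "Kop p = 0"
    have "cf s r (Kop p) = q ^ (n + tot n r + tot n s) *\<^sub>C cf s r p"
    proof (rule clinear_eqI[where f = "\<lambda>p. cf s r (Kop p)"])
      fix s' r' assume "s' \<in> exps n" "r' \<in> exps n"
      then show "cf s r (Kop (M s' r')) = q ^ (n + tot n r + tot n s) *\<^sub>C cf s r (M s' r')"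
        using sr by (auto simp: Kop_A[OF M_A] cf_simps cf_M scaleC_complex_def)
    qed (use sr in \<open>auto intro: clinear_compose[OF clinear_cf clinear_Kop] cpair.linear_compose_scale_right clinear_cf\<close>)
    then show "cf s r p = 0" using 0 sr q0 by (simp add: cf_simps scaleC_complex_def)
  qed
  then have "inj Kop" unfolding inj_def by (metis cpair.linear_diff[OF clinear_Kop] eq_iff_diff_eq_0)
  then obtain Ki where Ki: "clinear Ki" "Ki \<circ> Kop = id" using cpair.linear_injective_left_inverse[OF clinear_Kop] by blast
  have "\<exists>x. Kop x = p" for p
  proof (induction p rule: all_homog_induct)
    case (1 a b)
    then show ?case by (metis cpair.linear_add[OF clinear_Kop])
  next
    case (2 m m' p)
    then have "Kop (inverse (q ^ (n + m + m')) *\<^sub>C p) = p" using q0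
      by (simp add: cpair.linear_scale[OF clinear_Kop] Kop_A scaleC_scaleC scaleC_one)
    then show ?case by blast
  qed
  then have "Kop (Ki p) = p" for p using Ki(2) by (metis comp_apply id_apply)
  with Ki that show ?thesis by (metis comp_apply id_apply)
qed

lemma Kop_Q: "Kop (Q * p) = q^2 *\<^sub>C (Q * Kop p)"
proof (induction p rule: all_homog_induct)
  case (1 a b)
  then show ?case by (simp add: distrib_left cpair.linear_add[OF clinear_Kop] scaleC_add_right)
next
  case (2 m m' p)
  then show ?case by (simp add: Kop_A[OF Q_A] Kop_A scaleC_mult_right scaleC_scaleC power_add power2_eq_square mult_ac)
qed

lemma Kop_Lap: "Kop (Lap p) = (inverse q)^2 *\<^sub>C Lap (Kop p)"
proof (induction p rule: all_homog_induct)
  case (1 a b)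
  then show ?case by (simp add: cpair.linear_add[OF clinear_Lap] cpair.linear_add[OF clinear_Kop] scaleC_add_right)
next
  case (2 m m' p)
  show ?case
  proof (cases "m = 0 \<or> m' = 0")
    case True
    then show ?thesis using Lap_A0[OF 2] 2
      by (simp add: Kop_A cpair.linear_scale[OF clinear_Lap] cpair.linear_0[OF clinear_Kop])
  next
    case False
    then obtain i j where ij: "m = Suc i" "m' = Suc j" by (metis not0_implies_Suc)
    have "inverse q * inverse q * (q * (q * c)) = c" for c by (simp add: mult.assoc)
    then show ?thesis using 2 Kop_A[OF Lap_A[of p i j]] unfolding ij
      by (simp add: Kop_A cpair.linear_scale[OF clinear_Lap] scaleC_scaleC power2_eq_square)
  qed
qed

text \<open>The relation for \<open>ef - fe\<close>. Here the normalisation of \<omega>(e)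
  originates: \<open>q powi (1 - int n)\<close> cancels \<open>q ^ (n - 1)\<close> from
  \<open>Lap_Q\<close>, and the remaining \<open>qnum q (n + m + m')\<close> is the value of the
  right-hand side.\<close>

lemma Lap_Q_Kop:
  assumes "\<And>p. Ki (Kop p) = p" "clinear Ki"
  shows "(q powi (1 - int n)) *\<^sub>C (Lap (Q * p) - Q * Lap p) = inverse (q - inverse q) *\<^sub>C (Kop p - Ki p)"
proof (induction p rule: all_homog_induct)
  case (1 a b)
  then show ?case
    by (simp add: distrib_left clinear_simps[OF clinear_Lap] clinear_simps[OF clinear_Kop] clinear_simps[OF assms(2)]
      vec_simps algebra_simps)
next
  case (2 m m' p)
  let ?N = "n + m + m'"
  have "q ^ ?N *\<^sub>C Ki p = p" using assms(1)[of p] Kop_A[OF 2] by (simp add: cpair.linear_scale[OF assms(2)])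
  then have "inverse q ^ ?N *\<^sub>C (q ^ ?N *\<^sub>C Ki p) = inverse q ^ ?N *\<^sub>C p" by simp
  then have Ki: "Ki p = inverse q ^ ?N *\<^sub>C p" by (simp add: scaleC_scaleC scaleC_one)
  have "q powi (1 - int n) * q ^ (n - 1) = q powi (1 - int n) * q powi (int (n - 1))" by simp
  also have "\<dots> = q powi (1 - int n + int (n - 1))" using q0 by (intro power_int_add[symmetric]) simp
  also have "\<dots> = 1" using npos by simp
  finally have one: "q powi (1 - int n) * (q ^ (n - 1) * c) = c" for c by (simp add: mult.assoc[symmetric])
  have "(q powi (1 - int n)) *\<^sub>C (Lap (Q * p) - Q * Lap p) = qnum q ?N *\<^sub>C p"
    unfolding Lap_Q[OF 2] using one[of "qnum q ?N"] by (simp only: add_diff_cancel_left' scaleC_scaleC)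
  also have "\<dots> = inverse (q - inverse q) *\<^sub>C (Kop p - Ki p)"
    unfolding Kop_A[OF 2] Ki by (simp add: cvec.scale_left_diff_distrib[symmetric] scaleC_scaleC qnum_def divide_inverse mult.commute)
  finally show ?case .
qed

lemma sl2_action_ex:
  fixes k kinv e f :: "'u::complex_algebra_1"
  assumes "Uq_sl2 q k kinv e f"
  shows "\<exists>\<omega>. sl2_action n q z w d db \<gamma> \<gamma>b k e f \<omega>"
proof -
  obtain Ki where Ki: "clinear Ki" "\<And>p. Ki (Kop p) = p" "\<And>p. Kop (Ki p) = p" using Kop_inverse by blast
  define KK where "KK = Cendo Kop"
  define KI where "KI = Cendo Ki"
  define EE where "EE = Cendo (\<lambda>p. (q powi (1 - int n)) *\<^sub>C (Q * p))"
  define FF where "FF = Cendo (\<lambda>p. - Lap p)"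
  have app: "app_cendo KK = Kop" "app_cendo KI = Ki" "app_cendo EE = (\<lambda>p. (q powi (1 - int n)) *\<^sub>C (Q * p))"
    "app_cendo FF = (\<lambda>p. - Lap p)"
    unfolding KK_def KI_def EE_def FF_def
    by (rule Cendo_inverse, simp add: clinear_Kop Ki cpair.linear_compose_scale_right[OF clinear_mult_left] cpair.linear_compose_neg[OF clinear_Lap])+
  note cendo_simps = zero_cendo.rep_eq one_cendo.rep_eq plus_cendo.rep_eq minus_cendo.rep_eq times_cendo.rep_eq scaleC_cendo.rep_eq app
  have rel: "free_eval (case_sl2_gen KK KI EE FF) r = 0" if "r \<in> sl2_relations q" for r
  proof -
    have "KK * KI - 1 = 0" "KI * KK - 1 = 0"
      by (rule app_cendo_inject[THEN iffD1], simp add: fun_eq_iff cendo_simps Ki)+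
    moreover have "KK * EE - q^2 *\<^sub>C (EE * KK) = 0"
      by (rule app_cendo_inject[THEN iffD1])
        (simp add: fun_eq_iff cendo_simps cpair.linear_scale[OF clinear_Kop] Kop_Q scaleC_scaleC mult.commute)
    moreover have "KK * FF - (inverse q)^2 *\<^sub>C (FF * KK) = 0"
      by (rule app_cendo_inject[THEN iffD1])
        (simp add: fun_eq_iff cendo_simps cpair.linear_neg[OF clinear_Kop] Kop_Lap)
    moreover have "EE * FF - FF * EE - inverse (q - inverse q) *\<^sub>C (KK - KI) = 0"
    proof (rule app_cendo_inject[THEN iffD1], rule ext)
      fix p
      have "(q powi (1 - int n)) *\<^sub>C (Q * (- Lap p)) - (- Lap ((q powi (1 - int n)) *\<^sub>C (Q * p))) =
          inverse (q - inverse q) *\<^sub>C (Kop p - Ki p)"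
        using Lap_Q_Kop[OF Ki(2,1), of p] by (simp add: cpair.linear_scale[OF clinear_Lap] cvec.scale_right_diff_distrib)
      then show "app_cendo (EE * FF - FF * EE - inverse (q - inverse q) *\<^sub>C (KK - KI)) p = app_cendo 0 p"
        by (simp add: cendo_simps)
    qed
    ultimately show ?thesis using that unfolding sl2_relations_def by auto
  qed
  obtain \<phi> where \<phi>: "clinear \<phi>" "\<phi> 1 = 1" "\<And>a b. \<phi> (a * b) = \<phi> a * \<phi> b"
    "\<And>x. x \<in> UNIV \<Longrightarrow> \<phi> (case_sl2_gen k kinv e f x) = case_sl2_gen KK KI EE FF x"
    using presented_lift[OF assms[unfolded Uq_sl2_def] rel] by metis
  define \<omega> where "\<omega> X = app_cendo (\<phi> X)" for X
  have "\<omega> k = Kop" "\<omega> e = (\<lambda>p. (q powi (1 - int n)) *\<^sub>C (Q * p))" "\<omega> f = (\<lambda>p. - Lap p)"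
    using \<phi>(4)[of SK] \<phi>(4)[of SE] \<phi>(4)[of SF] by (simp_all add: \<omega>_def app)
  moreover have "representation \<omega>"
    unfolding representation_def \<omega>_def
    by (auto simp: clinear_app_cendo \<phi> fun_eq_iff cendo_simps clinear_simps[OF \<phi>(1)])
  ultimately have "sl2_action n q z w d db \<gamma> \<gamma>b k e f \<omega>"
    by (simp add: sl2_action_def Kop_def Lap_def)
  then show ?thesis by (intro exI[of _ \<omega>])
qed

end

section \<open>Discrete series inside the algebra\<close>

locale sl2_setting = zw_deg q n z w d db \<gamma> \<gamma>b
  for q n and z w :: "nat \<Rightarrow> 'a::complex_algebra_1" and d db \<gamma> \<gamma>b +
  fixes k kinv e f :: "'u::complex_algebra_1" and \<omega> :: "'u \<Rightarrow> 'a \<Rightarrow> 'a"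
  assumes U: "Uq_sl2 q k kinv e f" and act: "sl2_action n q z w d db \<gamma> \<gamma>b k e f \<omega>"
begin

lemma rep_omega: "representation \<omega>"
  and omega_k: "\<omega> k p = Kop p"
  and omega_e: "\<omega> e p = (q powi (1 - int n)) *\<^sub>C (Q * p)"
  and omega_f: "\<omega> f p = - Lap p"
  using act by (simp_all add: sl2_action_def Kop_def Lap_def)

lemma k_kinv: "k * kinv = 1" "kinv * k = 1"
proof -
  have R: "gen SK * gen SKinv - 1 \<in> sl2_relations q" "gen SKinv * gen SK - 1 \<in> sl2_relations q"
    by (simp_all add: sl2_relations_def)
  have "gen SK * gen SKinv - 1 \<in> free_on (UNIV :: sl2_gen set)" "gen SKinv * gen SK - 1 \<in> free_on (UNIV :: sl2_gen set)"
    by (intro free_on_intros UNIV_I)+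
  with R presented_relation[OF U[unfolded Uq_sl2_def]] have
    "free_eval (case_sl2_gen k kinv e f) (gen SK * gen SKinv - 1) = 0"
    "free_eval (case_sl2_gen k kinv e f) (gen SKinv * gen SK - 1) = 0" by blast+
  then show "k * kinv = 1" "kinv * k = 1" by simp_all
qed

text \<open>Compatibility with \<open>kinv\<close> follows from that with \<open>k\<close> by
  multiplying with the inverse on both sides.\<close>

lemma sl2_intertwiner:
  assumes "representation \<rho>" "representation \<sigma>" "clinear T"
    and "\<And>v. T (\<rho> k v) = \<sigma> k (T v)" "\<And>v. T (\<rho> e v) = \<sigma> e (T v)" "\<And>v. T (\<rho> f v) = \<sigma> f (T v)"
  shows "T (\<rho> X v) = \<sigma> X (T v)"
proof (rule intertwiner_on_generators[OF U[unfolded Uq_sl2_def] assms(1-3)])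
  note r = representationD[OF assms(1)] and s = representationD[OF assms(2)]
  fix x v
  have "\<sigma> kinv (T v) = \<sigma> kinv (T (\<rho> (k * kinv) v))" by (simp add: k_kinv r)
  also have "\<dots> = \<sigma> (kinv * k) (T (\<rho> kinv v))" by (simp add: r s assms(4))
  also have "\<dots> = T (\<rho> kinv v)" by (simp add: k_kinv s)
  finally show "T (\<rho> (case_sl2_gen k kinv e f x) v) = \<sigma> (case_sl2_gen k kinv e f x) (T v)"
    using assms(4-6) by (cases x) simp_all
qed

lemma sl2_action_unique: "sl2_action n q z w d db \<gamma> \<gamma>b k e f \<omega>' \<Longrightarrow> \<omega>' = \<omega>"
proof (rule ext, rule ext)
  fix X p assume "sl2_action n q z w d db \<gamma> \<gamma>b k e f \<omega>'"
  then show "\<omega>' X p = \<omega> X p"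
    using sl2_intertwiner[of \<omega>' \<omega> "\<lambda>x. x" X p] rep_omega
    by (simp add: sl2_action_def Kop_def omega_k omega_e omega_f Lap_def cvec.linear_ident)
qed

text \<open>The weights forced by the action of \<open>e\<close>: starting from 1, the image of
  \<open>ket (Suc r)\<close> is determined by that of \<open>ket r\<close> through
  \<open>coef_Suc\<close>.\<close>

definition coef :: "nat \<Rightarrow> nat \<Rightarrow> complex" where
  "coef l r = (\<Prod>i<r. q powi (1 - int n) / qnum q (i + l))"

lemma coef_nonzero: "l > 0 \<Longrightarrow> coef l r \<noteq> 0"
  using q0 by (simp add: coef_def qnum_eq_0_iff)

lemma coef_Suc: "l > 0 \<Longrightarrow> qnum q (r + l) * coef l (Suc r) = coef l r * q powi (1 - int n)"
  by (simp add: coef_def qnum_eq_0_iff)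

text \<open>\<open>Theta l h\<close> embeds the discrete series with lowest weight \<open>l\<close>, sending the lowest weight
  vector to the harmonic element \<open>h\<close>.\<close>

definition Theta :: "nat \<Rightarrow> 'a \<Rightarrow> (nat \<Rightarrow>\<^sub>0 complex) \<Rightarrow> 'a" where
  "Theta l h v = Psi (coef l) (pure_tensor v h)"

lemma clinear_pure_tensor: "clinear (\<lambda>v. pure_tensor v h)"
  by (rule clinearI; rule poly_mapping_eqI) (simp_all add: lookup_pure_tensor lookup_add lookup_scaleC vec_simps scaleC_complex_def)

lemma clinear_Theta: "clinear (Theta l h)"
  unfolding Theta_def by (rule clinear_compose[OF clinear_Psi clinear_pure_tensor])

lemma pure_tensor_ket: "pure_tensor (ket r) h = Poly_Mapping.single r h"
  by (rule poly_mapping_eqI) (simp add: lookup_pure_tensor ket_def lookup_single when_def scaleC_one)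

lemma Theta_ket: "Theta l h (ket r) = coef l r *\<^sub>C (Q ^ r * h)"
  by (simp add: Theta_def pure_tensor_ket Psi_single)

text \<open>For \<open>e\<close> this is the recursion that defines \<open>coef\<close>, for
  \<open>k\<close> a count of degrees. For \<open>f\<close> it is \<open>Lap_Q_pow\<close>: its
  factor \<open>qnum q (l + t)\<close> cancels the last denominator of
  \<open>coef l (Suc t)\<close>, and the powers of \<open>q\<close> cancel as well.\<close>

lemma Theta_intertwines:
  assumes D: "discrete_series q k e f l \<delta>" and h: "h \<in> H m m'" and l: "l = m + m' + n"
  shows "Theta l h (\<delta> X v) = \<omega> X (Theta l h v)"
proof (rule sl2_intertwiner[where T = "Theta l h" and \<rho> = \<delta> and \<sigma> = \<omega>])
  have l0: "l > 0" using l npos by simp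
  have rep: "representation \<delta>" and K: "\<delta> k (ket r) = q ^ (2 * r + l) *\<^sub>C ket r"
    and F: "\<delta> f (ket r) = (- qnum q r) *\<^sub>C ket (r - 1)" and E: "\<delta> e (ket r) = qnum q (r + l) *\<^sub>C ket (r + 1)" for r
    using D by (auto simp: discrete_series_def)
  show "representation \<delta>" "representation \<omega>" "clinear (Theta l h)" by (rule rep rep_omega clinear_Theta)+
  note lin = clinear_compose[OF clinear_Theta representationD(1)[OF rep]]
    clinear_compose[OF representationD(1)[OF rep_omega] clinear_Theta]
  have hA: "Q ^ r * h \<in> A (m + r) (m' + r)" for r using h by (intro Q_pow_A) (simp add: H_iff)
  show "Theta l h (\<delta> k v) = \<omega> k (Theta l h v)" for v
  proof (rule clinear_ket_eqI[OF lin], simp only: K omega_k cpair.linear_scale[OF clinear_Theta] Theta_ket cpair.linear_scale[OF clinear_Kop] Kop_A[OF hA])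
    show "q ^ (2 * r + l) *\<^sub>C coef l r *\<^sub>C (Q ^ r * h) = coef l r *\<^sub>C q ^ (n + (m + r) + (m' + r)) *\<^sub>C (Q ^ r * h)" for r
    proof -
      have "2 * r + l = n + (m + r) + (m' + r)" by (simp add: l)
      then show ?thesis by (simp only: scaleC_scaleC mult.commute)
    qed
  qed
  show "Theta l h (\<delta> e v) = \<omega> e (Theta l h v)" for v
  proof (rule clinear_ket_eqI[OF lin], simp only: E omega_e cpair.linear_scale[OF clinear_Theta] Theta_ket)
    show "qnum q (r + l) *\<^sub>C coef l (r + 1) *\<^sub>C (Q ^ (r + 1) * h) = (q powi (1 - int n)) *\<^sub>C (Q * coef l r *\<^sub>C (Q ^ r * h))" for r
      using coef_Suc[OF l0, of r] by (simp add: scaleC_scaleC scaleC_mult_right mult.assoc mult.commute[of "coef l r"])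
  qed
  show "Theta l h (\<delta> f v) = \<omega> f (Theta l h v)" for v
  proof (rule clinear_ket_eqI[OF lin], simp only: F omega_f cpair.linear_scale[OF clinear_Theta] Theta_ket cpair.linear_scale[OF clinear_Lap])
    fix r
    show "(- qnum q r) *\<^sub>C coef l (r - 1) *\<^sub>C (Q ^ (r - 1) * h) = - (coef l r *\<^sub>C Lap (Q ^ r * h))"
    proof (cases r)
      case 0
      then show ?thesis using h by (simp add: H_iff)
    next
      case (Suc t)
      have "q powi (1 - int n) * q ^ (n - 1) = q powi (1 - int n) * q powi (int (n - 1))" by simp
      also have "\<dots> = q powi (1 - int n + int (n - 1))" using q0 by (intro power_int_add[symmetric]) simp
      also have "\<dots> = 1" using npos by simp
      finally have one: "q powi (1 - int n) * q ^ (n - 1) = 1" .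
      have "coef l (Suc t) * (q ^ (n - 1) * qnum q (Suc t) * qnum q (m + m' + n + t)) =
        (qnum q (t + l) * coef l (Suc t)) * q ^ (n - 1) * qnum q (Suc t)" by (simp add: l mult_ac add_ac)
      also have "\<dots> = coef l t * qnum q (Suc t) * (q powi (1 - int n) * q ^ (n - 1))"
        unfolding coef_Suc[OF l0] by (simp add: mult_ac)
      finally have "coef l (Suc t) * (q ^ (n - 1) * qnum q (Suc t) * qnum q (m + m' + n + t)) = qnum q (Suc t) * coef l t"
        unfolding one by simp
      then show ?thesis unfolding Suc Lap_Q_pow[OF h] by (simp only: scaleC_scaleC) simp
    qed
  qed
qed

end

section \<open>The action of \<open>U\<^sub>q(gl\<^sub>n)\<close>\<close>

text \<open>If \<open>s i = 0\<close> this is no move but raises the total degree; in the formulas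
  for the action the coefficient is then zero, see \<open>ew_0\<close> and its companions.\<close>

definition mv :: "nat \<Rightarrow> nat \<Rightarrow> (nat \<Rightarrow> nat) \<Rightarrow> nat \<Rightarrow> nat" where "mv i j s = inc j (dec i s)"

lemma mv_exps: "s \<in> exps n \<Longrightarrow> j \<in> {1..n} \<Longrightarrow> mv i j s \<in> exps n"
  by (simp add: mv_def exps_inc exps_dec)

lemma tot_mv: "i \<in> {1..n} \<Longrightarrow> j \<in> {1..n} \<Longrightarrow> s i > 0 \<Longrightarrow> tot n (mv i j s) = tot n s"
  using tot_inc[of n i "dec i s"] by (simp add: mv_def tot_inc inc_dec)

text \<open>\<open>T\<close> is a skew derivation sending \<open>x\<^sub>i\<close> to \<open>\<beta> x\<^sub>i\<^sub>+\<^sub>1\<close>, or vice versa; \<open>h\<close> is the square root of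
  \<open>c\<close> by whose powers the group-like elements in the coproduct act.\<close>

locale skew_derivation = q_commuting n c x + generic_q c
  for n c and x :: "nat \<Rightarrow> 'a::complex_algebra_1" +
  fixes h \<beta> :: complex and i :: nat and T :: "'a \<Rightarrow> 'a" and y :: "nat \<Rightarrow> 'a"
  assumes h: "h * h = c" and i: "i \<in> {1..<n}" and T1: "T 1 = 0" and T_lin: "clinear T"
    and T_step: "\<And>j s. j \<in> {1..n} \<Longrightarrow> s \<in> exps n \<Longrightarrow>
      T (x j * monomial n x s) = y j * ((h ^ s i * inverse h ^ s (Suc i)) *\<^sub>C monomial n x s) +
        (if j = i then inverse h else if j = Suc i then h else 1) *\<^sub>C (x j * T (monomial n x s))"
begin

lemma h0: "h \<noteq> 0"
  using h q0 by auto

lemma h_simps [simp]: "h * inverse h = 1" "inverse h * h = 1" "h ^ a * inverse h ^ a = 1"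
  using h0 by (simp_all add: power_mult_distrib[symmetric])

lemma c_pow: "c ^ a = h ^ a * h ^ a" "inverse c ^ a = inverse h ^ a * inverse h ^ a" "inverse c = inverse h * inverse h"
  unfolding h[symmetric] by (simp_all add: power_mult_distrib)

text \<open>A new leftmost factor \<open>x j\<close> interacts only for \<open>j = i\<close>: then
  \<open>T\<close> on the new factor and \<open>T\<close> on the rest yield the same monomial, and
  the coefficients add up by \<open>qnum_Suc'\<close>. If \<open>j > i\<close>, there is no
  \<open>x i\<close> left to be raised.\<close>

lemma raise:
  assumes y: "\<And>j. y j = (if j = i then \<beta> *\<^sub>C x (Suc i) else 0)" and s: "s \<in> exps n"
  shows "T (monomial n x s) = (\<beta> * h ^ s i * inverse h * inverse h ^ s (Suc i) * qnum c (s i)) *\<^sub>C monomial n x (mv i (Suc i) s)"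
  using s
proof (induction rule: exps_induct_min)
  case zero
  show ?case by (simp add: monomial_0 T1)
next
  case (inc j s)
  let ?a = "s i" and ?b = "s (Suc i)"
  have eq: "T (monomial n x (inc j s)) = y j * ((h ^ ?a * inverse h ^ ?b) *\<^sub>C monomial n x s) +
      (if j = i then inverse h else if j = Suc i then h else 1) *\<^sub>C
      (x j * ((\<beta> * h ^ ?a * inverse h * inverse h ^ ?b * qnum c ?a) *\<^sub>C monomial n x (mv i (Suc i) s)))"
    using inc by (simp only: left_mult_min T_step)
  consider "j = i" | "j \<noteq> i" "?a = 0" | "j \<noteq> i" "?a > 0" by blast
  then show ?case
  proof cases
    case 1
    have lo: "lo s (Suc i) = ?a" using inc i 1 by (simp add: lo_Suc) (simp add: lo_def)
    have l: "x (Suc i) * monomial n x s = c ^ ?a *\<^sub>C monomial n x (inc (Suc i) s)"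
      using left_mult[of "Suc i" s] i lo by simp
    have r: "qnum c ?a *\<^sub>C (x i * monomial n x (mv i (Suc i) s)) = qnum c ?a *\<^sub>C monomial n x (inc (Suc i) s)"
    proof (cases "?a = 0")
      case False
      have "x i * monomial n x (mv i (Suc i) s) = monomial n x (inc i (mv i (Suc i) s))"
        using inc i 1 by (intro left_mult_min[symmetric]) (auto simp: mv_def inc_def dec_def)
      also have "inc i (mv i (Suc i) s) = inc (Suc i) s" using False by (simp add: mv_def inc_commute[of i] inc_dec)
      finally show ?thesis by simp
    qed simp
    have mvs: "mv i (Suc i) (inc i s) = inc (Suc i) s" by (simp add: mv_def)
    have "T (monomial n x (inc j s)) = (\<beta> * (h ^ ?a * inverse h ^ ?b) * c ^ ?a) *\<^sub>C monomial n x (inc (Suc i) s) +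
       (inverse h * (\<beta> * h ^ ?a * inverse h * inverse h ^ ?b)) *\<^sub>C (qnum c ?a *\<^sub>C (x i * monomial n x (mv i (Suc i) s)))"
      unfolding eq y using 1 by (simp add: scaleC_mult_left scaleC_mult_right l scaleC_scaleC mult_ac)
    also have "\<dots> = (\<beta> * (h ^ ?a * inverse h ^ ?b) * c ^ ?a + inverse h * (\<beta> * h ^ ?a * inverse h * inverse h ^ ?b) * qnum c ?a)
        *\<^sub>C monomial n x (inc (Suc i) s)"
      unfolding r by (simp add: scaleC_add_left scaleC_scaleC)
    also have "\<beta> * (h ^ ?a * inverse h ^ ?b) * c ^ ?a + inverse h * (\<beta> * h ^ ?a * inverse h * inverse h ^ ?b) * qnum c ?a
       = \<beta> * (h * h ^ ?a) * inverse h * inverse h ^ ?b * qnum c (Suc ?a)"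
      unfolding qnum_Suc' c_pow(3) using h0 by (simp add: field_simps)
    finally show ?thesis using 1 by (simp add: mvs)
  next
    case 2
    then show ?thesis unfolding eq y by simp
  next
    case 3
    then have "j < i" using inc by (metis linorder_neqE_nat less_numeral_extra(3))
    have "x j * monomial n x (mv i (Suc i) s) = monomial n x (inc j (mv i (Suc i) s))"
      using inc \<open>j < i\<close> by (intro left_mult_min[symmetric]) (auto simp: mv_def inc_def dec_def)
    also have "inc j (mv i (Suc i) s) = mv i (Suc i) (inc j s)"
      using \<open>j < i\<close> by (simp add: mv_def dec_inc_commute inc_commute[of j])
    finally have e: "x j * monomial n x (mv i (Suc i) s) = monomial n x (mv i (Suc i) (inc j s))" .
    show ?thesis unfolding eq y scaleC_mult_right e using \<open>j < i\<close> by (simp add: scaleC_one)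
  qed
qed

text \<open>The interesting case is \<open>j = Suc i\<close>, where minimality gives
  \<open>s i = 0\<close>. The second contribution gains a factor \<open>c\<close>, because
  \<open>x (Suc i)\<close> has to pass the newly created \<open>x i\<close>; the coefficients then
  add up by \<open>qnum_Suc\<close>.\<close>

lemma lower:
  assumes y: "\<And>j. y j = (if j = Suc i then \<beta> *\<^sub>C x i else 0)" and s: "s \<in> exps n"
  shows "T (monomial n x s) = (\<beta> * h ^ s (Suc i) * inverse h * inverse h ^ s i * qnum c (s (Suc i))) *\<^sub>C monomial n x (mv (Suc i) i s)"
  using s
proof (induction rule: exps_induct_min)
  case zero
  show ?case by (simp add: monomial_0 T1)
next
  case (inc j s)
  let ?a = "s i" and ?b = "s (Suc i)"
  have eq: "T (monomial n x (inc j s)) = y j * ((h ^ ?a * inverse h ^ ?b) *\<^sub>C monomial n x s) +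
      (if j = i then inverse h else if j = Suc i then h else 1) *\<^sub>C
      (x j * ((\<beta> * h ^ ?b * inverse h * inverse h ^ ?a * qnum c ?b) *\<^sub>C monomial n x (mv (Suc i) i s)))"
    using inc by (simp only: left_mult_min T_step)
  consider "j = Suc i" | "j \<noteq> Suc i" "?b = 0" | "j \<noteq> Suc i" "?b > 0" by blast
  then show ?case
  proof cases
    case 1
    have a0: "?a = 0" using inc 1 by simp
    have lo: "lo s i = 0" using inc i 1 by (simp add: lo_def)
    have l: "x i * monomial n x s = monomial n x (inc i s)"
      using left_mult[of i s] i lo by (simp add: scaleC_one)
    have r: "qnum c ?b *\<^sub>C (x (Suc i) * monomial n x (mv (Suc i) i s)) = (qnum c ?b * c) *\<^sub>C monomial n x (inc i s)"
    proof (cases "?b = 0")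
      case False
      have "lo (mv (Suc i) i s) (Suc i) = Suc 0" using inc i 1 by (simp add: lo_Suc mv_def lo_inc) (simp add: lo_def dec_def)
      then have "x (Suc i) * monomial n x (mv (Suc i) i s) = c *\<^sub>C monomial n x (inc (Suc i) (mv (Suc i) i s))"
        using left_mult[of "Suc i" "mv (Suc i) i s"] i by simp
      also have "inc (Suc i) (mv (Suc i) i s) = inc i s" using False by (simp add: mv_def inc_commute[of "Suc i"] inc_dec)
      finally show ?thesis by (simp add: scaleC_scaleC)
    qed simp
    have mvs: "mv (Suc i) i (inc (Suc i) s) = inc i s" by (simp add: mv_def)
    have "T (monomial n x (inc j s)) = (\<beta> * inverse h ^ ?b) *\<^sub>C monomial n x (inc i s) +
       (h * (\<beta> * h ^ ?b * inverse h)) *\<^sub>C (qnum c ?b *\<^sub>C (x (Suc i) * monomial n x (mv (Suc i) i s)))"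
      unfolding eq y using 1 a0 by (simp add: scaleC_mult_left scaleC_mult_right l scaleC_scaleC mult_ac)
    also have "\<dots> = (\<beta> * inverse h ^ ?b + h * (\<beta> * h ^ ?b * inverse h) * (qnum c ?b * c)) *\<^sub>C monomial n x (inc i s)"
      unfolding r by (simp add: scaleC_add_left scaleC_scaleC)
    also have "\<beta> * inverse h ^ ?b + h * (\<beta> * h ^ ?b * inverse h) * (qnum c ?b * c) = \<beta> * (h * h ^ ?b) * inverse h * qnum c (Suc ?b)"
      unfolding qnum_Suc c_pow(2) using h0 by (simp add: field_simps)
    finally show ?thesis using 1 a0 by (simp add: mvs)
  next
    case 2
    then show ?thesis unfolding eq y by simp
  next
    case 3
    then have "j \<le> i" using inc by (metis linorder_neqE_nat less_numeral_extra(3) not_less_eq_eq not_less)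
    have "x j * monomial n x (mv (Suc i) i s) = monomial n x (inc j (mv (Suc i) i s))"
      using inc \<open>j \<le> i\<close> by (intro left_mult_min[symmetric]) (auto simp: mv_def inc_def dec_def)
    also have "inc j (mv (Suc i) i s) = mv (Suc i) i (inc j s)"
      using \<open>j \<le> i\<close> by (simp add: mv_def dec_inc_commute inc_commute[of j])
    finally have e: "x j * monomial n x (mv (Suc i) i s) = monomial n x (mv (Suc i) i (inc j s))" .
    show ?thesis unfolding eq y scaleC_mult_right e using \<open>j \<le> i\<close> 3 by (auto simp: scaleC_one scaleC_scaleC mult_ac)
  qed
qed

end

locale gl_setting = zw_diff q n z w d db
  for q n and z w :: "nat \<Rightarrow> 'a::complex_algebra_1" and d db +
  fixes qh :: complex and x :: "gl_gen \<Rightarrow> 'g::complex_algebra_1" and L :: "'g \<Rightarrow> 'a \<Rightarrow> 'a"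
  assumes qh: "qh ^ 2 = q" and Ugl: "Uq_gl n q qh x" and gl: "gl_action n q qh z w x L"
begin

lemmas gl_presented = Ugl[unfolded Uq_gl_def]

lemma rep_L: "representation L"
  using gl by (simp add: gl_action_def)

lemmas L_rep = representationD[OF rep_L]
lemmas L_simps = clinear_simps[OF representationD(1)[OF rep_L]]

lemma qh0: "qh \<noteq> 0" using qh q0 by auto

lemma qh_simps: "qh * qh = q" "inverse qh * inverse qh = inverse q" "qh * inverse qh = 1" "inverse qh * qh = 1"
  "qh * (inverse qh * a) = a" "inverse qh * (qh * a) = a" "qh ^ b * inverse qh ^ b = 1" "inverse qh ^ b * qh ^ b = 1"
  using qh qh0 by (auto simp: power2_eq_square power_mult_distrib[symmetric] simp flip: mult.assoc inverse_mult_distrib)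

lemma gl_gensI: "i \<in> {1..n} \<Longrightarrow> GK i \<in> gl_gens n" "i \<in> {1..n} \<Longrightarrow> GKinv i \<in> gl_gens n"
  "i \<in> {1..<n} \<Longrightarrow> GE i \<in> gl_gens n" "i \<in> {1..<n} \<Longrightarrow> GF i \<in> gl_gens n"
  by (auto simp: gl_gens_def)

lemma K_inverse: "i \<in> {1..n} \<Longrightarrow> x (GK i) * x (GKinv i) = 1" "i \<in> {1..n} \<Longrightarrow> x (GKinv i) * x (GK i) = 1"
proof -
  assume i: "i \<in> {1..n}"
  have "gen (GK i) * gen (GKinv i) - 1 \<in> gl_relations n q qh" "gen (GKinv i) * gen (GK i) - 1 \<in> gl_relations n q qh"
    unfolding gl_relations_def using i by blast+
  moreover have "gen (GK i) * gen (GKinv i) - 1 \<in> free_on (gl_gens n)" "gen (GKinv i) * gen (GK i) - 1 \<in> free_on (gl_gens n)"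
    using i by (intro free_on_intros gl_gensI; assumption)+
  ultimately have "free_eval x (gen (GK i) * gen (GKinv i) - 1) = 0" "free_eval x (gen (GKinv i) * gen (GK i) - 1) = 0"
    using presented_relation[OF gl_presented] by blast+
  then show "x (GK i) * x (GKinv i) = 1" "x (GKinv i) * x (GK i) = 1" by simp_all
qed

abbreviation "KK i \<equiv> L (x (GK i))"
abbreviation "KI i \<equiv> L (x (GKinv i))"
abbreviation "EE i \<equiv> L (x (GE i))"
abbreviation "FF i \<equiv> L (x (GF i))"

lemma KI_KK: "i \<in> {1..n} \<Longrightarrow> KI i (KK i p) = p" and KK_KI: "i \<in> {1..n} \<Longrightarrow> KK i (KI i p) = p"
  using L_rep(3)[of "x (GKinv i)" "x (GK i)" p] L_rep(3)[of "x (GK i)" "x (GKinv i)" p] K_inverse[of i]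
  by (simp_all add: L_rep(2))

lemma L_mult: "G \<in> gl_gens n \<Longrightarrow> L (x G) (p * p') = (\<Sum>(X, Y)\<leftarrow>gl_comult x G. L X p * L Y p')"
  and L_one: "G \<in> gl_gens n \<Longrightarrow> L (x G) 1 = gl_counit G *\<^sub>C 1"
  using gl by (simp_all add: gl_action_def)

lemma KK_mult: "i \<in> {1..n} \<Longrightarrow> KK i (p * p') = KK i p * KK i p'"
  and KI_mult: "i \<in> {1..n} \<Longrightarrow> KI i (p * p') = KI i p * KI i p'"
  and EE_mult: "i \<in> {1..<n} \<Longrightarrow> EE i (p * p') = EE i p * KI i (KK (Suc i) p') + KK i (KI (Suc i) p) * EE i p'"
  and FF_mult: "i \<in> {1..<n} \<Longrightarrow> FF i (p * p') = FF i p * KI i (KK (Suc i) p') + KK i (KI (Suc i) p) * FF i p'"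
  using L_mult[of "GK i"] L_mult[of "GKinv i"] L_mult[of "GE i"] L_mult[of "GF i"]
  by (simp_all add: gl_gensI L_rep(3))

lemma KK_z: "i \<in> {1..n} \<Longrightarrow> j \<in> {1..n} \<Longrightarrow> KK i (z j) = (if i = j then qh else 1) *\<^sub>C z j"
  and KK_w: "i \<in> {1..n} \<Longrightarrow> j \<in> {1..n} \<Longrightarrow> KK i (w j) = (if i = j then inverse qh else 1) *\<^sub>C w j"
  using gl unfolding gl_action_def by blast+

lemma EE_z: "i \<in> {1..<n} \<Longrightarrow> j \<in> {1..n} \<Longrightarrow> EE i (z j) = (if j = i + 1 then z (j - 1) else 0)"
  and FF_z: "i \<in> {1..<n} \<Longrightarrow> j \<in> {1..n} \<Longrightarrow> FF i (z j) = (if j = i then z (j + 1) else 0)"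
  and EE_w: "i \<in> {1..<n} \<Longrightarrow> j \<in> {1..n} \<Longrightarrow> EE i (w j) = (if j = i then (- inverse q) *\<^sub>C w (j + 1) else 0)"
  and FF_w: "i \<in> {1..<n} \<Longrightarrow> j \<in> {1..n} \<Longrightarrow> FF i (w j) = (if j = i + 1 then (- q) *\<^sub>C w (j - 1) else 0)"
  using gl unfolding gl_action_def by blast+

lemma KI_eigen: "i \<in> {1..n} \<Longrightarrow> c \<noteq> 0 \<Longrightarrow> KK i p = c *\<^sub>C p \<Longrightarrow> KI i p = inverse c *\<^sub>C p"
proof -
  assume a: "i \<in> {1..n}" "c \<noteq> 0" "KK i p = c *\<^sub>C p"
  have "p = KI i (c *\<^sub>C p)" using KI_KK[OF a(1), of p] a(3) by simp
  then have "inverse c *\<^sub>C p = inverse c *\<^sub>C (c *\<^sub>C KI i p)" by (simp only: L_simps)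
  then show ?thesis using a by (simp add: scaleC_scaleC scaleC_one)
qed

section \<open>The generators on monomials\<close>

lemma KK_zm: "i \<in> {1..n} \<Longrightarrow> r \<in> exps n \<Longrightarrow> KK i (monomial n z r) = (qh ^ r i) *\<^sub>C monomial n z r"
proof -
  assume i: "i \<in> {1..n}"
  show "KK i (monomial n z r) = (qh ^ r i) *\<^sub>C monomial n z r" if "r \<in> exps n"
    using that
  proof (induction rule: exps_induct_min)
    case zero
    show ?case using L_one[OF gl_gensI(1)[OF i]] by (simp add: monomial_0 scaleC_one)
  next
    case (inc j r)
    then show ?case using i
      by (simp add: zq.left_mult_min KK_mult KK_z vec_simps)
  qed
qed

lemma KK_wm: "i \<in> {1..n} \<Longrightarrow> s \<in> exps n \<Longrightarrow> KK i (monomial n w s) = (inverse qh ^ s i) *\<^sub>C monomial n w s"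
proof -
  assume i: "i \<in> {1..n}"
  show "KK i (monomial n w s) = (inverse qh ^ s i) *\<^sub>C monomial n w s" if "s \<in> exps n"
    using that
  proof (induction rule: exps_induct_min)
    case zero
    show ?case using L_one[OF gl_gensI(1)[OF i]] by (simp add: monomial_0 scaleC_one)
  next
    case (inc j s)
    then show ?case using i
      by (simp add: wq.left_mult_min KK_mult KK_w vec_simps)
  qed
qed

lemma KI_zm: "i \<in> {1..n} \<Longrightarrow> r \<in> exps n \<Longrightarrow> KI i (monomial n z r) = (inverse qh ^ r i) *\<^sub>C monomial n z r"
  and KI_wm: "i \<in> {1..n} \<Longrightarrow> s \<in> exps n \<Longrightarrow> KI i (monomial n w s) = (qh ^ s i) *\<^sub>C monomial n w s"
  and KI_z: "i \<in> {1..n} \<Longrightarrow> j \<in> {1..n} \<Longrightarrow> KI i (z j) = (if i = j then inverse qh else 1) *\<^sub>C z j"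
  and KI_w: "i \<in> {1..n} \<Longrightarrow> j \<in> {1..n} \<Longrightarrow> KI i (w j) = (if i = j then qh else 1) *\<^sub>C w j"
  using KI_eigen[OF _ _ KK_zm, of i r] KI_eigen[OF _ _ KK_wm, of i s] KI_eigen[OF _ _ KK_z, of i j] KI_eigen[OF _ _ KK_w, of i j] qh0
  by (simp_all add: power_inverse)

lemma KK_M: "i \<in> {1..n} \<Longrightarrow> s \<in> exps n \<Longrightarrow> r \<in> exps n \<Longrightarrow> KK i (M s r) = (inverse qh ^ s i * qh ^ r i) *\<^sub>C M s r"
  and KI_M: "i \<in> {1..n} \<Longrightarrow> s \<in> exps n \<Longrightarrow> r \<in> exps n \<Longrightarrow> KI i (M s r) = (qh ^ s i * inverse qh ^ r i) *\<^sub>C M s r"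
  by (simp_all add: M_def KK_mult KI_mult KK_zm KK_wm KI_zm KI_wm vec_simps mult.commute)

lemma EE_wm:
  assumes "i \<in> {1..<n}" "s \<in> exps n"
  shows "EE i (monomial n w s) = (- inverse q * qh ^ s i * inverse qh * inverse qh ^ s (Suc i) * qnum q (s i)) *\<^sub>C monomial n w (mv i (Suc i) s)"
proof -
  interpret skew_derivation n q w qh "- inverse q" i "EE i" "\<lambda>j. if j = i then (- inverse q) *\<^sub>C w (Suc i) else 0"
    using assms(1) L_one[of "GE i"] qh
    by unfold_locales
      (auto simp: qh_simps gl_gensI L_rep(1) EE_mult EE_w KK_w KI_w KK_wm KI_wm L_simps vec_simps mult.commute)
  show ?thesis by (rule raise) (use assms in auto)
qed

lemma FF_wm:
  assumes "i \<in> {1..<n}" "s \<in> exps n"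
  shows "FF i (monomial n w s) = (- q * qh ^ s (Suc i) * inverse qh * inverse qh ^ s i * qnum q (s (Suc i))) *\<^sub>C monomial n w (mv (Suc i) i s)"
proof -
  interpret skew_derivation n q w qh "- q" i "FF i" "\<lambda>j. if j = Suc i then (- q) *\<^sub>C w i else 0"
    using assms(1) L_one[of "GF i"] qh
    by unfold_locales
      (auto simp: qh_simps gl_gensI L_rep(1) FF_mult FF_w KK_w KI_w KK_wm KI_wm L_simps vec_simps mult.commute)
  show ?thesis by (rule lower) (use assms in auto)
qed

lemma EE_zm:
  assumes "i \<in> {1..<n}" "r \<in> exps n"
  shows "EE i (monomial n z r) = (qh ^ r i * qh * inverse qh ^ r (Suc i) * qnum q (r (Suc i))) *\<^sub>C monomial n z (mv (Suc i) i r)"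
proof -
  interpret generic_q "inverse q" by (rule generic_inverse)
  \<comment> \<open>For the \<open>z\<close> the constant is \<open>inverse q\<close> with root
    \<open>inverse qh\<close>, and \<open>e_i\<close> lowers the index. The factor 1 is written out
    to match the shape \<open>\<beta> *\<^sub>C x i\<close> that \<open>lower\<close> asks
    for.\<close>
  interpret skew_derivation n "inverse q" z "inverse qh" 1 i "EE i" "\<lambda>j. if j = Suc i then 1 *\<^sub>C z i else 0"
    using assms(1) L_one[of "GE i"] qh
    by unfold_locales
      (auto simp: qh_simps gl_gensI L_rep(1) EE_mult EE_z KK_z KI_z KK_zm KI_zm L_simps vec_simps mult.commute)
  show ?thesis using lower[OF refl assms(2)] by (simp add: qnum_inverse mult_ac)
qed

lemma FF_zm:
  assumes "i \<in> {1..<n}" "r \<in> exps n"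
  shows "FF i (monomial n z r) = (inverse qh ^ r i * qh * qh ^ r (Suc i) * qnum q (r i)) *\<^sub>C monomial n z (mv i (Suc i) r)"
proof -
  interpret generic_q "inverse q" by (rule generic_inverse)
  interpret skew_derivation n "inverse q" z "inverse qh" 1 i "FF i" "\<lambda>j. if j = i then 1 *\<^sub>C z (Suc i) else 0"
    using assms(1) L_one[of "GF i"] qh
    by unfold_locales
      (auto simp: qh_simps gl_gensI L_rep(1) FF_mult FF_z KK_z KI_z KK_zm KI_zm L_simps vec_simps mult.commute)
  show ?thesis using raise[OF refl assms(2)] by (simp add: qnum_inverse mult_ac)
qed

text \<open>The coefficients of \<open>e_i\<close> and \<open>f_i\<close> on \<open>M s r\<close>,
  one for each term of the coproduct: in \<open>ew\<close> and \<open>fw\<close> the generator acts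
  on the \<open>w\<close> and the \<open>z\<close> contribute their weight, in \<open>ez\<close> and
  \<open>fz\<close> the roles are exchanged.\<close>

definition "ew i s r = - inverse q * qh ^ s i * inverse qh * inverse qh ^ s (Suc i) * qnum q (s i) * (inverse qh ^ r i * qh ^ r (Suc i))"
definition "ez i s r = inverse qh ^ s i * qh ^ s (Suc i) * (qh ^ r i * qh * inverse qh ^ r (Suc i) * qnum q (r (Suc i)))"
definition "fw i s r = - q * qh ^ s (Suc i) * inverse qh * inverse qh ^ s i * qnum q (s (Suc i)) * (inverse qh ^ r i * qh ^ r (Suc i))"
definition "fz i s r = inverse qh ^ s i * qh ^ s (Suc i) * (inverse qh ^ r i * qh * qh ^ r (Suc i) * qnum q (r i))"

lemma EE_M: "i \<in> {1..<n} \<Longrightarrow> s \<in> exps n \<Longrightarrow> r \<in> exps n \<Longrightarrow>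
    EE i (M s r) = ew i s r *\<^sub>C M (mv i (Suc i) s) r + ez i s r *\<^sub>C M s (mv (Suc i) i r)"
  and FF_M: "i \<in> {1..<n} \<Longrightarrow> s \<in> exps n \<Longrightarrow> r \<in> exps n \<Longrightarrow>
    FF i (M s r) = fw i s r *\<^sub>C M (mv (Suc i) i s) r + fz i s r *\<^sub>C M s (mv i (Suc i) r)"
  unfolding M_def
  by (simp_all add: EE_mult FF_mult EE_wm EE_zm FF_wm FF_zm KK_zm KK_wm KI_zm KI_wm L_simps scaleC_mult_left scaleC_mult_right scaleC_scaleC
      ew_def ez_def fw_def fz_def mult_ac)

end

context gl_setting
begin

lemma Suc_mem: "i \<in> {1..<n} \<Longrightarrow> i \<in> {1..n}" "i \<in> {1..<n} \<Longrightarrow> Suc i \<in> {1..n}"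
  by auto

lemma qh_q: "qh * inverse q = inverse qh" "inverse q * qh = inverse qh" "q * inverse qh = qh" "inverse qh * q = qh"
  using qh0 by (simp_all only: qh[symmetric] power2_eq_square inverse_mult_distrib) (simp_all add: mult.assoc)

lemma ew_0: "s i = 0 \<Longrightarrow> ew i s r = 0" and ez_0: "r (Suc i) = 0 \<Longrightarrow> ez i s r = 0"
  and fw_0: "s (Suc i) = 0 \<Longrightarrow> fw i s r = 0" and fz_0: "r i = 0 \<Longrightarrow> fz i s r = 0"
  by (simp_all add: ew_def ez_def fw_def fz_def)

lemma M_mv_A:
  assumes "s \<in> exps n" "tot n r = m" "tot n s = m'" "i \<in> {1..n}" "j \<in> {1..n}"
  shows "c = 0 \<or> s i > 0 \<Longrightarrow> c *\<^sub>C M (mv i j s) r \<in> A m m'"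
    and "c = 0 \<or> r i > 0 \<Longrightarrow> c *\<^sub>C M s (mv i j r) \<in> A m m'"
  using M_A[of "mv i j s" r] M_A[of s "mv i j r"] tot_mv[of i n j s] tot_mv[of i n j r] mv_exps[of s n j i] assms
  by (auto simp: cvec.subspace_0 cvec.subspace_scale)

lemma L_gen_A:
  assumes "G \<in> gl_gens n" "p \<in> A m m'"
  shows "L (x G) p \<in> A m m'"
  using assms(2)
proof (induction rule: A_induct)
  case (mono s r)
  consider (K) i where "i \<in> {1..n}" "G = GK i \<or> G = GKinv i" | (E) i where "i \<in> {1..<n}" "G = GE i \<or> G = GF i"
    using assms(1) by (auto simp: gl_gens_def)
  then show ?case
  proof cases
    case K
    then show ?thesis using mono M_A[of s r] by (auto simp: KK_M KI_M cvec.subspace_scale)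
  next
    case E
    have "ew i s r *\<^sub>C M (mv i (Suc i) s) r \<in> A m m'" "fw i s r *\<^sub>C M (mv (Suc i) i s) r \<in> A m m'"
      "ez i s r *\<^sub>C M s (mv (Suc i) i r) \<in> A m m'" "fz i s r *\<^sub>C M s (mv i (Suc i) r) \<in> A m m'"
      using mono E(1) ew_0[of s i r] ez_0[of r i s] fw_0[of s i r] fz_0[of r i s]
      by (intro M_mv_A; auto)+
    then show ?thesis using mono E by (auto simp: EE_M FF_M cvec.subspace_add)
  qed
qed (simp_all add: L_simps cvec.subspace_0 cvec.subspace_add cvec.subspace_scale)

text \<open>\<open>Q\<close> is invariant: the \<open>K\<close> fix each \<open>z j * w j\<close>,
  while under \<open>e_i\<close> and \<open>f_i\<close> only the summands \<open>i\<close> and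
  \<open>Suc i\<close> give nonzero terms, which cancel. The coproduct then hands the generator on
  to \<open>p\<close>.\<close>

lemma L_gen_Q:
  assumes "G \<in> gl_gens n"
  shows "L (x G) (Q * p) = Q * L (x G) p"
proof -
  have K: "KK i (z j * w j) = z j * w j" if "i \<in> {1..n}" "j \<in> {1..n}" for i j
    using that by (simp add: KK_mult KK_z KK_w scaleC_mult_left scaleC_mult_right scaleC_scaleC scaleC_one qh_simps)
  have KQ: "KK i Q = Q" if "i \<in> {1..n}" for i
    unfolding Q_elem_def L_simps by (rule sum.cong) (use K that in auto)
  have KIQ: "KI i Q = Q" if "i \<in> {1..n}" for i using KI_KK[OF that, of Q] KQ[OF that] by simp
  have two: "sum f {1..n} = f i + f (Suc i) + sum f ({1..n} - {i} - {Suc i})" if "i \<in> {1..<n}" for i and f :: "nat \<Rightarrow> 'a"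
    using that by (subst sum.remove[of _ i], simp, simp, subst sum.remove[of _ "Suc i"]) (auto simp: add.assoc)
  have EQ: "EE i Q = 0" if i: "i \<in> {1..<n}" for i
  proof -
    have "EE i (z j * w j) = 0" if "j \<in> {1..n} - {i} - {Suc i}" for j
      using i that by (auto simp: EE_mult EE_z EE_w)
    moreover have "EE i (z i * w i) + EE i (z (Suc i) * w (Suc i)) = 0"
      using i by (simp add: EE_mult EE_z EE_w KK_z KK_w KI_z KI_w L_simps scaleC_mult_left scaleC_mult_right scaleC_scaleC qh_q qh_simps)
    ultimately show ?thesis unfolding Q_elem_def L_simps two[OF i] by simp
  qed
  have FQ: "FF i Q = 0" if i: "i \<in> {1..<n}" for i
  proof -
    have "FF i (z j * w j) = 0" if "j \<in> {1..n} - {i} - {Suc i}" for j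
      using i that by (auto simp: FF_mult FF_z FF_w)
    moreover have "FF i (z i * w i) + FF i (z (Suc i) * w (Suc i)) = 0"
      using i by (simp add: FF_mult FF_z FF_w KK_z KK_w KI_z KI_w L_simps scaleC_mult_left scaleC_mult_right scaleC_scaleC qh_q qh_simps)
    ultimately show ?thesis unfolding Q_elem_def L_simps two[OF i] by simp
  qed
  show ?thesis using assms
    by (auto simp: gl_gens_def KK_mult KI_mult EE_mult FF_mult KQ KIQ EQ FQ)
qed

lemma L_Q: "L X (Q * p) = Q * L X p"
  using intertwiner_on_generators[OF gl_presented rep_L rep_L clinear_mult_left, of Q X p] L_gen_Q by auto

lemma L_Q_pow: "L X (Q ^ j * p) = Q ^ j * L X p"
  by (induction j) (simp_all add: L_Q mult.assoc)

subsection \<open>Contravariance of the form\<close>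

text \<open>The values on generators of the anti-involution for which the form is
  contravariant.\<close>

fun tau :: "gl_gen \<Rightarrow> gl_gen" where
  "tau (GK i) = GK i" | "tau (GKinv i) = GKinv i" | "tau (GE i) = GF i" | "tau (GF i) = GE i"

lemma tau_gens: "G \<in> gl_gens n \<Longrightarrow> tau G \<in> gl_gens n"
  by (auto simp: gl_gens_def)

lemma Bf_M_right: "s \<in> exps n \<Longrightarrow> r \<in> exps n \<Longrightarrow> tot n r = m \<Longrightarrow> tot n s = m' \<Longrightarrow> Bf m m' p (M s r) = N s r * cf s r p"
  by (simp add: Bf_sym[of m m' p] Bf_M)

text \<open>The factor \<open>q ^ (2 * i)\<close> in \<open>Nw\<close> is made for this: its ratio
  \<open>q^2\<close> between neighbouring indices compensates the constants
  \<open>- inverse q\<close> and \<open>- q\<close> with which \<open>e_i\<close> and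
  \<open>f_i\<close> act on the \<open>w\<close>. If one of the two moves is impossible, both sides
  vanish.\<close>

lemma adj_w:
  assumes "i \<in> {1..<n}" "\<sigma> \<in> exps n" "s \<in> exps n"
  shows "N s r * (ew i \<sigma> r * (if mv i (Suc i) \<sigma> = s then 1 else 0)) = N \<sigma> r * (fw i s r * (if mv (Suc i) i s = \<sigma> then 1 else 0))"
proof (cases "\<sigma> i > 0 \<and> mv i (Suc i) \<sigma> = s")
  case True
  define \<tau> where "\<tau> = dec i \<sigma>"
  have \<sigma>: "\<sigma> = inc i \<tau>" and s: "s = inc (Suc i) \<tau>" using True by (auto simp: \<tau>_def mv_def inc_dec)
  have e: "mv i (Suc i) \<sigma> = s" "mv (Suc i) i s = \<sigma>" by (simp_all add: \<sigma> s mv_def)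
  have N: "N s r = N \<tau> r * (qnum q (Suc (\<tau> (Suc i))) * q ^ \<tau> (Suc i) * q ^ (2 * Suc i))"
    "N \<sigma> r = N \<tau> r * (qnum q (Suc (\<tau> i)) * q ^ \<tau> i * q ^ (2 * i))"
    unfolding s \<sigma> using assms(1) by (simp_all only: N_inc_w Suc_mem)
  have p: "q ^ a = qh ^ a * qh ^ a" for a by (simp only: qh[symmetric] power2_eq_square power_mult_distrib)
  have ring: "(qb * (B * B) * (q * q)) * (inverse q * (qh * A) * h' * B' * qa * R) = (qa * (A * A)) * (q * (qh * B) * h' * A' * qb * R)"
    if "A * A' = 1" "B * B' = 1" for A A' B B' h' qa qb R :: complex
  proof -
    have "(qb * (B * B) * (q * q)) * (inverse q * (qh * A) * h' * B' * qa * R) = (q * (q * inverse q)) * (B * (B * B')) * (qb * (qh * A) * h' * qa * R)"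
      by (simp only: mult_ac)
    moreover have "(qa * (A * A)) * (q * (qh * B) * h' * A' * qb * R) = (q * B * (A * (A * A'))) * (qb * qh * h' * qa * R)"
      by (simp only: mult_ac)
    ultimately show ?thesis using that by (simp add: mult_ac)
  qed
  have "(qnum q (Suc (\<tau> (Suc i))) * (qh ^ \<tau> (Suc i) * qh ^ \<tau> (Suc i)) * (q * q)) *
     (inverse q * (qh * qh ^ \<tau> i) * inverse qh * inverse qh ^ \<tau> (Suc i) * qnum q (Suc (\<tau> i)) * (inverse qh ^ r i * qh ^ r (Suc i))) =
     (qnum q (Suc (\<tau> i)) * (qh ^ \<tau> i * qh ^ \<tau> i)) *
     (q * (qh * qh ^ \<tau> (Suc i)) * inverse qh * inverse qh ^ \<tau> i * qnum q (Suc (\<tau> (Suc i))) * (inverse qh ^ r i * qh ^ r (Suc i)))"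
    by (rule ring) (simp_all add: qh_simps)
  then have "N \<tau> r * (qnum q (Suc (\<tau> (Suc i))) * q ^ \<tau> (Suc i) * q ^ (2 * Suc i)) * ew i \<sigma> r =
      N \<tau> r * (qnum q (Suc (\<tau> i)) * q ^ \<tau> i * q ^ (2 * i)) * fw i s r"
    unfolding ew_def fw_def \<sigma> s by (simp add: p[of "\<tau> i"] p[of "\<tau> (Suc i)"] mult_ac qh_simps)
  then show ?thesis unfolding e N by simp
next
  case False
  have "ew i \<sigma> r * (if mv i (Suc i) \<sigma> = s then 1 else 0) = 0" using False ew_0[of \<sigma> i r] by auto
  moreover have "fw i s r * (if mv (Suc i) i s = \<sigma> then 1 else 0) = 0"
  proof (cases "s (Suc i) > 0 \<and> mv (Suc i) i s = \<sigma>")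
    case True
    then have "\<sigma> = inc i (dec (Suc i) s)" "s (Suc i) > 0" by (auto simp: mv_def)
    then have "\<sigma> i > 0 \<and> mv i (Suc i) \<sigma> = s" by (simp add: mv_def inc_dec)
    with False show ?thesis by simp
  next
    case False
    then show ?thesis using fw_0[of s i r] by auto
  qed
  ultimately show ?thesis by (simp only: mult_zero_right)
qed

lemma adj_z:
  assumes "i \<in> {1..<n}" "\<rho> \<in> exps n" "r \<in> exps n"
  shows "N s r * (ez i s \<rho> * (if mv (Suc i) i \<rho> = r then 1 else 0)) = N s \<rho> * (fz i s r * (if mv i (Suc i) r = \<rho> then 1 else 0))"
proof (cases "\<rho> (Suc i) > 0 \<and> mv (Suc i) i \<rho> = r")
  case True
  define \<tau> where "\<tau> = dec (Suc i) \<rho>"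
  have \<rho>: "\<rho> = inc (Suc i) \<tau>" and r: "r = inc i \<tau>" using True by (auto simp: \<tau>_def mv_def inc_dec)
  have e: "mv (Suc i) i \<rho> = r" "mv i (Suc i) r = \<rho>" by (simp_all add: \<rho> r mv_def)
  have N: "N s r = N s \<tau> * (qnum q (Suc (\<tau> i)) * inverse q ^ \<tau> i)"
    "N s \<rho> = N s \<tau> * (qnum q (Suc (\<tau> (Suc i))) * inverse q ^ \<tau> (Suc i))"
    unfolding r \<rho> using assms(1) by (simp_all only: N_inc_z Suc_mem)
  have p: "inverse q ^ a = inverse qh ^ a * inverse qh ^ a" for a
    by (simp only: qh[symmetric] power2_eq_square power_mult_distrib inverse_mult_distrib)
  have ring: "(qa * (A' * A')) * (A * h * (h' * B') * qb * R) = (qb * (B' * B')) * ((h' * A') * h * B * qa * R)"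
    if "A * A' = 1" "B * B' = 1" for A A' B B' h h' qa qb R :: complex
    using that by algebra
  have "(qnum q (Suc (\<tau> i)) * (inverse qh ^ \<tau> i * inverse qh ^ \<tau> i)) *
     (qh ^ \<tau> i * qh * (inverse qh * inverse qh ^ \<tau> (Suc i)) * qnum q (Suc (\<tau> (Suc i))) * (inverse qh ^ s i * qh ^ s (Suc i))) =
     (qnum q (Suc (\<tau> (Suc i))) * (inverse qh ^ \<tau> (Suc i) * inverse qh ^ \<tau> (Suc i))) *
     ((inverse qh * inverse qh ^ \<tau> i) * qh * qh ^ \<tau> (Suc i) * qnum q (Suc (\<tau> i)) * (inverse qh ^ s i * qh ^ s (Suc i)))"
    by (rule ring) (simp_all add: qh_simps)
  then have "N s \<tau> * (qnum q (Suc (\<tau> i)) * inverse q ^ \<tau> i) * ez i s \<rho> =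
      N s \<tau> * (qnum q (Suc (\<tau> (Suc i))) * inverse q ^ \<tau> (Suc i)) * fz i s r"
    unfolding ez_def fz_def \<rho> r by (simp only: p[of "\<tau> i"] p[of "\<tau> (Suc i)"]) (simp add: mult_ac qh_simps)
  then show ?thesis unfolding e N by simp
next
  case False
  have "ez i s \<rho> * (if mv (Suc i) i \<rho> = r then 1 else 0) = 0" using False ez_0[of \<rho> i s] by auto
  moreover have "fz i s r * (if mv i (Suc i) r = \<rho> then 1 else 0) = 0"
  proof (cases "r i > 0 \<and> mv i (Suc i) r = \<rho>")
    case True
    then have "\<rho> = inc (Suc i) (dec i r)" "r i > 0" by (auto simp: mv_def)
    then have "\<rho> (Suc i) > 0 \<and> mv (Suc i) i \<rho> = r" by (simp add: mv_def inc_dec)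
    with False show ?thesis by simp
  next
    case False
    then show ?thesis using fz_0[of r i s] by auto
  qed
  ultimately show ?thesis by (simp only: mult_zero_right)
qed

lemma Bf_EF:
  assumes "i \<in> {1..<n}" "p \<in> A m m'" "p' \<in> A m m'"
  shows "Bf m m' (EE i p) p' = Bf m m' p (FF i p')"
proof (rule bilinear_eqI[where f = "\<lambda>p p'. Bf m m' (EE i p) p'" and g = "\<lambda>p p'. Bf m m' p (FF i p')", OF _ _ _ _ _ assms(2,3)])
  show "clinear (\<lambda>p. Bf m m' (EE i p) p')" for p' by (rule clinear_compose[OF clinear_Bf_left L_rep(1)])
  show "clinear (Bf m m' (EE i p))" for p by (rule clinear_Bf_right)
  show "clinear (\<lambda>p. Bf m m' p (FF i p'))" for p' by (rule clinear_Bf_left)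
  show "clinear (\<lambda>p'. Bf m m' p (FF i p'))" for p by (rule clinear_compose[OF clinear_Bf_right L_rep(1)])
  fix \<sigma> \<rho> s r
  assume a: "\<sigma> \<in> exps n" "\<rho> \<in> exps n" "tot n \<rho> = m" "tot n \<sigma> = m'" "s \<in> exps n" "r \<in> exps n" "tot n r = m" "tot n s = m'"
  note i = assms(1) Suc_mem[OF assms(1)]
  have L: "Bf m m' (EE i (M \<sigma> \<rho>)) (M s r) =
      N s r * (ew i \<sigma> \<rho> * (if mv i (Suc i) \<sigma> = s \<and> \<rho> = r then 1 else 0) + ez i \<sigma> \<rho> * (if \<sigma> = s \<and> mv (Suc i) i \<rho> = r then 1 else 0))"
    using a i by (simp only: Bf_M_right EE_M cf_simps cf_M mv_exps scaleC_complex_def)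
  have R: "Bf m m' (M \<sigma> \<rho>) (FF i (M s r)) =
      N \<sigma> \<rho> * (fw i s r * (if mv (Suc i) i s = \<sigma> \<and> r = \<rho> then 1 else 0) + fz i s r * (if s = \<sigma> \<and> mv i (Suc i) r = \<rho> then 1 else 0))"
    using a i by (simp only: Bf_M FF_M cf_simps cf_M mv_exps scaleC_complex_def)
  \<comment> \<open>A move never fixes the exponents, so the diagonal entries vanish and at most one
    of the two terms contributes to any entry.\<close>
  have mvne: "mv i (Suc i) t \<noteq> t" "mv (Suc i) i t \<noteq> t" for t :: "nat \<Rightarrow> nat"
  proof -
    have "mv i (Suc i) t (Suc i) = Suc (t (Suc i))" "mv (Suc i) i t i = Suc (t i)" by (simp_all add: mv_def)
    then show "mv i (Suc i) t \<noteq> t" "mv (Suc i) i t \<noteq> t" by (metis n_not_Suc_n)+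
  qed
  consider "\<rho> = r" "\<sigma> \<noteq> s" | "\<sigma> = s" "\<rho> \<noteq> r" | "\<rho> = r" "\<sigma> = s" | "\<rho> \<noteq> r" "\<sigma> \<noteq> s" by blast
  then show "Bf m m' (EE i (M \<sigma> \<rho>)) (M s r) = Bf m m' (M \<sigma> \<rho>) (FF i (M s r))"
  proof cases
    case 1
    then show ?thesis unfolding L R using adj_w[OF i(1) a(1,5), of r] by auto
  next
    case 2
    then show ?thesis unfolding L R using adj_z[OF i(1) a(2,6), of s] by auto
  next
    case 3
    then show ?thesis unfolding L R using mvne by simp
  next
    case 4
    then show ?thesis unfolding L R by simp
  qed
qed

lemma Bf_K:
  assumes "i \<in> {1..n}" "p \<in> A m m'" "p' \<in> A m m'"
  shows "Bf m m' (KK i p) p' = Bf m m' p (KK i p')" and "Bf m m' (KI i p) p' = Bf m m' p (KI i p')"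
proof -
  show "Bf m m' (KK i p) p' = Bf m m' p (KK i p')"
  proof (rule bilinear_eqI[where f = "\<lambda>p p'. Bf m m' (KK i p) p'" and g = "\<lambda>p p'. Bf m m' p (KK i p')", OF _ _ _ _ _ assms(2,3)])
    fix \<sigma> \<rho> s r
    assume a: "\<sigma> \<in> exps n" "\<rho> \<in> exps n" "tot n \<rho> = m" "tot n \<sigma> = m'" "s \<in> exps n" "r \<in> exps n" "tot n r = m" "tot n s = m'"
    show "Bf m m' (KK i (M \<sigma> \<rho>)) (M s r) = Bf m m' (M \<sigma> \<rho>) (KK i (M s r))"
      using a assms(1) by (auto simp: KK_M clinear_simps[OF clinear_Bf_left] clinear_simps[OF clinear_Bf_right] Bf_MM)
  qed (rule clinear_compose[OF clinear_Bf_left L_rep(1)] clinear_Bf_right clinear_Bf_left clinear_compose[OF clinear_Bf_right L_rep(1)])+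
  show "Bf m m' (KI i p) p' = Bf m m' p (KI i p')"
  proof (rule bilinear_eqI[where f = "\<lambda>p p'. Bf m m' (KI i p) p'" and g = "\<lambda>p p'. Bf m m' p (KI i p')", OF _ _ _ _ _ assms(2,3)])
    fix \<sigma> \<rho> s r
    assume a: "\<sigma> \<in> exps n" "\<rho> \<in> exps n" "tot n \<rho> = m" "tot n \<sigma> = m'" "s \<in> exps n" "r \<in> exps n" "tot n r = m" "tot n s = m'"
    show "Bf m m' (KI i (M \<sigma> \<rho>)) (M s r) = Bf m m' (M \<sigma> \<rho>) (KI i (M s r))"
      using a assms(1) by (auto simp: KI_M clinear_simps[OF clinear_Bf_left] clinear_simps[OF clinear_Bf_right] Bf_MM)
  qed (rule clinear_compose[OF clinear_Bf_left L_rep(1)] clinear_Bf_right clinear_Bf_left clinear_compose[OF clinear_Bf_right L_rep(1)])+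
qed

lemma Bf_contravariant:
  assumes "G \<in> gl_gens n" "p \<in> A m m'" "p' \<in> A m m'"
  shows "Bf m m' (L (x G) p) p' = Bf m m' p (L (x (tau G)) p')"
proof -
  have "Bf m m' (FF i p) p' = Bf m m' p (EE i p')" if "i \<in> {1..<n}" for i
    using Bf_EF[OF that assms(3,2)] by (metis Bf_sym)
  with assms Bf_EF Bf_K show ?thesis unfolding gl_gens_def by fastforce
qed

text \<open>By nondegeneracy: \<open>Lap\<close> is, up to scalars, adjoint to multiplication by the invariant \<open>Q\<close>.\<close>

lemma L_gen_Lap:
  assumes G: "G \<in> gl_gens n"
  shows "L (x G) (Lap p) = Lap (L (x G) p)"
proof (induction p rule: all_homog_induct)
  case (1 a b)
  then show ?case by (simp add: cpair.linear_add[OF clinear_Lap] L_simps)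
next
  case (2 m m' p)
  show ?case
  proof (cases "m = 0 \<or> m' = 0")
    case True
    then show ?thesis using Lap_A0[OF 2] Lap_A0[OF L_gen_A[OF G 2]] by (simp add: L_simps)
  next
    case False
    then obtain i j where ij: "m = Suc i" "m' = Suc j" by (metis not0_implies_Suc)
    have pA: "p \<in> A (Suc i) (Suc j)" using 2 ij by simp
    let ?c = "q ^ (2 * n + j) * inverse q ^ i"
    have c0: "?c \<noteq> 0" using q0 by simp
    have "L (x G) (Lap p) - Lap (L (x G) p) = 0"
    proof (rule Bf_nondegenerate)
      show "L (x G) (Lap p) - Lap (L (x G) p) \<in> A i j"
        by (intro cvec.subspace_diff[OF subspace_A] L_gen_A[OF G] Lap_A pA)
      fix s r assume sr: "s \<in> exps n" "r \<in> exps n" "tot n r = i" "tot n s = j"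
      then have MA: "M s r \<in> A i j" using M_A[of s r] by simp
      have tG: "tau G \<in> gl_gens n" "tau (tau G) = G" using G by (auto simp: gl_gens_def)
      have "?c * Bf i j (M s r) (L (x G) (Lap p)) = ?c * Bf i j (L (x (tau G)) (M s r)) (Lap p)"
        using Bf_contravariant[OF tG(1) MA Lap_A[OF pA]] tG(2) by simp
      also have "\<dots> = Bf (Suc i) (Suc j) (Q * L (x (tau G)) (M s r)) p"
        by (rule Bf_Q[symmetric, OF L_gen_A[OF tG(1) MA] pA])
      also have "\<dots> = Bf (Suc i) (Suc j) (L (x (tau G)) (Q * M s r)) p"
        by (simp only: L_gen_Q[OF tG(1)])
      also have "\<dots> = Bf (Suc i) (Suc j) (Q * M s r) (L (x G) p)"
        using Bf_contravariant[OF tG(1) Q_A[OF MA] pA] tG(2) by simp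
      also have "\<dots> = ?c * Bf i j (M s r) (Lap (L (x G) p))"
        by (rule Bf_Q[OF MA L_gen_A[OF G pA]])
      finally have "Bf i j (M s r) (L (x G) (Lap p)) = Bf i j (M s r) (Lap (L (x G) p))"
        unfolding mult_left_cancel[OF c0] .
      then show "Bf i j (M s r) (L (x G) (Lap p) - Lap (L (x G) p)) = 0"
        by (simp add: clinear_simps[OF clinear_Bf_right])
    qed
    then show ?thesis by simp
  qed
qed

lemma L_Lap: "L X (Lap p) = Lap (L X p)"
  using intertwiner_on_generators[OF gl_presented rep_L rep_L clinear_Lap, of X p] L_gen_Lap by simp

lemma subrep_A: "subrep L (A m m')"
  by (rule invariant_on_generators[OF gl_presented rep_L subspace_A]) (rule L_gen_A)

lemma subrep_H: "subrep L (H m m')"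
  unfolding subrep_def using subrep_A[of m m'] by (auto simp: H_iff L_Lap[symmetric] L_simps subrep_def)

end

text \<open>A dimension count. \<open>T\<close> sends \<open>h\<close> to a combination of the basis
  \<open>B\<close> of \<open>V'\<close> with the pairings as coefficients. It cannot be injective on
  the span of \<open>B\<close> and a further vector \<open>h0\<close> of \<open>V\<close>, and a
  nonzero vector in its kernel is orthogonal to \<open>V'\<close>.\<close>

lemma orthogonal_vector:
  fixes V V' :: "'v::complex_vector set" and b :: "'v \<Rightarrow> 'v \<Rightarrow> complex"
  assumes fin: "finite S" "V \<subseteq> cvec.span S" and sub: "cvec.subspace V" "cvec.subspace V'" "V' \<subseteq> V" "V' \<noteq> V"
    and left: "\<And>y. clinear (\<lambda>x. b x y)" and right: "\<And>x. clinear (b x)"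
  obtains h where "h \<in> V" "h \<noteq> 0" "\<And>v. v \<in> V' \<Longrightarrow> b v h = 0"
proof -
  obtain B where B: "B \<subseteq> V'" "cvec.independent B" "V' \<subseteq> cvec.span B"
    using cvec.maximal_independent_subset[of V'] by blast
  have spanB: "cvec.span B = V'" using B sub(2) by (meson antisym cvec.span_minimal)
  have "B \<subseteq> cvec.span S" using B(1) sub(3) fin(2) by blast
  with cvec.independent_span_bound[OF fin(1) B(2)] have finB: "finite B" by blast
  obtain h0 where h0: "h0 \<in> V" "h0 \<notin> V'" using sub by blast
  define T where "T h = (\<Sum>u\<in>B. b u h *\<^sub>C u)" for h
  have linT: "clinear T" unfolding T_def
    by (intro cpair.linear_compose_sum ballI clinear_compose[OF clinear_scale_left right])
  have "\<exists>h\<in>V. h \<noteq> 0 \<and> T h = 0"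
  proof (rule ccontr)
    assume neg: "\<not> ?thesis"
    have "cvec.span (insert h0 B) \<subseteq> V"
      using sub h0 B(1) by (intro cvec.span_minimal) auto
    with neg have ker: "\<forall>u\<in>cvec.span (insert h0 B). T u = 0 \<longrightarrow> u = 0" by blast
    have inj: "inj_on T (cvec.span (insert h0 B))"
    proof (rule inj_onI)
      fix u v assume "u \<in> cvec.span (insert h0 B)" "v \<in> cvec.span (insert h0 B)" "T u = T v"
      then have "u - v \<in> cvec.span (insert h0 B)" "T (u - v) = 0" by (simp_all add: cvec.span_diff cpair.linear_diff[OF linT])
      with ker show "u = v" by (metis eq_iff_diff_eq_0)
    qed
    have ind: "cvec.independent (insert h0 B)"
      using h0(2) B(2) spanB by (simp add: cvec.independent_insertI)
    have "cvec.independent (T ` insert h0 B)"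
      by (rule cpair.linear_independent_injective_image[OF linT ind inj])
    moreover have "T ` insert h0 B \<subseteq> cvec.span B"
      unfolding T_def by (auto intro!: cvec.span_sum cvec.span_scale intro: cvec.span_base)
    ultimately have "card (T ` insert h0 B) \<le> card B" using cvec.independent_span_bound[OF finB] by blast
    moreover have "card (T ` insert h0 B) = card (insert h0 B)"
      by (rule card_image) (rule inj_on_subset[OF inj], auto intro: cvec.span_base)
    moreover have "h0 \<notin> B" using h0(2) B(1) by blast
    ultimately show False using finB by simp
  qed
  then obtain h where h: "h \<in> V" "h \<noteq> 0" "T h = 0" by blast
  have "\<forall>u. (\<Sum>v\<in>B. u v *\<^sub>C v) = 0 \<longrightarrow> (\<forall>v\<in>B. u v = 0)"
    using B(2) finB cvec.independent_explicit_finite_subsets[of B] by blast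
  from this[rule_format, of "\<lambda>u. b u h"] have "b u h = 0" if "u \<in> B" for u
    using h(3) that by (simp add: T_def)
  then have "b v h = 0" if "v \<in> V'" for v
    using cpair.linear_eq_on[OF left cpair.linear_zero, of v B h] that spanB by simp
  with h that show ?thesis by blast
qed

context gl_setting
begin

section \<open>Highest weight vectors\<close>

lemma cf_off: "p \<in> A m m' \<Longrightarrow> s \<in> exps n \<Longrightarrow> r \<in> exps n \<Longrightarrow> tot n r \<noteq> m \<or> tot n s \<noteq> m' \<Longrightarrow> cf s r p = 0"
proof (induction rule: A_induct)
  case (mono s' r')
  then have "\<not> (s' = s \<and> r' = r)" by auto
  with mono show ?case by (simp add: cf_M)
qed (simp_all add: cf_simps scaleC_complex_def)

definition s0 :: "nat \<Rightarrow> nat \<Rightarrow> nat" where "s0 m' = (\<lambda>i. if i = n then m' else 0)"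
definition r0 :: "nat \<Rightarrow> nat \<Rightarrow> nat" where "r0 m = (\<lambda>i. if i = 1 then m else 0)"
definition v0 :: "nat \<Rightarrow> nat \<Rightarrow> 'a" where "v0 m m' = M (s0 m') (r0 m)"

lemma s0_exps: "s0 m' \<in> exps n" and r0_exps: "r0 m \<in> exps n"
  using npos by (auto simp: s0_def r0_def exps_def)

lemma tot_s0: "tot n (s0 m') = m'" and tot_r0: "tot n (r0 m) = m"
  using npos by (simp_all add: tot_def s0_def r0_def)

lemma v0_A: "v0 m m' \<in> A m m'"
  using M_A[OF s0_exps, of m' "r0 m"] by (simp add: v0_def tot_s0 tot_r0)

lemma v0_nonzero: "v0 m m' \<noteq> 0"
  using cf_M[OF s0_exps r0_exps s0_exps r0_exps, of m' m] cf_simps(3)[OF s0_exps r0_exps] by (metis v0_def zero_neq_one)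

lemma Lap_v0:
  assumes "\<not> (n = 1 \<and> m > 0 \<and> m' > 0)"
  shows "Lap (v0 m m') = 0"
  unfolding v0_def Lap_M[OF s0_exps r0_exps]
proof (rule sum.neutral, rule ballI)
  fix k assume "k \<in> {1..n}"
  then have "s0 m' k = 0 \<or> r0 m k = 0" using assms by (auto simp: s0_def r0_def)
  then show "(q ^ hi n (r0 m) k * inverse q ^ lo (s0 m') k * qnum q (s0 m' k) * qnum q (r0 m k)) *\<^sub>C
      M (dec k (s0 m')) (dec k (r0 m)) = 0" by auto
qed

lemma v0_H: "\<not> (n = 1 \<and> m > 0 \<and> m' > 0) \<Longrightarrow> v0 m m' \<in> H m m'"
  by (simp add: H_iff v0_A Lap_v0)

lemma EE_v0: "i \<in> {1..<n} \<Longrightarrow> EE i (v0 m m') = 0"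
proof -
  assume i: "i \<in> {1..<n}"
  then have "ew i (s0 m') (r0 m) = 0" "ez i (s0 m') (r0 m) = 0"
    using ew_0[of "s0 m'" i] ez_0[of "r0 m" i] by (auto simp: s0_def r0_def)
  then show ?thesis by (simp only: v0_def EE_M[OF i s0_exps r0_exps] cvec.scale_zero_left add_0)
qed

lemma KK_v0: "i \<in> {1..n} \<Longrightarrow> KK i (v0 m m') = ((if i = n then inverse qh ^ m' else 1) * (if i = 1 then qh ^ m else 1)) *\<^sub>C v0 m m'"
  using KK_M[OF _ s0_exps r0_exps, of i m' m] by (simp add: v0_def s0_def r0_def)

text \<open>For a harmonic highest weight vector \<open>p\<close>, pairing with \<open>GF i\<close> applied to monomials gives
  two-term recursions for the rescaled coordinates \<open>b\<close>, and pairing with multiples of \<open>Q\<close> a linear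
  relation. The recursions kill all coordinates except those on one chain of monomials, where they
  determine \<open>b\<close> up to a scalar \<open>c\<close>; the linear relation then telescopes to \<open>c [N] = 0\<close> with
  \<open>N > 0\<close>.\<close>

context
  fixes p :: 'a and m m' :: nat
  assumes pH: "p \<in> H m m'" and hw: "\<And>i. i \<in> {1..<n} \<Longrightarrow> EE i p = 0"
begin

private lemma pA: "p \<in> A m m'" and pL: "Lap p = 0"
  using pH by (simp_all add: H_iff)

text \<open>On the bidegree of \<open>p\<close> this is the pairing of \<open>M s r\<close> with
  \<open>p\<close>, elsewhere it is zero; so the relations below hold for all exponents.\<close>

private definition b where "b s r = N s r * cf s r p"

private lemma b_off: "s \<in> exps n \<Longrightarrow> r \<in> exps n \<Longrightarrow> tot n r \<noteq> m \<or> tot n s \<noteq> m' \<Longrightarrow> b s r = 0"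
  using cf_off[OF pA] by (simp add: b_def)

text \<open>The coefficients \<open>fw\<close> and \<open>fz\<close> share a nonzero factor, which
  is cancelled; the minus sign in the action of \<open>f_i\<close> on the \<open>w\<close> makes the
  relation an equality of two terms.\<close>

private lemma rel_E:
  assumes i: "i \<in> {1..<n}" and sr: "s \<in> exps n" "r \<in> exps n"
  shows "qnum q (s (Suc i)) * b (mv (Suc i) i s) r = qnum q (r i) * b s (mv i (Suc i) r)"
proof (cases "tot n r = m \<and> tot n s = m'")
  case True
  note j = Suc_mem[OF i]
  have MA: "M s r \<in> A m m'" using M_A[OF sr(1), of r] True by simp
  have 1: "fw i s r * Bf m m' (M (mv (Suc i) i s) r) p = fw i s r * b (mv (Suc i) i s) r"
  proof (cases "s (Suc i) = 0")
    case False
    then show ?thesis using Bf_M[OF mv_exps[OF sr(1) j(1), of "Suc i"] sr(2), of m m' p] tot_mv[OF j(2,1), of s] True by (simp add: b_def)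
  qed (simp add: fw_0)
  have 2: "fz i s r * Bf m m' (M s (mv i (Suc i) r)) p = fz i s r * b s (mv i (Suc i) r)"
  proof (cases "r i = 0")
    case False
    then show ?thesis using Bf_M[OF sr(1) mv_exps[OF sr(2) j(2), of i], of m m' p] tot_mv[OF j, of r] True by (simp add: b_def)
  qed (simp add: fz_0)
  have "0 = Bf m m' (M s r) (EE i p)" by (simp add: hw[OF i] cpair.linear_0[OF clinear_Bf_right])
  also have "\<dots> = Bf m m' (FF i (M s r)) p" by (metis Bf_EF[OF i pA MA] Bf_sym)
  also have "\<dots> = fw i s r * b (mv (Suc i) i s) r + fz i s r * b s (mv i (Suc i) r)"
    by (simp only: FF_M[OF i sr] cpair.linear_add[OF clinear_Bf_left] cpair.linear_scale[OF clinear_Bf_left] scaleC_complex_def 1 2)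
  also have "\<dots> = (qh * (inverse qh ^ s i * qh ^ s (Suc i)) * (inverse qh ^ r i * qh ^ r (Suc i))) *
     (qnum q (r i) * b s (mv i (Suc i) r) - qnum q (s (Suc i)) * b (mv (Suc i) i s) r)"
  proof -
    have q: "fw i s r = - ((q * inverse qh) * (inverse qh ^ s i * qh ^ s (Suc i)) * (inverse qh ^ r i * qh ^ r (Suc i)) * qnum q (s (Suc i)))"
      by (simp add: fw_def mult_ac)
    show ?thesis unfolding q qh_q fz_def by (simp add: right_diff_distrib mult_ac)
  qed
  finally have "qnum q (r i) * b s (mv i (Suc i) r) - qnum q (s (Suc i)) * b (mv (Suc i) i s) r = 0"
    using qh0 by simp
  then show ?thesis by simp
next
  case False
  note j = Suc_mem[OF i]
  have "qnum q (s (Suc i)) * b (mv (Suc i) i s) r = 0"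
    using False tot_mv[OF j(2,1), of s] b_off[OF mv_exps[OF sr(1) j(1), of "Suc i"] sr(2)] by (cases "s (Suc i) = 0") auto
  moreover have "qnum q (r i) * b s (mv i (Suc i) r) = 0"
    using False tot_mv[OF j, of r] b_off[OF sr(1) mv_exps[OF sr(2) j(2), of i]] by (cases "r i = 0") auto
  ultimately show ?thesis by (rule trans[OF _ sym])
qed

text \<open>\<open>rel_E\<close> at \<open>inc (Suc i) \<sigma>\<close> and
  \<open>inc i \<rho>\<close>: a common pair of factors of index \<open>i\<close> is shifted to
  index \<open>Suc i\<close> at the cost of a nonzero ratio.\<close>

private lemma rel_shift:
  assumes i: "i \<in> {1..<n}" and sr: "\<sigma> \<in> exps n" "\<rho> \<in> exps n"
  shows "qnum q (Suc (\<sigma> (Suc i))) * b (inc i \<sigma>) (inc i \<rho>) = qnum q (Suc (\<rho> i)) * b (inc (Suc i) \<sigma>) (inc (Suc i) \<rho>)"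
  using rel_E[OF i exps_inc[OF sr(1) Suc_mem(2)[OF i]] exps_inc[OF sr(2) Suc_mem(1)[OF i]]] by (simp add: mv_def)

text \<open>\<open>rel_shift\<close> moves common factors from \<open>Suc i\<close> down to
  \<open>i\<close>, which keeps the excess of \<open>r\<close> over \<open>s\<close> at
  \<open>Suc i\<close>, until \<open>s (Suc i) = 0\<close>. There one side of \<open>rel_E\<close>
  is zero and the other a nonzero multiple of \<open>b s r\<close>.\<close>

private lemma zero_above:
  "s \<in> exps n \<Longrightarrow> r \<in> exps n \<Longrightarrow> i \<in> {1..<n} \<Longrightarrow> r (Suc i) > s (Suc i) \<Longrightarrow> b s r = 0"
proof (induction "s (Suc i)" arbitrary: s r)
  case 0
  have r: "inc (Suc i) (dec (Suc i) r) = r" using 0 by (simp add: inc_dec)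
  have "qnum q (s (Suc i)) * b (mv (Suc i) i s) (inc i (dec (Suc i) r)) = qnum q (Suc (dec (Suc i) r i)) * b s r"
    using rel_E[OF 0(4) 0(2) exps_inc[OF exps_dec[OF 0(3)] Suc_mem(1)[OF 0(4)]], of "Suc i"] r by (simp add: mv_def)
  then show ?case using 0(1) by (simp add: qnum_eq_0_iff)
next
  case (Suc t)
  define \<sigma> where "\<sigma> = dec (Suc i) s"
  define \<rho> where "\<rho> = dec (Suc i) r"
  have sr: "s = inc (Suc i) \<sigma>" "r = inc (Suc i) \<rho>"
    using Suc by (auto simp: \<sigma>_def \<rho>_def inc_dec)
  have ex: "\<sigma> \<in> exps n" "\<rho> \<in> exps n" using Suc by (simp_all add: \<sigma>_def \<rho>_def exps_dec)
  have "b (inc i \<sigma>) (inc i \<rho>) = 0"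
    using Suc(2,5,6) ex Suc_mem(1)[OF Suc(5)] unfolding sr by (intro Suc(1)) (auto simp: exps_inc)
  then show ?case using rel_shift[OF Suc(5) ex] unfolding sr by (simp add: qnum_eq_0_iff)
qed

text \<open>The mirror image: common factors move from \<open>i\<close> up to \<open>Suc i\<close>
  until \<open>r i = 0\<close>.\<close>

private lemma zero_below:
  "s \<in> exps n \<Longrightarrow> r \<in> exps n \<Longrightarrow> i \<in> {1..<n} \<Longrightarrow> s i > r i \<Longrightarrow> b s r = 0"
proof (induction "r i" arbitrary: s r)
  case 0
  have s: "inc i (dec i s) = s" using 0 by (simp add: inc_dec)
  have "qnum q (Suc (dec i s (Suc i))) * b s r = qnum q (r i) * b (inc (Suc i) (dec i s)) (mv i (Suc i) r)"
    using rel_E[OF 0(4) exps_inc[OF exps_dec[OF 0(2)] Suc_mem(2)[OF 0(4)]] 0(3), of i] s by (simp add: mv_def)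
  then show ?case using 0(1) by (simp add: qnum_eq_0_iff)
next
  case (Suc t)
  define \<sigma> where "\<sigma> = dec i s"
  define \<rho> where "\<rho> = dec i r"
  have sr: "s = inc i \<sigma>" "r = inc i \<rho>"
    using Suc by (auto simp: \<sigma>_def \<rho>_def inc_dec)
  have ex: "\<sigma> \<in> exps n" "\<rho> \<in> exps n" using Suc by (simp_all add: \<sigma>_def \<rho>_def exps_dec)
  have "b (inc (Suc i) \<sigma>) (inc (Suc i) \<rho>) = 0"
    using Suc(2,5,6) ex Suc_mem(2)[OF Suc(5)] unfolding sr by (intro Suc(1)) (auto simp: exps_inc)
  then show ?case using rel_shift[OF Suc(5) ex] unfolding sr by (simp add: qnum_eq_0_iff)
qed

text \<open>\<open>p\<close> is orthogonal to all multiples of \<open>Q\<close>, because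
  \<open>Bf_Q\<close> carries \<open>Q\<close> over to \<open>Lap p = 0\<close>.\<close>

private lemma rel_Q:
  assumes "\<sigma> \<in> exps n" "\<rho> \<in> exps n"
  shows "(\<Sum>i=1..n. q ^ (2 * (n - i)) * q ^ hi n \<sigma> i * inverse q ^ lo \<rho> i * b (inc i \<sigma>) (inc i \<rho>)) = 0"
proof (cases "Suc (tot n \<rho>) = m \<and> Suc (tot n \<sigma>) = m'")
  case True
  have pA': "p \<in> A (Suc (tot n \<rho>)) (Suc (tot n \<sigma>))" using pA True by simp
  have "0 = Bf m m' (Q * M \<sigma> \<rho>) p"
    using Bf_Q[OF M_A[OF assms(1), of \<rho>] pA'] True by (simp add: pL cpair.linear_0[OF clinear_Bf_right])
  also have "\<dots> = (\<Sum>i=1..n. q ^ (2 * (n - i)) * q ^ hi n \<sigma> i * inverse q ^ lo \<rho> i * Bf m m' (M (inc i \<sigma>) (inc i \<rho>)) p)"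
    unfolding Q_M by (simp add: cpair.linear_sum[OF clinear_Bf_left] cpair.linear_scale[OF clinear_Bf_left] scaleC_complex_def)
  also have "\<dots> = (\<Sum>i=1..n. q ^ (2 * (n - i)) * q ^ hi n \<sigma> i * inverse q ^ lo \<rho> i * b (inc i \<sigma>) (inc i \<rho>))"
    by (rule sum.cong) (use assms True in \<open>simp_all add: Bf_M exps_inc tot_inc b_def\<close>)
  finally show ?thesis by simp
next
  case False
  show ?thesis by (rule sum.neutral) (use False assms in \<open>auto simp: b_off exps_inc tot_inc\<close>)
qed

private lemma zero_common:
  assumes ex: "\<sigma> \<in> exps n" "\<rho> \<in> exps n" and i: "i \<in> {1..n}"
  shows "b (inc i \<sigma>) (inc i \<rho>) = 0"
proof (cases "(\<exists>j\<in>{1..<n}. \<rho> (Suc j) > \<sigma> (Suc j)) \<or> (\<exists>j\<in>{1..<n}. \<sigma> j > \<rho> j)")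
  case True
  then show ?thesis
  proof
    assume "\<exists>j\<in>{1..<n}. \<rho> (Suc j) > \<sigma> (Suc j)"
    then obtain j where j: "j \<in> {1..<n}" "\<rho> (Suc j) > \<sigma> (Suc j)" by blast
    show ?thesis by (rule zero_above[OF exps_inc[OF ex(1) i] exps_inc[OF ex(2) i] j(1)]) (use j in \<open>auto simp: inc_def\<close>)
  next
    assume "\<exists>j\<in>{1..<n}. \<sigma> j > \<rho> j"
    then obtain j where j: "j \<in> {1..<n}" "\<sigma> j > \<rho> j" by blast
    show ?thesis by (rule zero_below[OF exps_inc[OF ex(1) i] exps_inc[OF ex(2) i] j(1)]) (use j in \<open>auto simp: inc_def\<close>)
  qed
next
  case False
  then have le: "\<rho> (Suc j) \<le> \<sigma> (Suc j)" "\<sigma> j \<le> \<rho> j" if "j \<in> {1..<n}" for j using that by (auto simp: not_less)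
  \<comment> \<open>An interior index is subject to both inequalities, once as a successor and once
    directly; the indices \<open>1\<close> and \<open>n\<close> to at most one each.\<close>
  have interior: "\<rho> j = \<sigma> j" if "1 < j" "j < n" for j
  proof -
    have "j - 1 \<in> {1..<n}" "Suc (j - 1) = j" "j \<in> {1..<n}" using that by auto
    then show ?thesis using le(1)[of "j - 1"] le(2)[of j] by simp
  qed
  \<comment> \<open>Chosen so that \<open>rel_shift\<close> says that
    \<open>b (inc j \<sigma>) (inc j \<rho>) / qnum q (u j)\<close> does not depend on
    \<open>j\<close>. Since \<rho> and \<sigma> agree inside, \<open>lo u\<close> and
    \<open>hi u\<close> also produce the powers of \<open>q\<close> in \<open>rel_Q\<close>.\<close>
  define u where "u j = Suc (if j = 1 then \<rho> j else \<sigma> j)" for j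
  define c where "c = b (inc 1 \<sigma>) (inc 1 \<rho>) / qnum q (u 1)"
  have bu: "b (inc j \<sigma>) (inc j \<rho>) = c * qnum q (u j)" if "1 \<le> j" "j \<le> n" for j
    using that
  proof (induction j rule: nat_induct_at_least)
    case base
    show ?case by (simp add: c_def qnum_eq_0_iff u_def)
  next
    case (Suc j)
    have uj: "u j = Suc (\<rho> j)" "u (Suc j) = Suc (\<sigma> (Suc j))"
      using Suc interior[of j] by (auto simp: u_def)
    have "j \<in> {1..<n}" using Suc by auto
    then have "qnum q (u j) * b (inc (Suc j) \<sigma>) (inc (Suc j) \<rho>) = qnum q (u (Suc j)) * b (inc j \<sigma>) (inc j \<rho>)"
      using rel_shift[OF _ ex] by (simp only: uj)
    also have "b (inc j \<sigma>) (inc j \<rho>) = c * qnum q (u j)" using Suc by simp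
    also have "qnum q (u (Suc j)) * (c * qnum q (u j)) = qnum q (u j) * (c * qnum q (u (Suc j)))" by (simp only: mult_ac)
    finally have "qnum q (u j) * b (inc (Suc j) \<sigma>) (inc (Suc j) \<rho>) = qnum q (u j) * (c * qnum q (u (Suc j)))" .
    moreover have "qnum q (u j) \<noteq> 0" by (simp add: qnum_eq_0_iff u_def)
    ultimately show ?case by simp
  qed
  have lo_u: "lo u j = lo \<rho> j + (j - 1)" if "j \<in> {1..n}" for j
  proof -
    have "lo u j = (\<Sum>a\<in>{1..<j}. \<rho> a + 1)"
      unfolding lo_def by (rule sum.cong) (use that interior in \<open>auto simp: u_def\<close>)
    then show ?thesis by (simp only: sum.distrib lo_def) simp
  qed
  have hi_u: "hi n u j = hi n \<sigma> j + (n - j)" if "j \<in> {1..n}" for j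
  proof -
    have "hi n u j = (\<Sum>a\<in>{j<..n}. \<sigma> a + 1)"
      unfolding hi_def by (rule sum.cong) (use that in \<open>auto simp: u_def\<close>)
    then show ?thesis by (simp only: sum.distrib hi_def) simp
  qed
  have "0 = (\<Sum>i=1..n. (q ^ (n - 1) * c) * (q ^ hi n u i * inverse q ^ lo u i * qnum q (u i)))"
    unfolding rel_Q[OF ex, symmetric]
  proof (rule sum.cong)
    fix j assume j: "j \<in> {1..n}"
    have e1: "q ^ (2 * (n - j)) = q ^ (n - j) * q ^ (n - j)" by (simp add: mult_2 power_add)
    have e2: "q ^ (n - 1) = q ^ (n - j) * q ^ (j - 1)" using j by (simp add: power_add[symmetric])
    have e3: "q ^ hi n u j = q ^ hi n \<sigma> j * q ^ (n - j)" "inverse q ^ lo u j = inverse q ^ lo \<rho> j * inverse q ^ (j - 1)"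
      by (simp_all only: lo_u[OF j] hi_u[OF j] power_add)
    have e4: "b (inc j \<sigma>) (inc j \<rho>) = c * qnum q (u j)" using bu j by simp
    have ring: "a * a * S * R * (c * U) = (a * J * c) * ((S * a) * (R * J') * U)" if "J * J' = 1" for a J J' S R U :: complex
      using that by algebra
    show "q ^ (2 * (n - j)) * q ^ hi n \<sigma> j * inverse q ^ lo \<rho> j * b (inc j \<sigma>) (inc j \<rho>) =
        (q ^ (n - 1) * c) * (q ^ hi n u j * inverse q ^ lo u j * qnum q (u j))"
      unfolding e1 e2 e3 e4 by (rule ring) simp
  qed simp
  also have "\<dots> = (q ^ (n - 1) * c) * qnum q (tot n u)"
    using qnum_telescope[where n = n and r = u] by (simp add: sum_distrib_left[symmetric])
  finally have "c * qnum q (tot n u) = 0" using q0 by simp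
  moreover have "tot n u > 0" using tot_split[OF i, of u] by (simp add: u_def)
  ultimately have "c = 0" by (simp add: qnum_eq_0_iff)
  then show ?thesis using bu[of i] i by simp
qed

private lemma zero_both:
  assumes "s \<in> exps n" "r \<in> exps n" "s i > 0" "r i > 0"
  shows "b s r = 0"
proof -
  have i: "i \<in> {1..n}" using assms by (auto simp: exps_def)
  show ?thesis using zero_common[OF exps_dec[OF assms(1)] exps_dec[OF assms(2)] i, of i i] assms by (simp add: inc_dec)
qed

text \<open>By \<open>zero_both\<close> the exponents have disjoint supports. An index carrying only
  a \<open>z\<close> is then ruled out by \<open>zero_above\<close> unless it is \<open>1\<close>,
  one carrying only a \<open>w\<close> by \<open>zero_below\<close> unless it is \<open>n\<close>;
  for \<open>n = 1\<close> these ends coincide.\<close>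

lemma highest_weight_coordinates:
  assumes "s \<in> exps n" "r \<in> exps n" "cf s r p \<noteq> 0"
  shows "s = s0 m' \<and> r = r0 m \<and> \<not> (n = 1 \<and> m > 0 \<and> m' > 0)"
proof -
  have b: "b s r \<noteq> 0" using assms N_nonzero by (simp add: b_def)
  have disj: "s i = 0 \<or> r i = 0" for i using zero_both[OF assms(1,2)] b by blast
  have r0: "r j = 0" if "j \<noteq> 1" for j
  proof (rule ccontr)
    assume "r j \<noteq> 0"
    then have "j \<in> {1..n}" using assms(2) by (auto simp: exps_def)
    then have "j - 1 \<in> {1..<n}" "Suc (j - 1) = j" using that by auto
    then show False using zero_above[OF assms(1,2), of "j - 1"] disj[of j] \<open>r j \<noteq> 0\<close> b by auto
  qed
  have s0: "s j = 0" if "j \<noteq> n" for j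
  proof (rule ccontr)
    assume "s j \<noteq> 0"
    then have "j \<in> {1..n}" using assms(1) by (auto simp: exps_def)
    then have "j \<in> {1..<n}" using that by auto
    then show False using zero_below[OF assms(1,2), of j] disj[of j] \<open>s j \<noteq> 0\<close> b by auto
  qed
  have t: "tot n r = m" "tot n s = m'" using b b_off[OF assms(1,2)] by auto
  have "tot n r = r 1" "tot n s = s n"
    using npos r0 s0 sum.remove[of "{1..n}" 1 r] sum.remove[of "{1..n}" n s] by (auto simp: tot_def)
  then have "r 1 = m" "s n = m'" using t by simp_all
  then show ?thesis using r0 s0 disj[of 1] by (auto simp: s0_def r0_def fun_eq_iff)
qed

lemma highest_weight_unique:
  "p = cf (s0 m') (r0 m) p *\<^sub>C v0 m m'" "n = 1 \<Longrightarrow> m > 0 \<Longrightarrow> m' > 0 \<Longrightarrow> p = 0"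
proof -
  have "p - cf (s0 m') (r0 m) p *\<^sub>C v0 m m' = 0"
  proof (rule coords_zero)
    fix s r assume sr: "s \<in> exps n" "r \<in> exps n"
    show "cf s r (p - cf (s0 m') (r0 m) p *\<^sub>C v0 m m') = 0"
      using highest_weight_coordinates[OF sr] sr
      by (cases "s0 m' = s \<and> r0 m = r") (auto simp: cf_simps v0_def cf_M s0_exps r0_exps scaleC_complex_def)
  qed
  then show "p = cf (s0 m') (r0 m) p *\<^sub>C v0 m m'" by simp
  show "p = 0" if "n = 1" "m > 0" "m' > 0"
    by (rule coords_zero) (use highest_weight_coordinates that in blast)
qed

end

text \<open>The two effects of \<open>e_i\<close>, moving a \<open>w\<close> from \<open>i\<close>
  to \<open>Suc i\<close> and a \<open>z\<close> from \<open>Suc i\<close> to \<open>i\<close>, each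
  lower this number by exactly one, so repeated application of the \<open>e_i\<close> must end in
  zero.\<close>

definition wt :: "(nat \<Rightarrow> nat) \<Rightarrow> (nat \<Rightarrow> nat) \<Rightarrow> nat" where
  "wt s r = (\<Sum>i=1..n. (n - i) * s i) + (\<Sum>i=1..n. i * r i)"

lemma wsum_inc: "j \<in> {1..n} \<Longrightarrow> (\<Sum>i=1..n. f i * inc j s i) = (\<Sum>i=1..n. f i * s i) + (f j :: nat)"
proof -
  assume j: "j \<in> {1..n}"
  have "(\<Sum>i=1..n. f i * inc j s i) = (\<Sum>i=1..n. f i * s i + (if i = j then f i else 0))"
    by (rule sum.cong) (auto simp: inc_def)
  then show ?thesis using j by (simp add: sum.distrib)
qed

lemma wt_mv:
  assumes "i \<in> {1..<n}"
  shows "s i > 0 \<Longrightarrow> wt s r = Suc (wt (mv i (Suc i) s) r)" and "r (Suc i) > 0 \<Longrightarrow> wt s r = Suc (wt s (mv (Suc i) i r))"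
proof -
  note j = Suc_mem[OF assms]
  assume "s i > 0"
  then have "wt s r = wt (inc i (dec i s)) r" by (simp add: inc_dec)
  then show "wt s r = Suc (wt (mv i (Suc i) s) r)"
    unfolding wt_def mv_def wsum_inc[OF j(1)] wsum_inc[OF j(2)] using assms by auto
next
  note j = Suc_mem[OF assms]
  assume "r (Suc i) > 0"
  then have "wt s r = wt s (inc (Suc i) (dec (Suc i) r))" by (simp add: inc_dec)
  then show "wt s r = Suc (wt s (mv (Suc i) i r))"
    unfolding wt_def mv_def wsum_inc[OF j(1)] wsum_inc[OF j(2)] by simp
qed

definition Wt :: "nat \<Rightarrow> 'a set" where
  "Wt K = cvec.span {M s r |s r. s \<in> exps n \<and> r \<in> exps n \<and> wt s r < K}"

lemma EE_Wt:
  assumes "i \<in> {1..<n}" "p \<in> Wt (Suc K)"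
  shows "EE i p \<in> Wt K"
proof -
  have sub: "cvec.subspace (Wt K)" by (simp add: Wt_def cvec.subspace_span)
  have base: "M s r \<in> Wt K" if "s \<in> exps n" "r \<in> exps n" "wt s r < K" for s r
    unfolding Wt_def using that by (intro cvec.span_base) blast
  show ?thesis using assms(2) unfolding Wt_def[of "Suc K"]
  proof (rule clinear_span_into[OF L_rep(1) _ sub, rotated])
    fix y assume "y \<in> {M s r |s r. s \<in> exps n \<and> r \<in> exps n \<and> wt s r < Suc K}"
    then obtain s r where y: "y = M s r" "s \<in> exps n" "r \<in> exps n" "wt s r < Suc K" by blast
    have "ew i s r *\<^sub>C M (mv i (Suc i) s) r \<in> Wt K"
      using y wt_mv(1)[OF assms(1), of s r] base[of "mv i (Suc i) s" r] assms(1) ew_0[of s i r] sub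
      by (cases "s i = 0") (auto simp: cvec.subspace_0 cvec.subspace_scale mv_exps)
    moreover have "ez i s r *\<^sub>C M s (mv (Suc i) i r) \<in> Wt K"
      using y wt_mv(2)[OF assms(1), of r s] base[of s "mv (Suc i) i r"] assms(1) ez_0[of r i s] sub
      by (cases "r (Suc i) = 0") (auto simp: cvec.subspace_0 cvec.subspace_scale mv_exps)
    ultimately show "EE i y \<in> Wt K" using y assms(1) sub by (simp add: EE_M cvec.subspace_add)
  qed
qed

lemma highest_weight_exists:
  assumes "subrep L V" "V \<subseteq> A m m'" "V \<noteq> {0}"
  obtains v where "v \<in> V" "v \<noteq> 0" "\<And>i. i \<in> {1..<n} \<Longrightarrow> EE i v = 0"
proof -
  have "\<exists>v\<in>V. v \<noteq> 0 \<and> (\<forall>i\<in>{1..<n}. EE i v = 0)" if "p \<in> V" "p \<noteq> 0" "p \<in> Wt K" for p K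
    using that
  proof (induction K arbitrary: p)
    case 0
    then show ?case by (simp add: Wt_def)
  next
    case (Suc K)
    show ?case
    proof (cases "\<forall>i\<in>{1..<n}. EE i p = 0")
      case True
      then show ?thesis using Suc by blast
    next
      case False
      then obtain i where "i \<in> {1..<n}" "EE i p \<noteq> 0" by blast
      then show ?thesis using Suc EE_Wt[of i p K] assms(1) by (auto simp: subrep_def)
    qed
  qed
  moreover obtain p where p: "p \<in> V" "p \<noteq> 0" using assms(1,3) cvec.subspace_0 by (auto simp: subrep_def)
  moreover have "\<exists>K. p \<in> Wt K"
  proof -
    define K where "K = Suc (Max (insert 0 ((\<lambda>(s, r). wt s r) ` Ix m m')))"
    have "M s r \<in> Wt K" if "(s, r) \<in> Ix m m'" for s r
    proof -
      have "wt s r \<le> Max (insert 0 ((\<lambda>(s, r). wt s r) ` Ix m m'))" using that by (intro Max_ge) (auto simp: image_iff)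
      then have "wt s r < K" by (simp only: K_def less_Suc_eq_le)
      then show ?thesis using that unfolding Wt_def
        by (intro cvec.span_base CollectI exI[of _ s] exI[of _ r]) (auto simp: Ix_def)
    qed
    moreover have "p \<in> A m m'" using p(1) assms(2) by blast
    ultimately have "(\<Sum>(s, r)\<in>Ix m m'. cf s r p *\<^sub>C M s r) \<in> Wt K"
      unfolding Wt_def by (intro cvec.span_sum) (auto intro: cvec.span_scale)
    then show ?thesis using expand[OF \<open>p \<in> A m m'\<close>] by metis
  qed
  ultimately show ?thesis using that by blast
qed

lemma v0_in_subrep:
  assumes "subrep L V" "V \<subseteq> H m m'" "V \<noteq> {0}"
  shows "v0 m m' \<in> V"
proof -
  have "V \<subseteq> A m m'" using assms(2) by (auto simp: H_iff)
  from highest_weight_exists[OF assms(1) this assms(3)] obtain v where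
    v: "v \<in> V" "v \<noteq> 0" "\<And>i. i \<in> {1..<n} \<Longrightarrow> EE i v = 0" by blast
  have eq: "v = cf (s0 m') (r0 m) v *\<^sub>C v0 m m'"
    by (rule highest_weight_unique(1)) (use v assms in auto)
  define c where "c = cf (s0 m') (r0 m) v"
  have c: "v = c *\<^sub>C v0 m m'" "c \<noteq> 0" using eq v(2) by (auto simp: c_def)
  have "inverse c *\<^sub>C v \<in> V" using v(1) assms(1) by (simp add: subrep_def cvec.subspace_scale)
  then show ?thesis using c by (simp add: scaleC_scaleC scaleC_one)
qed

text \<open>For \<open>n = 1\<close> there are no \<open>e_i\<close>, so every harmonic element
  counts as a highest weight vector and \<open>highest_weight_unique\<close> applies; otherwise
  \<open>v0 m m'\<close> is a nonzero element.\<close>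

lemma H_zero_iff: "H m m' = {0} \<longleftrightarrow> n = 1 \<and> m > 0 \<and> m' > 0"
proof
  assume "H m m' = {0}"
  then show "n = 1 \<and> m > 0 \<and> m' > 0" using v0_H[of m m'] v0_nonzero[of m m'] by blast
next
  assume a: "n = 1 \<and> m > 0 \<and> m' > 0"
  then have "p = 0" if "p \<in> H m m'" for p using highest_weight_unique(2)[OF that] by simp
  then show "H m m' = {0}" using cvec.subspace_0[OF subspace_H] by blast
qed

text \<open>A proper nonzero submodule \<open>V\<close> has a nonzero orthogonal complement
  \<open>V'\<close> in \<open>H m m'\<close>, by \<open>orthogonal_vector\<close>, and
  contravariance makes \<open>V'\<close> a submodule. Both then contain \<open>v0 m m'\<close>,
  whose norm \<open>N (s0 m') (r0 m)\<close> is not zero.\<close>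

lemma irreducible_H:
  assumes "H m m' \<noteq> {0}"
  shows "irreducible_rep L (H m m')"
  unfolding irreducible_rep_def
proof (intro conjI allI impI)
  fix V assume V: "subrep L V \<and> V \<subseteq> H m m'"
  show "V = {0} \<or> V = H m m'"
  proof (rule ccontr)
    assume "\<not> ?thesis"
    then have V0: "V \<noteq> {0}" and VH: "V \<noteq> H m m'" by blast+
    have HA: "H m m' \<subseteq> A m m'" by (auto simp: H_iff)
    have "H m m' \<subseteq> cvec.span ((\<lambda>(s, r). M s r) ` Ix m m')"
    proof
      fix h assume "h \<in> H m m'"
      then have "h = (\<Sum>(s, r)\<in>Ix m m'. cf s r h *\<^sub>C M s r)" using HA by (intro expand) auto
      moreover have "(\<Sum>(s, r)\<in>Ix m m'. cf s r h *\<^sub>C M s r) \<in> cvec.span ((\<lambda>(s, r). M s r) ` Ix m m')"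
        by (intro cvec.span_sum) (auto intro!: cvec.span_scale intro: cvec.span_base image_eqI[where x = "(_, _)"])
      ultimately show "h \<in> cvec.span ((\<lambda>(s, r). M s r) ` Ix m m')" by simp
    qed
    note spans = this
    have fin: "finite ((\<lambda>(s, r). M s r) ` Ix m m')" by simp
    have sV: "cvec.subspace V" "V \<subseteq> H m m'" using V by (auto simp: subrep_def)
    obtain h where h: "h \<in> H m m'" "h \<noteq> 0" "\<And>v. v \<in> V \<Longrightarrow> Bf m m' v h = 0"
      using orthogonal_vector[where b = "Bf m m'", OF fin spans subspace_H sV VH clinear_Bf_left clinear_Bf_right] by blast
    define V' where "V' = {h \<in> H m m'. \<forall>v\<in>V. Bf m m' v h = 0}"
    have "subrep L V'"
    proof (rule invariant_on_generators[OF gl_presented rep_L])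
      show "cvec.subspace V'" unfolding V'_def cvec.subspace_def
        using cvec.subspace_0[OF subspace_H] cvec.subspace_add[OF subspace_H] cvec.subspace_scale[OF subspace_H]
        by (auto simp: clinear_simps[OF clinear_Bf_right])
      fix G u assume G: "G \<in> gl_gens n" and u: "u \<in> V'"
      have "L (x G) u \<in> H m m'" using u subrep_H by (auto simp: V'_def subrep_def)
      moreover have "Bf m m' v (L (x G) u) = 0" if v: "v \<in> V" for v
      proof -
        have "tau (tau G) = G" using G by (auto simp: gl_gens_def)
        moreover have "v \<in> A m m'" "u \<in> A m m'" using v u V HA by (auto simp: V'_def)
        ultimately have "Bf m m' v (L (x G) u) = Bf m m' (L (x (tau G)) v) u"
          using Bf_contravariant[OF tau_gens[OF G], of v m m' u] by simp
        moreover have "L (x (tau G)) v \<in> V" using V v by (simp add: subrep_def)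
        ultimately show ?thesis using u by (simp add: V'_def)
      qed
      ultimately show "L (x G) u \<in> V'" by (simp add: V'_def)
    qed
    moreover have "V' \<noteq> {0}" using h by (auto simp: V'_def)
    ultimately have "v0 m m' \<in> V'" using v0_in_subrep[of V' m m'] by (auto simp: V'_def)
    moreover have "v0 m m' \<in> V" using v0_in_subrep[of V m m'] V V0 by blast
    ultimately have "Bf m m' (v0 m m') (v0 m m') = 0" by (auto simp: V'_def)
    moreover have "Bf m m' (v0 m m') (v0 m m') = N (s0 m') (r0 m)"
      unfolding v0_def by (subst Bf_MM) (auto simp: s0_exps r0_exps tot_s0 tot_r0)
    ultimately show False using N_nonzero by simp
  qed
qed (use assms subrep_H in auto)

end

section \<open>The dual pair\<close>

locale discrete_rep = generic_q q for q +
  fixes k e f :: "'u::complex_algebra_1" and l :: nat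
    and \<delta> :: "'u \<Rightarrow> (nat \<Rightarrow>\<^sub>0 complex) \<Rightarrow> (nat \<Rightarrow>\<^sub>0 complex)"
  assumes l0: "l > 0" and D: "discrete_series q k e f l \<delta>"
begin

lemma rep_delta: "representation \<delta>" and delta_k: "\<delta> k (ket r) = q ^ (2 * r + l) *\<^sub>C ket r"
  and delta_f: "\<delta> f (ket r) = (- qnum q r) *\<^sub>C ket (r - 1)"
  and delta_e: "\<delta> e (ket r) = qnum q (r + l) *\<^sub>C ket (r + 1)"
  using D by (auto simp: discrete_series_def)

lemma clinear_lookup: "clinear (\<lambda>v. Poly_Mapping.lookup v t :: complex)"
  by (simp add: clinear_complex_iff lookup_add lookup_scaleC scaleC_complex_def)

lemma lookup_ket: "Poly_Mapping.lookup (ket r) t = (if r = t then 1 else 0)"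
  by (simp add: ket_def lookup_single when_def)

lemma lookup_delta_f_ket: "Poly_Mapping.lookup (\<delta> f (ket r)) t = (if r = Suc t then - qnum q (Suc t) else 0)"
  by (cases r) (auto simp: delta_f lookup_scaleC lookup_ket scaleC_complex_def)

lemma lookup_delta_f: "Poly_Mapping.lookup (\<delta> f v) t = - qnum q (Suc t) * Poly_Mapping.lookup v (Suc t)"
proof (rule clinear_ket_eqI[where f = "\<lambda>v. Poly_Mapping.lookup (\<delta> f v) t"])
  show "clinear (\<lambda>v. Poly_Mapping.lookup (\<delta> f v) t)"
    by (rule clinear_compose[OF clinear_lookup representationD(1)[OF rep_delta]])
  show "clinear (\<lambda>v. - qnum q (Suc t) * Poly_Mapping.lookup v (Suc t))"
    using cpair.linear_compose_scale_right[OF clinear_lookup, of "- qnum q (Suc t)" "Suc t"] by (simp add: scaleC_complex_def)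
qed (simp add: lookup_delta_f_ket lookup_ket)

lemma delta_f_zero:
  assumes "\<delta> f v = 0"
  shows "v = Poly_Mapping.lookup v 0 *\<^sub>C ket 0"
proof (rule poly_mapping_eqI)
  fix t
  show "Poly_Mapping.lookup v t = Poly_Mapping.lookup (Poly_Mapping.lookup v 0 *\<^sub>C ket 0) t"
  proof (cases t)
    case (Suc s)
    then show ?thesis using lookup_delta_f[of v s] assms by (simp add: lookup_scaleC lookup_ket qnum_eq_0_iff scaleC_complex_def)
  qed (simp add: lookup_scaleC lookup_ket scaleC_complex_def)
qed

lemma ket_nonzero: "ket r \<noteq> 0"
  by (metis lookup_ket lookup_zero zero_neq_one)

text \<open>\<open>f\<close> shortens the support of a vector, so by induction on a bound
  \<open>K\<close> any nonzero \<open>V\<close> contains a nonzero multiple of \<open>ket 0\<close>.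
  From there \<open>e\<close> reaches every \<open>ket r\<close>, since its coefficients do not
  vanish for \<open>l > 0\<close>.\<close>

lemma irreducible_delta: "irreducible_rep \<delta> UNIV"
  unfolding irreducible_rep_def
proof (intro conjI allI impI)
  show "subrep \<delta> UNIV" by (simp add: subrep_def cvec.subspace_UNIV)
  show "UNIV \<noteq> {0 :: nat \<Rightarrow>\<^sub>0 complex}" using ket_nonzero by blast
  fix V assume V: "subrep \<delta> V \<and> V \<subseteq> UNIV"
  then have sub: "cvec.subspace V" and inv: "\<And>X v. v \<in> V \<Longrightarrow> \<delta> X v \<in> V" by (auto simp: subrep_def)
  show "V = {0} \<or> V = UNIV"
  proof (rule disjCI)
    assume "V \<noteq> UNIV"
    have "v = 0" if "v \<in> V" "\<And>t. t \<ge> K \<Longrightarrow> Poly_Mapping.lookup v t = 0" for v K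
      using that
    proof (induction K arbitrary: v)
      case 0
      then show ?case by (intro poly_mapping_eqI) simp
    next
      case (Suc K)
      have "\<delta> f v = 0" using Suc.prems inv by (intro Suc.IH) (auto simp: lookup_delta_f)
      then have v: "v = Poly_Mapping.lookup v 0 *\<^sub>C ket 0" by (rule delta_f_zero)
      show "v = 0"
      proof (rule ccontr)
        assume "v \<noteq> 0"
        then have c: "Poly_Mapping.lookup v 0 \<noteq> 0" using v by (metis cvec.scale_zero_left)
        have "inverse (Poly_Mapping.lookup v 0) *\<^sub>C (Poly_Mapping.lookup v 0 *\<^sub>C ket 0) \<in> V"
          using Suc.prems(1) v sub by (simp add: cvec.subspace_scale)
        then have k0: "ket 0 \<in> V" using c by (simp add: scaleC_scaleC scaleC_one)
        have "ket r \<in> V" for r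
        proof (induction r)
          case (Suc r)
          have "inverse (qnum q (r + l)) *\<^sub>C \<delta> e (ket r) \<in> V" using Suc inv sub by (simp add: cvec.subspace_scale)
          then show ?case using l0 by (simp add: delta_e scaleC_scaleC scaleC_one qnum_eq_0_iff)
        qed (rule k0)
        then have "(\<Sum>r\<in>Poly_Mapping.keys u. Poly_Mapping.lookup u r *\<^sub>C ket r) \<in> V" for u :: "nat \<Rightarrow>\<^sub>0 complex"
          by (intro cvec.subspace_sum[OF sub] cvec.subspace_scale[OF sub])
        then have "(\<Sum>r\<in>Poly_Mapping.keys u. Poly_Mapping.single r (Poly_Mapping.lookup u r)) \<in> V" for u :: "nat \<Rightarrow>\<^sub>0 complex"
          by (simp add: ket_def scaleC_single scaleC_complex_def)
        then have "u \<in> V" for u :: "nat \<Rightarrow>\<^sub>0 complex"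
          by (subst poly_mapping_sum_single)
        with \<open>V \<noteq> UNIV\<close> show False by blast
      qed
    qed
    moreover have "\<exists>K. \<forall>t\<ge>K. Poly_Mapping.lookup v t = 0" for v :: "nat \<Rightarrow>\<^sub>0 complex"
    proof -
      obtain K where "\<forall>t\<in>Poly_Mapping.keys v. t < K" using finite_nat_set_iff_bounded finite_keys by blast
      then show ?thesis by (intro exI[of _ K]) (auto simp: in_keys_iff not_less[symmetric])
    qed
    ultimately show "V = {0}" using cvec.subspace_0[OF sub] by blast
  qed
qed

lemma outer_single: "clinear (\<tau> Y) \<Longrightarrow> outer_tensor \<delta> \<tau> (X, Y) (Poly_Mapping.single r h) = pure_tensor (\<delta> X (ket r)) (\<tau> Y h)"
  by (cases "h = 0") (auto simp: outer_tensor_def cpair.linear_0 intro!: poly_mapping_eqI simp: lookup_pure_tensor)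

text \<open>As for \<delta> alone, \<open>(f, 1)\<close> shortens the support down to slot 0. The
  elements of \<open>V\<close> in that slot form a submodule \<open>V0\<close> of \<open>H\<close>;
  if it is nonzero it is all of \<open>H\<close>, and \<open>(e, 1)\<close> carries it into every
  slot.\<close>

lemma irreducible_outer:
  fixes \<tau> :: "'g::complex_algebra_1 \<Rightarrow> 'v::complex_vector \<Rightarrow> 'v"
  assumes rep: "representation \<tau>" and irr: "irreducible_rep \<tau> H" and sub_out: "subrep (outer_tensor \<delta> \<tau>) (tensor_space H)"
  shows "irreducible_rep (outer_tensor \<delta> \<tau>) (tensor_space H)"
  unfolding irreducible_rep_def
proof (intro conjI allI impI sub_out)
  have subH: "cvec.subspace H" and H0: "H \<noteq> {0}" using irr by (auto simp: irreducible_rep_def subrep_def)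
  then obtain h1 where h1: "h1 \<in> H" "h1 \<noteq> 0" using cvec.subspace_0 by blast
  have single: "Poly_Mapping.single r h \<in> tensor_space H" if "h \<in> H" for h r
    using that cvec.subspace_0[OF subH] by (simp add: tensor_space_def lookup_single when_def)
  have "Poly_Mapping.single 0 h1 \<noteq> (0 :: nat \<Rightarrow>\<^sub>0 'v)" using h1(2) by (metis lookup_single_eq lookup_zero)
  then show "tensor_space H \<noteq> {0}" using single[OF h1(1), of 0] by blast
  fix V assume V: "subrep (outer_tensor \<delta> \<tau>) V \<and> V \<subseteq> tensor_space H"
  then have sub: "cvec.subspace V" and inv: "\<And>X v. v \<in> V \<Longrightarrow> outer_tensor \<delta> \<tau> X v \<in> V" and VH: "V \<subseteq> tensor_space H"
    by (auto simp: subrep_def)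
  have f_lookup: "Poly_Mapping.lookup (outer_tensor \<delta> \<tau> (f, 1) g) t = (- qnum q (Suc t)) *\<^sub>C Poly_Mapping.lookup g (Suc t)" for g t
  proof -
    have "Poly_Mapping.lookup (outer_tensor \<delta> \<tau> (f, 1) g) t =
        (\<Sum>r\<in>Poly_Mapping.keys g. if r = Suc t then (- qnum q (Suc t)) *\<^sub>C Poly_Mapping.lookup g (Suc t) else 0)"
      unfolding outer_tensor_def prod.case lookup_sum
      by (rule sum.cong) (auto simp: lookup_pure_tensor lookup_delta_f_ket representationD(2)[OF rep])
    then show ?thesis by (simp add: in_keys_iff)
  qed
  show "V = {0} \<or> V = tensor_space H"
  proof (rule disjCI)
    assume ne: "V \<noteq> tensor_space H"
    have zero0: "h = 0" if h: "Poly_Mapping.single 0 h \<in> V" for h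
    proof (rule ccontr)
      assume "h \<noteq> 0"
      define V0 where "V0 = {h. Poly_Mapping.single 0 h \<in> V}"
      have "V0 \<subseteq> H" using VH unfolding V0_def tensor_space_def by (metis (mono_tags, lifting) lookup_single_eq mem_Collect_eq subset_iff)
      moreover have "subrep \<tau> V0"
        unfolding subrep_def
      proof (intro conjI allI ballI)
        show "cvec.subspace V0" unfolding V0_def cvec.subspace_def
          using cvec.subspace_0[OF sub] cvec.subspace_add[OF sub] cvec.subspace_scale[OF sub]
          by (auto simp: single_add scaleC_single[symmetric])
        fix Y u assume "u \<in> V0"
        then have "outer_tensor \<delta> \<tau> (1, Y) (Poly_Mapping.single 0 u) \<in> V" using inv by (simp add: V0_def)
        moreover have "outer_tensor \<delta> \<tau> (1, Y) (Poly_Mapping.single 0 u) = Poly_Mapping.single 0 (\<tau> Y u)"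
          unfolding outer_single[of \<tau>, OF representationD(1)[OF rep]]
          by (rule poly_mapping_eqI) (simp add: representationD(2)[OF rep_delta] lookup_pure_tensor lookup_ket lookup_single when_def scaleC_one)
        ultimately show "\<tau> Y u \<in> V0" by (simp add: V0_def)
      qed
      moreover have "V0 \<noteq> {0}" using h \<open>h \<noteq> 0\<close> by (auto simp: V0_def)
      ultimately have V0: "V0 = H" using irr by (auto simp: irreducible_rep_def)
      have all: "Poly_Mapping.single r u \<in> V" if u: "u \<in> H" for r u
      proof (induction r)
        case 0
        show ?case using V0 u by (auto simp: V0_def)
      next
        case (Suc r)
        have eq: "outer_tensor \<delta> \<tau> (e, 1) (Poly_Mapping.single r u) = qnum q (r + l) *\<^sub>C Poly_Mapping.single (Suc r) u"
          unfolding outer_single[of \<tau>, OF representationD(1)[OF rep]]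
          by (rule poly_mapping_eqI)
            (simp add: representationD(2)[OF rep] delta_e lookup_pure_tensor lookup_scaleC lookup_ket lookup_single when_def scaleC_complex_def)
        have "inverse (qnum q (r + l)) *\<^sub>C outer_tensor \<delta> \<tau> (e, 1) (Poly_Mapping.single r u) \<in> V"
          using Suc inv sub by (simp add: cvec.subspace_scale)
        then show ?case unfolding eq using l0 by (simp add: scaleC_scaleC scaleC_one qnum_eq_0_iff)
      qed
      have "tensor_space H \<subseteq> V"
      proof
        fix g assume "g \<in> tensor_space H"
        then have "(\<Sum>r\<in>Poly_Mapping.keys g. Poly_Mapping.single r (Poly_Mapping.lookup g r)) \<in> V"
          by (intro cvec.subspace_sum[OF sub] all) (simp add: tensor_space_def)
        then show "g \<in> V" by (subst poly_mapping_sum_single)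
      qed
      with VH ne show False by blast
    qed
    have "g = 0" if "g \<in> V" "\<And>t. t \<ge> K \<Longrightarrow> Poly_Mapping.lookup g t = 0" for g K
      using that
    proof (induction K arbitrary: g)
      case 0
      then show ?case by (intro poly_mapping_eqI) simp
    next
      case (Suc K)
      have "outer_tensor \<delta> \<tau> (f, 1) g = 0" using Suc.prems inv by (intro Suc.IH) (auto simp: f_lookup)
      then have "Poly_Mapping.lookup g (Suc t) = 0" for t
        using f_lookup[of g t] by (simp add: qnum_eq_0_iff)
      then have g: "g = Poly_Mapping.single 0 (Poly_Mapping.lookup g 0)"
        by (intro poly_mapping_eqI) (metis lookup_single_eq lookup_single_not_eq not0_implies_Suc)
      then have "Poly_Mapping.lookup g 0 = 0" using zero0 Suc.prems(1) by metis
      then show ?case using g by simp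
    qed
    moreover have "\<exists>K. \<forall>t\<ge>K. Poly_Mapping.lookup g t = 0" for g :: "nat \<Rightarrow>\<^sub>0 'v"
    proof -
      obtain K where "\<forall>t\<in>Poly_Mapping.keys g. t < K" using finite_nat_set_iff_bounded finite_keys by blast
      then show ?thesis by (intro exI[of _ K]) (auto simp: in_keys_iff not_less[symmetric])
    qed
    ultimately show "V = {0}" using cvec.subspace_0[OF sub] by blast
  qed
qed

end

text \<open>The kernel of \<open>f\<close> is the line through \<open>ket 0\<close>, on which
  \<open>k\<close> acts by \<open>q ^ l\<close>; an intertwiner preserves both.\<close>

lemma discrete_series_equiv_iff:
  assumes "generic_q q" "l > 0" "l' > 0" "discrete_series q k e f l \<delta>" "discrete_series q k e f l' \<delta>'"
    and eq: "rep_equiv \<delta> UNIV \<delta>' UNIV"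
  shows "l = l'"
proof -
  interpret generic_q q by fact
  interpret d: discrete_rep q k e f l \<delta> by unfold_locales fact+
  interpret d': discrete_rep q k e f l' \<delta>' by unfold_locales fact+
  obtain \<Phi> where \<Phi>: "clinear \<Phi>" "bij \<Phi>" "\<And>X v. \<Phi> (\<delta> X v) = \<delta>' X (\<Phi> v)"
    using eq unfolding rep_equiv_def by auto
  let ?v = "\<Phi> (ket 0)"
  have v0: "?v \<noteq> 0" using \<Phi> d.ket_nonzero cpair.linear_0[OF \<Phi>(1)] by (metis bij_def injD)
  have "\<delta>' f ?v = 0" using \<Phi>(3)[of f "ket 0"] by (simp add: d.delta_f cpair.linear_0[OF \<Phi>(1)])
  then have v: "?v = Poly_Mapping.lookup ?v 0 *\<^sub>C ket 0" by (rule d'.delta_f_zero)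
  have "\<delta>' k ?v = q ^ l' *\<^sub>C ?v"
    by (subst (1 2) v) (simp add: cpair.linear_scale[OF representationD(1)[OF d'.rep_delta]] d'.delta_k scaleC_scaleC mult.commute)
  moreover have "\<delta>' k ?v = q ^ l *\<^sub>C ?v"
    using \<Phi>(3)[of k "ket 0"] by (simp add: d.delta_k cpair.linear_scale[OF \<Phi>(1)])
  ultimately have "q ^ l = q ^ l'" using v0 by simp
  then show ?thesis by (rule pow_inj)
qed

section \<open>The two actions together\<close>

locale dual_pair = sl2_setting q n z w d db \<gamma> \<gamma>b k kinv e f \<omega> + gl_setting q n z w d db qh x L
  for q n and z w :: "nat \<Rightarrow> 'a::complex_algebra_1" and d db \<gamma> \<gamma>b
    and k kinv e f :: "'u::complex_algebra_1" and \<omega>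
    and qh and x :: "gl_gen \<Rightarrow> 'g::complex_algebra_1" and L +
  fixes D :: "nat \<Rightarrow> 'u \<Rightarrow> (nat \<Rightarrow>\<^sub>0 complex) \<Rightarrow> (nat \<Rightarrow>\<^sub>0 complex)"
  assumes D: "\<And>l. l > 0 \<Longrightarrow> discrete_series q k e f l (D l)"
begin

lemma L_A: "p \<in> A m m' \<Longrightarrow> L Y p \<in> A m m'" and L_H: "h \<in> H m m' \<Longrightarrow> L Y h \<in> H m m'"
  using subrep_A[of m m'] subrep_H[of m m'] by (auto simp: subrep_def)

lemma L_Kop: "L Y (Kop p) = Kop (L Y p)"
proof (induction p rule: all_homog_induct)
  case (2 m m' p)
  then show ?case using L_A[OF 2, of Y] by (simp add: Kop_A L_simps)
qed (simp add: L_simps cpair.linear_add[OF clinear_Kop])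

lemma omega_L_commute: "\<omega> X (L Y p) = L Y (\<omega> X p)"
  by (rule sl2_intertwiner[OF rep_omega rep_omega L_rep(1), symmetric])
    (simp_all add: omega_k omega_e omega_f L_Kop L_simps L_Q L_Lap)

lemma nl: "m + m' + n > 0" using npos by simp

lemma discrete_rep_D: "l > 0 \<Longrightarrow> discrete_rep q k e f l (D l)"
  by unfold_locales (use D in auto)

text \<open>Slot by slot this is \<open>Theta_intertwines\<close>, applied to the harmonic element
  \<open>L Y (lookup g r)\<close>; the operator \<open>L Y\<close> has passed the power of
  \<open>Q\<close>.\<close>

lemma Psi_intertwines:
  assumes "g \<in> tensor_space (H m m')"
  shows "Psi (coef (m + m' + n)) (outer_tensor (D (m + m' + n)) L (X, Y) g) = \<omega> X (L Y (Psi (coef (m + m' + n)) g))"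
proof -
  let ?l = "m + m' + n"
  have gH: "Poly_Mapping.lookup g r \<in> H m m'" for r using assms by (simp add: tensor_space_def)
  have "Psi (coef ?l) (outer_tensor (D ?l) L (X, Y) g) = (\<Sum>r\<in>Poly_Mapping.keys g. Theta ?l (L Y (Poly_Mapping.lookup g r)) (D ?l X (ket r)))"
    by (simp add: outer_tensor_def cpair.linear_sum[OF clinear_Psi] Theta_def)
  also have "\<dots> = (\<Sum>r\<in>Poly_Mapping.keys g. \<omega> X (L Y (coef ?l r *\<^sub>C (Q ^ r * Poly_Mapping.lookup g r))))"
    by (rule sum.cong) (simp_all add: Theta_intertwines[OF D[OF nl] L_H[OF gH] refl] Theta_ket L_simps L_Q_pow)
  also have "\<dots> = \<omega> X (L Y (Psi (coef ?l) g))"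
    unfolding Psi_def L_simps cpair.linear_sum[OF representationD(1)[OF rep_omega]] ..
  finally show ?thesis .
qed

lemma subrep_outer: "subrep (outer_tensor (D (m + m' + n)) L) (tensor_space (H m m'))"
  unfolding subrep_def
proof (intro conjI allI ballI)
  fix X :: "'u \<times> 'g" and g assume g: "g \<in> tensor_space (H m m')"
  obtain Y Z where X: "X = (Y, Z)" by (cases X)
  show "outer_tensor (D (m + m' + n)) L X g \<in> tensor_space (H m m')"
    using g L_H unfolding X outer_tensor_def tensor_space_def
    by (auto simp: lookup_sum lookup_pure_tensor intro!: cvec.subspace_sum cvec.subspace_scale)
qed (simp add: subspace_tensor_space)

lemma Psi_CQ: "Psi (coef (m + m' + n)) ` tensor_space (H m m') = CQ m m'"
  using coef_nonzero[OF nl] by (simp add: CQ_span Psi_image)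

lemma subrep_CQ: "subrep (rep_prod \<omega> L) (CQ m m')"
  unfolding subrep_def
proof (intro conjI allI ballI)
  fix X :: "'u \<times> 'g" and v assume "v \<in> CQ m m'"
  then obtain g where g: "g \<in> tensor_space (H m m')" "v = Psi (coef (m + m' + n)) g" using Psi_CQ by blast
  obtain Y Z where X: "X = (Y, Z)" by (cases X)
  have "outer_tensor (D (m + m' + n)) L X g \<in> tensor_space (H m m')" using subrep_outer[of m m'] g unfolding subrep_def by blast
  then have "Psi (coef (m + m' + n)) (outer_tensor (D (m + m' + n)) L X g) \<in> CQ m m'" using Psi_CQ by blast
  then show "rep_prod \<omega> L X v \<in> CQ m m'" unfolding X g(2) Psi_intertwines[OF g(1)] by (simp add: rep_prod_def)
qed simp

lemma CQ_omega: "v \<in> CQ m m' \<Longrightarrow> \<omega> X v \<in> CQ m m'" and CQ_L: "v \<in> CQ m m' \<Longrightarrow> L Y v \<in> CQ m m'"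
proof -
  assume v: "v \<in> CQ m m'"
  then have "rep_prod \<omega> L (X, 1) v \<in> CQ m m'" "rep_prod \<omega> L (1, Y) v \<in> CQ m m'"
    using subrep_CQ unfolding subrep_def by blast+
  then show "\<omega> X v \<in> CQ m m'" "L Y v \<in> CQ m m'"
    by (simp_all add: rep_prod_def L_rep(2) representationD(2)[OF rep_omega])
qed

lemma CQ_equiv: "rep_equiv (rep_prod \<omega> L) (CQ m m') (outer_tensor (D (m + m' + n)) L) (tensor_space (H m m'))"
proof (rule rep_equiv_sym)
  have "bij_betw (Psi (coef (m + m' + n))) (tensor_space (H m m')) (CQ m m')"
    unfolding bij_betw_def using Psi_CQ Psi_inj[of "coef (m + m' + n)" m m'] coef_nonzero[OF nl] by blast
  moreover have "Psi (coef (m + m' + n)) (outer_tensor (D (m + m' + n)) L X g) = rep_prod \<omega> L X (Psi (coef (m + m' + n)) g)"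
    if "g \<in> tensor_space (H m m')" for X g
    using Psi_intertwines[OF that] by (cases X) (simp add: rep_prod_def)
  ultimately show "rep_equiv (outer_tensor (D (m + m' + n)) L) (tensor_space (H m m')) (rep_prod \<omega> L) (CQ m m')"
    unfolding rep_equiv_def using subrep_outer subrep_CQ clinear_Psi by blast
qed

lemma irreducible_D: "l > 0 \<Longrightarrow> irreducible_rep (D l) UNIV"
  by (rule discrete_rep.irreducible_delta[OF discrete_rep_D])

lemma irreducible_tensor:
  "H m m' \<noteq> {0} \<Longrightarrow> irreducible_rep (outer_tensor (D (m + m' + n)) L) (tensor_space (H m m'))"
  by (rule discrete_rep.irreducible_outer[OF discrete_rep_D[OF nl] rep_L irreducible_H subrep_outer])

subsection \<open>Inequivalence\<close>

lemma qh_pow_inj: "qh ^ a = qh ^ b \<Longrightarrow> a = b"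
proof -
  assume "qh ^ a = qh ^ b"
  then have "(qh ^ a)^2 = (qh ^ b)^2" by simp
  then have "q ^ a = q ^ b" unfolding qh[symmetric] by (simp add: power_mult[symmetric] mult.commute)
  then show ?thesis by (rule pow_inj)
qed

lemma qh_ratio: "inverse qh ^ a * qh ^ b = inverse qh ^ a' * qh ^ b' \<Longrightarrow> b + a' = b' + a"
proof -
  assume e: "inverse qh ^ a * qh ^ b = inverse qh ^ a' * qh ^ b'"
  have "qh ^ (b + a') = qh ^ a * qh ^ a' * (inverse qh ^ a * qh ^ b)"
    using qh_simps(7)[of a] by (simp add: power_add mult_ac)
  also have "\<dots> = qh ^ (b' + a)" unfolding e using qh_simps(7)[of a'] by (simp add: power_add mult_ac)
  finally show ?thesis by (rule qh_pow_inj)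
qed

text \<open>The weight of \<open>v0 m m'\<close> under the square roots of the \<open>k_i\<close>;
  for \<open>n = 1\<close> both factors fall on the same index.\<close>

abbreviation chi :: "nat \<Rightarrow> nat \<Rightarrow> nat \<Rightarrow> complex" where
  "chi m m' i \<equiv> (if i = n then inverse qh ^ m' else 1) * (if i = 1 then qh ^ m else 1)"

lemma highest_weight_determines:
  assumes "H m m' \<noteq> {0}" "v \<in> H p p'" "v \<noteq> 0" "\<And>i. i \<in> {1..<n} \<Longrightarrow> EE i v = 0"
    and "\<And>i. i \<in> {1..n} \<Longrightarrow> KK i v = chi m m' i *\<^sub>C v"
  shows "m = p \<and> m' = p'"
proof -
  have Hp: "H p p' \<noteq> {0}" using assms(2,3) by blast
  obtain c where v: "v = c *\<^sub>C v0 p p'" using highest_weight_unique(1)[OF assms(2,4)] by blast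
  have "chi m m' i = chi p p' i" if "i \<in> {1..n}" for i
  proof -
    have "KK i v = chi p p' i *\<^sub>C v" unfolding v L_simps KK_v0[OF that] by (simp only: scaleC_scaleC mult.commute)
    with assms(5)[OF that] assms(3) show ?thesis by simp
  qed
  from this[of 1] this[of n] npos have chi: "chi m m' 1 = chi p p' 1" "chi m m' n = chi p p' n" by auto
  show ?thesis
  proof (cases "n = 1")
    case True
    \<comment> \<open>With a single index the weight determines only \<open>m - m'\<close>; that one
      of the degrees is zero has to be taken from \<open>H_zero_iff\<close>.\<close>
    then have "m + p' = p + m'" using chi(1) qh_ratio[of m' m p' p] by simp
    moreover have "m = 0 \<or> m' = 0" "p = 0 \<or> p' = 0" using assms(1) Hp True H_zero_iff by auto
    ultimately show ?thesis by auto
  next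
    case False
    then have "qh ^ m = qh ^ p" "inverse qh ^ m' = inverse qh ^ p'" using chi by simp_all
    then show ?thesis using qh_pow_inj by (simp add: power_inverse)
  qed
qed

lemma L_equiv_iff:
  assumes "H m m' \<noteq> {0}" "H p p' \<noteq> {0}"
  shows "rep_equiv L (H m m') L (H p p') \<longleftrightarrow> m = p \<and> m' = p'"
proof
  assume "rep_equiv L (H m m') L (H p p')"
  then obtain \<Phi> where \<Phi>: "clinear \<Phi>" "bij_betw \<Phi> (H m m') (H p p')" "\<And>X v. v \<in> H m m' \<Longrightarrow> \<Phi> (L X v) = L X (\<Phi> v)"
    unfolding rep_equiv_def by blast
  have v0: "v0 m m' \<in> H m m'" using v0_H assms(1) H_zero_iff by blast
  show "m = p \<and> m' = p'"
  proof (rule highest_weight_determines[OF assms(1)])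
    show "\<Phi> (v0 m m') \<in> H p p'" using \<Phi>(2) v0 by (auto simp: bij_betw_def)
    show "\<Phi> (v0 m m') \<noteq> 0"
      using \<Phi>(2) v0 v0_nonzero cpair.linear_0[OF \<Phi>(1)] cvec.subspace_0[OF subspace_H] by (metis bij_betw_def inj_onD)
    show "EE i (\<Phi> (v0 m m')) = 0" if "i \<in> {1..<n}" for i
      using \<Phi>(3)[OF v0, of "x (GE i)"] EE_v0[OF that] cpair.linear_0[OF \<Phi>(1)] by simp
    show "KK i (\<Phi> (v0 m m')) = chi m m' i *\<^sub>C \<Phi> (v0 m m')" if "i \<in> {1..n}" for i
      using \<Phi>(3)[OF v0, of "x (GK i)"] unfolding KK_v0[OF that] cpair.linear_scale[OF \<Phi>(1)] by simp
  qed
qed (auto intro: rep_equiv_refl subrep_H)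

lemma D_equiv_iff: "rep_equiv (D (m + m' + n)) UNIV (D (p + p' + n)) UNIV \<longleftrightarrow> m + m' = p + p'"
proof
  assume "rep_equiv (D (m + m' + n)) UNIV (D (p + p' + n)) UNIV"
  from discrete_series_equiv_iff[OF generic_q_axioms nl nl D[OF nl] D[OF nl] this] show "m + m' = p + p'" by simp
next
  assume "m + m' = p + p'"
  then show "rep_equiv (D (m + m' + n)) UNIV (D (p + p' + n)) UNIV"
    using irreducible_D[OF nl, of m m'] by (auto simp: irreducible_rep_def intro: rep_equiv_refl)
qed

lemma central_scalar:
  assumes "p \<in> A m m'"
  shows "L (prod_list (map (\<lambda>i. x (GK i)) [1..<Suc n])) p = (inverse qh ^ m' * qh ^ m) *\<^sub>C p"
  using assms
proof (induction rule: A_induct)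
  case (mono s r)
  have "L (prod_list (map (\<lambda>i. x (GK i)) [1..<Suc j])) (M s r) = (inverse qh ^ lo s (Suc j) * qh ^ lo r (Suc j)) *\<^sub>C M s r" if "j \<le> n" for j
    using that
  proof (induction j)
    case 0
    then show ?case by (simp add: L_rep(2) scaleC_one)
  next
    case (Suc j)
    then show ?case using mono
      by (simp add: L_rep(3) KK_M L_simps scaleC_scaleC lo_Suc power_add mult_ac)
  qed
  from this[of n] mono show ?case by (simp add: tot_eq_lo)
qed (simp_all add: L_simps vec_simps mult.commute)

text \<open>The discrete series determines \<open>m + m'\<close>, and the scalar is a power of
  \<open>qh\<close> that determines \<open>m - m'\<close>; together they recover both
  degrees.\<close>

lemma same_scalar_equiv:
  assumes "H m m' \<noteq> {0}" "H p p' \<noteq> {0}" "m + m' = p + p'"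
    and "\<And>h. h \<in> H m m' \<union> H p p' \<Longrightarrow> L (prod_list (map (\<lambda>i. x (GK i)) [1..<Suc n])) h = c *\<^sub>C h"
  shows "rep_equiv L (H m m') L (H p p')"
proof -
  have "v0 m m' \<in> H m m'" "v0 p p' \<in> H p p'" using v0_H assms(1,2) H_zero_iff by blast+
  then have "(inverse qh ^ m' * qh ^ m) *\<^sub>C v0 m m' = c *\<^sub>C v0 m m'" "(inverse qh ^ p' * qh ^ p) *\<^sub>C v0 p p' = c *\<^sub>C v0 p p'"
    unfolding central_scalar[OF v0_A, symmetric] by (intro assms(4); simp)+
  then have "inverse qh ^ m' * qh ^ m = c" "inverse qh ^ p' * qh ^ p = c"
    using v0_nonzero cvec.scale_cancel_right by blast+
  then have "inverse qh ^ m' * qh ^ m = inverse qh ^ p' * qh ^ p" by simp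
  then have "m + p' = p + m'" by (rule qh_ratio)
  then show ?thesis using assms(1-3) L_equiv_iff by auto
qed

subsection \<open>Isotypic components\<close>

text \<open>Finer than the sum of the \<open>CQ m m'\<close>: each power of \<open>Q\<close> is a
  summand of its own, so conditions on a vector can be tested on single harmonic elements.\<close>

lemma Q_pow_direct_sum: "is_direct_sum (\<lambda>(j, m, m'). (*) (Q ^ j) ` H m m')"
proof (rule is_direct_sumI)
  show "cvec.subspace (case i of (j, m, m') \<Rightarrow> (*) (Q ^ j) ` H m m')" for i
    by (cases i) (simp add: cpair.linear_subspace_image[OF clinear_mult_left])
  fix v
  have "QH m m' \<subseteq> (\<Union>i. case i of (j, m, m') \<Rightarrow> (*) (Q ^ j) ` H m m')" for m m'
    unfolding QH_def by fastforce
  then show "v \<in> cvec.span (\<Union>i. case i of (j, m, m') \<Rightarrow> (*) (Q ^ j) ` H m m')"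
  proof (induction v rule: all_homog_induct)
    case (2 m m' p)
    then show ?case using harmonic_decomposition[of p m m'] cvec.span_mono by blast
  qed (blast intro: cvec.span_add)
next
  fix F and v :: "nat \<times> nat \<times> nat \<Rightarrow> 'a"
  assume F: "finite F" "\<And>i. i \<in> F \<Longrightarrow> v i \<in> (case i of (j, m, m') \<Rightarrow> (*) (Q ^ j) ` H m m')" "(\<Sum>i\<in>F. v i) = 0"
  then have "\<exists>h. h \<in> H (fst (snd i)) (snd (snd i)) \<and> v i = Q ^ fst i * h" if "i \<in> F" for i
    using F(2)[OF that] by (auto split: prod.splits)
  then obtain h where h: "\<And>i. i \<in> F \<Longrightarrow> h i \<in> H (fst (snd i)) (snd (snd i))" "\<And>i. i \<in> F \<Longrightarrow> v i = Q ^ fst i * h i"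
    by metis
  then have "(\<Sum>i\<in>F. Q ^ fst i * h i) = 0" using F(3) by simp
  then have "h i = 0" if "i \<in> F" for i
    using Q_pow_H_independent[where F = F and j = fst and a = "fst \<circ> snd" and b = "snd \<circ> snd" and h = h and i = i] F(1) h(1) that
    by (simp add: inj_on_def)
  then show "\<forall>i\<in>F. v i = 0" using h(2) by simp
qed

lemma Q_pow_decomposition:
  obtains F h where "finite F" "\<And>i. i \<in> F \<Longrightarrow> h i \<in> H (fst (snd i)) (snd (snd i))" "v = (\<Sum>i\<in>F. Q ^ fst i * h i)"
proof -
  obtain g where g: "\<forall>i. Poly_Mapping.lookup g i \<in> (case i of (j, m, m') \<Rightarrow> (*) (Q ^ j) ` H m m')"
    "v = (\<Sum>i\<in>Poly_Mapping.keys g. Poly_Mapping.lookup g i)"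
    using Q_pow_direct_sum unfolding is_direct_sum_def by metis
  have "\<exists>h. h \<in> H (fst (snd i)) (snd (snd i)) \<and> Poly_Mapping.lookup g i = Q ^ fst i * h" for i
    using spec[OF g(1), of i] by (auto split: prod.splits)
  then obtain h where "\<And>i. h i \<in> H (fst (snd i)) (snd (snd i))" "\<And>i. Poly_Mapping.lookup g i = Q ^ fst i * h i" by metis
  then show ?thesis using that[of "Poly_Mapping.keys g" h] g(2) by simp
qed

lemma Q_pow_decomposition_zero:
  assumes "finite F" "\<And>i. i \<in> F \<Longrightarrow> h i \<in> H (fst (snd i)) (snd (snd i))" "(\<Sum>i\<in>F. Q ^ fst i * h i) = 0" "i \<in> F"
  shows "h i = 0"
  using Q_pow_H_independent[where F = F and j = fst and a = "fst \<circ> snd" and b = "snd \<circ> snd" and h = h and i = i] assms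
  by (simp add: inj_on_def)

text \<open>\<open>L\<close> commutes with \<open>Q\<close> and preserves the harmonics, so every
  component \<open>h t\<close> of \<open>v\<close> satisfies the same conditions. A nonzero one is a
  highest weight vector of this weight, hence lies in \<open>H m m'\<close>.\<close>

lemma highest_weight_in_CQ:
  assumes "H m m' \<noteq> {0}" "\<And>i. i \<in> {1..<n} \<Longrightarrow> EE i v = 0" "\<And>i. i \<in> {1..n} \<Longrightarrow> KK i v = chi m m' i *\<^sub>C v"
  shows "v \<in> CQ m m'"
proof -
  obtain F h where F: "finite F" "\<And>i. i \<in> F \<Longrightarrow> h i \<in> H (fst (snd i)) (snd (snd i))" "v = (\<Sum>i\<in>F. Q ^ fst i * h i)"
    by (rule Q_pow_decomposition[of v]) blast
  have E: "EE i (h t) = 0" if "i \<in> {1..<n}" "t \<in> F" for i t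
  proof (rule Q_pow_decomposition_zero[of F "\<lambda>t. EE i (h t)", OF F(1) _ _ that(2)])
    show "(\<Sum>t\<in>F. Q ^ fst t * EE i (h t)) = 0"
      using assms(2)[OF that(1)] unfolding F(3) L_simps L_Q_pow .
  qed (rule L_H[OF F(2)])
  have K: "KK i (h t) = chi m m' i *\<^sub>C h t" if "i \<in> {1..n}" "t \<in> F" for i t
  proof -
    have "KK i (h t) - chi m m' i *\<^sub>C h t = 0"
    proof (rule Q_pow_decomposition_zero[of F "\<lambda>t. KK i (h t) - chi m m' i *\<^sub>C h t", OF F(1) _ _ that(2)])
      have "(\<Sum>t\<in>F. Q ^ fst t * KK i (h t)) = (\<Sum>t\<in>F. chi m m' i *\<^sub>C (Q ^ fst t * h t))"
        using assms(3)[OF that(1)] unfolding F(3) L_simps L_Q_pow cvec.scale_sum_right .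
      then show "(\<Sum>t\<in>F. Q ^ fst t * (KK i (h t) - chi m m' i *\<^sub>C h t)) = 0"
        by (simp only: right_diff_distrib scaleC_mult_right sum_subtractf) simp
    qed (intro cvec.subspace_diff[OF subspace_H] cvec.subspace_scale[OF subspace_H] L_H F(2); assumption)
    then show ?thesis by simp
  qed
  have "Q ^ fst t * h t \<in> CQ m m'" if t: "t \<in> F" for t
  proof (cases "h t = 0")
    case False
    then show ?thesis using highest_weight_determines[OF assms(1) F(2)[OF t] False E[OF _ t] K[OF _ t]] F(2)[OF t] CQ_I by simp
  qed (simp add: cvec.subspace_0)
  then show ?thesis unfolding F(3) by (intro cvec.subspace_sum) simp_all
qed

text \<open>For an equivalence \<Phi>, the elements of \<open>H m m'\<close> sent into
  \<open>CQ m m'\<close> form a submodule containing \<open>v0 m m'\<close>, hence all of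
  \<open>H m m'\<close>. Conversely multiplication by \<open>Q ^ r\<close> embeds
  \<open>H m m'\<close> equivariantly. The zero space is treated apart.\<close>

lemma isotypic_L: "isotypic_component L L (H m m') = CQ m m'"
proof (rule antisym)
  have "V \<subseteq> CQ m m'" if V: "rep_equiv L V L (H m m')" for V
  proof -
    obtain \<Phi> where \<Phi>: "clinear \<Phi>" "bij_betw \<Phi> (H m m') V" "\<And>X v. v \<in> H m m' \<Longrightarrow> \<Phi> (L X v) = L X (\<Phi> v)"
      using rep_equiv_sym[OF V] unfolding rep_equiv_def by blast
    show ?thesis
    proof (cases "H m m' = {0}")
      case True
      then have "V = {0}" using \<Phi>(2) cpair.linear_0[OF \<Phi>(1)] by (auto simp: bij_betw_def)
      then show ?thesis by (simp add: cvec.subspace_0)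
    next
      case False
      then have v0: "v0 m m' \<in> H m m'" using v0_H H_zero_iff by blast
      define U where "U = {h \<in> H m m'. \<Phi> h \<in> CQ m m'}"
      have "\<Phi> (v0 m m') \<in> CQ m m'"
      proof (rule highest_weight_in_CQ[OF False])
        show "EE i (\<Phi> (v0 m m')) = 0" if "i \<in> {1..<n}" for i
          using \<Phi>(3)[OF v0, of "x (GE i)"] EE_v0[OF that] cpair.linear_0[OF \<Phi>(1)] by simp
        show "KK i (\<Phi> (v0 m m')) = chi m m' i *\<^sub>C \<Phi> (v0 m m')" if "i \<in> {1..n}" for i
          using \<Phi>(3)[OF v0, of "x (GK i)"] unfolding KK_v0[OF that] cpair.linear_scale[OF \<Phi>(1)] by simp
      qed
      then have "U \<noteq> {0}" using v0 v0_nonzero[of m m'] by (auto simp: U_def)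
      moreover have "subrep L U" unfolding subrep_def
      proof (intro conjI allI ballI)
        have "U = H m m' \<inter> {h. \<Phi> h \<in> CQ m m'}" by (auto simp: U_def)
        then show "cvec.subspace U" using cvec.subspace_inter[OF subspace_H subspace_vimage[OF \<Phi>(1) subspace_CQ]] by simp
        show "L X u \<in> U" if "u \<in> U" for X u using that \<Phi>(3)[of u X] L_H CQ_L by (auto simp: U_def)
      qed
      ultimately have "U = H m m'" using irreducible_H[OF False] unfolding irreducible_rep_def U_def by blast
      then show ?thesis using \<Phi>(2) by (auto simp: U_def bij_betw_def)
    qed
  qed
  then show "isotypic_component L L (H m m') \<subseteq> CQ m m'"
    unfolding isotypic_component_def by (intro cvec.span_minimal) auto
  have "Q ^ r * h \<in> \<Union> {V. rep_equiv L V L (H m m')}" if h: "h \<in> H m m'" for r h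
  proof -
    have inv: "L X ((*) (Q ^ r) h) \<in> (*) (Q ^ r) ` H m m'" if "h \<in> H m m'" for X h
      using L_H[OF that, of X] by (simp add: L_Q_pow)
    have sub: "subrep L ((*) (Q ^ r) ` H m m')"
      unfolding subrep_def using inv cpair.linear_subspace_image[OF clinear_mult_left subspace_H] by auto
    have "inj_on ((*) (Q ^ r)) (H m m')"
    proof (rule inj_onI)
      fix u v assume "u \<in> H m m'" "v \<in> H m m'" "Q ^ r * u = Q ^ r * v"
      then have "u - v \<in> H m m'" "Q ^ r * (u - v) = 0" by (simp_all add: cvec.subspace_diff right_diff_distrib)
      then show "u = v" using Q_pow_zero by fastforce
    qed
    then have "rep_equiv L (H m m') L ((*) (Q ^ r) ` H m m')"
      unfolding rep_equiv_def using sub subrep_H clinear_mult_left[of "Q ^ r"]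
      by (auto intro!: exI[of _ "(*) (Q ^ r)"] simp: bij_betw_def L_Q_pow)
    from rep_equiv_sym[OF this] h show ?thesis by blast
  qed
  then show "CQ m m' \<subseteq> isotypic_component L L (H m m')"
    unfolding CQ_span isotypic_component_def by (intro cvec.span_mono) auto
qed

text \<open>\<open>v\<close> is split into components \<open>Q ^ j * h\<close>. Applying
  \<open>Q * Lap\<close> instead of \<open>Lap\<close> keeps each an eigenvector, with eigenvalue
  zero only for \<open>j = 0\<close>; \<open>Kop\<close> then gives
  \<open>m + m' + n = l\<close>.\<close>

lemma lowest_weight_in_CQ:
  assumes "Lap v = 0" "Kop v = q ^ l *\<^sub>C v"
  shows "v \<in> cvec.span (\<Union>{CQ m m' |m m'. m + m' + n = l})"
proof -
  obtain F h where F: "finite F" "\<And>i. i \<in> F \<Longrightarrow> h i \<in> H (fst (snd i)) (snd (snd i))" "v = (\<Sum>i\<in>F. Q ^ fst i * h i)"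
    by (rule Q_pow_decomposition[of v]) blast
  let ?a = "\<lambda>i. fst (snd i)" and ?b = "\<lambda>i. snd (snd i)"
  define c where "c i = q ^ (n - 1) * (qnum q (fst i) * qnum q (?a i + ?b i + n + fst i - 1))" for i :: "nat \<times> nat \<times> nat"
  have 1: "c t *\<^sub>C h t = 0" if "t \<in> F" for t
  proof (rule Q_pow_decomposition_zero[of F "\<lambda>t. c t *\<^sub>C h t", OF F(1) _ _ that])
    have "Q * Lap v = (\<Sum>t\<in>F. Q * Lap (Q ^ fst t * h t))"
      unfolding F(3) cpair.linear_sum[OF clinear_Lap] sum_distrib_left ..
    also have "\<dots> = (\<Sum>t\<in>F. Q ^ fst t * (c t *\<^sub>C h t))"
      by (rule sum.cong) (simp_all add: QLap_eigen[OF F(2)] c_def scaleC_mult_right)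
    finally show "(\<Sum>t\<in>F. Q ^ fst t * (c t *\<^sub>C h t)) = 0" using assms(1) by simp
  qed (simp add: cvec.subspace_scale F(2))
  let ?e = "\<lambda>t. n + (?a t + fst t) + (?b t + fst t)"
  have 2: "(q ^ ?e t - q ^ l) *\<^sub>C h t = 0" if "t \<in> F" for t
  proof (rule Q_pow_decomposition_zero[of F "\<lambda>t. (q ^ ?e t - q ^ l) *\<^sub>C h t", OF F(1) _ _ that])
    have "Kop v - q ^ l *\<^sub>C v = (\<Sum>t\<in>F. Kop (Q ^ fst t * h t) - q ^ l *\<^sub>C (Q ^ fst t * h t))"
      unfolding F(3) cpair.linear_sum[OF clinear_Kop] cvec.scale_sum_right sum_subtractf ..
    also have "\<dots> = (\<Sum>t\<in>F. Q ^ fst t * ((q ^ ?e t - q ^ l) *\<^sub>C h t))"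
    proof (rule sum.cong)
      fix t assume "t \<in> F"
      then have "Q ^ fst t * h t \<in> A (?a t + fst t) (?b t + fst t)" using F(2) by (intro Q_pow_A) (simp add: H_iff)
      from Kop_A[OF this] show "Kop (Q ^ fst t * h t) - q ^ l *\<^sub>C (Q ^ fst t * h t) = Q ^ fst t * ((q ^ ?e t - q ^ l) *\<^sub>C h t)"
        by (simp only: scaleC_mult_right cvec.scale_left_diff_distrib right_diff_distrib)
    qed simp
    finally show "(\<Sum>t\<in>F. Q ^ fst t * ((q ^ ?e t - q ^ l) *\<^sub>C h t)) = 0" using assms(2) by simp
  qed (simp add: cvec.subspace_scale F(2))
  have "Q ^ fst t * h t \<in> cvec.span (\<Union>{CQ m m' |m m'. m + m' + n = l})" if t: "t \<in> F" for t
  proof (cases "h t = 0")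
    case False
    then have "c t = 0" "q ^ ?e t = q ^ l" using 1[OF t] 2[OF t] by simp_all
    then have j: "fst t = 0" and "?e t = l" using q0 npos pow_inj by (auto simp: c_def qnum_eq_0_iff)
    then have "?a t + ?b t + n = l" by simp
    moreover have "Q ^ fst t * h t \<in> CQ (?a t) (?b t)" using CQ_I[OF F(2)[OF t]] .
    ultimately show ?thesis by (intro cvec.span_base) blast
  qed (simp add: cvec.span_zero)
  then show ?thesis unfolding F(3) by (rule cvec.span_sum)
qed

text \<open>The same pattern with the lowest weight vector: an equivalence sends
  \<open>ket 0\<close> into the right-hand side, and irreducibility of \<open>D l\<close> brings the
  rest along. Conversely each nonzero harmonic \<open>h\<close> of the right degree spans a copy of
  \<open>D l\<close> through \<open>Theta l h\<close>, and this copy contains all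
  \<open>Q ^ r * h\<close>.\<close>

lemma isotypic_omega:
  assumes l: "l > 0"
  shows "isotypic_component \<omega> (D l) UNIV = cvec.span (\<Union>{CQ m m' |m m'. m + m' + n = l})" (is "_ = ?S")
proof (rule antisym)
  have subS: "subrep \<omega> ?S"
    by (rule subrep_span_Union) (auto simp: subrep_def CQ_omega representationD(1)[OF rep_omega])
  interpret dl: discrete_rep q k e f l "D l" by unfold_locales (use l D in auto)
  have "V \<subseteq> ?S" if V: "rep_equiv \<omega> V (D l) UNIV" for V
  proof -
    obtain \<Phi> where \<Phi>: "clinear \<Phi>" "bij_betw \<Phi> UNIV V" "\<And>X v. \<Phi> (D l X v) = \<omega> X (\<Phi> v)"
      using rep_equiv_sym[OF V] unfolding rep_equiv_def by blast
    define U where "U = {v. \<Phi> v \<in> ?S}"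
    have "\<Phi> (ket 0) \<in> ?S"
    proof (rule lowest_weight_in_CQ)
      show "Lap (\<Phi> (ket 0)) = 0" using \<Phi>(3)[of f "ket 0"] by (simp add: dl.delta_f omega_f cpair.linear_0[OF \<Phi>(1)])
      show "Kop (\<Phi> (ket 0)) = q ^ l *\<^sub>C \<Phi> (ket 0)"
        using \<Phi>(3)[of k "ket 0"] by (simp add: dl.delta_k omega_k cpair.linear_scale[OF \<Phi>(1)])
    qed
    then have "ket 0 \<in> U" by (simp add: U_def)
    then have "U \<noteq> {0}" using dl.ket_nonzero[of 0] by blast
    moreover have "subrep (D l) U"
      unfolding subrep_def U_def using subspace_vimage[OF \<Phi>(1) cvec.subspace_span] subS by (auto simp: \<Phi>(3) subrep_def)
    ultimately have "U = UNIV" using dl.irreducible_delta by (auto simp: irreducible_rep_def)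
    then show ?thesis using \<Phi>(2) by (auto simp: U_def bij_betw_def)
  qed
  then show "isotypic_component \<omega> (D l) UNIV \<subseteq> ?S"
    unfolding isotypic_component_def by (intro cvec.span_minimal) auto
  have *: "Q ^ r * h \<in> isotypic_component \<omega> (D l) UNIV" if h: "h \<in> H m m'" and lm: "m + m' + n = l" for m m' r h
  proof (cases "h = 0")
    case True
    then show ?thesis by (simp add: isotypic_component_def cvec.span_zero)
  next
    case False
    note tw = Theta_intertwines[OF D[OF l] h lm[symmetric]]
    have "inj (Theta l h)"
    proof (rule injI)
      fix u v assume "Theta l h u = Theta l h v"
      moreover have "pure_tensor a h \<in> tensor_space (H m m')" for a
        using h by (simp add: tensor_space_def lookup_pure_tensor cvec.subspace_scale)
      ultimately have "pure_tensor u h = pure_tensor v h"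
        using Psi_inj[of "coef l" m m'] coef_nonzero[OF l] unfolding Theta_def inj_on_def by blast
      then have "Poly_Mapping.lookup u t *\<^sub>C h = Poly_Mapping.lookup v t *\<^sub>C h" for t by (metis lookup_pure_tensor)
      then show "u = v" using False by (intro poly_mapping_eqI) simp
    qed
    moreover have "subrep \<omega> (range (Theta l h))" unfolding subrep_def
      using cpair.linear_subspace_image[OF clinear_Theta cvec.subspace_UNIV, of l h] tw by (auto simp: tw[symmetric])
    ultimately have "rep_equiv (D l) UNIV \<omega> (range (Theta l h))"
      unfolding rep_equiv_def using tw clinear_Theta by (auto intro!: exI[of _ "Theta l h"] simp: bij_betw_def subrep_def cvec.subspace_UNIV)
    then have "range (Theta l h) \<subseteq> isotypic_component \<omega> (D l) UNIV"
      unfolding isotypic_component_def using rep_equiv_sym by (blast intro: cvec.span_base)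
    moreover have "Q ^ r * h = Theta l h (inverse (coef l r) *\<^sub>C ket r)"
      using coef_nonzero[OF l] by (simp add: cpair.linear_scale[OF clinear_Theta] Theta_ket scaleC_scaleC scaleC_one)
    ultimately show ?thesis by auto
  qed
  have "CQ m m' \<subseteq> isotypic_component \<omega> (D l) UNIV" if "m + m' + n = l" for m m'
    unfolding CQ_span using * that by (intro cvec.span_minimal) (auto simp: isotypic_component_def cvec.subspace_span)
  then show "?S \<subseteq> isotypic_component \<omega> (D l) UNIV"
    by (intro cvec.span_minimal) (auto simp: isotypic_component_def cvec.subspace_span)
qed

end

text \<open>As \<open>irreducible_rep\<close> excludes the zero space, the vanishing
  \<open>H m m'\<close>, which occur for \<open>n = 1\<close> only, are characterised
  separately.\<close>

theorem mainTheorem8: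
  fixes n :: nat and q qh :: complex
    and z w :: "nat \<Rightarrow> 'a::complex_algebra_1"
    and d db :: "nat \<Rightarrow> 'a \<Rightarrow> 'a" and \<gamma> \<gamma>b :: "'a \<Rightarrow> 'a"
    and k kinv e f :: "'u::complex_algebra_1"
    and D :: "nat \<Rightarrow> 'u \<Rightarrow> (nat \<Rightarrow>\<^sub>0 complex) \<Rightarrow> (nat \<Rightarrow>\<^sub>0 complex)"
    and x :: "gl_gen \<Rightarrow> 'g::complex_algebra_1"
    and L :: "'g \<Rightarrow> 'a \<Rightarrow> 'a"
  defines "H \<equiv> harmonics n z w d db"
    and "Q \<equiv> Q_elem n z w"
  assumes "n \<ge> 1" and "q \<noteq> 0" and "\<And>j. j > 0 \<Longrightarrow> q ^ j \<noteq> 1" and "qh ^ 2 = q"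
    and "zw_algebra n q z w"
    and "\<And>i. i \<in> {1..n} \<Longrightarrow> is_partial n q z w i (d i)"
    and "\<And>i. i \<in> {1..n} \<Longrightarrow> is_partial_bar n q z w i (db i)"
    and "clinear \<gamma>" and "\<And>m m' p. p \<in> homog n z w m m' \<Longrightarrow> \<gamma> p = q ^ m *\<^sub>C p"
    and "clinear \<gamma>b" and "\<And>m m' p. p \<in> homog n z w m m' \<Longrightarrow> \<gamma>b p = q ^ m' *\<^sub>C p"
    and "Uq_sl2 q k kinv e f"
    and "\<And>l. l > 0 \<Longrightarrow> discrete_series q k e f l (D l)"
    and "Uq_gl n q qh x"
    and "gl_action n q qh z w x L"
  shows
    "(\<exists>!\<omega>. sl2_action n q z w d db \<gamma> \<gamma>b k e f \<omega>) \<and>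
     (\<forall>\<omega>. sl2_action n q z w d db \<gamma> \<gamma>b k e f \<omega> \<longrightarrow>
       (\<forall>X Y. \<omega> X \<circ> L Y = L Y \<circ> \<omega> X) \<and>
       (\<forall>m m'.
          inj_on (mult_Q Q) (tensor_space (H m m')) \<and>
          rep_equiv (rep_prod \<omega> L) (CQ_tensor Q (H m m'))
            (outer_tensor (D (m + m' + n)) L) (tensor_space (H m m')) \<and>
          (H m m' = {0} \<longleftrightarrow> n = 1 \<and> m > 0 \<and> m' > 0) \<and>
          (H m m' \<noteq> {0} \<longrightarrow>
             irreducible_rep (D (m + m' + n)) UNIV \<and> irreducible_rep L (H m m') \<and>
             irreducible_rep (outer_tensor (D (m + m' + n)) L) (tensor_space (H m m')))) \<and>
       is_direct_sum (\<lambda>(m, m'). CQ_tensor Q (H m m')) \<and>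
       (\<comment> \<open>one \<open>D l\<close> is paired with all components of total degree \<open>l - n\<close>; these are told apart
            by the scalar by which the central element \<open>\<Prod>i. x (GK i)\<close> acts\<close>
        \<forall>m m' p p'. H m m' \<noteq> {0} \<and> H p p' \<noteq> {0} \<longrightarrow>
          (rep_equiv L (H m m') L (H p p') \<longleftrightarrow> m = p \<and> m' = p') \<and>
          (rep_equiv (D (m + m' + n)) UNIV (D (p + p' + n)) UNIV \<longleftrightarrow> m + m' = p + p') \<and>
          (rep_equiv L (H m m') L (H p p') \<longrightarrow>
             rep_equiv (D (m + m' + n)) UNIV (D (p + p' + n)) UNIV) \<and>
          (rep_equiv (D (m + m' + n)) UNIV (D (p + p' + n)) UNIV \<and>
             (\<exists>c. \<forall>h \<in> H m m' \<union> H p p'. L (prod_list (map (\<lambda>i. x (GK i)) [1..<Suc n])) h = c *\<^sub>C h)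
             \<longrightarrow> rep_equiv L (H m m') L (H p p'))) \<and>
       (\<forall>m m'. isotypic_component L L (H m m') = CQ_tensor Q (H m m')) \<and>
       (\<forall>l>0. isotypic_component \<omega> (D l) UNIV =
          cvec.span (\<Union>{CQ_tensor Q (H m m') |m m'. m + m' + n = l})))"
proof -
  interpret zw_deg q n z w d db \<gamma> \<gamma>b
    by (intro zw_deg.intro zw_deg_axioms.intro zw_diff.intro zw_diff_axioms.intro
        zw.intro zw_axioms.intro generic_q.intro; (rule assms; assumption)?; fact)
  have ex1: "\<exists>!\<omega>. sl2_action n q z w d db \<gamma> \<gamma>b k e f \<omega>"
  proof (rule ex_ex1I)
    show "\<exists>\<omega>. sl2_action n q z w d db \<gamma> \<gamma>b k e f \<omega>"
      by (rule sl2_action_ex) fact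
    fix \<omega> \<omega>' assume a: "sl2_action n q z w d db \<gamma> \<gamma>b k e f \<omega>" "sl2_action n q z w d db \<gamma> \<gamma>b k e f \<omega>'"
    interpret sl2_setting q n z w d db \<gamma> \<gamma>b k kinv e f \<omega>' by unfold_locales fact+
    show "\<omega> = \<omega>'" by (rule sl2_action_unique) fact
  qed
  have "(\<forall>X Y. \<omega> X \<circ> L Y = L Y \<circ> \<omega> X) \<and>
       (\<forall>m m'.
          inj_on (mult_Q Q) (tensor_space (H m m')) \<and>
          rep_equiv (rep_prod \<omega> L) (CQ_tensor Q (H m m'))
            (outer_tensor (D (m + m' + n)) L) (tensor_space (H m m')) \<and>
          (H m m' = {0} \<longleftrightarrow> n = 1 \<and> m > 0 \<and> m' > 0) \<and>
          (H m m' \<noteq> {0} \<longrightarrow>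
             irreducible_rep (D (m + m' + n)) UNIV \<and> irreducible_rep L (H m m') \<and>
             irreducible_rep (outer_tensor (D (m + m' + n)) L) (tensor_space (H m m')))) \<and>
       is_direct_sum (\<lambda>(m, m'). CQ_tensor Q (H m m')) \<and>
       (\<forall>m m' p p'. H m m' \<noteq> {0} \<and> H p p' \<noteq> {0} \<longrightarrow>
          (rep_equiv L (H m m') L (H p p') \<longleftrightarrow> m = p \<and> m' = p') \<and>
          (rep_equiv (D (m + m' + n)) UNIV (D (p + p' + n)) UNIV \<longleftrightarrow> m + m' = p + p') \<and>
          (rep_equiv L (H m m') L (H p p') \<longrightarrow>
             rep_equiv (D (m + m' + n)) UNIV (D (p + p' + n)) UNIV) \<and>
          (rep_equiv (D (m + m' + n)) UNIV (D (p + p' + n)) UNIV \<and>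
             (\<exists>c. \<forall>h \<in> H m m' \<union> H p p'. L (prod_list (map (\<lambda>i. x (GK i)) [1..<Suc n])) h = c *\<^sub>C h)
             \<longrightarrow> rep_equiv L (H m m') L (H p p'))) \<and>
       (\<forall>m m'. isotypic_component L L (H m m') = CQ_tensor Q (H m m')) \<and>
       (\<forall>l>0. isotypic_component \<omega> (D l) UNIV =
          cvec.span (\<Union>{CQ_tensor Q (H m m') |m m'. m + m' + n = l}))"
    if act: "sl2_action n q z w d db \<gamma> \<gamma>b k e f \<omega>" for \<omega>
  proof -
    interpret dual_pair q n z w d db \<gamma> \<gamma>b k kinv e f \<omega> qh x L D
      by unfold_locales fact+
    show ?thesis unfolding H_def Q_def
    proof (intro conjI allI impI; (elim conjE)?)
      show "\<omega> X \<circ> L Y = L Y \<circ> \<omega> X" for X Y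
        by (simp add: fun_eq_iff omega_L_commute)
    next
      fix m m'
      show "inj_on (mult_Q (Q_elem n z w)) (tensor_space (harmonics n z w d db m m'))"
        unfolding mult_Q_Psi by (rule Psi_inj) simp
      show "rep_equiv (rep_prod \<omega> L) (CQ_tensor (Q_elem n z w) (harmonics n z w d db m m'))
        (outer_tensor (D (m + m' + n)) L) (tensor_space (harmonics n z w d db m m'))"
        by (rule CQ_equiv)
      show "harmonics n z w d db m m' = {0} \<longleftrightarrow> n = 1 \<and> m > 0 \<and> m' > 0" by (rule H_zero_iff)
      show "isotypic_component L L (harmonics n z w d db m m') = CQ_tensor (Q_elem n z w) (harmonics n z w d db m m')"
        by (rule isotypic_L)
      assume ne: "harmonics n z w d db m m' \<noteq> {0}"
      show "irreducible_rep (D (m + m' + n)) UNIV" by (rule irreducible_D[OF nl])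
      show "irreducible_rep L (harmonics n z w d db m m')" by (rule irreducible_H[OF ne])
      show "irreducible_rep (outer_tensor (D (m + m' + n)) L) (tensor_space (harmonics n z w d db m m'))"
        by (rule irreducible_tensor[OF ne])
    next
      show "is_direct_sum (\<lambda>(m, m'). CQ_tensor (Q_elem n z w) (harmonics n z w d db m m'))"
        by (rule CQ_direct_sum)
    next
      fix m m' p p' assume ne: "harmonics n z w d db m m' \<noteq> {0}" "harmonics n z w d db p p' \<noteq> {0}"
      show "rep_equiv L (harmonics n z w d db m m') L (harmonics n z w d db p p') \<longleftrightarrow> m = p \<and> m' = p'"
        by (rule L_equiv_iff[OF ne])
      show "rep_equiv (D (m + m' + n)) UNIV (D (p + p' + n)) UNIV \<longleftrightarrow> m + m' = p + p'" by (rule D_equiv_iff)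
      show "rep_equiv (D (m + m' + n)) UNIV (D (p + p' + n)) UNIV"
        if "rep_equiv L (harmonics n z w d db m m') L (harmonics n z w d db p p')"
        using that unfolding L_equiv_iff[OF ne] D_equiv_iff by simp
      show "rep_equiv L (harmonics n z w d db m m') L (harmonics n z w d db p p')"
        if "rep_equiv (D (m + m' + n)) UNIV (D (p + p' + n)) UNIV"
          "\<exists>c. \<forall>h \<in> harmonics n z w d db m m' \<union> harmonics n z w d db p p'.
            L (prod_list (map (\<lambda>i. x (GK i)) [1..<Suc n])) h = c *\<^sub>C h"
        using that same_scalar_equiv[OF ne] unfolding D_equiv_iff by blast
    next
      show "isotypic_component \<omega> (D l) UNIV =
          cvec.span (\<Union>{CQ_tensor (Q_elem n z w) (harmonics n z w d db m m') |m m'. m + m' + n = l})" if "l > 0" for l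
        by (rule isotypic_omega[OF that])
    qed
  qed
  with ex1 show ?thesis by blast
qed

end
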